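(* Let $k$ be a field, $n,m>0$ integers, and $B=B_{n,m}$ the bipath poset. (a) Let $V$ be a bipath persistence module over $B$. Then Algorithm A (described in the context), applied to $V$, correctly computes the interval decomposition of $V$: it outputs a finite multiset $\mathcal{J}$ of intervals of $B$ such that $V\cong\bigoplus_{J\in\mathcal{J}}k_J$. (b) Let $q\ge 0$ and let $S$ be a bipath filtration over $B$ such that $H_q(S_a;k)$ is finite dimensional for all $a\in B$. Then Algorithm B (described in the context), applied to $(S,q)$, correctly computes the $q$th bipath persistence diagram of $S$: it outputs the finite multiset $\mathcal{D}_q(S)$ of intervals of $B$ for which $H_q(S;k)\cong\bigoplus_{J\in\mathcal{D}_q(S)}k_J$.
   Context: **Basic notions.** For a poset $P$, a $P$-persistence module is a functor from $P$ (viewed as a category, with a unique morphism $a\to b$ whenever $a\le b$) to finite-dimensional $k$-vector spaces. Morphisms are natural transformations, and the category is denoted $\mathrm{rep}_k(P)$. An interval $I$ of a finite poset $P$ is a subset that is convex ($a<z<b$ with $a,b\in I$ implies $z\in I$) and connected (any two elements are joined by a sequence in $I$ with consecutive elements comparable). The interval module $k_I$ has $k_I(a)=k$ for $a\in I$ and $0$ otherwise, with $k_I(a\le b)=1_k$ if $a,b\in I$ and $0$ otherwise. The bipath poset $B=B_{n,m}$ has elements $\hat0,1,\dots,n,1',\dots,m',\hat1$ and is the union of two chains sharing only $\hat0$ (global minimum) and $\hat1$ (global maximum): the upper path $U:\hat0<1<\dots<n<\hat1$ and the lower path $D:\hat0<1'<\dots<m'<\hat1$, with elements of $\{1,\dots,n\}$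 and $\{1',\dots,m'\}$ pairwise incomparable. For $a\le b$ in $U$ (resp. in $D$), $[a,b]$ denotes the interval of the chain $U$ (resp. $D$). A bipath persistence module is a $B$-persistence module. $V_U$ and $V_D$ denote the restrictions of $V$ to $U$ and $D$; since $U$ and $D$ are chains, these are isomorphic to finite direct sums of interval modules. A bipath filtration is a functor $S:B\to\mathsf{Top}$, $a\mapsto S_a$, all of whose maps $S_a\hookrightarrow S_b$ ($a\le b$) are inclusions. $H_q(S;k)$ is the bipath persistence module $a\mapsto H_q(S_a;k)$ with maps induced by the inclusions. Its restrictions to $U$ and $D$ are the homology persistence modules of the ordinary filtrations $S_U$ and $S_D$. **Notation for intervals of $B$.** - For $t\in U$, $s\in D$, both $\ne\hat1$: $\langle s,t\rangle:=[\hat0,t]\cup[\hat0,s]$. - For $s\in U$, $t\in D$, both $\neq\hat0$: $\langle s,t\rangle:=[s,\hat1]\cup[t,\hat1]$. - For $s\le t$ in $U\setminus\{\hat0,\hat1\}$: $\langle s,t\rangle:=[s,t]$. - For $t\le s$ in $D\setminus\{\hat0,\hat1\}$: $\langle s,t\rangle:=[t,s]$. **Algorithm A (input $V$).** *Step 1.* Compute isomorphisms $\phi:V_U\to X:=\bigoplus_{I}k_I^{m_U(I)}$ in $\mathrm{rep}_k(U)$ and $\psi:V_D\to Y:=\bigoplus_I k_I^{m_D(I)}$ in $\mathrm{rep}_k(D)$, where the sums run over the intervals of $U$ and $D$ respectively. Write $X=X_\ell\oplus X_c\oplus X_r\oplus X_o$, where $X_c$ collects the summands $k_{[\hat0,\hat1]}$,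 $X_\ell$ the summands nonzero at $\hat0$ and zero at $\hat1$, $X_r$ those zero at $\hat0$ and nonzero at $\hat1$, and $X_o$ the remaining ones. Decompose $Y$ likewise. *Step 2.* Put $\Lambda:=\psi_{\hat0}\phi_{\hat0}^{-1}:X_\ell(\hat0)\oplus X_c(\hat0)\to Y_\ell(\hat0)\oplus Y_c(\hat0)$ and $\Gamma:=\psi_{\hat1}\phi_{\hat1}^{-1}:X_c(\hat1)\oplus X_r(\hat1)\to Y_c(\hat1)\oplus Y_r(\hat1)$, written as matrices in the standard bases coming from the summands. They have the block forms $\Lambda=\begin{bmatrix}\Lambda_{\ell\ell}&\Lambda_{\ell c}\\0&\Lambda_{cc}\end{bmatrix}$ and $\Gamma=\begin{bmatrix}\Gamma_{cc}&\Gamma_{cr}\\0&\Gamma_{rr}\end{bmatrix}$ with $\Lambda_{cc}=\Gamma_{cc}$. Form the single block matrix $$M=\begin{bmatrix}\Lambda_{\ell\ell}&\Lambda_{\ell c}&\emptyset\\0&\Lambda_{cc}=\Gamma_{cc}&\Gamma_{cr}\\ \emptyset&0&\Gamma_{rr}\end{bmatrix},$$ where the blocks $\emptyset$ are always ignored (they stay empty under all operations). Each column is labelled by the interval of $U$, and each row by the interval of $D$, of the corresponding summand. Columns are ordered according to their labels as $[\hat0,\hat0],[\hat0,1],\dots,[\hat0,n],[\hat0,\hat1],[1,\hat1],\dots,[n,\hat1],[\hat1,\hat1]$, and rows analogously with $1',\dots,m'$ in place of $1,\dots,n$; the order among equal labels is arbitrary. *Step 3 (normal form).* (i) By elementary operations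 on the rows labelled $[\hat0,\hat1]$ and on the columns labelled $[\hat0,\hat1]$, transform the central block to an identity matrix. (ii) Add multiples of the columns labelled $[\hat0,\hat1]$ to columns to their right, and multiples of the rows labelled $[\hat0,\hat1]$ to rows above them, to make the blocks to the right of and above the central block zero. (iii) Independently to the upper-left block (position $\Lambda_{\ell\ell}$) and to the lower-right block (position $\Gamma_{rr}$), apply the following reduction of a square matrix $A$: for each column index $\mathrm{col}=1,2,\dots$ in order, let $\mathrm{row}=\max\{i: A_{i,\mathrm{col}}\ne0\}$; multiply row $\mathrm{row}$ by $(A_{\mathrm{row},\mathrm{col}})^{-1}$; then use the entry at $(\mathrm{row},\mathrm{col})$ to zero out all entries to its right by column operations and all entries above it by row operations. After all columns are processed, the result is a permutation matrix. The entries $1$ in the resulting matrix match each summand of $X_\ell$, $X_c$, $X_r$ (column label) with a summand of $Y_\ell$, $Y_c$, $Y_r$ (row label), respectively. *Step 4 (output, with multiplicities).* - For each matched pair $[\hat0,\hat1]$ in $U$, $[\hat0,\hat1]$ in $D$: the interval $B$. - For each matched pair $[\hat0,i]$ in $U$, $[\hat0,j]$ in $D$ ($i,j\neq\hat1$): $\langle j,i\rangle$. - For each matched pair $[i,\hat1]$ in $U$, $[j,\hat1]$ in $D$ ($i,j\ne\hat0$): $\langle i,j\rangle$. - For each summand $k_{[i_1,i_2]}$ of $X_o$: $\langle i_1,i_2\rangle$. - For each summand $k_{[j_1,j_2]}$ of $Y_o$: $\langle j_2,j_1\rangle$. **Algorithm B (input $S,q$).** Compute the standard $q$th persistence diagrams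 (multisets of intervals of the decompositions) of $S_U$ and $S_D$ together with representative cycles. That is, for each interval $[b,d]$ of the diagram (with multiplicity) give a cycle in $S_b$, such that the homology class becomes zero at all points $>d$ of the path and, at each point $x$ of the path, the images of the classes with $x\in[b,d]$ form a basis of $H_q(S_x;k)$. Let $\Lambda$ (resp. $\Gamma$) be the change-of-basis matrix of $H_q(S_{\hat0};k)$ (resp. $H_q(S_{\hat1};k)$) from the basis determined by the representative cycles of the upper path to the basis determined by those of the lower path. Form the labelled block matrix $M$ from $\Lambda,\Gamma$ and the intervals of the two diagrams as in Step 2, then carry out Steps 3 and 4. *)

theory Defs
  imports
    "HOL-Homology.Homology"
    "Jordan_Normal_Form.Column_Operations"
    "Jordan_Normal_Form.VS_Connect"
begin

section \<open>Persistence modules\<close>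

text \<open>
  A poset is a subset \<open>P\<close> of a type of class \<^class>\<open>order\<close>, with the induced order. The field \<open>k\<close> is a
  type of class \<^class>\<open>field\<close>, seen as the ring \<^term>\<open>class_ring\<close>; vector spaces are \<open>module\<close> records.
  All components of a persistence module are carrier-based and only meaningful for indices in \<open>P\<close>, so
  that the restriction of \<open>V\<close> to \<open>P' \<subseteq> P\<close> is \<open>V\<close> itself, regarded over \<open>P'\<close>.
\<close>

record ('p, 'k, 'v) pers_module =
  pspace :: "'p \<Rightarrow> ('k, 'v) module"
  pmap :: "'p \<Rightarrow> 'p \<Rightarrow> 'v \<Rightarrow> 'v"

definition persistence_module ::
  "'p::order set \<Rightarrow> ('p, 'k::field, 'v) pers_module \<Rightarrow> bool" where
  "persistence_module P V \<longleftrightarrow>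
     (\<forall>a\<in>P. vectorspace class_ring (pspace V a) \<and> vectorspace.fin_dim class_ring (pspace V a)) \<and>
     (\<forall>a\<in>P. \<forall>b\<in>P. a \<le> b \<longrightarrow> linear_map class_ring (pspace V a) (pspace V b) (pmap V a b)) \<and>
     (\<forall>a\<in>P. \<forall>x\<in>carrier (pspace V a). pmap V a a x = x) \<and>
     (\<forall>a\<in>P. \<forall>b\<in>P. \<forall>c\<in>P. a \<le> b \<and> b \<le> c \<longrightarrow>
        (\<forall>x\<in>carrier (pspace V a). pmap V b c (pmap V a b x) = pmap V a c x))"

definition pm_hom ::
  "'p::order set \<Rightarrow> ('p, 'k::field, 'v) pers_module \<Rightarrow> ('p, 'k, 'w) pers_module
     \<Rightarrow> ('p \<Rightarrow> 'v \<Rightarrow> 'w) \<Rightarrow> bool" where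
  "pm_hom P V W \<phi> \<longleftrightarrow>
     (\<forall>a\<in>P. linear_map class_ring (pspace V a) (pspace W a) (\<phi> a)) \<and>
     (\<forall>a\<in>P. \<forall>b\<in>P. a \<le> b \<longrightarrow>
        (\<forall>x\<in>carrier (pspace V a). \<phi> b (pmap V a b x) = pmap W a b (\<phi> a x)))"

definition pm_iso ::
  "'p::order set \<Rightarrow> ('p, 'k::field, 'v) pers_module \<Rightarrow> ('p, 'k, 'w) pers_module
     \<Rightarrow> ('p \<Rightarrow> 'v \<Rightarrow> 'w) \<Rightarrow> bool" where
  "pm_iso P V W \<phi> \<longleftrightarrow> pm_hom P V W \<phi> \<and>
     (\<exists>\<theta>. pm_hom P W V \<theta> \<and>
        (\<forall>a\<in>P. (\<forall>x\<in>carrier (pspace V a). \<theta> a (\<phi> a x) = x) \<and>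
               (\<forall>y\<in>carrier (pspace W a). \<phi> a (\<theta> a y) = y)))"

definition poset_connected :: "'p::order set \<Rightarrow> bool" where
  "poset_connected I \<longleftrightarrow>
     (\<forall>a\<in>I. \<forall>b\<in>I. (a, b) \<in> {(x, y). x \<in> I \<and> y \<in> I \<and> (x \<le> y \<or> y \<le> x)}\<^sup>*)"

text \<open>Intervals are nonempty, as connected objects are; otherwise interval decompositions would
  not be unique.\<close>

definition poset_interval :: "'p::order set \<Rightarrow> 'p set \<Rightarrow> bool" where
  "poset_interval P I \<longleftrightarrow> I \<subseteq> P \<and> I \<noteq> {} \<and>
     (\<forall>a\<in>I. \<forall>b\<in>I. \<forall>z\<in>P. a < z \<and> z < b \<longrightarrow> z \<in> I) \<and> poset_connected I"

definition interval_module :: "'p set \<Rightarrow> ('p, 'k::field, 'k) pers_module" where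
  "interval_module I = \<lparr>
     pspace = (\<lambda>a. \<lparr>carrier = (if a \<in> I then UNIV else {0}),
                     mult = (*), one = 1, zero = 0, add = (+), smult = (*)\<rparr>),
     pmap = (\<lambda>a b x. if a \<in> I \<and> b \<in> I then x else 0)\<rparr>"

definition pm_dsum ::
  "nat \<Rightarrow> (nat \<Rightarrow> ('p, 'k, 'v) pers_module) \<Rightarrow> ('p, 'k, nat \<Rightarrow> 'v) pers_module" where
  "pm_dsum N W = \<lparr>
     pspace = (\<lambda>a. \<lparr>
       carrier = (\<Pi>\<^sub>E i\<in>{..<N}. carrier (pspace (W i) a)),
       mult = undefined, one = undefined,
       zero = (\<lambda>i\<in>{..<N}. zero (pspace (W i) a)),
       add = (\<lambda>x y. \<lambda>i\<in>{..<N}. x i \<oplus>\<^bsub>pspace (W i) a\<^esub> y i),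
       smult = (\<lambda>c x. \<lambda>i\<in>{..<N}. c \<odot>\<^bsub>pspace (W i) a\<^esub> x i)\<rparr>),
     pmap = (\<lambda>a b x. \<lambda>i\<in>{..<N}. pmap (W i) a b (x i))\<rparr>"

definition interval_sum :: "'p set list \<Rightarrow> ('p, 'k::field, nat \<Rightarrow> 'k) pers_module" where
  "interval_sum Is = pm_dsum (length Is) (\<lambda>i. interval_module (Is ! i))"

definition interval_decomposition ::
  "'p::order set \<Rightarrow> ('p, 'k::field, 'v) pers_module \<Rightarrow> 'p set multiset \<Rightarrow> bool" where
  "interval_decomposition P V \<J> \<longleftrightarrow>
     (\<forall>I\<in>#\<J>. poset_interval P I) \<and>
     (\<exists>Is \<phi>. mset Is = \<J> \<and> pm_iso P V (interval_sum Is) \<phi>)"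

definition persistence_diagram ::
  "'p::order set \<Rightarrow> ('p, 'k::field, 'v) pers_module \<Rightarrow> 'p set multiset" where
  "persistence_diagram P V = (THE \<J>. interval_decomposition P V \<J>)"

section \<open>The bipath poset\<close>

text \<open>\<open>Upper i\<close> and \<open>Lower i\<close> are the elements \<open>i\<close> and \<open>i'\<close>. The order is put on the whole datatype;
  \<open>bipath_poset n m\<close> cuts out the elements of $B_{n,m}$.\<close>

datatype bipath = Hat0 | Upper nat | Lower nat | Hat1

instantiation bipath :: order
begin

fun less_eq_bipath :: "bipath \<Rightarrow> bipath \<Rightarrow> bool" where
  "less_eq_bipath Hat0 _ = True"
| "less_eq_bipath _ Hat1 = True"
| "less_eq_bipath (Upper i) (Upper j) = (i \<le> j)"
| "less_eq_bipath (Lower i) (Lower j) = (i \<le> j)"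
| "less_eq_bipath _ _ = False"

definition less_bipath :: "bipath \<Rightarrow> bipath \<Rightarrow> bool" where
  "less_bipath x y \<longleftrightarrow> x \<le> y \<and> \<not> y \<le> x"

instance
proof
  fix x y z :: bipath
  show "x < y \<longleftrightarrow> x \<le> y \<and> \<not> y \<le> x" by (rule less_bipath_def)
  show "x \<le> x" by (cases x) auto
  show "x \<le> y \<Longrightarrow> y \<le> z \<Longrightarrow> x \<le> z" by (cases x; cases y; cases z) auto
  show "x \<le> y \<Longrightarrow> y \<le> x \<Longrightarrow> x = y" by (cases x; cases y) auto
qed

end

definition upper_path :: "nat \<Rightarrow> bipath set" where
  "upper_path n = {Hat0, Hat1} \<union> Upper ` {1..n}"

definition lower_path :: "nat \<Rightarrow> bipath set" where
  "lower_path m = {Hat0, Hat1} \<union> Lower ` {1..m}"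

definition bipath_poset :: "nat \<Rightarrow> nat \<Rightarrow> bipath set" where
  "bipath_poset n m = upper_path n \<union> lower_path m"

definition angle :: "nat \<Rightarrow> nat \<Rightarrow> bipath \<Rightarrow> bipath \<Rightarrow> bipath set" where
  "angle n m s t =
     (let U = upper_path n; D = lower_path m in
      if t \<in> U \<and> s \<in> D \<and> t \<noteq> Hat1 \<and> s \<noteq> Hat1 then (U \<inter> {Hat0..t}) \<union> (D \<inter> {Hat0..s})
      else if s \<in> U \<and> t \<in> D \<and> s \<noteq> Hat0 \<and> t \<noteq> Hat0 then (U \<inter> {s..Hat1}) \<union> (D \<inter> {t..Hat1})
      else if s \<in> U - {Hat0, Hat1} \<and> t \<in> U - {Hat0, Hat1} \<and> s \<le> t then U \<inter> {s..t}
      else if s \<in> D - {Hat0, Hat1} \<and> t \<in> D - {Hat0, Hat1} \<and> t \<le> s then D \<inter> {t..s}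
      else undefined)"

section \<open>The labelled block matrix\<close>

text \<open>The intervals of a path \<open>P\<close> are given by their endpoints: the label \<open>(a, b)\<close> stands for
  \<open>[a, b] = P \<inter> {a..b}\<close>. The four classes of labels are those of the summands of
  $X_\ell, X_c, X_r, X_o$.\<close>

type_synonym label = "bipath \<times> bipath"

definition path_labels :: "bipath set \<Rightarrow> label set" where
  "path_labels P = {(a, b). a \<in> P \<and> b \<in> P \<and> a \<le> b}"

definition label_interval :: "bipath set \<Rightarrow> label \<Rightarrow> bipath set" where
  "label_interval P l = P \<inter> {fst l..snd l}"

definition left_label :: "label \<Rightarrow> bool" where
  "left_label l \<longleftrightarrow> fst l = Hat0 \<and> snd l \<noteq> Hat1"

definition central_label :: "label \<Rightarrow> bool" where
  "central_label l \<longleftrightarrow> fst l = Hat0 \<and> snd l = Hat1"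

definition right_label :: "label \<Rightarrow> bool" where
  "right_label l \<longleftrightarrow> fst l \<noteq> Hat0 \<and> snd l = Hat1"

definition other_label :: "label \<Rightarrow> bool" where
  "other_label l \<longleftrightarrow> fst l \<noteq> Hat0 \<and> snd l \<noteq> Hat1"

text \<open>On the labels $[\hat0,b]$ and $[a,\hat1]$ of one path the componentwise order is the total order
  $[\hat0,\hat0],[\hat0,1],\dots,[\hat0,\hat1],[1,\hat1],\dots,[\hat1,\hat1]$.\<close>

definition label_le :: "label \<Rightarrow> label \<Rightarrow> bool" where
  "label_le l l' \<longleftrightarrow> fst l \<le> fst l' \<and> snd l \<le> snd l'"

text \<open>\<open>is\<close> lists, in label order, the positions in \<open>ls\<close> of the labels that occur in the matrix.\<close>

definition label_order :: "label list \<Rightarrow> nat list \<Rightarrow> bool" where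
  "label_order ls is \<longleftrightarrow> distinct is \<and>
     set is = {i. i < length ls \<and> \<not> other_label (ls ! i)} \<and>
     sorted_wrt label_le (map ((!) ls) is)"

text \<open>In the following \<open>us\<close> and \<open>ds\<close> list the labels of all summands for the upper and the lower path.
  \<open>\<Lambda> r c\<close> is the entry of \<open>\<Lambda>\<close> in the row of the summand \<open>ds ! r\<close> and the column of the summand \<open>us ! c\<close>,
  and is only meaningful if both summands are nonzero at \<open>Hat0\<close>; similarly for \<open>\<Gamma>\<close> and \<open>Hat1\<close>.\<close>

definition block_form ::
  "label list \<Rightarrow> label list \<Rightarrow> (nat \<Rightarrow> nat \<Rightarrow> 'k::zero) \<Rightarrow> (nat \<Rightarrow> nat \<Rightarrow> 'k) \<Rightarrow> bool" where
  "block_form us ds \<Lambda> \<Gamma> \<longleftrightarrow> (\<forall>r < length ds. \<forall>c < length us.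
     (central_label (ds ! r) \<and> left_label (us ! c) \<longrightarrow> \<Lambda> r c = 0) \<and>
     (right_label (ds ! r) \<and> central_label (us ! c) \<longrightarrow> \<Gamma> r c = 0) \<and>
     (central_label (ds ! r) \<and> central_label (us ! c) \<longrightarrow> \<Lambda> r c = \<Gamma> r c))"

text \<open>The entries of the blocks \<open>\<emptyset>\<close> are \<^const>\<open>None\<close>.\<close>

definition initial_matrix ::
  "label list \<Rightarrow> label list \<Rightarrow> nat list \<Rightarrow> nat list \<Rightarrow> (nat \<Rightarrow> nat \<Rightarrow> 'k) \<Rightarrow> (nat \<Rightarrow> nat \<Rightarrow> 'k)
     \<Rightarrow> 'k option mat" where
  "initial_matrix us ds cs rs \<Lambda> \<Gamma> = mat (length rs) (length cs) (\<lambda>(i, j).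
     let r = rs ! i; c = cs ! j in
     if fst (ds ! r) = Hat0 \<and> fst (us ! c) = Hat0 then Some (\<Lambda> r c)
     else if snd (ds ! r) = Hat1 \<and> snd (us ! c) = Hat1 then Some (\<Gamma> r c)
     else None)"

text \<open>\<open>opt_add_mult a x y\<close> is \<open>y + a * x\<close>, where empty entries stay empty and are never added.\<close>

fun opt_add_mult :: "'k::semiring_0 \<Rightarrow> 'k option \<Rightarrow> 'k option \<Rightarrow> 'k option" where
  "opt_add_mult a (Some x) (Some y) = Some (y + a * x)"
| "opt_add_mult a _ y = y"

text \<open>\<open>k\<close> is the row (column) that is changed.\<close>

definition opt_multrow :: "nat \<Rightarrow> 'k::semiring_0 \<Rightarrow> 'k option mat \<Rightarrow> 'k option mat" where
  "opt_multrow k a M = mat (dim_row M) (dim_col M)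
     (\<lambda>(i, j). if i = k then map_option ((*) a) (M $$ (i, j)) else M $$ (i, j))"

definition opt_multcol :: "nat \<Rightarrow> 'k::semiring_0 \<Rightarrow> 'k option mat \<Rightarrow> 'k option mat" where
  "opt_multcol k a M = mat (dim_row M) (dim_col M)
     (\<lambda>(i, j). if j = k then map_option ((*) a) (M $$ (i, j)) else M $$ (i, j))"

definition opt_addrow :: "'k::semiring_0 \<Rightarrow> nat \<Rightarrow> nat \<Rightarrow> 'k option mat \<Rightarrow> 'k option mat" where
  "opt_addrow a k l M = mat (dim_row M) (dim_col M)
     (\<lambda>(i, j). if i = k then opt_add_mult a (M $$ (l, j)) (M $$ (i, j)) else M $$ (i, j))"

definition opt_addcol :: "'k::semiring_0 \<Rightarrow> nat \<Rightarrow> nat \<Rightarrow> 'k option mat \<Rightarrow> 'k option mat" where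
  "opt_addcol a k l M = mat (dim_row M) (dim_col M)
     (\<lambda>(i, j). if j = k then opt_add_mult a (M $$ (i, l)) (M $$ (i, j)) else M $$ (i, j))"

text \<open>In the following \<open>R\<close> and \<open>C\<close> are the lists of the row and of the column labels of the matrix.\<close>

definition label_positions :: "(label \<Rightarrow> bool) \<Rightarrow> label list \<Rightarrow> nat list" where
  "label_positions Q ls = filter (\<lambda>i. Q (ls ! i)) [0..<length ls]"

text \<open>Only used for blocks without empty entries.\<close>

definition label_block ::
  "label list \<Rightarrow> label list \<Rightarrow> (label \<Rightarrow> bool) \<Rightarrow> (label \<Rightarrow> bool) \<Rightarrow> 'k option mat \<Rightarrow> 'k mat" where
  "label_block R C Q Q' M =
     mat (length (label_positions Q R)) (length (label_positions Q' C))
       (\<lambda>(i, j). the (M $$ (label_positions Q R ! i, label_positions Q' C ! j)))"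

section \<open>Normal form\<close>

inductive central_op ::
  "label list \<Rightarrow> label list \<Rightarrow> 'k::field option mat \<Rightarrow> 'k option mat \<Rightarrow> bool"
  for R C where
  "i \<in> set (label_positions central_label R) \<Longrightarrow> i' \<in> set (label_positions central_label R) \<Longrightarrow>
     central_op R C M (swaprows i i' M)"
| "i \<in> set (label_positions central_label R) \<Longrightarrow> a \<noteq> 0 \<Longrightarrow>
     central_op R C M (opt_multrow i a M)"
| "i \<in> set (label_positions central_label R) \<Longrightarrow> i' \<in> set (label_positions central_label R) \<Longrightarrow>
     i \<noteq> i' \<Longrightarrow> central_op R C M (opt_addrow a i i' M)"
| "j \<in> set (label_positions central_label C) \<Longrightarrow> j' \<in> set (label_positions central_label C) \<Longrightarrow>
     central_op R C M (swapcols j j' M)"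
| "j \<in> set (label_positions central_label C) \<Longrightarrow> a \<noteq> 0 \<Longrightarrow>
     central_op R C M (opt_multcol j a M)"
| "j \<in> set (label_positions central_label C) \<Longrightarrow> j' \<in> set (label_positions central_label C) \<Longrightarrow>
     j \<noteq> j' \<Longrightarrow> central_op R C M (opt_addcol a j j' M)"

definition normalize_central ::
  "label list \<Rightarrow> label list \<Rightarrow> 'k::field option mat \<Rightarrow> 'k option mat \<Rightarrow> bool" where
  "normalize_central R C M M' \<longleftrightarrow> (central_op R C)\<^sup>*\<^sup>* M M' \<and>
     label_block R C central_label central_label M' = 1\<^sub>m (length (label_positions central_label R))"

inductive clearing_op ::
  "label list \<Rightarrow> label list \<Rightarrow> 'k::field option mat \<Rightarrow> 'k option mat \<Rightarrow> bool"
  for R C where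
  "j \<in> set (label_positions central_label C) \<Longrightarrow> j' \<in> set (label_positions right_label C) \<Longrightarrow>
     clearing_op R C M (opt_addcol a j' j M)"
| "i \<in> set (label_positions central_label R) \<Longrightarrow> i' \<in> set (label_positions left_label R) \<Longrightarrow>
     clearing_op R C M (opt_addrow a i' i M)"

definition clear_central ::
  "label list \<Rightarrow> label list \<Rightarrow> 'k::field option mat \<Rightarrow> 'k option mat \<Rightarrow> bool" where
  "clear_central R C M M' \<longleftrightarrow> (clearing_op R C)\<^sup>*\<^sup>* M M' \<and>
     label_block R C central_label right_label M' =
       0\<^sub>m (length (label_positions central_label R)) (length (label_positions right_label C)) \<and>
     label_block R C left_label central_label M' =
       0\<^sub>m (length (label_positions left_label R)) (length (label_positions central_label C))"

definition reduce_col :: "nat \<Rightarrow> 'k::field mat \<Rightarrow> 'k mat" where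
  "reduce_col c A =
     (let r = Max {i. i < dim_row A \<and> A $$ (i, c) \<noteq> 0};
          A1 = multrow r (inverse (A $$ (r, c))) A;
          A2 = fold (\<lambda>j X. addcol (- X $$ (r, j)) j c X) [Suc c..<dim_col A] A1
      in fold (\<lambda>i X. addrow (- X $$ (i, c)) i r X) [0..<r] A2)"

definition reduction :: "'k::field mat \<Rightarrow> 'k mat" where
  "reduction A = fold reduce_col [0..<dim_col A] A"

definition permutation_matrix :: "'k::{zero,one} mat \<Rightarrow> bool" where
  "permutation_matrix A \<longleftrightarrow> (\<exists>p. p permutes {..<dim_col A} \<and>
     A = mat (dim_col A) (dim_col A) (\<lambda>(i, j). if i = p j then 1 else 0))"

text \<open>The pairs (row label, column label) of the entries 1 of \<open>A\<close>, the final state of the square block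
  whose rows and columns are those with labels in the class \<open>Q\<close>.\<close>

definition matched_pairs ::
  "label list \<Rightarrow> label list \<Rightarrow> (label \<Rightarrow> bool) \<Rightarrow> 'k::one mat \<Rightarrow> (label \<times> label) multiset" where
  "matched_pairs R C Q A =
     image_mset (\<lambda>(i, j). (R ! (label_positions Q R ! i), C ! (label_positions Q C ! j)))
       (mset_set {(i, j). i < dim_row A \<and> j < dim_col A \<and> A $$ (i, j) = 1})"

text \<open>\<open>M\<close> is the matrix with normalized and cleared central block; the reduction of the two outer
  blocks is part of the computation of the output.\<close>

definition output_intervals ::
  "nat \<Rightarrow> nat \<Rightarrow> label list \<Rightarrow> label list \<Rightarrow> label list \<Rightarrow> label list \<Rightarrow> 'k::field option mat
     \<Rightarrow> bipath set multiset" where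
  "output_intervals n m us ds R C M =
     image_mset (\<lambda>_. bipath_poset n m)
       (matched_pairs R C central_label (label_block R C central_label central_label M)) +
     image_mset (\<lambda>(r, c). angle n m (snd r) (snd c))
       (matched_pairs R C left_label (reduction (label_block R C left_label left_label M))) +
     image_mset (\<lambda>(r, c). angle n m (fst c) (fst r))
       (matched_pairs R C right_label (reduction (label_block R C right_label right_label M))) +
     image_mset (\<lambda>(i1, i2). angle n m i1 i2) (filter_mset other_label (mset us)) +
     image_mset (\<lambda>(j1, j2). angle n m j2 j1) (filter_mset other_label (mset ds))"

definition normalize_and_output ::
  "nat \<Rightarrow> nat \<Rightarrow> label list \<Rightarrow> label list \<Rightarrow> (nat \<Rightarrow> nat \<Rightarrow> 'k::field) \<Rightarrow> (nat \<Rightarrow> nat \<Rightarrow> 'k)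
     \<Rightarrow> bipath set multiset \<Rightarrow> bool" where
  "normalize_and_output n m us ds \<Lambda> \<Gamma> \<J> \<longleftrightarrow>
     (\<exists>cs rs M1 M2. label_order us cs \<and> label_order ds rs \<and>
        (let C = map ((!) us) cs; R = map ((!) ds) rs in
           normalize_central R C (initial_matrix us ds cs rs \<Lambda> \<Gamma>) M1 \<and> clear_central R C M1 M2 \<and>
           \<J> = output_intervals n m us ds R C M2))"

text \<open>The assertions that are part of the description of the algorithms: \<open>\<Lambda>\<close> and \<open>\<Gamma>\<close> have the block
  forms, and, whatever choices have been made before, the central block can be normalized and cleared,
  and the reductions end with permutation matrices.\<close>

definition steps_well_defined ::
  "label list \<Rightarrow> label list \<Rightarrow> (nat \<Rightarrow> nat \<Rightarrow> 'k::field) \<Rightarrow> (nat \<Rightarrow> nat \<Rightarrow> 'k) \<Rightarrow> bool" where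
  "steps_well_defined us ds \<Lambda> \<Gamma> \<longleftrightarrow> block_form us ds \<Lambda> \<Gamma> \<and>
     (\<forall>cs rs. label_order us cs \<and> label_order ds rs \<longrightarrow>
        (let C = map ((!) us) cs; R = map ((!) ds) rs; M = initial_matrix us ds cs rs \<Lambda> \<Gamma> in
           (\<exists>M1. normalize_central R C M M1) \<and>
           (\<forall>M1. normalize_central R C M M1 \<longrightarrow>
              (\<exists>M2. clear_central R C M1 M2) \<and>
              (\<forall>M2. clear_central R C M1 M2 \<longrightarrow>
                 permutation_matrix (reduction (label_block R C left_label left_label M2)) \<and>
                 permutation_matrix (reduction (label_block R C right_label right_label M2))))))"

section \<open>Algorithm A\<close>

definition path_decomposition ::
  "bipath set \<Rightarrow> (bipath, 'k::field, 'v) pers_module \<Rightarrow> label list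
     \<Rightarrow> (bipath \<Rightarrow> 'v \<Rightarrow> nat \<Rightarrow> 'k) \<Rightarrow> bool" where
  "path_decomposition P V ls \<phi> \<longleftrightarrow> set ls \<subseteq> path_labels P \<and>
     pm_iso P V (interval_sum (map (label_interval P) ls)) \<phi>"

text \<open>The entry in row \<open>r\<close> and column \<open>c\<close> of $\psi_x\phi_x^{-1}$ in the standard bases;
  \<open>N\<close> is the number of summands of the target of \<open>\<phi>\<close>.\<close>

definition transition_entry ::
  "(bipath, 'k::field, 'v) pers_module \<Rightarrow> nat \<Rightarrow> (bipath \<Rightarrow> 'v \<Rightarrow> nat \<Rightarrow> 'k)
     \<Rightarrow> (bipath \<Rightarrow> 'v \<Rightarrow> nat \<Rightarrow> 'k) \<Rightarrow> bipath \<Rightarrow> nat \<Rightarrow> nat \<Rightarrow> 'k" where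
  "transition_entry V N \<phi> \<psi> x r c =
     \<psi> x (inv_into (carrier (pspace V x)) (\<phi> x) (\<lambda>i\<in>{..<N}. if i = c then 1 else 0)) r"

text \<open>\<open>algorithm_A n m V \<J>\<close>: some run of the algorithm on \<open>V\<close> outputs \<open>\<J>\<close>.\<close>

definition algorithm_A ::
  "nat \<Rightarrow> nat \<Rightarrow> (bipath, 'k::field, 'v) pers_module \<Rightarrow> bipath set multiset \<Rightarrow> bool" where
  "algorithm_A n m V \<J> \<longleftrightarrow>
     (\<exists>us \<phi> ds \<psi>.
        path_decomposition (upper_path n) V us \<phi> \<and> path_decomposition (lower_path m) V ds \<psi> \<and>
        normalize_and_output n m us ds (transition_entry V (length us) \<phi> \<psi> Hat0)
          (transition_entry V (length us) \<phi> \<psi> Hat1) \<J>)"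

definition algorithm_A_well_defined ::
  "nat \<Rightarrow> nat \<Rightarrow> (bipath, 'k::field, 'v) pers_module \<Rightarrow> bool" where
  "algorithm_A_well_defined n m V \<longleftrightarrow>
     (\<forall>us \<phi> ds \<psi>.
        path_decomposition (upper_path n) V us \<phi> \<and> path_decomposition (lower_path m) V ds \<psi> \<longrightarrow>
        steps_well_defined us ds (transition_entry V (length us) \<phi> \<psi> Hat0)
          (transition_entry V (length us) \<phi> \<psi> Hat1))"

section \<open>Singular homology with coefficients in a field\<close>

text \<open>The library's singular homology has integer coefficients; the following is the same
  construction, on the same simplices and faces, with coefficients in \<open>'k\<close>.\<close>

type_synonym ('x, 'k) kchain = "((nat \<Rightarrow> real) \<Rightarrow> 'x) \<Rightarrow>\<^sub>0 'k"

definition kchains :: "nat \<Rightarrow> 'x topology \<Rightarrow> ('x, 'k::field) kchain set" where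
  "kchains q X = {c. Poly_Mapping.keys c \<subseteq> singular_simplex_set q X}"

definition kboundary :: "nat \<Rightarrow> ('x, 'k::field) kchain \<Rightarrow> ('x, 'k) kchain" where
  "kboundary q c = (if q = 0 then 0 else
     (\<Sum>\<sigma>\<in>Poly_Mapping.keys c. \<Sum>i\<le>q.
        Poly_Mapping.single (singular_face q i \<sigma>) ((-1) ^ i * Poly_Mapping.lookup c \<sigma>)))"

definition kcycles :: "nat \<Rightarrow> 'x topology \<Rightarrow> ('k::field, ('x, 'k) kchain) module" where
  "kcycles q X = \<lparr>carrier = {c \<in> kchains q X. kboundary q c = 0},
     mult = undefined, one = undefined, zero = 0, add = (+),
     smult = (\<lambda>a. Poly_Mapping.map ((*) a))\<rparr>"

definition kboundaries :: "nat \<Rightarrow> 'x topology \<Rightarrow> ('x, 'k::field) kchain set" where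
  "kboundaries q X = kboundary (Suc q) ` kchains (Suc q) X"

definition quotient_module :: "('k, 'v) module \<Rightarrow> 'v set \<Rightarrow> ('k, 'v set) module" where
  "quotient_module M N = \<lparr>carrier = a_rcosets\<^bsub>M\<^esub> N,
     mult = undefined, one = undefined, zero = N, add = set_add M,
     smult = (\<lambda>a X. \<Union>x\<in>X. N +>\<^bsub>M\<^esub> (a \<odot>\<^bsub>M\<^esub> x))\<rparr>"

definition khomology :: "nat \<Rightarrow> 'x topology \<Rightarrow> ('k::field, ('x, 'k) kchain set) module" where
  "khomology q X = quotient_module (kcycles q X) (kboundaries q X)"

definition homology_class ::
  "nat \<Rightarrow> 'x topology \<Rightarrow> ('x, 'k::field) kchain \<Rightarrow> ('x, 'k) kchain set" where
  "homology_class q X z = kboundaries q X +>\<^bsub>kcycles q X\<^esub> z"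

definition kchain_map :: "nat \<Rightarrow> ('x \<Rightarrow> 'y) \<Rightarrow> ('x, 'k::field) kchain \<Rightarrow> ('y, 'k) kchain" where
  "kchain_map q f c =
     (\<Sum>\<sigma>\<in>Poly_Mapping.keys c. Poly_Mapping.single (simplex_map q f \<sigma>) (Poly_Mapping.lookup c \<sigma>))"

definition khom_induced ::
  "nat \<Rightarrow> 'y topology \<Rightarrow> ('x \<Rightarrow> 'y) \<Rightarrow> ('x, 'k::field) kchain set \<Rightarrow> ('y, 'k) kchain set" where
  "khom_induced q Y f c = (\<Union>z\<in>c. homology_class q Y (kchain_map q f z))"

text \<open>The maps of a filtration are inclusions of underlying sets; \<open>S a\<close> is not required to carry the
  subspace topology of \<open>S b\<close>, only the inclusion has to be continuous.\<close>

definition filtration :: "'p::order set \<Rightarrow> ('p \<Rightarrow> 'x topology) \<Rightarrow> bool" where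
  "filtration P S \<longleftrightarrow> (\<forall>a\<in>P. \<forall>b\<in>P. a \<le> b \<longrightarrow>
     topspace (S a) \<subseteq> topspace (S b) \<and> continuous_map (S a) (S b) id)"

definition homology_pm ::
  "nat \<Rightarrow> ('p \<Rightarrow> 'x topology) \<Rightarrow> ('p, 'k::field, ('x, 'k) kchain set) pers_module" where
  "homology_pm q S = \<lparr>pspace = (\<lambda>a. khomology q (S a)), pmap = (\<lambda>a b. khom_induced q (S b) id)\<rparr>"

section \<open>Algorithm B\<close>

definition basis_family ::
  "('k::field, 'v) module \<Rightarrow> 'i set \<Rightarrow> ('i \<Rightarrow> 'v) \<Rightarrow> bool" where
  "basis_family W J f \<longleftrightarrow> inj_on f J \<and> vectorspace.basis class_ring W (f ` J)"

definition basis_coeff ::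
  "('k::field, 'v) module \<Rightarrow> 'i set \<Rightarrow> ('i \<Rightarrow> 'v) \<Rightarrow> 'v \<Rightarrow> 'i \<Rightarrow> 'k" where
  "basis_coeff W J f x =
     (THE a. a \<in> J \<rightarrow>\<^sub>E UNIV \<and> x = (\<Oplus>\<^bsub>W\<^esub>j\<in>J. a j \<odot>\<^bsub>W\<^esub> f j))"

text \<open>The image at \<open>x\<close> of the class of the \<open>i\<close>-th cycle, which is born at \<open>fst (ls ! i)\<close>.\<close>

definition rep_class ::
  "nat \<Rightarrow> (bipath \<Rightarrow> 'x topology) \<Rightarrow> label list \<Rightarrow> ('x, 'k::field) kchain list \<Rightarrow> bipath \<Rightarrow> nat
     \<Rightarrow> ('x, 'k) kchain set" where
  "rep_class q S ls zs x i =
     pmap (homology_pm q S) (fst (ls ! i)) x (homology_class q (S (fst (ls ! i))) (zs ! i))"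

definition alive :: "label list \<Rightarrow> bipath \<Rightarrow> nat set" where
  "alive ls x = {i. i < length ls \<and> fst (ls ! i) \<le> x \<and> x \<le> snd (ls ! i)}"

definition representative_cycles ::
  "bipath set \<Rightarrow> nat \<Rightarrow> (bipath \<Rightarrow> 'x topology) \<Rightarrow> label list \<Rightarrow> ('x, 'k::field) kchain list
     \<Rightarrow> bool" where
  "representative_cycles P q S ls zs \<longleftrightarrow>
     set ls \<subseteq> path_labels P \<and> length zs = length ls \<and>
     interval_decomposition P (homology_pm q S :: (bipath, 'k, ('x, 'k) kchain set) pers_module)
       (mset (map (label_interval P) ls)) \<and>
     (\<forall>i < length ls. zs ! i \<in> carrier (kcycles q (S (fst (ls ! i)))) \<and>
        (\<forall>x\<in>P. snd (ls ! i) < x \<longrightarrow> rep_class q S ls zs x i = \<zero>\<^bsub>khomology q (S x)\<^esub>)) \<and>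
     (\<forall>x\<in>P. basis_family (khomology q (S x)) (alive ls x) (rep_class q S ls zs x))"

text \<open>Column \<open>c\<close> of the change-of-basis matrix at \<open>x\<close> consists of the coordinates of the \<open>c\<close>-th basis
  vector of the upper path in the basis of the lower path.\<close>

definition cycle_entry ::
  "nat \<Rightarrow> (bipath \<Rightarrow> 'x topology) \<Rightarrow> label list \<Rightarrow> ('x, 'k::field) kchain list \<Rightarrow> label list
     \<Rightarrow> ('x, 'k) kchain list \<Rightarrow> bipath \<Rightarrow> nat \<Rightarrow> nat \<Rightarrow> 'k" where
  "cycle_entry q S us zs ds ws x r c =
     basis_coeff (khomology q (S x)) (alive ds x) (rep_class q S ds ws x) (rep_class q S us zs x c) r"

text \<open>The field is passed as a type argument, since it does not occur in the input \<open>(S, q)\<close>.\<close>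

definition algorithm_B ::
  "'k::field itself \<Rightarrow> nat \<Rightarrow> nat \<Rightarrow> nat \<Rightarrow> (bipath \<Rightarrow> 'x topology) \<Rightarrow> bipath set multiset
     \<Rightarrow> bool" where
  "algorithm_B _ n m q S \<J> \<longleftrightarrow>
     (\<exists>us (zs :: ('x, 'k) kchain list) ds ws.
        representative_cycles (upper_path n) q S us zs \<and>
        representative_cycles (lower_path m) q S ds ws \<and>
        normalize_and_output n m us ds (cycle_entry q S us zs ds ws Hat0) (cycle_entry q S us zs ds ws Hat1) \<J>)"

definition algorithm_B_well_defined ::
  "'k::field itself \<Rightarrow> nat \<Rightarrow> nat \<Rightarrow> nat \<Rightarrow> (bipath \<Rightarrow> 'x topology) \<Rightarrow> bool" where
  "algorithm_B_well_defined _ n m q S \<longleftrightarrow>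
     (\<forall>us (zs :: ('x, 'k) kchain list) ds ws.
        representative_cycles (upper_path n) q S us zs \<and>
        representative_cycles (lower_path m) q S ds ws \<longrightarrow>
        steps_well_defined us ds (cycle_entry q S us zs ds ws Hat0)
          (cycle_entry q S us zs ds ws Hat1))"

end

theory Submission imports Defs begin

text \<open>
  Write \<open>U\<close> and \<open>D\<close> for the upper and the lower path. A decomposition of the restriction of \<open>V\<close> to a
  path is a compatible choice of coordinates at all points of the path, a \<^emph>\<open>frame\<close> (\<open>pm_iso_iff_frame\<close>).
  A frame over \<open>U\<close> and a frame over \<open>D\<close> describe the same spaces at \<open>Hat0\<close> and \<open>Hat1\<close>; the two
  transition matrices there, assembled into one block matrix, measure their disagreement.

  Frames can be changed by automorphisms of the sum of interval modules, and the matrix then changes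
  by row or column operations. On a path the identity on the overlap is a morphism from \<open>[a, b]\<close> to
  \<open>[a', b']\<close> if \<open>a' \<le> a\<close> and \<open>b' \<le> b\<close>. This is the order of the labels, so the operations that come from
  automorphisms include all additions of columns to columns further right and of rows to rows further
  up. These are the additions that the algorithm uses. Hence every matrix that occurs in a run is again
  the matrix of some pair of frames (\<open>realised_addcol\<close>, \<open>realised_addrow\<close>, \<open>block_reduction\<close>), whatever
  choices the run makes.

  Transition matrices are invertible, and the zero blocks of the block form make the three diagonal blocks
  invertible as well. So the central block can be normalized and cleared, and the reduction of the
  outer blocks ends with permutation matrices (\<open>reduction_permutation\<close>). At the end there are frames
  over \<open>U\<close> and \<open>D\<close> whose coordinates at \<open>Hat0\<close> and \<open>Hat1\<close> agree up to a bijection between the summands.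
  Every relation between points of different paths factors through \<open>Hat0\<close> or \<open>Hat1\<close>, hence such frames
  glue to a frame over the bipath poset (\<open>frame_glue\<close>); two matched intervals become their union,
  which is the interval in the output (\<open>run_decomposes\<close>).

  The same gluing proves that a module over a chain decomposes (\<open>chain_frame\<close>): split off the two
  topmost points, bring the linear map between them to rank normal form, and reduce the transition
  matrix at the point that the two parts share.

  The decomposition is unique because a composite \<open>k\<^sub>I \<rightarrow> k\<^sub>J \<rightarrow> k\<^sub>I\<close> vanishes for intervals \<open>I \<noteq> J\<close>, so
  that comparing two decompositions restricts to an isomorphism between the copies of each interval
  (\<open>interval_decomposition_unique\<close>). For the second algorithm, the classes of representative cycles
  form bases that the structure maps respect, which is a frame of the homology module, and its change-of-basis
  matrices are the transition matrices (\<open>path_decomposition_of_representative_cycles\<close>). So its runs are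
  runs of the first algorithm.
\<close>

section \<open>Interval decompositions in coordinates\<close>

lemma linear_map_iff:
  fixes V :: "('k::field, 'v) module" and W :: "('k, 'w) module"
  shows "linear_map class_ring V W T \<longleftrightarrow> vectorspace class_ring V \<and> vectorspace class_ring W \<and>
    T \<in> carrier V \<rightarrow> carrier W \<and>
    (\<forall>x\<in>carrier V. \<forall>y\<in>carrier V. T (x \<oplus>\<^bsub>V\<^esub> y) = T x \<oplus>\<^bsub>W\<^esub> T y) \<and>
    (\<forall>c. \<forall>x\<in>carrier V. T (c \<odot>\<^bsub>V\<^esub> x) = c \<odot>\<^bsub>W\<^esub> T x)"
  unfolding linear_map_def mod_hom_def mod_hom_axioms_def module_hom_def vectorspace_def
  by (auto simp: class_ring_simps)

lemma interval_module_simps [simp]: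
  "carrier (pspace (interval_module I) a) = (if a \<in> I then UNIV else {0})"
  "zero (pspace (interval_module I) a) = 0"
  "x \<oplus>\<^bsub>pspace (interval_module I) a\<^esub> y = x + y"
  "c \<odot>\<^bsub>pspace (interval_module I) a\<^esub> x = c * x"
  "pmap (interval_module I) a b x = (if a \<in> I \<and> b \<in> I then x else 0)"
  by (simp_all add: interval_module_def)

lemma interval_sum_simps [simp]:
  "zero (pspace (interval_sum Is) a) = (\<lambda>i\<in>{..<length Is}. 0)"
  "f \<oplus>\<^bsub>pspace (interval_sum Is) a\<^esub> g = (\<lambda>i\<in>{..<length Is}. f i + g i)"
  "c \<odot>\<^bsub>pspace (interval_sum Is) a\<^esub> f = (\<lambda>i\<in>{..<length Is}. c * f i)"
  "pmap (interval_sum Is) a b f =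
     (\<lambda>i\<in>{..<length Is}. if a \<in> Is ! i \<and> b \<in> Is ! i then f i else 0)"
  by (simp_all add: interval_sum_def pm_dsum_def)

lemma carrier_interval_sum:
  "f \<in> carrier (pspace (interval_sum Is) a) \<longleftrightarrow>
     f \<in> extensional {..<length Is} \<and> (\<forall>i<length Is. a \<notin> Is ! i \<longrightarrow> f i = 0)"
  by (auto simp: interval_sum_def pm_dsum_def PiE_def Pi_def split: if_splits)

lemma vectorspace_interval_sum:
  "vectorspace class_ring (pspace (interval_sum Is :: ('p, 'k::field, nat \<Rightarrow> 'k) pers_module) a)"
  (is "vectorspace _ ?X")
proof (rule vs_criteria)
  show "field (class_ring :: 'k ring)" by (rule class_field)
  show "\<forall>v\<in>carrier ?X. \<exists>w\<in>carrier ?X. v \<oplus>\<^bsub>?X\<^esub> w = \<zero>\<^bsub>?X\<^esub>"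
  proof
    fix v assume "v \<in> carrier ?X"
    then show "\<exists>w\<in>carrier ?X. v \<oplus>\<^bsub>?X\<^esub> w = \<zero>\<^bsub>?X\<^esub>"
      by (intro bexI[of _ "\<lambda>i\<in>{..<length Is}. - v i"]) (auto simp: carrier_interval_sum)
  qed
next
  show "\<forall>v\<in>carrier ?X. v \<oplus>\<^bsub>?X\<^esub> \<zero>\<^bsub>?X\<^esub> = v" "\<forall>v\<in>carrier ?X. \<one>\<^bsub>class_ring\<^esub> \<odot>\<^bsub>?X\<^esub> v = v"
    by (auto simp: carrier_interval_sum class_ring_simps intro!: extensionalityI[of _ "{..<length Is}"])
qed (auto simp: carrier_interval_sum class_ring_simps add.commute add.assoc mult.assoc
    distrib_left distrib_right intro!: restrict_ext)

text \<open>An isomorphism onto a sum of interval modules, written coordinatewise: \<open>\<phi> x v i\<close> is the \<open>i\<close>-th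
  coordinate of \<open>v\<close>. All later arguments are then equations in the field \<open>k\<close>.\<close>

definition frame :: "'p::order set \<Rightarrow> ('p, 'k::field, 'v) pers_module \<Rightarrow> 'p set list
    \<Rightarrow> ('p \<Rightarrow> 'v \<Rightarrow> nat \<Rightarrow> 'k) \<Rightarrow> bool" where
  "frame P V Is \<phi> \<longleftrightarrow>
     (\<forall>x\<in>P. bij_betw (\<phi> x) (carrier (pspace V x)) (carrier (pspace (interval_sum Is) x)) \<and>
        (\<forall>v\<in>carrier (pspace V x). \<forall>w\<in>carrier (pspace V x). \<forall>i<length Is.
           \<phi> x (v \<oplus>\<^bsub>pspace V x\<^esub> w) i = \<phi> x v i + \<phi> x w i) \<and>
        (\<forall>c. \<forall>v\<in>carrier (pspace V x). \<forall>i<length Is. \<phi> x (c \<odot>\<^bsub>pspace V x\<^esub> v) i = c * \<phi> x v i)) \<and>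
     (\<forall>a\<in>P. \<forall>b\<in>P. a \<le> b \<longrightarrow> (\<forall>v\<in>carrier (pspace V a). \<forall>i<length Is.
        \<phi> b (pmap V a b v) i = (if a \<in> Is ! i \<and> b \<in> Is ! i then \<phi> a v i else 0)))"

lemma persistence_moduleD:
  assumes "persistence_module P V"
  shows "a \<in> P \<Longrightarrow> vectorspace class_ring (pspace V a)"
    and "a \<in> P \<Longrightarrow> vectorspace.fin_dim class_ring (pspace V a)"
    and "a \<in> P \<Longrightarrow> b \<in> P \<Longrightarrow> a \<le> b \<Longrightarrow> linear_map class_ring (pspace V a) (pspace V b) (pmap V a b)"
    and "a \<in> P \<Longrightarrow> v \<in> carrier (pspace V a) \<Longrightarrow> pmap V a a v = v"
    and "a \<in> P \<Longrightarrow> b \<in> P \<Longrightarrow> c \<in> P \<Longrightarrow> a \<le> b \<Longrightarrow> b \<le> c \<Longrightarrow> v \<in> carrier (pspace V a) \<Longrightarrow>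
      pmap V b c (pmap V a b v) = pmap V a c v"
  using assms unfolding persistence_module_def by auto

lemma persistence_module_subset:
  "persistence_module P V \<Longrightarrow> Q \<subseteq> P \<Longrightarrow> persistence_module Q V"
  unfolding persistence_module_def by (simp add: subset_iff)

lemma pmap_closed:
  assumes "persistence_module P V" "a \<in> P" "b \<in> P" "a \<le> b" "v \<in> carrier (pspace V a)"
  shows "pmap V a b v \<in> carrier (pspace V b)"
  using persistence_moduleD(3)[OF assms(1-4)] assms(5) by (auto simp: linear_map_iff)

lemma pspace_closed:
  assumes "persistence_module P V" "a \<in> P"
  shows "v \<in> carrier (pspace V a) \<Longrightarrow> w \<in> carrier (pspace V a) \<Longrightarrow> v \<oplus>\<^bsub>pspace V a\<^esub> w \<in> carrier (pspace V a)"
    and "v \<in> carrier (pspace V a) \<Longrightarrow> c \<odot>\<^bsub>pspace V a\<^esub> v \<in> carrier (pspace V a)"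
proof -
  interpret vectorspace class_ring "pspace V a" using persistence_moduleD(1)[OF assms] .
  show "v \<in> carrier (pspace V a) \<Longrightarrow> w \<in> carrier (pspace V a) \<Longrightarrow> v \<oplus>\<^bsub>pspace V a\<^esub> w \<in> carrier (pspace V a)"
    and "v \<in> carrier (pspace V a) \<Longrightarrow> c \<odot>\<^bsub>pspace V a\<^esub> v \<in> carrier (pspace V a)"
    by (auto simp: class_ring_simps)
qed

text \<open>A bijective morphism has an inverse morphism, and the operations of a sum of interval modules are
  determined by the coordinates.\<close>

lemma pm_iso_iff_frame:
  fixes V :: "('p::order, 'k::field, 'v) pers_module"
  assumes V: "persistence_module P V"
  shows "pm_iso P V (interval_sum Is) \<phi> \<longleftrightarrow> frame P V Is \<phi>"
proof
  assume iso: "pm_iso P V (interval_sum Is) \<phi>"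
  then obtain \<theta> where hom: "pm_hom P V (interval_sum Is) \<phi>" and hom': "pm_hom P (interval_sum Is) V \<theta>"
    and inv: "\<And>a x. a \<in> P \<Longrightarrow> x \<in> carrier (pspace V a) \<Longrightarrow> \<theta> a (\<phi> a x) = x"
      "\<And>a y. a \<in> P \<Longrightarrow> y \<in> carrier (pspace (interval_sum Is) a) \<Longrightarrow> \<phi> a (\<theta> a y) = y"
    unfolding pm_iso_def by blast
  show "frame P V Is \<phi>"
    unfolding frame_def
  proof (intro conjI ballI)
    fix x assume x: "x \<in> P"
    have lin: "linear_map class_ring (pspace V x) (pspace (interval_sum Is) x) (\<phi> x)"
      and lin': "linear_map class_ring (pspace (interval_sum Is) x) (pspace V x) (\<theta> x)"
      using hom hom' x unfolding pm_hom_def by auto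
    show "bij_betw (\<phi> x) (carrier (pspace V x)) (carrier (pspace (interval_sum Is) x))"
      using lin lin' inv x by (intro bij_betw_byWitness[of _ "\<theta> x"]) (auto simp: linear_map_iff)
    show "\<forall>i<length Is. \<phi> x (v \<oplus>\<^bsub>pspace V x\<^esub> w) i = \<phi> x v i + \<phi> x w i"
      if "v \<in> carrier (pspace V x)" "w \<in> carrier (pspace V x)" for v w
      using lin that by (auto simp: linear_map_iff)
    show "\<forall>c. \<forall>v\<in>carrier (pspace V x). \<forall>i<length Is. \<phi> x (c \<odot>\<^bsub>pspace V x\<^esub> v) i = c * \<phi> x v i"
      using lin by (auto simp: linear_map_iff)
  next
    fix a b assume "a \<in> P" "b \<in> P"
    then show "a \<le> b \<longrightarrow> (\<forall>v\<in>carrier (pspace V a). \<forall>i<length Is.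
        \<phi> b (pmap V a b v) i = (if a \<in> Is ! i \<and> b \<in> Is ! i then \<phi> a v i else 0))"
      using hom unfolding pm_hom_def by auto
  qed
next
  assume fr: "frame P V Is \<phi>"
  let ?X = "interval_sum Is :: ('p, 'k, nat \<Rightarrow> 'k) pers_module"
  have bij: "bij_betw (\<phi> x) (carrier (pspace V x)) (carrier (pspace ?X x))" if "x \<in> P" for x
    using fr that unfolding frame_def by blast
  have ext: "\<phi> x v \<in> extensional {..<length Is}" if "x \<in> P" "v \<in> carrier (pspace V x)" for x v
    using bij_betwE[OF bij[OF that(1)]] that(2) by (auto simp: carrier_interval_sum)
  have hom: "pm_hom P V ?X \<phi>"
    unfolding pm_hom_def linear_map_iff
  proof (intro conjI ballI allI impI)
    fix a assume a: "a \<in> P"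
    show "vectorspace class_ring (pspace V a)" using persistence_moduleD(1)[OF V a] .
    show "vectorspace class_ring (pspace ?X a)" by (rule vectorspace_interval_sum)
    show "\<phi> a \<in> carrier (pspace V a) \<rightarrow> carrier (pspace ?X a)" using bij[OF a] by (auto simp: bij_betw_def)
    fix x assume x: "x \<in> carrier (pspace V a)"
    { fix y assume y: "y \<in> carrier (pspace V a)"
      show "\<phi> a (x \<oplus>\<^bsub>pspace V a\<^esub> y) = \<phi> a x \<oplus>\<^bsub>pspace ?X a\<^esub> \<phi> a y"
        by (rule extensionalityI[OF ext[OF a pspace_closed(1)[OF V a x y]]])
          (use fr a x y in \<open>auto simp: frame_def\<close>) }
    { fix c show "\<phi> a (c \<odot>\<^bsub>pspace V a\<^esub> x) = c \<odot>\<^bsub>pspace ?X a\<^esub> \<phi> a x"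
        by (rule extensionalityI[OF ext[OF a pspace_closed(2)[OF V a x]]])
          (use fr a x in \<open>auto simp: frame_def\<close>) }
    { fix b assume b: "b \<in> P" "a \<le> b"
      show "\<phi> b (pmap V a b x) = pmap ?X a b (\<phi> a x)"
        by (rule extensionalityI[OF ext[OF b(1) pmap_closed[OF V a b x]]])
          (use fr a x b in \<open>auto simp: frame_def\<close>) }
  qed
  define \<theta> where "\<theta> a = inv_into (carrier (pspace V a)) (\<phi> a)" for a
  have t1: "\<theta> a y \<in> carrier (pspace V a)" "\<phi> a (\<theta> a y) = y" if "a \<in> P" "y \<in> carrier (pspace ?X a)" for a y
    using bij[OF that(1)] that(2) unfolding \<theta>_def bij_betw_def
    by (auto intro: inv_into_into f_inv_into_f)
  have t2: "\<theta> a (\<phi> a x) = x" if "a \<in> P" "x \<in> carrier (pspace V a)" for a x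
    using bij[OF that(1)] that(2) unfolding \<theta>_def bij_betw_def by auto
  have eqI: "\<theta> a y = x" if "a \<in> P" "x \<in> carrier (pspace V a)" "y = \<phi> a x" for a x y
    using t2 that by simp
  have "pm_hom P ?X V \<theta>"
    unfolding pm_hom_def linear_map_iff
  proof (intro conjI ballI allI impI)
    fix a assume a: "a \<in> P"
    show "vectorspace class_ring (pspace V a)" using persistence_moduleD(1)[OF V a] .
    show "vectorspace class_ring (pspace ?X a)" by (rule vectorspace_interval_sum)
    show "\<theta> a \<in> carrier (pspace ?X a) \<rightarrow> carrier (pspace V a)" using t1 a by auto
    fix x assume x: "x \<in> carrier (pspace ?X a)"
    { fix y assume y: "y \<in> carrier (pspace ?X a)"
      show "\<theta> a (x \<oplus>\<^bsub>pspace ?X a\<^esub> y) = \<theta> a x \<oplus>\<^bsub>pspace V a\<^esub> \<theta> a y"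
        using hom a t1[OF a x] t1[OF a y] pspace_closed(1)[OF V a]
        by (intro eqI) (auto simp: pm_hom_def linear_map_iff) }
    { fix c show "\<theta> a (c \<odot>\<^bsub>pspace ?X a\<^esub> x) = c \<odot>\<^bsub>pspace V a\<^esub> \<theta> a x"
        using hom a t1[OF a x] pspace_closed(2)[OF V a]
        by (intro eqI) (auto simp: pm_hom_def linear_map_iff) }
    { fix b assume b: "b \<in> P" "a \<le> b"
      show "\<theta> b (pmap ?X a b x) = pmap V a b (\<theta> a x)"
        using hom a b t1[OF a x] pmap_closed[OF V a b]
        by (intro eqI) (auto simp: pm_hom_def) }
  qed
  with hom t1 t2 show "pm_iso P V ?X \<phi>" unfolding pm_iso_def by blast
qed

definition active :: "'p set list \<Rightarrow> 'p \<Rightarrow> nat set" where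
  "active Is x = {i. i < length Is \<and> x \<in> Is ! i}"

lemma finite_active [simp]: "finite (active Is x)"
  by (simp add: active_def)

text \<open>The dual basis of the coordinates. The vector is only meaningful if the \<open>c\<close>-th summand is nonzero
  at \<open>x\<close>.\<close>

definition frame_vec :: "('p, 'k::field, 'v) pers_module \<Rightarrow> nat \<Rightarrow> ('p \<Rightarrow> 'v \<Rightarrow> nat \<Rightarrow> 'k) \<Rightarrow> 'p \<Rightarrow> nat \<Rightarrow> 'v" where
  "frame_vec V N \<phi> x c =
     inv_into (carrier (pspace V x)) (\<phi> x) (\<lambda>i\<in>{..<N}. if i = c then 1 else 0)"

lemma transition_entry_frame_vec:
  "transition_entry V N \<phi> \<psi> x r c = \<psi> x (frame_vec V N \<phi> x c) r"
  by (simp add: transition_entry_def frame_vec_def)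

lemma frameD:
  assumes "frame P V Is \<phi>" "x \<in> P"
  shows "bij_betw (\<phi> x) (carrier (pspace V x)) (carrier (pspace (interval_sum Is) x))"
    and "v \<in> carrier (pspace V x) \<Longrightarrow> w \<in> carrier (pspace V x) \<Longrightarrow> i < length Is \<Longrightarrow>
       \<phi> x (v \<oplus>\<^bsub>pspace V x\<^esub> w) i = \<phi> x v i + \<phi> x w i"
    and "v \<in> carrier (pspace V x) \<Longrightarrow> i < length Is \<Longrightarrow> \<phi> x (c \<odot>\<^bsub>pspace V x\<^esub> v) i = c * \<phi> x v i"
    and "v \<in> carrier (pspace V x) \<Longrightarrow> b \<in> P \<Longrightarrow> x \<le> b \<Longrightarrow> i < length Is \<Longrightarrow>
       \<phi> b (pmap V x b v) i = (if x \<in> Is ! i \<and> b \<in> Is ! i then \<phi> x v i else 0)"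
    and "v \<in> carrier (pspace V x) \<Longrightarrow> \<phi> x v \<in> extensional {..<length Is}"
    and "v \<in> carrier (pspace V x) \<Longrightarrow> i < length Is \<Longrightarrow> x \<notin> Is ! i \<Longrightarrow> \<phi> x v i = 0"
proof -
  show bij: "bij_betw (\<phi> x) (carrier (pspace V x)) (carrier (pspace (interval_sum Is) x))"
    using assms unfolding frame_def by blast
  show "v \<in> carrier (pspace V x) \<Longrightarrow> \<phi> x v \<in> extensional {..<length Is}"
    and "v \<in> carrier (pspace V x) \<Longrightarrow> i < length Is \<Longrightarrow> x \<notin> Is ! i \<Longrightarrow> \<phi> x v i = 0"
    using bij_betwE[OF bij] by (auto simp: carrier_interval_sum)
qed (use assms in \<open>auto simp: frame_def\<close>)

lemma frame_eqI:
  assumes "frame P V Is \<phi>" "x \<in> P" "v \<in> carrier (pspace V x)" "w \<in> carrier (pspace V x)"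
    and "\<And>i. i \<in> active Is x \<Longrightarrow> \<phi> x v i = \<phi> x w i"
  shows "v = w"
proof -
  have "\<phi> x v i = \<phi> x w i" if "i < length Is" for i
    using assms(3-5) frameD(6)[OF assms(1,2) _ that] that by (cases "x \<in> Is ! i") (simp_all add: active_def)
  then have "\<phi> x v = \<phi> x w"
    by (intro extensionalityI[OF frameD(5)[OF assms(1-3)] frameD(5)[OF assms(1,2,4)]]) simp
  then show ?thesis
    using frameD(1)[OF assms(1,2)] assms(3,4) by (auto simp: bij_betw_def inj_on_def)
qed

lemma frame_vec:
  assumes "frame P V Is \<phi>" "x \<in> P" "c \<in> active Is x"
  shows "frame_vec V (length Is) \<phi> x c \<in> carrier (pspace V x)"
    and "i < length Is \<Longrightarrow> \<phi> x (frame_vec V (length Is) \<phi> x c) i = (if i = c then 1 else 0)"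
proof -
  have "(\<lambda>i\<in>{..<length Is}. if i = c then 1 else 0) \<in> carrier (pspace (interval_sum Is) x)"
    using assms(3) by (auto simp: carrier_interval_sum active_def)
  then have *: "(\<lambda>i\<in>{..<length Is}. if i = c then 1 else 0) \<in> \<phi> x ` carrier (pspace V x)"
    using frameD(1)[OF assms(1,2)] by (simp add: bij_betw_def)
  show "frame_vec V (length Is) \<phi> x c \<in> carrier (pspace V x)"
    unfolding frame_vec_def by (rule inv_into_into[OF *])
  show "i < length Is \<Longrightarrow> \<phi> x (frame_vec V (length Is) \<phi> x c) i = (if i = c then 1 else 0)"
    unfolding frame_vec_def f_inv_into_f[OF *] by simp
qed

lemma frame_vec_eqI:
  assumes "frame P V Is \<phi>" "x \<in> P" "c \<in> active Is x" "v \<in> carrier (pspace V x)"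
    and "\<And>i. i \<in> active Is x \<Longrightarrow> \<phi> x v i = (if i = c then 1 else 0)"
  shows "frame_vec V (length Is) \<phi> x c = v"
  by (rule frame_eqI[OF assms(1,2) frame_vec(1)[OF assms(1-3)] assms(4)])
    (use frame_vec(2)[OF assms(1-3)] assms(5) in \<open>auto simp: active_def\<close>)

text \<open>Stated for functionals rather than for the vector itself, since it is used to expand one coordinate
  of another frame.\<close>

lemma frame_expansion:
  fixes L :: "'v \<Rightarrow> 'k::field"
  assumes V: "persistence_module P V" and fr: "frame P V Is \<phi>" and x: "x \<in> P" and v: "v \<in> carrier (pspace V x)"
    and add: "\<And>v w. v \<in> carrier (pspace V x) \<Longrightarrow> w \<in> carrier (pspace V x) \<Longrightarrow> L (v \<oplus>\<^bsub>pspace V x\<^esub> w) = L v + L w"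
    and smult: "\<And>c v. v \<in> carrier (pspace V x) \<Longrightarrow> L (c \<odot>\<^bsub>pspace V x\<^esub> v) = c * L v"
  shows "L v = (\<Sum>c\<in>active Is x. \<phi> x v c * L (frame_vec V (length Is) \<phi> x c))"
proof -
  have "A \<subseteq> active Is x \<Longrightarrow> v \<in> carrier (pspace V x) \<Longrightarrow> (\<forall>i\<in>active Is x - A. \<phi> x v i = 0) \<Longrightarrow>
     L v = (\<Sum>c\<in>A. \<phi> x v c * L (frame_vec V (length Is) \<phi> x c))" if "finite A" for A v
    using that
  proof (induction A arbitrary: v)
    case empty
    have "v = 0 \<odot>\<^bsub>pspace V x\<^esub> v"
      by (rule frame_eqI[OF fr x]) (use empty pspace_closed(2)[OF V x] frameD(3)[OF fr x] in \<open>auto simp: active_def\<close>)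
    then have "L v = 0 * L v" using smult[OF empty(2), of 0] by simp
    then show ?case by simp
  next
    case (insert c A)
    let ?e = "frame_vec V (length Is) \<phi> x c"
    have c: "c \<in> active Is x" and cN: "c < length Is" using insert by (auto simp: active_def)
    note e = frame_vec[OF fr x c]
    note se = pspace_closed(2)[OF V x e(1)]
    let ?w = "v \<oplus>\<^bsub>pspace V x\<^esub> (- \<phi> x v c) \<odot>\<^bsub>pspace V x\<^esub> ?e"
    have w: "?w \<in> carrier (pspace V x)" using pspace_closed(1)[OF V x insert.prems(2) se] .
    have co: "\<phi> x ?w i = \<phi> x v i - (if i = c then \<phi> x v c else 0)" if "i < length Is" for i
      using that frameD(2)[OF fr x insert.prems(2) se] frameD(3)[OF fr x e(1)] e(2) by simp
    have A: "i < length Is" if "i \<in> A" for i using that insert.prems(1) by (auto simp: active_def)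
    have "L ?w = (\<Sum>d\<in>A. \<phi> x ?w d * L (frame_vec V (length Is) \<phi> x d))"
      using insert.prems co by (intro insert.IH[OF _ w]) (auto simp: active_def)
    also have "\<dots> = (\<Sum>d\<in>A. \<phi> x v d * L (frame_vec V (length Is) \<phi> x d))"
      using insert.hyps(2) by (intro sum.cong) (auto simp: co A)
    also have "L ?w = L v - \<phi> x v c * L ?e"
      using add[OF insert.prems(2) se] smult[OF e(1)] by simp
    finally show ?case using insert.hyps by (simp add: algebra_simps)
  qed
  from this[of "active Is x" v] v show ?thesis by simp
qed

text \<open>The condition says that the identity of \<open>k\<close> on \<open>I \<inter> J\<close>, extended by zero, is a
  morphism \<open>k\<^sub>I \<rightarrow> k\<^sub>J\<close>.\<close>

definition overlap_hom :: "'p::order set \<Rightarrow> 'p set \<Rightarrow> 'p set \<Rightarrow> bool" where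
  "overlap_hom P I J \<longleftrightarrow> (\<forall>a\<in>P. \<forall>b\<in>P. a \<le> b \<longrightarrow> (a \<in> I \<and> b \<in> I \<and> b \<in> J \<longleftrightarrow> a \<in> I \<and> a \<in> J \<and> b \<in> J))"

text \<open>The composition of a frame with the automorphism \<open>1 + a f\<close>, where \<open>f\<close> is the identity on the overlap,
  from the \<open>l\<close>-th to the \<open>k\<close>-th summand. The guard \<open>x \<in> Is ! k\<close> keeps the \<open>k\<close>-th coordinate zero outside
  its interval.\<close>

definition shear :: "'p set list \<Rightarrow> 'k::field \<Rightarrow> nat \<Rightarrow> nat \<Rightarrow> ('p \<Rightarrow> 'v \<Rightarrow> nat \<Rightarrow> 'k) \<Rightarrow> 'p \<Rightarrow> 'v \<Rightarrow> nat \<Rightarrow> 'k" where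
  "shear Is a k l \<phi> x v = (\<lambda>i\<in>{..<length Is}. if i = k \<and> x \<in> Is ! k then \<phi> x v k + a * \<phi> x v l else \<phi> x v i)"

definition rescale :: "'p set list \<Rightarrow> 'k::field \<Rightarrow> nat \<Rightarrow> ('p \<Rightarrow> 'v \<Rightarrow> nat \<Rightarrow> 'k) \<Rightarrow> 'p \<Rightarrow> 'v \<Rightarrow> nat \<Rightarrow> 'k" where
  "rescale Is a k \<phi> x v = (\<lambda>i\<in>{..<length Is}. if i = k then a * \<phi> x v k else \<phi> x v i)"

text \<open>Compatibility with the structure maps is exactly that \<open>f\<close> is a morphism.\<close>

lemma frame_shear:
  fixes V :: "('p::order, 'k::field, 'v) pers_module"
  assumes V: "persistence_module P V" and fr: "frame P V Is \<phi>" and kl: "k < length Is" "l < length Is" "k \<noteq> l"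
    and hom: "overlap_hom P (Is ! l) (Is ! k)"
  shows "frame P V Is (shear Is a k l \<phi>)"
  unfolding frame_def
proof (intro conjI ballI allI impI)
  fix x assume x: "x \<in> P"
  define E where "E b f = (\<lambda>i\<in>{..<length Is}. if i = k \<and> x \<in> Is ! k then f k + b * f l else f i)" for b and f :: "nat \<Rightarrow> 'k"
  have "bij_betw (E a) (carrier (pspace (interval_sum Is) x)) (carrier (pspace (interval_sum Is) x))"
    using kl by (intro bij_betw_byWitness[of _ "E (- a)"])
      (auto simp: E_def carrier_interval_sum intro!: extensionalityI[of _ "{..<length Is}"])
  from bij_betw_trans[OF frameD(1)[OF fr x] this]
  show "bij_betw (shear Is a k l \<phi> x) (carrier (pspace V x)) (carrier (pspace (interval_sum Is) x))"
    by (rule bij_betw_cong[THEN iffD1, rotated]) (simp add: E_def shear_def)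
  fix v i assume v: "v \<in> carrier (pspace V x)" and i: "i < length Is"
  { fix w assume "w \<in> carrier (pspace V x)"
    then show "shear Is a k l \<phi> x (v \<oplus>\<^bsub>pspace V x\<^esub> w) i = shear Is a k l \<phi> x v i + shear Is a k l \<phi> x w i"
      using v i kl frameD(2)[OF fr x] by (simp add: shear_def algebra_simps) }
  { fix c show "shear Is a k l \<phi> x (c \<odot>\<^bsub>pspace V x\<^esub> v) i = c * shear Is a k l \<phi> x v i"
      using v i kl frameD(3)[OF fr x] by (simp add: shear_def algebra_simps) }
  { fix b assume b: "b \<in> P" "x \<le> b"
    have *: "x \<in> Is ! l \<and> b \<in> Is ! l \<and> b \<in> Is ! k \<longleftrightarrow> x \<in> Is ! l \<and> x \<in> Is ! k \<and> b \<in> Is ! k"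
      using hom x b unfolding overlap_hom_def by blast
    show "shear Is a k l \<phi> b (pmap V x b v) i =
       (if x \<in> Is ! i \<and> b \<in> Is ! i then shear Is a k l \<phi> x v i else 0)"
      using i kl frameD(4)[OF fr x v b] frameD(6)[OF fr x v] * by (auto simp: shear_def) }
qed

lemma frame_rescale:
  fixes V :: "('p::order, 'k::field, 'v) pers_module"
  assumes V: "persistence_module P V" and fr: "frame P V Is \<phi>" and k: "k < length Is" and a: "a \<noteq> 0"
  shows "frame P V Is (rescale Is a k \<phi>)"
  unfolding frame_def
proof (intro conjI ballI allI impI)
  fix x assume x: "x \<in> P"
  define E where "E b f = (\<lambda>i\<in>{..<length Is}. if i = k then b * f k else f i)" for b and f :: "nat \<Rightarrow> 'k"
  have "bij_betw (E a) (carrier (pspace (interval_sum Is) x)) (carrier (pspace (interval_sum Is) x))"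
    using k a by (intro bij_betw_byWitness[of _ "E (inverse a)"])
      (auto simp: E_def carrier_interval_sum intro!: extensionalityI[of _ "{..<length Is}"])
  from bij_betw_trans[OF frameD(1)[OF fr x] this]
  show "bij_betw (rescale Is a k \<phi> x) (carrier (pspace V x)) (carrier (pspace (interval_sum Is) x))"
    by (rule bij_betw_cong[THEN iffD1, rotated]) (simp add: E_def rescale_def)
qed (use k frameD(2-4)[OF fr] in \<open>auto simp: rescale_def algebra_simps\<close>)

text \<open>The dual basis changes by the inverse of the automorphism; therefore \<open>k\<close> and \<open>l\<close> change places and \<open>a\<close> its
  sign.\<close>

lemma frame_vec_shear:
  fixes V :: "('p::order, 'k::field, 'v) pers_module"
  assumes V: "persistence_module P V" and fr: "frame P V Is \<phi>" and kl: "k < length Is" "l < length Is" "k \<noteq> l"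
    and hom: "overlap_hom P (Is ! l) (Is ! k)" and x: "x \<in> P" and c: "c \<in> active Is x"
  shows "frame_vec V (length Is) (shear Is a k l \<phi>) x c =
     (if c = l \<and> x \<in> Is ! k then frame_vec V (length Is) \<phi> x l \<oplus>\<^bsub>pspace V x\<^esub> (- a) \<odot>\<^bsub>pspace V x\<^esub> frame_vec V (length Is) \<phi> x k
      else frame_vec V (length Is) \<phi> x c)"
proof (cases "c = l \<and> x \<in> Is ! k")
  case True
  then have k: "k \<in> active Is x" and l: "l \<in> active Is x" using kl c by (auto simp: active_def)
  note ek = frame_vec[OF fr x k] and el = frame_vec[OF fr x l]
  note sk = pspace_closed(2)[OF V x ek(1)]
  show ?thesis
    unfolding if_P[OF True]
    using True kl ek el sk pspace_closed(1)[OF V x el(1) sk] frameD(2)[OF fr x el(1) sk] frameD(3)[OF fr x ek(1)]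
    by (intro frame_vec_eqI[OF frame_shear[OF V fr kl hom] x c]) (auto simp: shear_def active_def)
next
  case False
  show ?thesis
    unfolding if_not_P[OF False]
    using False kl frame_vec[OF fr x c] c
    by (intro frame_vec_eqI[OF frame_shear[OF V fr kl hom] x c]) (auto simp: shear_def active_def)
qed

lemma frame_vec_rescale:
  fixes V :: "('p::order, 'k::field, 'v) pers_module"
  assumes V: "persistence_module P V" and fr: "frame P V Is \<phi>" and k: "k < length Is" and a: "a \<noteq> 0"
    and x: "x \<in> P" and c: "c \<in> active Is x"
  shows "frame_vec V (length Is) (rescale Is a k \<phi>) x c =
     (if c = k then inverse a \<odot>\<^bsub>pspace V x\<^esub> frame_vec V (length Is) \<phi> x k else frame_vec V (length Is) \<phi> x c)"
  using k a c frame_vec[OF fr x c] pspace_closed(2)[OF V x frame_vec(1)[OF fr x c]] frameD(3)[OF fr x frame_vec(1)[OF fr x c]]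
  by (intro frame_vec_eqI[OF frame_rescale[OF V fr k a] x c]) (auto simp: rescale_def active_def)

section \<open>Matrix reduction over a field\<close>

text \<open>If \<open>p < q\<close>, then padding with zeros gives square matrices with \<open>B0 * A0 = 1\<close>, hence \<open>A0 * B0 = 1\<close>; but
  the \<open>p\<close>-th row of \<open>A0\<close> is zero.\<close>

lemma right_inverse_dim_le:
  fixes A B :: "nat \<Rightarrow> nat \<Rightarrow> 'k::field"
  assumes inv: "\<And>j l. j < q \<Longrightarrow> l < q \<Longrightarrow> (\<Sum>i<p. B j i * A i l) = (if j = l then 1 else 0)"
  shows "q \<le> p"
proof (rule ccontr)
  assume "\<not> q \<le> p"
  define A0 where "A0 = mat q q (\<lambda>(i, j). if i < p then A i j else 0)"
  define B0 where "B0 = mat q q (\<lambda>(j, i). if i < p then B j i else 0)"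
  have "B0 * A0 = 1\<^sub>m q"
  proof (rule eq_matI)
    fix j l assume "j < dim_row (1\<^sub>m q)" "l < dim_col (1\<^sub>m q :: 'k mat)"
    then have jl: "j < q" "l < q" by auto
    have "(B0 * A0) $$ (j, l) = (\<Sum>i<q. (if i < p then B j i else 0) * (if i < p then A i l else 0))"
      using jl by (simp add: A0_def B0_def scalar_prod_def lessThan_atLeast0)
    also have "\<dots> = (\<Sum>i<p. B j i * A i l)"
      using \<open>\<not> q \<le> p\<close> by (intro sum.mono_neutral_cong_right) auto
    finally show "(B0 * A0) $$ (j, l) = 1\<^sub>m q $$ (j, l)" using inv jl by simp
  qed (auto simp: A0_def B0_def)
  then have "A0 * B0 = 1\<^sub>m q"
    by (rule mat_mult_left_right_inverse[rotated 2]) (auto simp: A0_def B0_def)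
  then have "(A0 * B0) $$ (p, p) = 1" using \<open>\<not> q \<le> p\<close> by simp
  moreover have "(A0 * B0) $$ (p, p) = 0"
    using \<open>\<not> q \<le> p\<close> by (simp add: A0_def B0_def scalar_prod_def)
  ultimately show False by simp
qed

text \<open>The loop that clears the entries to the right of a pivot. A step changes neither column \<open>c\<close> nor the
  columns still to come, so it has the same effect as subtracting multiples of column \<open>c\<close> simultaneously. The
  predicate \<open>St\<close> is any invariant of the operations; here and below it carries the information that
  the matrix is the transition matrix of some pair of frames.\<close>

lemma fold_addcol:
  fixes X :: "'k::field mat"
  assumes "distinct js" "set js \<subseteq> {..<q}" "c < q" "c \<notin> set js" "r < p" "St X"
    and dims: "\<And>A. St A \<Longrightarrow> A \<in> carrier_mat p q"
    and op: "\<And>A j a. St A \<Longrightarrow> j \<in> set js \<Longrightarrow> St (addcol a j c A)"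
  shows "St (fold (\<lambda>j X. addcol (- X $$ (r, j)) j c X) js X) \<and>
    (\<forall>i<p. \<forall>j<q. fold (\<lambda>j X. addcol (- X $$ (r, j)) j c X) js X $$ (i, j) =
       (if j \<in> set js then X $$ (i, j) - X $$ (r, j) * X $$ (i, c) else X $$ (i, j)))"
  using assms(1-6) op
proof (induction js arbitrary: X)
  case (Cons k js)
  let ?X = "addcol (- X $$ (r, k)) k c X"
  have St: "St ?X" using Cons.prems by simp
  have d: "dim_row X = p" "dim_col X = q" using dims[OF \<open>St X\<close>] by auto
  have ent: "?X $$ (i, j) = (if j = k then X $$ (i, j) - X $$ (r, j) * X $$ (i, c) else X $$ (i, j))"
    if "i < p" "j < q" for i j
    using that d Cons.prems by simp
  have prems: "distinct js" "set js \<subseteq> {..<q}" "c < q" "c \<notin> set js" "r < p" "k < q" "k \<notin> set js" "k \<noteq> c"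
    using Cons.prems(1-5) by auto
  have op': "\<And>A j a. St A \<Longrightarrow> j \<in> set js \<Longrightarrow> St (addcol a j c A)" using Cons.prems(7) by simp
  note IH = Cons.IH[OF prems(1-5) St op']
  have "fold (\<lambda>j X. addcol (- X $$ (r, j)) j c X) js ?X $$ (i, j) =
       (if j \<in> set (k # js) then X $$ (i, j) - X $$ (r, j) * X $$ (i, c) else X $$ (i, j))"
    if ij: "i < p" "j < q" for i j
  proof -
    have "fold (\<lambda>j X. addcol (- X $$ (r, j)) j c X) js ?X $$ (i, j) =
       (if j \<in> set js then ?X $$ (i, j) - ?X $$ (r, j) * ?X $$ (i, c) else ?X $$ (i, j))"
      using IH ij by blast
    then show ?thesis
      unfolding ent[OF ij] ent[OF prems(5) ij(2)] ent[OF ij(1) prems(3)] using prems(7,8) by (cases "j = k") simp_all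
  qed
  with IH show ?case by simp
qed simp

lemma fold_addrow:
  fixes X :: "'k::field mat"
  assumes "distinct js" "set js \<subseteq> {..<p}" "r < p" "r \<notin> set js" "c < q" "St X"
    and dims: "\<And>A. St A \<Longrightarrow> A \<in> carrier_mat p q"
    and op: "\<And>A i a. St A \<Longrightarrow> i \<in> set js \<Longrightarrow> St (addrow a i r A)"
  shows "St (fold (\<lambda>i X. addrow (- X $$ (i, c)) i r X) js X) \<and>
    (\<forall>i<p. \<forall>j<q. fold (\<lambda>i X. addrow (- X $$ (i, c)) i r X) js X $$ (i, j) =
       (if i \<in> set js then X $$ (i, j) - X $$ (i, c) * X $$ (r, j) else X $$ (i, j)))"
  using assms(1-6) op
proof (induction js arbitrary: X)
  case (Cons k js)
  let ?X = "addrow (- X $$ (k, c)) k r X"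
  have St: "St ?X" using Cons.prems by simp
  have d: "dim_row X = p" "dim_col X = q" using dims[OF \<open>St X\<close>] by auto
  have ent: "?X $$ (i, j) = (if i = k then X $$ (i, j) - X $$ (i, c) * X $$ (r, j) else X $$ (i, j))"
    if "i < p" "j < q" for i j
    using that d Cons.prems by simp
  have prems: "distinct js" "set js \<subseteq> {..<p}" "r < p" "r \<notin> set js" "c < q" "k < p" "k \<notin> set js" "k \<noteq> r"
    using Cons.prems(1-5) by auto
  have op': "\<And>A j a. St A \<Longrightarrow> j \<in> set js \<Longrightarrow> St (addrow a j r A)" using Cons.prems(7) by simp
  note IH = Cons.IH[OF prems(1-5) St op']
  have "fold (\<lambda>i X. addrow (- X $$ (i, c)) i r X) js ?X $$ (i, j) =
       (if i \<in> set (k # js) then X $$ (i, j) - X $$ (i, c) * X $$ (r, j) else X $$ (i, j))"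
    if ij: "i < p" "j < q" for i j
  proof -
    have "fold (\<lambda>i X. addrow (- X $$ (i, c)) i r X) js ?X $$ (i, j) =
       (if i \<in> set js then ?X $$ (i, j) - ?X $$ (i, c) * ?X $$ (r, j) else ?X $$ (i, j))"
      using IH ij by blast
    then show ?thesis
      unfolding ent[OF ij] ent[OF prems(3) ij(2)] ent[OF ij(1) prems(5)] using prems(7,8) by (cases "i = k") simp_all
  qed
  with IH show ?case by simp
qed simp

text \<open>After \<open>c\<close> columns each of them contains a single \<open>1\<close>, in pairwise different rows, and these rows
  vanish to the right of it. The next pivot lies in a new row for that reason, and clearing with it leaves the
  earlier columns alone. In the end every column is a unit vector with a pivot of its own, and as no row is zero, all
  rows have pivots. Rows and columns stay nonzero because \<open>St\<close> is preserved.\<close>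

lemma reduction_permutation:
  fixes A :: "'k::field mat"
  assumes A: "St A"
    and dims: "\<And>A. St A \<Longrightarrow> A \<in> carrier_mat p q"
    and nzc: "\<And>A j. St A \<Longrightarrow> j < q \<Longrightarrow> \<exists>i<p. A $$ (i, j) \<noteq> 0"
    and nzr: "\<And>A i. St A \<Longrightarrow> i < p \<Longrightarrow> \<exists>j<q. A $$ (i, j) \<noteq> 0"
    and mult: "\<And>A i a. St A \<Longrightarrow> i < p \<Longrightarrow> a \<noteq> 0 \<Longrightarrow> St (multrow i a A)"
    and addc: "\<And>A i j a. St A \<Longrightarrow> i < j \<Longrightarrow> j < q \<Longrightarrow> St (addcol a j i A)"
    and addr: "\<And>A i j a. St A \<Longrightarrow> i < j \<Longrightarrow> j < p \<Longrightarrow> St (addrow a i j A)"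
  shows "St (reduction A)" and "permutation_matrix (reduction A)"
proof -
  define Inv where "Inv c A r \<longleftrightarrow> inj_on r {..<c} \<and> (\<forall>j<c. r j < p \<and>
     (\<forall>i<p. A $$ (i, j) = (if i = r j then 1 else 0)) \<and> (\<forall>k. j < k \<and> k < q \<longrightarrow> A $$ (r j, k) = 0))"
    for c :: nat and A :: "'k mat" and r :: "nat \<Rightarrow> nat"
  have step: "St (reduce_col c A) \<and> (\<exists>r. Inv (Suc c) (reduce_col c A) r)"
    if St: "St A" and inv: "Inv c A r" and c: "c < q" for c A r
  proof -
    have d: "dim_row A = p" "dim_col A = q" using dims[OF St] by auto
    let ?S = "{i. i < p \<and> A $$ (i, c) \<noteq> 0}"
    define r0 where "r0 = Max ?S"
    have "?S \<noteq> {}" using nzc[OF St c] by auto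
    then have "r0 \<in> ?S" unfolding r0_def by (intro Max_in) auto
    then have r0: "r0 < p" "A $$ (r0, c) \<noteq> 0" by auto
    have below: "A $$ (i, c) = 0" if "i < p" "r0 < i" for i
    proof (rule ccontr)
      assume "A $$ (i, c) \<noteq> 0"
      then have "i \<le> r0" unfolding r0_def using that by (intro Max_ge) auto
      with that show False by simp
    qed
    \<comment> \<open>the rows of the earlier pivots vanish in column \<open>c\<close>\<close>
    have new: "r0 \<noteq> r j" if "j < c" for j
      using inv r0(2) that c unfolding Inv_def by auto
    define A1 where "A1 = multrow r0 (inverse (A $$ (r0, c))) A"
    have St1: "St A1" unfolding A1_def using mult[OF St r0(1)] r0(2) by simp
    have A1: "A1 $$ (i, j) = (if i = r0 then A $$ (r0, j) / A $$ (r0, c) else A $$ (i, j))"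
      if "i < p" "j < q" for i j
      using that d unfolding A1_def by (simp add: field_simps)
    define A2 where "A2 = fold (\<lambda>j X. addcol (- X $$ (r0, j)) j c X) [Suc c..<q] A1"
    have 2: "St A2 \<and> (\<forall>i<p. \<forall>j<q. A2 $$ (i, j) =
       (if j \<in> set [Suc c..<q] then A1 $$ (i, j) - A1 $$ (r0, j) * A1 $$ (i, c) else A1 $$ (i, j)))"
      unfolding A2_def by (rule fold_addcol) (use St1 c r0 dims addc in auto)
    define A3 where "A3 = fold (\<lambda>i X. addrow (- X $$ (i, c)) i r0 X) [0..<r0] A2"
    have 3: "St A3 \<and> (\<forall>i<p. \<forall>j<q. A3 $$ (i, j) =
       (if i \<in> set [0..<r0] then A2 $$ (i, j) - A2 $$ (i, c) * A2 $$ (r0, j) else A2 $$ (i, j)))"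
      unfolding A3_def by (rule fold_addrow) (use 2 c r0 dims addr in auto)
    have red: "reduce_col c A = A3"
      unfolding reduce_col_def A3_def A2_def A1_def r0_def d by (simp add: Let_def d)
    have row: "A2 $$ (r0, j) = (if j = c then 1 else 0)" if "j < q" for j
    proof (cases "j < c")
      case True
      then have "A $$ (r0, j) = 0" using inv new[OF True] r0(1) unfolding Inv_def by auto
      then show ?thesis using 2 A1 that c True r0 by simp
    next
      case False
      then show ?thesis using 2 A1 that c r0 by auto
    qed
    have A3_old: "A3 $$ (i, j) = A2 $$ (i, j)" if "i < p" "j < q" "j \<noteq> c" for i j
      using 3 row that by simp
    have A3_c: "A3 $$ (i, c) = (if i = r0 then 1 else 0)" if "i < p" for i
      using 3 row[OF c] that c below[OF that] 2 A1[OF that c] by auto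
    have "Inv (Suc c) A3 (r(c := r0))"
      unfolding Inv_def
    proof (intro conjI allI impI)
      show "inj_on (r(c := r0)) {..<Suc c}"
        unfolding lessThan_Suc inj_on_insert
      proof
        have "inj_on r {..<c}" using inv by (simp add: Inv_def)
        then show "inj_on (r(c := r0)) {..<c}" by (simp add: inj_on_def)
        show "(r(c := r0)) c \<notin> (r(c := r0)) ` ({..<c} - {c})" using new by auto
      qed
      fix j assume j: "j < Suc c"
      show "(r(c := r0)) j < p" using inv j r0 unfolding Inv_def by (auto simp: less_Suc_eq)
      { fix i assume i: "i < p"
        show "A3 $$ (i, j) = (if i = (r(c := r0)) j then 1 else 0)"
        proof (cases "j = c")
          case False
          then have jc: "j < c" using j by simp
          have "A3 $$ (i, j) = A $$ (i, j)"
            using A3_old[OF i, of j] 2 A1[OF i, of j] jc c i inv new[OF jc] r0(1) unfolding Inv_def by auto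
          then show ?thesis using inv jc i unfolding Inv_def by auto
        qed (use A3_c i in auto) }
      { fix k assume k: "j < k \<and> k < q"
        show "A3 $$ ((r(c := r0)) j, k) = 0"
        proof (cases "j = c")
          case True
          then show ?thesis using A3_old[of r0 k] row[of k] k r0 by auto
        next
          case False
          then have jc: "j < c" using j by simp
          have rj: "r j < p" "r j \<noteq> r0" using inv jc new[OF jc] unfolding Inv_def by auto
          have z: "A $$ (r j, l) = 0" if "j < l" "l < q" for l using inv jc that unfolding Inv_def by auto
          have "A2 $$ (r j, l) = 0" if "j < l" "l < q" for l
            using 2 A1[OF rj(1)] rj z[OF that] z[of c] jc c that by auto
          then show ?thesis using 3 rj k jc c row False by auto
        qed }
    qed
    with 3 red show ?thesis by blast
  qed
  have "c \<le> q \<Longrightarrow> St (fold reduce_col [0..<c] A) \<and> (\<exists>r. Inv c (fold reduce_col [0..<c] A) r)" for c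
  proof (induction c)
    case 0
    then show ?case using A by (auto simp: Inv_def)
  next
    case (Suc c)
    then obtain r where "St (fold reduce_col [0..<c] A)" "Inv c (fold reduce_col [0..<c] A) r" by auto
    then have "St (reduce_col c (fold reduce_col [0..<c] A)) \<and>
        (\<exists>r. Inv (Suc c) (reduce_col c (fold reduce_col [0..<c] A)) r)"
      using Suc.prems by (intro step) auto
    then show ?case by simp
  qed
  from this[of q] obtain r where St: "St (reduction A)" and inv: "Inv q (reduction A) r"
    using dims[OF A] by (auto simp: reduction_def)
  show "St (reduction A)" by (rule St)
  let ?R = "reduction A"
  have d: "dim_row ?R = p" "dim_col ?R = q" using dims[OF St] by auto
  have inj: "inj_on r {..<q}" and r: "\<And>j. j < q \<Longrightarrow> r j < p"
    and ent: "\<And>i j. i < p \<Longrightarrow> j < q \<Longrightarrow> ?R $$ (i, j) = (if i = r j then 1 else 0)"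
    using inv unfolding Inv_def by auto
  have surj: "r ` {..<q} = {..<p}"
  proof
    show "{..<p} \<subseteq> r ` {..<q}"
    proof
      fix i assume "i \<in> {..<p}"
      then obtain j where "j < q" "?R $$ (i, j) \<noteq> 0" using nzr[OF St] by auto
      then show "i \<in> r ` {..<q}" using ent \<open>i \<in> {..<p}\<close> by (auto split: if_splits)
    qed
  qed (use r in auto)
  then have pq: "p = q" using card_image[OF inj] by simp
  define \<sigma> where "\<sigma> j = (if j < q then r j else j)" for j
  have "bij_betw \<sigma> {..<q} {..<q}"
    using inj surj pq by (auto simp: bij_betw_def \<sigma>_def inj_on_def image_def)
  then have "\<sigma> permutes {..<q}" by (intro bij_imp_permutes) (auto simp: \<sigma>_def)
  moreover have "?R = mat q q (\<lambda>(i, j). if i = \<sigma> j then 1 else 0)"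
    by (rule eq_matI) (use d pq ent in \<open>auto simp: \<sigma>_def\<close>)
  ultimately show "permutation_matrix ?R" unfolding permutation_matrix_def d by blast
qed

text \<open>Gaussian elimination with pivots anywhere. Matrices are functions here, because only the values at
  indices below \<open>p\<close> and \<open>q\<close> matter and the operations then need no dimensions.\<close>

lemma rank_normal_form:
  fixes F :: "nat \<Rightarrow> nat \<Rightarrow> 'k::field"
  assumes F: "St F"
    and swapr: "\<And>F i k. St F \<Longrightarrow> i < p \<Longrightarrow> k < p \<Longrightarrow>
       St (\<lambda>r c. F (if r = i then k else if r = k then i else r) c)"
    and swapc: "\<And>F i k. St F \<Longrightarrow> i < q \<Longrightarrow> k < q \<Longrightarrow>
       St (\<lambda>r c. F r (if c = i then k else if c = k then i else c))"
    and mult: "\<And>F i a. St F \<Longrightarrow> i < p \<Longrightarrow> a \<noteq> 0 \<Longrightarrow> St (\<lambda>r c. if r = i then a * F r c else F r c)"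
    and addr: "\<And>F i k a. St F \<Longrightarrow> i < p \<Longrightarrow> k < p \<Longrightarrow> i \<noteq> k \<Longrightarrow>
       St (\<lambda>r c. if r = i then F r c + a * F k c else F r c)"
    and addc: "\<And>F i k a. St F \<Longrightarrow> i < q \<Longrightarrow> k < q \<Longrightarrow> i \<noteq> k \<Longrightarrow>
       St (\<lambda>r c. if c = i then F r c + a * F r k else F r c)"
  shows "\<exists>F' k. St F' \<and> k \<le> p \<and> k \<le> q \<and> (\<forall>i<p. \<forall>j<q. F' i j = (if i = j \<and> i < k then 1 else 0))"
proof -
  define Inv where "Inv k F \<longleftrightarrow> St F \<and> k \<le> p \<and> k \<le> q \<and>
     (\<forall>i<p. \<forall>j<q. i < k \<or> j < k \<longrightarrow> F i j = (if i = j then 1 else 0))" for k and F :: "nat \<Rightarrow> nat \<Rightarrow> 'k"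
  have clear_rows: "distinct is \<Longrightarrow> set is \<subseteq> {..<p} - {k} \<Longrightarrow> k < p \<Longrightarrow> St F \<Longrightarrow>
     St (\<lambda>i j. if i \<in> set is then F i j + a i * F k j else F i j)" for "is" k F a
  proof (induction "is" arbitrary: F)
    case (Cons l ls)
    have "St (\<lambda>i j. if i = l then F i j + a l * F k j else F i j)"
      using Cons.prems by (intro addr) auto
    then have "St (\<lambda>i j. if i \<in> set ls then (if i = l then F i j + a l * F k j else F i j) + a i * (if k = l then F k j + a l * F k j else F k j)
       else (if i = l then F i j + a l * F k j else F i j))"
      using Cons.prems by (intro Cons.IH) auto
    also have "(\<lambda>i j. if i \<in> set ls then (if i = l then F i j + a l * F k j else F i j) + a i * (if k = l then F k j + a l * F k j else F k j)
       else (if i = l then F i j + a l * F k j else F i j)) = (\<lambda>i j. if i \<in> set (l # ls) then F i j + a i * F k j else F i j)"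
      using Cons.prems by (intro ext) auto
    finally show ?case .
  qed simp
  have clear_cols: "distinct js \<Longrightarrow> set js \<subseteq> {..<q} - {k} \<Longrightarrow> k < q \<Longrightarrow> St F \<Longrightarrow>
     St (\<lambda>i j. if j \<in> set js then F i j + a j * F i k else F i j)" for js k F a
  proof (induction js arbitrary: F)
    case (Cons l ls)
    have "St (\<lambda>i j. if j = l then F i j + a l * F i k else F i j)"
      using Cons.prems by (intro addc) auto
    then have "St (\<lambda>i j. if j \<in> set ls then (if j = l then F i j + a l * F i k else F i j) + a j * (if k = l then F i k + a l * F i k else F i k)
       else (if j = l then F i j + a l * F i k else F i j))"
      using Cons.prems by (intro Cons.IH) auto
    also have "(\<lambda>i j. if j \<in> set ls then (if j = l then F i j + a l * F i k else F i j) + a j * (if k = l then F i k + a l * F i k else F i k)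
       else (if j = l then F i j + a l * F i k else F i j)) = (\<lambda>i j. if j \<in> set (l # ls) then F i j + a j * F i k else F i j)"
      using Cons.prems by (intro ext) auto
    finally show ?case .
  qed simp
  have step: "\<exists>F'. Inv (Suc k) F'" if inv: "Inv k F" and i: "i < p" "j < q" "F i j \<noteq> 0" "k \<le> i" "k \<le> j" for k F i j
  proof -
    have kp: "k < p" "k < q" using i by auto
    define F1 where "F1 = (\<lambda>r c. F (if r = i then k else if r = k then i else r) c)"
    define F2 where "F2 = (\<lambda>r c. F1 r (if c = j then k else if c = k then j else c))"
    define F3 where "F3 = (\<lambda>r c. if r = k then inverse (F2 k k) * F2 r c else F2 r c)"
    define F4 where "F4 = (\<lambda>r c. if r \<in> set (remove1 k [0..<p]) then F3 r c + (- F3 r k) * F3 k c else F3 r c)"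
    define F5 where "F5 = (\<lambda>r c. if c \<in> set (remove1 k [0..<q]) then F4 r c + (- F4 k c) * F4 r k else F4 r c)"
    have F2kk: "F2 k k \<noteq> 0" using i by (auto simp: F2_def F1_def)
    have "St F" using inv by (simp add: Inv_def)
    then have "St F1" unfolding F1_def using i kp by (intro swapr) auto
    then have "St F2" unfolding F2_def using i kp by (intro swapc) auto
    then have "St F3" unfolding F3_def using kp F2kk by (intro mult) auto
    then have "St F4" unfolding F4_def using kp by (intro clear_rows) auto
    then have St: "St F5" unfolding F5_def using kp by (intro clear_cols) auto
    have Fk: "F r c = (if r = c then 1 else 0)" if "r < p" "c < q" "r < k \<or> c < k" for r c
      using inv that unfolding Inv_def by blast
    have F2: "F2 r c = (if r = c then 1 else 0)" if "r < p" "c < q" "r < k \<or> c < k" for r c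
    proof -
      define s where "s = (if r = i then k else if r = k then i else r)"
      define t where "t = (if c = j then k else if c = k then j else c)"
      have s: "s < p" "r < k \<Longrightarrow> s = r" "k \<le> r \<Longrightarrow> k \<le> s"
        using that(1) i(1,4) kp unfolding s_def by (auto split: if_splits)
      have t: "t < q" "c < k \<Longrightarrow> t = c" "k \<le> c \<Longrightarrow> k \<le> t"
        using that(2) i(2,5) kp unfolding t_def by (auto split: if_splits)
      have st: "s < k \<or> t < k" using that(3) s(2) t(2) by fastforce
      have "s = t \<longleftrightarrow> r = c" using that(3) s t by (metis not_le)
      moreover have "F2 r c = F s t" by (simp add: F2_def F1_def s_def t_def)
      ultimately show ?thesis using Fk[OF s(1) t(1) st] by simp
    qed
    have F3: "F3 r c = (if r = c then 1 else 0)" if "r < p" "c < q" "r < k \<or> c < k" for r c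
      using that F2 kp by (auto simp: F3_def)
    have F3kk: "F3 k k = 1" using F2kk by (simp add: F3_def)
    have F4: "F4 r c = (if r = c then 1 else 0)" if "r < p" "c < q" "r < k \<or> c < k" for r c
      using that F3 kp by (auto simp: F4_def)
    have F4k: "F4 r k = (if r = k then 1 else 0)" if "r < p" for r
      using that F3kk by (auto simp: F4_def)
    have F5: "F5 r c = (if r = c then 1 else 0)" if "r < p" "c < q" "r \<le> k \<or> c \<le> k" for r c
    proof (cases "c = k")
      case True
      then show ?thesis using F4k[OF that(1)] by (simp add: F5_def)
    next
      case False
      then have "F5 r c = F4 r c - F4 k c * (if r = k then 1 else 0)"
        using F4k[OF that(1)] that(2) by (simp add: F5_def)
      moreover have "r < k \<or> c < k" if "r \<noteq> k" using \<open>r \<le> k \<or> c \<le> k\<close> that False by auto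
      ultimately show ?thesis using F4[OF that(1,2)] False by (cases "r = k") simp_all
    qed
    show ?thesis
      by (rule exI[of _ F5]) (use St F5 kp in \<open>auto simp: Inv_def less_Suc_eq_le\<close>)
  qed
  have "\<exists>F' k'. Inv k' F' \<and> (\<forall>i<p. \<forall>j<q. k' \<le> i \<and> k' \<le> j \<longrightarrow> F' i j = 0)" if "Inv k F" for k F
    using that
  proof (induction "p - k" arbitrary: k F rule: less_induct)
    case less
    show ?case
    proof (cases "\<forall>i<p. \<forall>j<q. k \<le> i \<and> k \<le> j \<longrightarrow> F i j = 0")
      case False
      then obtain i j where ij: "i < p" "j < q" "F i j \<noteq> 0" "k \<le> i" "k \<le> j" by blast
      obtain F' where F': "Inv (Suc k) F'" using step[OF less.prems ij] by blast
      have "p - Suc k < p - k" using ij by simp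
      then show ?thesis by (rule less.hyps[OF _ F'])
    next
      case True
      with less.prems show ?thesis by blast
    qed
  qed
  moreover have "Inv 0 F" using F by (simp add: Inv_def)
  ultimately obtain F' k where "Inv k F'" and 0: "\<forall>i<p. \<forall>j<q. k \<le> i \<and> k \<le> j \<longrightarrow> F' i j = 0"
    by meson
  then have "St F'" "k \<le> p" "k \<le> q"
    and 1: "\<forall>i<p. \<forall>j<q. i < k \<or> j < k \<longrightarrow> F' i j = (if i = j then 1 else 0)"
    by (simp_all add: Inv_def)
  moreover have "F' i j = (if i = j \<and> i < k then 1 else 0)" if ij: "i < p" "j < q" for i j
  proof (cases "i < k \<or> j < k")
    case True
    then have "F' i j = (if i = j then 1 else 0)" using 1 ij by blast
    then show ?thesis using True by auto
  next
    case False
    then show ?thesis using 0 ij by simp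
  qed
  ultimately show ?thesis by blast
qed

section \<open>Transition matrices between two frames\<close>

lemma transition_expansion:
  fixes V :: "(bipath, 'k::field, 'v) pers_module"
  assumes V: "persistence_module P V" and fr: "frame P V Is \<phi>" and fr': "frame Q V Js \<psi>"
    and x: "x \<in> P" "x \<in> Q" and v: "v \<in> carrier (pspace V x)" and r: "r < length Js"
  shows "\<psi> x v r = (\<Sum>c\<in>active Is x. \<phi> x v c * transition_entry V (length Is) \<phi> \<psi> x r c)"
  unfolding transition_entry_frame_vec
  by (rule frame_expansion[OF V fr x(1) v, where L = "\<lambda>v. \<psi> x v r"])
    (use frameD(2)[OF fr' x(2)] frameD(3)[OF fr' x(2)] r in auto)

lemma transition_inverse:
  fixes V :: "(bipath, 'k::field, 'v) pers_module"
  assumes V: "persistence_module P V" and fr: "frame P V Is \<phi>" and fr': "frame Q V Js \<psi>"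
    and x: "x \<in> P" "x \<in> Q" and rs: "r < length Js" "s \<in> active Js x"
  shows "(\<Sum>c\<in>active Is x. transition_entry V (length Is) \<phi> \<psi> x r c *
      transition_entry V (length Js) \<psi> \<phi> x c s) = (if r = s then 1 else 0)"
proof -
  note e = frame_vec[OF fr' x(2) rs(2)]
  have "(if r = s then 1 else 0) = \<psi> x (frame_vec V (length Js) \<psi> x s) r" using e(2) rs(1) by simp
  also have "\<dots> = (\<Sum>c\<in>active Is x. \<phi> x (frame_vec V (length Js) \<psi> x s) c *
      transition_entry V (length Is) \<phi> \<psi> x r c)"
    by (rule transition_expansion[OF V fr fr' x e(1) rs(1)])
  finally show ?thesis unfolding transition_entry_frame_vec by (simp add: mult.commute)
qed

text \<open>The product of the two transition matrices has a \<open>1\<close> at \<open>(r, r)\<close>, so one of the summands of this entry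
  is nonzero.\<close>

lemma transition_nonzero_row:
  fixes V :: "(bipath, 'k::field, 'v) pers_module"
  assumes V: "persistence_module P V" and fr: "frame P V Is \<phi>" and fr': "frame Q V Js \<psi>"
    and x: "x \<in> P" "x \<in> Q" and r: "r \<in> active Js x"
  shows "\<exists>c\<in>active Is x. transition_entry V (length Is) \<phi> \<psi> x r c \<noteq> 0 \<and>
    transition_entry V (length Js) \<psi> \<phi> x c r \<noteq> 0"
proof (rule ccontr)
  assume "\<not> ?thesis"
  then have "(\<Sum>c\<in>active Is x. transition_entry V (length Is) \<phi> \<psi> x r c *
      transition_entry V (length Js) \<psi> \<phi> x c r) = 0"
    by (intro sum.neutral) auto
  then show False using transition_inverse[OF V fr fr' x _ r] r by (simp add: active_def)
qed

lemma pmap_frame_vec: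
  fixes V :: "(bipath, 'k::field, 'v) pers_module"
  assumes V: "persistence_module P V" and fr: "frame P V Is \<phi>" and ab: "a \<in> P" "b \<in> P" "a \<le> b"
    and c: "c \<in> active Is a" "c \<in> active Is b"
  shows "pmap V a b (frame_vec V (length Is) \<phi> a c) = frame_vec V (length Is) \<phi> b c"
proof (rule sym, rule frame_vec_eqI[OF fr ab(2) c(2)])
  note e = frame_vec[OF fr ab(1) c(1)]
  show "pmap V a b (frame_vec V (length Is) \<phi> a c) \<in> carrier (pspace V b)"
    by (rule pmap_closed[OF V ab e(1)])
  fix i assume "i \<in> active Is b"
  then show "\<phi> b (pmap V a b (frame_vec V (length Is) \<phi> a c)) i = (if i = c then 1 else 0)"
    using frameD(4)[OF fr ab(1) e(1) ab(2,3)] e(2) c by (auto simp: active_def)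
qed

text \<open>The \<open>c\<close>-th basis vector is mapped to zero at \<open>b\<close>, whereas its \<open>r\<close>-th coordinate is kept.\<close>

lemma transition_dies:
  fixes V :: "(bipath, 'k::field, 'v) pers_module"
  assumes V: "persistence_module P V" and fr: "frame P V Is \<phi>" and fr': "frame Q V Js \<psi>"
    and a: "a \<in> P" "a \<in> Q" and b: "b \<in> P" "b \<in> Q" and ab: "a \<le> b"
    and c: "c \<in> active Is a" "c \<notin> active Is b" and r: "r \<in> active Js a" "r \<in> active Js b"
  shows "transition_entry V (length Is) \<phi> \<psi> a r c = 0"
proof -
  let ?v = "frame_vec V (length Is) \<phi> a c"
  note e = frame_vec[OF fr a(1) c(1)]
  note w = pmap_closed[OF V a(1) b(1) ab e(1)]
  have rN: "r < length Js" using r by (simp add: active_def)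
  have "\<phi> b (pmap V a b ?v) i = 0" if "i \<in> active Is b" for i
    using that c e(2)[of i] frameD(4)[OF fr a(1) e(1) b(1) ab, of i] by (auto simp: active_def)
  then have "\<psi> b (pmap V a b ?v) r = 0"
    using transition_expansion[OF V fr fr' b w rN] by simp
  then show ?thesis
    unfolding transition_entry_frame_vec
    using frameD(4)[OF fr' a(2) e(1) b(2) ab rN] r by (simp add: active_def)
qed

text \<open>The \<open>c\<close>-th basis vector at \<open>b\<close> is the image of that at \<open>a\<close>. So it has no component in a summand that
  is born after \<open>a\<close>.\<close>

lemma transition_born:
  fixes V :: "(bipath, 'k::field, 'v) pers_module"
  assumes V: "persistence_module P V" and fr: "frame P V Is \<phi>" and fr': "frame Q V Js \<psi>"
    and a: "a \<in> P" "a \<in> Q" and b: "b \<in> P" "b \<in> Q" and ab: "a \<le> b"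
    and c: "c \<in> active Is a" "c \<in> active Is b" and r: "r \<in> active Js b"
  shows "transition_entry V (length Is) \<phi> \<psi> b r c =
    (if r \<in> active Js a then transition_entry V (length Is) \<phi> \<psi> a r c else 0)"
  using frameD(4)[OF fr' a(2) frame_vec(1)[OF fr a(1) c(1)] b(2) ab, of r] r
  unfolding transition_entry_frame_vec pmap_frame_vec[OF V fr a(1) b(1) ab c, symmetric]
  by (simp add: active_def)

lemma transition_shear_row:
  "r < length Js \<Longrightarrow> transition_entry V N \<phi> (shear Js a k l \<psi>) x r c =
     (if r = k \<and> x \<in> Js ! k then transition_entry V N \<phi> \<psi> x k c + a * transition_entry V N \<phi> \<psi> x l c
      else transition_entry V N \<phi> \<psi> x r c)"
  by (simp add: transition_entry_frame_vec shear_def)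

lemma transition_rescale_row:
  "r < length Js \<Longrightarrow> transition_entry V N \<phi> (rescale Js a k \<psi>) x r c =
     (if r = k then a * transition_entry V N \<phi> \<psi> x k c else transition_entry V N \<phi> \<psi> x r c)"
  by (simp add: transition_entry_frame_vec rescale_def)

lemma transition_shear_col:
  fixes V :: "(bipath, 'k::field, 'v) pers_module"
  assumes V: "persistence_module P V" and fr: "frame P V Is \<phi>" and fr': "frame Q V Js \<psi>"
    and kl: "k < length Is" "l < length Is" "k \<noteq> l" and hom: "overlap_hom P (Is ! l) (Is ! k)"
    and x: "x \<in> P" "x \<in> Q" and c: "c \<in> active Is x" and r: "r < length Js"
  shows "transition_entry V (length Is) (shear Is (- a) k l \<phi>) \<psi> x r c =
     (if c = l \<and> x \<in> Is ! k then transition_entry V (length Is) \<phi> \<psi> x r l + a * transition_entry V (length Is) \<phi> \<psi> x r k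
      else transition_entry V (length Is) \<phi> \<psi> x r c)"
proof (cases "c = l \<and> x \<in> Is ! k")
  case True
  then have k: "k \<in> active Is x" and l: "l \<in> active Is x" using kl c by (auto simp: active_def)
  note ek = frame_vec(1)[OF fr x(1) k] and el = frame_vec(1)[OF fr x(1) l]
  show ?thesis
    unfolding transition_entry_frame_vec frame_vec_shear[OF V fr kl hom x(1) c]
    using True frameD(2)[OF fr' x(2) el pspace_closed(2)[OF V x(1) ek] r] frameD(3)[OF fr' x(2) ek r]
    by simp
next
  case False
  show ?thesis
    unfolding transition_entry_frame_vec frame_vec_shear[OF V fr kl hom x(1) c] if_not_P[OF False] ..
qed

lemma transition_rescale_col:
  fixes V :: "(bipath, 'k::field, 'v) pers_module"
  assumes V: "persistence_module P V" and fr: "frame P V Is \<phi>" and fr': "frame Q V Js \<psi>"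
    and k: "k < length Is" and a: "a \<noteq> 0" and x: "x \<in> P" "x \<in> Q" and c: "c \<in> active Is x" and r: "r < length Js"
  shows "transition_entry V (length Is) (rescale Is (inverse a) k \<phi>) \<psi> x r c =
     (if c = k then a * transition_entry V (length Is) \<phi> \<psi> x r k else transition_entry V (length Is) \<phi> \<psi> x r c)"
proof -
  have a': "inverse a \<noteq> 0" using a by simp
  show ?thesis
    unfolding transition_entry_frame_vec frame_vec_rescale[OF V fr k a' x(1) c]
    using frameD(3)[OF fr' x(2) frame_vec(1)[OF fr x(1) c] r] by auto
qed

text \<open>The rows \<open>R\<close> and the columns \<open>C\<close> form a block that splits off from the transition matrix at \<open>x\<close>.\<close>

definition block_diagonal_at ::
  "(bipath, 'k::field, 'v) pers_module \<Rightarrow> bipath set list \<Rightarrow> bipath set list \<Rightarrow> bipath \<Rightarrow> nat set \<Rightarrow> nat set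
     \<Rightarrow> (bipath \<Rightarrow> 'v \<Rightarrow> nat \<Rightarrow> 'k) \<Rightarrow> (bipath \<Rightarrow> 'v \<Rightarrow> nat \<Rightarrow> 'k) \<Rightarrow> bool" where
  "block_diagonal_at V Is Js x C R \<phi> \<psi> \<longleftrightarrow> (\<forall>r\<in>active Js x. \<forall>c\<in>active Is x.
     (r \<in> R) \<noteq> (c \<in> C) \<longrightarrow> transition_entry V (length Is) \<phi> \<psi> x r c = 0)"

text \<open>Both the coordinates and the dual basis outside \<open>C\<close> are kept: a frame enters a transition matrix
  through its coordinates on the row side and through its dual basis on the column side.\<close>

definition agree_off ::
  "'p set \<Rightarrow> ('p, 'k::field, 'v) pers_module \<Rightarrow> 'p set list \<Rightarrow> nat set
     \<Rightarrow> ('p \<Rightarrow> 'v \<Rightarrow> nat \<Rightarrow> 'k) \<Rightarrow> ('p \<Rightarrow> 'v \<Rightarrow> nat \<Rightarrow> 'k) \<Rightarrow> bool" where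
  "agree_off P V Is C \<phi> \<phi>' \<longleftrightarrow> (\<forall>y\<in>P. \<forall>i<length Is. i \<notin> C \<longrightarrow>
     (\<forall>v\<in>carrier (pspace V y). \<phi>' y v i = \<phi> y v i) \<and>
     (i \<in> active Is y \<longrightarrow> frame_vec V (length Is) \<phi>' y i = frame_vec V (length Is) \<phi> y i))"

lemma agree_off_refl: "agree_off P V Is C \<phi> \<phi>"
  by (simp add: agree_off_def)

lemma agree_off_trans: "agree_off P V Is C \<phi> \<phi>' \<Longrightarrow> agree_off P V Is C \<phi>' \<phi>'' \<Longrightarrow> agree_off P V Is C \<phi> \<phi>''"
  by (simp add: agree_off_def)

lemma agree_off_shear:
  fixes V :: "(bipath, 'k::field, 'v) pers_module"
  assumes "persistence_module P V" "frame P V Is \<phi>" "k < length Is" "l < length Is" "k \<noteq> l"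
    "overlap_hom P (Is ! l) (Is ! k)" "k \<in> C" "l \<in> C"
  shows "agree_off P V Is C \<phi> (shear Is a k l \<phi>)"
  unfolding agree_off_def
proof (intro ballI allI impI conjI)
  fix y i assume y: "y \<in> P" and i: "i < length Is" "i \<notin> C"
  then have "i \<noteq> k" "i \<noteq> l" using assms(7,8) by auto
  then show "shear Is a k l \<phi> y v i = \<phi> y v i" for v using i by (simp add: shear_def)
  show "frame_vec V (length Is) (shear Is a k l \<phi>) y i = frame_vec V (length Is) \<phi> y i" if "i \<in> active Is y"
    using frame_vec_shear[OF assms(1-6) y that] \<open>i \<noteq> l\<close> by simp
qed

lemma agree_off_rescale:
  fixes V :: "(bipath, 'k::field, 'v) pers_module"
  assumes "persistence_module P V" "frame P V Is \<phi>" "k < length Is" "a \<noteq> 0" "k \<in> C"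
  shows "agree_off P V Is C \<phi> (rescale Is a k \<phi>)"
  unfolding agree_off_def
proof (intro ballI allI impI conjI)
  fix y i assume y: "y \<in> P" and i: "i < length Is" "i \<notin> C"
  then have "i \<noteq> k" using assms(5) by auto
  then show "rescale Is a k \<phi> y v i = \<phi> y v i" for v using i by (simp add: rescale_def)
  show "frame_vec V (length Is) (rescale Is a k \<phi>) y i = frame_vec V (length Is) \<phi> y i" if "i \<in> active Is y"
    using frame_vec_rescale[OF assms(1-4) y that] \<open>i \<noteq> k\<close> by simp
qed

lemma agree_off_transition:
  assumes "agree_off P V Is C \<phi> \<phi>'" "agree_off Q V Js R \<psi> \<psi>'" "frame P V Is \<phi>"
    "x \<in> P" "x \<in> Q" "c \<in> active Is x" "r < length Js" "c \<notin> C" "r \<notin> R"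
  shows "transition_entry V (length Is) \<phi>' \<psi>' x r c = transition_entry V (length Is) \<phi> \<psi> x r c"
  using assms frame_vec(1)[OF assms(3,4,6)] unfolding transition_entry_frame_vec agree_off_def
  by (simp add: active_def)

text \<open>The reduction only adds columns to columns further right and rows to rows further up, and \<open>homc\<close>
  and \<open>homr\<close> say that these additions come from shears of the two frames. So the reduction of the block
  runs through transition matrices only. The frames change only in the summands that belong to the
  block; this permits the reduction of several blocks one after the other.\<close>

lemma block_reduction:
  fixes V :: "(bipath, 'k::field, 'v) pers_module"
  assumes V: "persistence_module P V" "persistence_module Q V"
    and fr: "frame P V Is \<phi>" "frame Q V Js \<psi>" and x: "x \<in> P" "x \<in> Q"
    and Lc: "distinct Lc" "set Lc \<subseteq> active Is x" and Lr: "distinct Lr" "set Lr \<subseteq> active Js x"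
    and homc: "\<And>i j. i < j \<Longrightarrow> j < length Lc \<Longrightarrow> overlap_hom P (Is ! (Lc ! j)) (Is ! (Lc ! i))"
    and homr: "\<And>i j. i < j \<Longrightarrow> j < length Lr \<Longrightarrow> overlap_hom Q (Js ! (Lr ! j)) (Js ! (Lr ! i))"
    and bd: "block_diagonal_at V Is Js x (set Lc) (set Lr) \<phi> \<psi>"
  defines "T \<equiv> \<lambda>\<phi> \<psi>. mat (length Lr) (length Lc) (\<lambda>(i, j). transition_entry V (length Is) \<phi> \<psi> x (Lr ! i) (Lc ! j))"
  shows "permutation_matrix (reduction (T \<phi> \<psi>)) \<and>
    (\<exists>\<phi>' \<psi>'. frame P V Is \<phi>' \<and> frame Q V Js \<psi>' \<and> T \<phi>' \<psi>' = reduction (T \<phi> \<psi>) \<and>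
       block_diagonal_at V Is Js x (set Lc) (set Lr) \<phi>' \<psi>' \<and>
       agree_off P V Is (set Lc) \<phi> \<phi>' \<and> agree_off Q V Js (set Lr) \<psi> \<psi>')"
proof -
  define good where "good \<phi>' \<psi>' \<longleftrightarrow> frame P V Is \<phi>' \<and> frame Q V Js \<psi>' \<and>
       block_diagonal_at V Is Js x (set Lc) (set Lr) \<phi>' \<psi>' \<and>
       agree_off P V Is (set Lc) \<phi> \<phi>' \<and> agree_off Q V Js (set Lr) \<psi> \<psi>'" for \<phi>' \<psi>'
  define St where "St A \<longleftrightarrow> (\<exists>\<phi>' \<psi>'. good \<phi>' \<psi>' \<and> A = T \<phi>' \<psi>')" for A
  let ?t = "\<lambda>\<phi> \<psi>. transition_entry V (length Is) \<phi> \<psi> x"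
  have c: "Lc ! j \<in> active Is x" "Lc ! j < length Is" "Lc ! j \<in> set Lc" "x \<in> Is ! (Lc ! j)" if "j < length Lc" for j
    using subsetD[OF Lc(2) nth_mem[OF that]] that by (simp_all add: active_def)
  have r: "Lr ! j \<in> active Js x" "Lr ! j < length Js" "Lr ! j \<in> set Lr" "x \<in> Js ! (Lr ! j)" if "j < length Lr" for j
    using subsetD[OF Lr(2) nth_mem[OF that]] that by (simp_all add: active_def)
  have ent: "T \<phi>' \<psi>' $$ (i, j) = ?t \<phi>' \<psi>' (Lr ! i) (Lc ! j)" if "i < length Lr" "j < length Lc" for \<phi>' \<psi>' i j
    using that by (simp add: T_def)
  have dim: "dim_row (T \<phi>' \<psi>') = length Lr" "dim_col (T \<phi>' \<psi>') = length Lc" for \<phi>' \<psi>' by (simp_all add: T_def)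
  have init: "St (T \<phi> \<psi>)"
    unfolding St_def good_def using fr bd agree_off_refl by blast
  have dims: "A \<in> carrier_mat (length Lr) (length Lc)" if "St A" for A
    using that unfolding St_def T_def by auto
  have nzc: "\<exists>i<length Lr. A $$ (i, j) \<noteq> 0" if "St A" and j: "j < length Lc" for A j
  proof -
    from \<open>St A\<close> obtain \<phi>' \<psi>' where g: "good \<phi>' \<psi>'" and A: "A = T \<phi>' \<psi>'" unfolding St_def by blast
    have f: "frame P V Is \<phi>'" "frame Q V Js \<psi>'" using g by (auto simp: good_def)
    obtain s where s: "s \<in> active Js x" "?t \<phi>' \<psi>' s (Lc ! j) \<noteq> 0"
      using transition_nonzero_row[OF V(2) f(2,1) x(2,1) c(1)[OF j]] by blast
    then have "s \<in> set Lr" using g c[OF j] unfolding good_def block_diagonal_at_def by blast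
    then obtain i where "i < length Lr" "Lr ! i = s" by (auto simp: in_set_conv_nth)
    then show ?thesis using s ent[OF _ j] A by auto
  qed
  have nzr: "\<exists>j<length Lc. A $$ (i, j) \<noteq> 0" if "St A" and i: "i < length Lr" for A i
  proof -
    from \<open>St A\<close> obtain \<phi>' \<psi>' where g: "good \<phi>' \<psi>'" and A: "A = T \<phi>' \<psi>'" unfolding St_def by blast
    have f: "frame P V Is \<phi>'" "frame Q V Js \<psi>'" using g by (auto simp: good_def)
    obtain s where s: "s \<in> active Is x" "?t \<phi>' \<psi>' (Lr ! i) s \<noteq> 0"
      using transition_nonzero_row[OF V(1) f x r(1)[OF i]] by blast
    then have "s \<in> set Lc" using g r[OF i] unfolding good_def block_diagonal_at_def by blast
    then obtain j where "j < length Lc" "Lc ! j = s" by (auto simp: in_set_conv_nth)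
    then show ?thesis using s ent[OF i] A by auto
  qed
  have mult: "St (multrow i a A)" if "St A" and i: "i < length Lr" and a: "a \<noteq> 0" for A i a
  proof -
    from \<open>St A\<close> obtain \<phi>' \<psi>' where g: "good \<phi>' \<psi>'" and A: "A = T \<phi>' \<psi>'" unfolding St_def by blast
    have f: "frame P V Is \<phi>'" "frame Q V Js \<psi>'" using g by (auto simp: good_def)
    let ?\<psi> = "rescale Js a (Lr ! i) \<psi>'"
    have t: "?t \<phi>' ?\<psi> s d = (if s = Lr ! i then a * ?t \<phi>' \<psi>' (Lr ! i) d else ?t \<phi>' \<psi>' s d)" if "s < length Js" for s d
      using transition_rescale_row[OF that] .
    have "block_diagonal_at V Is Js x (set Lc) (set Lr) \<phi>' ?\<psi>"
      using g r[OF i] unfolding good_def block_diagonal_at_def by (auto simp: t active_def)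
    then have "good \<phi>' ?\<psi>"
      using g frame_rescale[OF V(2) f(2) r(2)[OF i] a]
        agree_off_trans[OF _ agree_off_rescale[OF V(2) f(2) r(2)[OF i] a r(3)[OF i]]]
      unfolding good_def by auto
    moreover have "multrow i a A = T \<phi>' ?\<psi>"
      by (rule eq_matI) (auto simp: A ent dim t r nth_eq_iff_index_eq[OF Lr(1)] i)
    ultimately show ?thesis unfolding St_def by blast
  qed
  have addr: "St (addrow a i j A)" if "St A" and ij: "i < j" "j < length Lr" for A i j a
  proof -
    from \<open>St A\<close> obtain \<phi>' \<psi>' where g: "good \<phi>' \<psi>'" and A: "A = T \<phi>' \<psi>'" unfolding St_def by blast
    have f: "frame P V Is \<phi>'" "frame Q V Js \<psi>'" using g by (auto simp: good_def)
    have i: "i < length Lr" using ij by simp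
    have ne: "Lr ! i \<noteq> Lr ! j" using ij i by (simp add: nth_eq_iff_index_eq[OF Lr(1)])
    let ?\<psi> = "shear Js a (Lr ! i) (Lr ! j) \<psi>'"
    have t: "?t \<phi>' ?\<psi> s d = (if s = Lr ! i then ?t \<phi>' \<psi>' (Lr ! i) d + a * ?t \<phi>' \<psi>' (Lr ! j) d else ?t \<phi>' \<psi>' s d)"
      if "s < length Js" for s d
      using r(4)[OF i] by (simp add: transition_shear_row[OF that])
    have "block_diagonal_at V Is Js x (set Lc) (set Lr) \<phi>' ?\<psi>"
      using g r[OF i] r[OF ij(2)] unfolding good_def block_diagonal_at_def by (auto simp: t active_def)
    then have "good \<phi>' ?\<psi>"
      using g frame_shear[OF V(2) f(2) r(2)[OF i] r(2)[OF ij(2)] ne homr[OF ij]]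
        agree_off_trans[OF _ agree_off_shear[OF V(2) f(2) r(2)[OF i] r(2)[OF ij(2)] ne homr[OF ij] r(3)[OF i] r(3)[OF ij(2)]]]
      unfolding good_def by auto
    moreover have "addrow a i j A = T \<phi>' ?\<psi>"
      by (rule eq_matI) (auto simp: A ent dim t r nth_eq_iff_index_eq[OF Lr(1)] i ij)
    ultimately show ?thesis unfolding St_def by blast
  qed
  have addc: "St (addcol a j i A)" if "St A" and ij: "i < j" "j < length Lc" for A i j a
  proof -
    from \<open>St A\<close> obtain \<phi>' \<psi>' where g: "good \<phi>' \<psi>'" and A: "A = T \<phi>' \<psi>'" unfolding St_def by blast
    have f: "frame P V Is \<phi>'" "frame Q V Js \<psi>'" using g by (auto simp: good_def)
    have i: "i < length Lc" using ij by simp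
    have ne: "Lc ! i \<noteq> Lc ! j" using ij i by (simp add: nth_eq_iff_index_eq[OF Lc(1)])
    let ?\<phi> = "shear Is (- a) (Lc ! i) (Lc ! j) \<phi>'"
    have t: "?t ?\<phi> \<psi>' s d = (if d = Lc ! j then ?t \<phi>' \<psi>' s (Lc ! j) + a * ?t \<phi>' \<psi>' s (Lc ! i) else ?t \<phi>' \<psi>' s d)"
      if "s < length Js" "d \<in> active Is x" for s d
      using transition_shear_col[OF V(1) f c(2)[OF i] c(2)[OF ij(2)] ne homc[OF ij] x that(2,1)] c(4)[OF i] by auto
    have "block_diagonal_at V Is Js x (set Lc) (set Lr) ?\<phi> \<psi>'"
      using g c[OF i] c[OF ij(2)] unfolding good_def block_diagonal_at_def
      by (auto simp: t active_def[of Js])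
    then have "good ?\<phi> \<psi>'"
      using g frame_shear[OF V(1) f(1) c(2)[OF i] c(2)[OF ij(2)] ne homc[OF ij]]
        agree_off_trans[OF _ agree_off_shear[OF V(1) f(1) c(2)[OF i] c(2)[OF ij(2)] ne homc[OF ij] c(3)[OF i] c(3)[OF ij(2)]]]
      unfolding good_def by auto
    moreover have "addcol a j i A = T ?\<phi> \<psi>'"
      by (rule eq_matI) (auto simp: A ent dim t r c nth_eq_iff_index_eq[OF Lc(1)] i ij)
    ultimately show ?thesis unfolding St_def by blast
  qed
  note red = reduction_permutation[where St = St, OF init dims nzc nzr mult addc addr]
  from red(1) obtain \<phi>' \<psi>' where "good \<phi>' \<psi>'" "reduction (T \<phi> \<psi>) = T \<phi>' \<psi>'"
    unfolding St_def by blast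
  then show ?thesis using red(2) unfolding good_def by (intro conjI exI[of _ \<phi>'] exI[of _ \<psi>']) simp_all
qed

section \<open>The block matrix of two frames\<close>

lemma path_decomposition_iff_frame:
  assumes "persistence_module P V"
  shows "path_decomposition P V ls \<phi> \<longleftrightarrow>
    set ls \<subseteq> path_labels P \<and> frame P V (map (label_interval P) ls) \<phi>"
  by (simp add: path_decomposition_def pm_iso_iff_frame[OF assms])

lemma active_label_interval:
  "x \<in> P \<Longrightarrow> active (map (label_interval P) ls) x = {i. i < length ls \<and> fst (ls ! i) \<le> x \<and> x \<le> snd (ls ! i)}"
  by (auto simp: active_def label_interval_def)

lemma bipath_bounds [simp]:
  "Hat0 \<le> (x :: bipath)" "x \<le> Hat1" "x \<le> Hat0 \<longleftrightarrow> x = Hat0" "Hat1 \<le> x \<longleftrightarrow> x = Hat1"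
  by (cases x; simp)+

lemma hats_in_paths [simp]:
  "Hat0 \<in> upper_path n" "Hat1 \<in> upper_path n" "Hat0 \<in> lower_path m" "Hat1 \<in> lower_path m"
  by (simp_all add: upper_path_def lower_path_def)

text \<open>The link between the order of the labels and the morphisms between interval modules.\<close>

lemma overlap_hom_label:
  "label_le l' l \<Longrightarrow> overlap_hom P (label_interval P l) (label_interval P l')"
  unfolding overlap_hom_def label_interval_def label_le_def
  by (auto intro: order_trans)

lemma active_hat0:
  "Hat0 \<in> P \<Longrightarrow> active (map (label_interval P) ls) Hat0 = {i. i < length ls \<and> fst (ls ! i) = Hat0}"
  by (simp add: active_label_interval)

lemma active_hat1:
  "Hat1 \<in> P \<Longrightarrow> active (map (label_interval P) ls) Hat1 = {i. i < length ls \<and> snd (ls ! i) = Hat1}"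
  by (simp add: active_label_interval)

text \<open>An entry of the block matrix, indexed by summands instead of positions.\<close>

definition label_entry ::
  "label list \<Rightarrow> label list \<Rightarrow> (nat \<Rightarrow> nat \<Rightarrow> 'k) \<Rightarrow> (nat \<Rightarrow> nat \<Rightarrow> 'k) \<Rightarrow> nat \<Rightarrow> nat \<Rightarrow> 'k option" where
  "label_entry us ds \<Lambda> \<Gamma> r c =
     (if fst (ds ! r) = Hat0 \<and> fst (us ! c) = Hat0 then Some (\<Lambda> r c)
      else if snd (ds ! r) = Hat1 \<and> snd (us ! c) = Hat1 then Some (\<Gamma> r c) else None)"

lemma initial_matrix_label_entry:
  "initial_matrix us ds cs rs \<Lambda> \<Gamma> =
     mat (length rs) (length cs) (\<lambda>(i, j). label_entry us ds \<Lambda> \<Gamma> (rs ! i) (cs ! j))"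
  by (simp add: initial_matrix_def label_entry_def Let_def)

text \<open>One column operation on the block matrix acts on \<open>\<Lambda>\<close> and \<open>\<Gamma>\<close> at once. In the delicate case
  the column \<open>l\<close> that is added is a left one and \<open>k\<close> is not: then \<open>\<Gamma>\<close> has no column \<open>l\<close> and stays as it is, and the
  rows that \<open>l\<close> shares with \<open>\<Gamma>\<close> are central, where \<open>\<Lambda> r l\<close> is zero by the block form.\<close>

lemma label_entry_add_col:
  fixes \<Lambda> :: "nat \<Rightarrow> nat \<Rightarrow> 'k::field"
  assumes bf: "block_form us ds \<Lambda> \<Gamma>" and rc: "r < length ds" "k < length us" "l < length us"
    and no: "\<not> other_label (ds ! r)" "\<not> other_label (us ! k)" "\<not> other_label (us ! l)"
    and le: "label_le (us ! l) (us ! k)"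
    and 0: "fst (ds ! r) = Hat0 \<Longrightarrow> fst (us ! k) = Hat0 \<Longrightarrow> \<Lambda>' r k = \<Lambda> r k + a * \<Lambda> r l"
    and 1: "snd (ds ! r) = Hat1 \<Longrightarrow> snd (us ! k) = Hat1 \<Longrightarrow>
       \<Gamma>' r k = (if snd (us ! l) = Hat1 then \<Gamma> r k + a * \<Gamma> r l else \<Gamma> r k)"
  shows "label_entry us ds \<Lambda>' \<Gamma>' r k = opt_add_mult a (label_entry us ds \<Lambda> \<Gamma> r l) (label_entry us ds \<Lambda> \<Gamma> r k)"
proof -
  have le0: "fst (us ! k) = Hat0 \<Longrightarrow> fst (us ! l) = Hat0" and le1: "snd (us ! l) = Hat1 \<Longrightarrow> snd (us ! k) = Hat1"
    using le unfolding label_le_def by auto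
  have z: "fst (ds ! r) = Hat0 \<Longrightarrow> snd (ds ! r) = Hat1 \<Longrightarrow> fst (us ! l) = Hat0 \<Longrightarrow> snd (us ! l) \<noteq> Hat1 \<Longrightarrow> \<Lambda> r l = 0"
    and e: "fst (ds ! r) = Hat0 \<Longrightarrow> snd (ds ! r) = Hat1 \<Longrightarrow> fst (us ! l) = Hat0 \<Longrightarrow> snd (us ! l) = Hat1 \<Longrightarrow> \<Lambda> r l = \<Gamma> r l"
    using bf rc unfolding block_form_def central_label_def left_label_def by blast+
  have none: "opt_add_mult a o' None = None" for o' :: "'k option" by (cases o') simp_all
  consider "fst (ds ! r) = Hat0 \<and> fst (us ! k) = Hat0"
    | "\<not> (fst (ds ! r) = Hat0 \<and> fst (us ! k) = Hat0)" "snd (ds ! r) = Hat1 \<and> snd (us ! k) = Hat1"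
    | "\<not> (fst (ds ! r) = Hat0 \<and> fst (us ! k) = Hat0)" "\<not> (snd (ds ! r) = Hat1 \<and> snd (us ! k) = Hat1)"
    by blast
  then show ?thesis
  proof cases
    case 1
    then show ?thesis using 0 le0 by (simp add: label_entry_def)
  next
    case 2
    show ?thesis
    proof (cases "snd (us ! l) = Hat1")
      case True
      then show ?thesis using 2 1 e by (auto simp: label_entry_def)
    next
      case False
      then have "fst (us ! l) = Hat0" using no(3) by (simp add: other_label_def)
      then show ?thesis using 2 1 z False by (auto simp: label_entry_def)
    qed
  next
    case 3
    then have "label_entry us ds L G r k = None" for L G :: "nat \<Rightarrow> nat \<Rightarrow> 'k"
      unfolding label_entry_def by simp
    then show ?thesis by (simp only: none)
  qed
qed

text \<open>The mirror image: a right row \<open>l\<close> is invisible to \<open>\<Lambda>\<close>, and its entries in the central columns are zero.\<close>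

lemma label_entry_add_row:
  fixes \<Lambda> :: "nat \<Rightarrow> nat \<Rightarrow> 'k::field"
  assumes bf: "block_form us ds \<Lambda> \<Gamma>" and rc: "c < length us" "k < length ds" "l < length ds"
    and no: "\<not> other_label (us ! c)" "\<not> other_label (ds ! k)" "\<not> other_label (ds ! l)"
    and le: "label_le (ds ! k) (ds ! l)"
    and 0: "fst (ds ! k) = Hat0 \<Longrightarrow> fst (us ! c) = Hat0 \<Longrightarrow>
       \<Lambda>' k c = (if fst (ds ! l) = Hat0 then \<Lambda> k c + a * \<Lambda> l c else \<Lambda> k c)"
    and 1: "snd (ds ! k) = Hat1 \<Longrightarrow> snd (us ! c) = Hat1 \<Longrightarrow> \<Gamma>' k c = \<Gamma> k c + a * \<Gamma> l c"
  shows "label_entry us ds \<Lambda>' \<Gamma>' k c = opt_add_mult a (label_entry us ds \<Lambda> \<Gamma> l c) (label_entry us ds \<Lambda> \<Gamma> k c)"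
proof -
  have le0: "fst (ds ! l) = Hat0 \<Longrightarrow> fst (ds ! k) = Hat0" and le1: "snd (ds ! k) = Hat1 \<Longrightarrow> snd (ds ! l) = Hat1"
    using le unfolding label_le_def by auto
  have z: "fst (us ! c) = Hat0 \<Longrightarrow> snd (us ! c) = Hat1 \<Longrightarrow> fst (ds ! l) \<noteq> Hat0 \<Longrightarrow> snd (ds ! l) = Hat1 \<Longrightarrow> \<Gamma> l c = 0"
    and e: "fst (us ! c) = Hat0 \<Longrightarrow> snd (us ! c) = Hat1 \<Longrightarrow> fst (ds ! l) = Hat0 \<Longrightarrow> snd (ds ! l) = Hat1 \<Longrightarrow> \<Lambda> l c = \<Gamma> l c"
    using bf rc unfolding block_form_def central_label_def right_label_def by blast+
  have none: "opt_add_mult a o' None = None" for o' :: "'k option" by (cases o') simp_all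
  consider "fst (ds ! k) = Hat0 \<and> fst (us ! c) = Hat0"
    | "\<not> (fst (ds ! k) = Hat0 \<and> fst (us ! c) = Hat0)" "snd (ds ! k) = Hat1 \<and> snd (us ! c) = Hat1"
    | "\<not> (fst (ds ! k) = Hat0 \<and> fst (us ! c) = Hat0)" "\<not> (snd (ds ! k) = Hat1 \<and> snd (us ! c) = Hat1)"
    by blast
  then show ?thesis
  proof cases
    case 1
    show ?thesis
    proof (cases "fst (ds ! l) = Hat0")
      case True
      then show ?thesis using 1 0 by (simp add: label_entry_def)
    next
      case False
      then have "snd (ds ! l) = Hat1" using no(3) by (simp add: other_label_def)
      then show ?thesis using 1 0 z False by (auto simp: label_entry_def)
    qed
  next
    case 2
    then show ?thesis using 1 le1 e by (auto simp: label_entry_def)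
  next
    case 3
    then have "label_entry us ds L G k c = None" for L G :: "nat \<Rightarrow> nat \<Rightarrow> 'k"
      unfolding label_entry_def by simp
    then show ?thesis by (simp only: none)
  qed
qed

locale bipath_matrix =
  fixes n m :: nat and V :: "(bipath, 'k::field, 'v) pers_module"
    and us ds :: "label list" and cs rs :: "nat list"
  assumes V: "persistence_module (bipath_poset n m) V"
    and cs: "label_order us cs" and rs: "label_order ds rs"
begin

abbreviation "U \<equiv> upper_path n"
abbreviation "D \<equiv> lower_path m"
abbreviation "Us \<equiv> map (label_interval U) us"
abbreviation "Ds \<equiv> map (label_interval D) ds"
abbreviation "C \<equiv> map ((!) us) cs"
abbreviation "R \<equiv> map ((!) ds) rs"

definition T :: "(bipath \<Rightarrow> 'v \<Rightarrow> nat \<Rightarrow> 'k) \<Rightarrow> (bipath \<Rightarrow> 'v \<Rightarrow> nat \<Rightarrow> 'k) \<Rightarrow> bipath \<Rightarrow> nat \<Rightarrow> nat \<Rightarrow> 'k" where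
  "T \<phi> \<psi> = transition_entry V (length us) \<phi> \<psi>"

text \<open>The invariant of all runs.\<close>

definition realised :: "'k option mat \<Rightarrow> bool" where
  "realised M \<longleftrightarrow> (\<exists>\<phi> \<psi>. frame U V Us \<phi> \<and> frame D V Ds \<psi> \<and>
     M = initial_matrix us ds cs rs (T \<phi> \<psi> Hat0) (T \<phi> \<psi> Hat1))"

lemma VU: "persistence_module U V" and VD: "persistence_module D V"
  using V persistence_module_subset unfolding bipath_poset_def by blast+

text \<open>A summand that dies before \<open>Hat1\<close> has no component in a summand that survives, a summand born at \<open>Hat0\<close>
  has no component in one that is born later, and the structure map from \<open>Hat0\<close> to \<open>Hat1\<close> identifies the
  two central blocks.\<close>

lemma frames_block_form:
  assumes "frame U V Us \<phi>" "frame D V Ds \<psi>"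
  shows "block_form us ds (T \<phi> \<psi> Hat0) (T \<phi> \<psi> Hat1)"
  unfolding block_form_def
proof (intro allI impI conjI)
  fix r c assume rc: "r < length ds" "c < length us"
  { assume "central_label (ds ! r) \<and> left_label (us ! c)"
    then show "T \<phi> \<psi> Hat0 r c = 0"
      using transition_dies[OF VU assms, of Hat0 Hat1 c r] rc
      by (simp add: T_def active_hat0 active_hat1 central_label_def left_label_def) }
  { assume "right_label (ds ! r) \<and> central_label (us ! c)"
    then show "T \<phi> \<psi> Hat1 r c = 0"
      using transition_born[OF VU assms, of Hat0 Hat1 c r] rc
      by (simp add: T_def active_hat0 active_hat1 central_label_def right_label_def) }
  { assume "central_label (ds ! r) \<and> central_label (us ! c)"
    then show "T \<phi> \<psi> Hat0 r c = T \<phi> \<psi> Hat1 r c"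
      using transition_born[OF VU assms, of Hat0 Hat1 c r] rc
      by (simp add: T_def active_hat0 active_hat1 central_label_def) }
qed

lemma cs_D: "j < length cs \<Longrightarrow> cs ! j < length us" "j < length cs \<Longrightarrow> \<not> other_label (us ! (cs ! j))"
  and rs_D: "i < length rs \<Longrightarrow> rs ! i < length ds" "i < length rs \<Longrightarrow> \<not> other_label (ds ! (rs ! i))"
  using cs rs nth_mem[of j cs] nth_mem[of i rs] unfolding label_order_def by auto

lemma cs_inj: "i < length cs \<Longrightarrow> j < length cs \<Longrightarrow> cs ! i = cs ! j \<longleftrightarrow> i = j"
  and rs_inj: "i < length rs \<Longrightarrow> j < length rs \<Longrightarrow> rs ! i = rs ! j \<longleftrightarrow> i = j"
  using cs rs unfolding label_order_def by (auto simp: nth_eq_iff_index_eq)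

text \<open>Columns are indexed by the dual basis of the upper frame, so adding column \<open>l\<close> to column \<open>k\<close> is a shear
  of the coordinate \<open>l\<close> by the coordinate \<open>k\<close> with the opposite sign.\<close>

lemma realised_addcol:
  assumes M: "realised M" and kl: "k < length cs" "l < length cs" "k \<noteq> l" and le: "label_le (C ! l) (C ! k)"
  shows "realised (opt_addcol a k l M)"
proof -
  from M obtain \<phi> \<psi> where f: "frame U V Us \<phi>" "frame D V Ds \<psi>"
    and M: "M = initial_matrix us ds cs rs (T \<phi> \<psi> Hat0) (T \<phi> \<psi> Hat1)" unfolding realised_def by blast
  have k: "cs ! k < length us" "\<not> other_label (us ! (cs ! k))" and l: "cs ! l < length us" "\<not> other_label (us ! (cs ! l))"
    using cs_D kl by auto
  have ne: "cs ! l \<noteq> cs ! k" using kl cs_inj by auto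
  have le': "label_le (us ! (cs ! l)) (us ! (cs ! k))" using le kl by simp
  \<comment> \<open>the dual basis vector \<open>k\<close> is to receive \<open>a\<close> times the vector \<open>l\<close>\<close>
  let ?\<phi> = "shear Us (- a) (cs ! l) (cs ! k) \<phi>"
  have hom: "overlap_hom U (Us ! (cs ! k)) (Us ! (cs ! l))"
    using overlap_hom_label[OF le'] k l by simp
  have kl': "cs ! l < length Us" "cs ! k < length Us" using k l by auto
  note f' = frame_shear[OF VU f(1) kl' ne hom]
  have t: "T ?\<phi> \<psi> x r c = (if c = cs ! k \<and> x \<in> Us ! (cs ! l) then T \<phi> \<psi> x r (cs ! k) + a * T \<phi> \<psi> x r (cs ! l)
      else T \<phi> \<psi> x r c)" if "x \<in> U" "x \<in> D" "c \<in> active Us x" "r < length ds" for x r c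
    using transition_shear_col[OF VU f kl' ne hom that(1-3)] that(4) unfolding T_def by simp
  have "opt_addcol a k l M = initial_matrix us ds cs rs (T ?\<phi> \<psi> Hat0) (T ?\<phi> \<psi> Hat1)"
  proof (rule eq_matI)
    fix i j assume "i < dim_row (initial_matrix us ds cs rs (T ?\<phi> \<psi> Hat0) (T ?\<phi> \<psi> Hat1))"
      "j < dim_col (initial_matrix us ds cs rs (T ?\<phi> \<psi> Hat0) (T ?\<phi> \<psi> Hat1))"
    then have ij: "i < length rs" "j < length cs" by (auto simp: initial_matrix_label_entry)
    note r = rs_D[OF ij(1)] and c = cs_D[OF ij(2)]
    have "label_entry us ds (T ?\<phi> \<psi> Hat0) (T ?\<phi> \<psi> Hat1) (rs ! i) (cs ! j) =
      (if j = k then opt_add_mult a (label_entry us ds (T \<phi> \<psi> Hat0) (T \<phi> \<psi> Hat1) (rs ! i) (cs ! l))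
          (label_entry us ds (T \<phi> \<psi> Hat0) (T \<phi> \<psi> Hat1) (rs ! i) (cs ! k))
       else label_entry us ds (T \<phi> \<psi> Hat0) (T \<phi> \<psi> Hat1) (rs ! i) (cs ! j))"
    proof (cases "j = k")
      case True
      have "label_entry us ds (T ?\<phi> \<psi> Hat0) (T ?\<phi> \<psi> Hat1) (rs ! i) (cs ! k) =
        opt_add_mult a (label_entry us ds (T \<phi> \<psi> Hat0) (T \<phi> \<psi> Hat1) (rs ! i) (cs ! l))
          (label_entry us ds (T \<phi> \<psi> Hat0) (T \<phi> \<psi> Hat1) (rs ! i) (cs ! k))"
      proof (rule label_entry_add_col[OF frames_block_form[OF f] r(1) k(1) l(1) r(2) k(2) l(2) le'])
        assume "fst (us ! (cs ! k)) = Hat0"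
        then show "T ?\<phi> \<psi> Hat0 (rs ! i) (cs ! k) = T \<phi> \<psi> Hat0 (rs ! i) (cs ! k) + a * T \<phi> \<psi> Hat0 (rs ! i) (cs ! l)"
          using k l r le' by (subst t) (auto simp: active_hat0 label_interval_def label_le_def)
      next
        assume "snd (us ! (cs ! k)) = Hat1"
        then show "T ?\<phi> \<psi> Hat1 (rs ! i) (cs ! k) = (if snd (us ! (cs ! l)) = Hat1
            then T \<phi> \<psi> Hat1 (rs ! i) (cs ! k) + a * T \<phi> \<psi> Hat1 (rs ! i) (cs ! l) else T \<phi> \<psi> Hat1 (rs ! i) (cs ! k))"
          using k l r by (subst t) (auto simp: active_hat1 label_interval_def)
      qed
      with True show ?thesis by simp
    next
      case False
      then have "cs ! j \<noteq> cs ! k" using cs_inj ij kl by simp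
      then have "T ?\<phi> \<psi> x r (cs ! j) = T \<phi> \<psi> x r (cs ! j)" if "x \<in> U" "x \<in> D" "cs ! j \<in> active Us x" "r < length ds" for x r
        using t[OF that] by simp
      then show ?thesis using False r c by (simp add: label_entry_def active_hat0 active_hat1)
    qed
    then show "opt_addcol a k l M $$ (i, j) = initial_matrix us ds cs rs (T ?\<phi> \<psi> Hat0) (T ?\<phi> \<psi> Hat1) $$ (i, j)"
      using ij kl by (simp add: M opt_addcol_def initial_matrix_label_entry)
  qed (simp_all add: M opt_addcol_def initial_matrix_label_entry)
  then show ?thesis unfolding realised_def using f f' by blast
qed

lemma realised_addrow:
  assumes M: "realised M" and kl: "k < length rs" "l < length rs" "k \<noteq> l" and le: "label_le (R ! k) (R ! l)"
  shows "realised (opt_addrow a k l M)"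
proof -
  from M obtain \<phi> \<psi> where f: "frame U V Us \<phi>" "frame D V Ds \<psi>"
    and M: "M = initial_matrix us ds cs rs (T \<phi> \<psi> Hat0) (T \<phi> \<psi> Hat1)" unfolding realised_def by blast
  have k: "rs ! k < length ds" "\<not> other_label (ds ! (rs ! k))" and l: "rs ! l < length ds" "\<not> other_label (ds ! (rs ! l))"
    using rs_D kl by auto
  have ne: "rs ! k \<noteq> rs ! l" using kl rs_inj by auto
  have le': "label_le (ds ! (rs ! k)) (ds ! (rs ! l))" using le kl by simp
  let ?\<psi> = "shear Ds a (rs ! k) (rs ! l) \<psi>"
  have hom: "overlap_hom D (Ds ! (rs ! l)) (Ds ! (rs ! k))"
    using overlap_hom_label[OF le'] k l by simp
  have kl': "rs ! k < length Ds" "rs ! l < length Ds" using k l by auto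
  note f' = frame_shear[OF VD f(2) kl' ne hom]
  have t: "T \<phi> ?\<psi> x r c = (if r = rs ! k \<and> x \<in> Ds ! (rs ! k) then T \<phi> \<psi> x (rs ! k) c + a * T \<phi> \<psi> x (rs ! l) c
      else T \<phi> \<psi> x r c)" if "r < length ds" for x r c
  proof -
    have rN: "r < length Ds" using that by simp
    show ?thesis unfolding T_def by (rule transition_shear_row[OF rN])
  qed
  have z: "T \<phi> \<psi> x (rs ! l) c = 0" if "x \<in> U" "x \<in> D" "c \<in> active Us x" "x \<notin> Ds ! (rs ! l)" for x c
    using frameD(6)[OF f(2) that(2) _ kl'(2) that(4)] frame_vec(1)[OF f(1) that(1,3)]
    unfolding T_def transition_entry_frame_vec by simp
  have "opt_addrow a k l M = initial_matrix us ds cs rs (T \<phi> ?\<psi> Hat0) (T \<phi> ?\<psi> Hat1)"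
  proof (rule eq_matI)
    fix i j assume "i < dim_row (initial_matrix us ds cs rs (T \<phi> ?\<psi> Hat0) (T \<phi> ?\<psi> Hat1))"
      "j < dim_col (initial_matrix us ds cs rs (T \<phi> ?\<psi> Hat0) (T \<phi> ?\<psi> Hat1))"
    then have ij: "i < length rs" "j < length cs" by (auto simp: initial_matrix_label_entry)
    note r = rs_D[OF ij(1)] and c = cs_D[OF ij(2)]
    have "label_entry us ds (T \<phi> ?\<psi> Hat0) (T \<phi> ?\<psi> Hat1) (rs ! i) (cs ! j) =
      (if i = k then opt_add_mult a (label_entry us ds (T \<phi> \<psi> Hat0) (T \<phi> \<psi> Hat1) (rs ! l) (cs ! j))
          (label_entry us ds (T \<phi> \<psi> Hat0) (T \<phi> \<psi> Hat1) (rs ! k) (cs ! j))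
       else label_entry us ds (T \<phi> \<psi> Hat0) (T \<phi> \<psi> Hat1) (rs ! i) (cs ! j))"
    proof (cases "i = k")
      case True
      have "label_entry us ds (T \<phi> ?\<psi> Hat0) (T \<phi> ?\<psi> Hat1) (rs ! k) (cs ! j) =
        opt_add_mult a (label_entry us ds (T \<phi> \<psi> Hat0) (T \<phi> \<psi> Hat1) (rs ! l) (cs ! j))
          (label_entry us ds (T \<phi> \<psi> Hat0) (T \<phi> \<psi> Hat1) (rs ! k) (cs ! j))"
      proof (rule label_entry_add_row[OF frames_block_form[OF f] c(1) k(1) l(1) c(2) k(2) l(2) le'])
        assume *: "fst (ds ! (rs ! k)) = Hat0" "fst (us ! (cs ! j)) = Hat0"
        have "T \<phi> \<psi> Hat0 (rs ! l) (cs ! j) = 0" if "fst (ds ! (rs ! l)) \<noteq> Hat0"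
          using that * c l by (intro z) (auto simp: active_hat0 label_interval_def)
        then show "T \<phi> ?\<psi> Hat0 (rs ! k) (cs ! j) = (if fst (ds ! (rs ! l)) = Hat0
            then T \<phi> \<psi> Hat0 (rs ! k) (cs ! j) + a * T \<phi> \<psi> Hat0 (rs ! l) (cs ! j) else T \<phi> \<psi> Hat0 (rs ! k) (cs ! j))"
          using * k by (subst t) (auto simp: label_interval_def)
      next
        assume "snd (ds ! (rs ! k)) = Hat1"
        then show "T \<phi> ?\<psi> Hat1 (rs ! k) (cs ! j) = T \<phi> \<psi> Hat1 (rs ! k) (cs ! j) + a * T \<phi> \<psi> Hat1 (rs ! l) (cs ! j)"
          using k by (subst t) (auto simp: label_interval_def)
      qed
      with True show ?thesis by simp
    next
      case False
      then have "rs ! i \<noteq> rs ! k" using rs_inj ij kl by simp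
      then show ?thesis using False r by (simp add: label_entry_def t)
    qed
    then show "opt_addrow a k l M $$ (i, j) = initial_matrix us ds cs rs (T \<phi> ?\<psi> Hat0) (T \<phi> ?\<psi> Hat1) $$ (i, j)"
      using ij kl by (simp add: M opt_addrow_def initial_matrix_label_entry)
  qed (simp_all add: M opt_addrow_def initial_matrix_label_entry)
  then show ?thesis unfolding realised_def using f f' by blast
qed

lemma realised_multcol:
  assumes M: "realised M" and k: "k < length cs" and a: "a \<noteq> 0"
  shows "realised (opt_multcol k a M)"
proof -
  from M obtain \<phi> \<psi> where f: "frame U V Us \<phi>" "frame D V Ds \<psi>"
    and M: "M = initial_matrix us ds cs rs (T \<phi> \<psi> Hat0) (T \<phi> \<psi> Hat1)" unfolding realised_def by blast
  have k': "cs ! k < length Us" using cs_D[OF k] by simp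
  have a': "inverse a \<noteq> 0" using a by simp
  let ?\<phi> = "rescale Us (inverse a) (cs ! k) \<phi>"
  have t: "T ?\<phi> \<psi> x r c = (if c = cs ! k then a * T \<phi> \<psi> x r (cs ! k) else T \<phi> \<psi> x r c)"
    if "x \<in> U" "x \<in> D" "c \<in> active Us x" "r < length ds" for x r c
    using transition_rescale_col[OF VU f k' a that(1-3)] that(4) unfolding T_def by simp
  have "opt_multcol k a M = initial_matrix us ds cs rs (T ?\<phi> \<psi> Hat0) (T ?\<phi> \<psi> Hat1)"
  proof (rule eq_matI)
    fix i j assume "i < dim_row (initial_matrix us ds cs rs (T ?\<phi> \<psi> Hat0) (T ?\<phi> \<psi> Hat1))"
      "j < dim_col (initial_matrix us ds cs rs (T ?\<phi> \<psi> Hat0) (T ?\<phi> \<psi> Hat1))"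
    then have ij: "i < length rs" "j < length cs" by (auto simp: initial_matrix_label_entry)
    then show "opt_multcol k a M $$ (i, j) = initial_matrix us ds cs rs (T ?\<phi> \<psi> Hat0) (T ?\<phi> \<psi> Hat1) $$ (i, j)"
      using k rs_D[OF ij(1)] cs_D[OF ij(2)] cs_inj[OF ij(2) k]
      by (simp add: M opt_multcol_def initial_matrix_label_entry label_entry_def t active_hat0 active_hat1)
  qed (simp_all add: M opt_multcol_def initial_matrix_label_entry)
  then show ?thesis unfolding realised_def using f frame_rescale[OF VU f(1) k' a'] by blast
qed

lemma realised_multrow:
  assumes M: "realised M" and k: "k < length rs" and a: "a \<noteq> 0"
  shows "realised (opt_multrow k a M)"
proof -
  from M obtain \<phi> \<psi> where f: "frame U V Us \<phi>" "frame D V Ds \<psi>"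
    and M: "M = initial_matrix us ds cs rs (T \<phi> \<psi> Hat0) (T \<phi> \<psi> Hat1)" unfolding realised_def by blast
  have k': "rs ! k < length Ds" using rs_D[OF k] by simp
  let ?\<psi> = "rescale Ds a (rs ! k) \<psi>"
  have t: "T \<phi> ?\<psi> x r c = (if r = rs ! k then a * T \<phi> \<psi> x (rs ! k) c else T \<phi> \<psi> x r c)"
    if "r < length ds" for x r c
  proof -
    have rN: "r < length Ds" using that by simp
    show ?thesis unfolding T_def by (rule transition_rescale_row[OF rN])
  qed
  have "opt_multrow k a M = initial_matrix us ds cs rs (T \<phi> ?\<psi> Hat0) (T \<phi> ?\<psi> Hat1)"
  proof (rule eq_matI)
    fix i j assume "i < dim_row (initial_matrix us ds cs rs (T \<phi> ?\<psi> Hat0) (T \<phi> ?\<psi> Hat1))"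
      "j < dim_col (initial_matrix us ds cs rs (T \<phi> ?\<psi> Hat0) (T \<phi> ?\<psi> Hat1))"
    then have ij: "i < length rs" "j < length cs" by (auto simp: initial_matrix_label_entry)
    then show "opt_multrow k a M $$ (i, j) = initial_matrix us ds cs rs (T \<phi> ?\<psi> Hat0) (T \<phi> ?\<psi> Hat1) $$ (i, j)"
      using k rs_D[OF ij(1)] rs_inj[OF ij(1) k]
      by (cases "i = k") (simp_all add: M opt_multrow_def initial_matrix_label_entry label_entry_def t)
  qed (simp_all add: M opt_multrow_def initial_matrix_label_entry)
  then show ?thesis unfolding realised_def using f frame_rescale[OF VD f(2) k' a] by blast
qed

end

section \<open>Normalizing and clearing the central block\<close>

text \<open>This makes exchanges of rows instances of the operations that automorphisms realise.\<close>

lemma swaprows_by_additions: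
  fixes M :: "'k::field option mat"
  assumes "i \<noteq> k" "i < dim_row M" "k < dim_row M"
    and "\<And>j. j < dim_col M \<Longrightarrow> M $$ (i, j) \<noteq> None \<and> M $$ (k, j) \<noteq> None"
  shows "swaprows i k M = opt_multrow i (- 1) (opt_addrow 1 k i (opt_addrow (- 1) i k (opt_addrow 1 k i M)))"
proof (rule eq_matI)
  fix a j assume "a < dim_row (opt_multrow i (- 1) (opt_addrow 1 k i (opt_addrow (- 1) i k (opt_addrow 1 k i M))))"
    "j < dim_col (opt_multrow i (- 1) (opt_addrow 1 k i (opt_addrow (- 1) i k (opt_addrow 1 k i M))))"
  then have aj: "a < dim_row M" "j < dim_col M" by (simp_all add: opt_multrow_def opt_addrow_def)
  then obtain x y where "M $$ (i, j) = Some x" "M $$ (k, j) = Some y" using assms(4) by blast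
  then show "swaprows i k M $$ (a, j) =
      opt_multrow i (- 1) (opt_addrow 1 k i (opt_addrow (- 1) i k (opt_addrow 1 k i M))) $$ (a, j)"
    using aj assms(1-3) by (simp add: opt_multrow_def opt_addrow_def)
qed (simp_all add: opt_multrow_def opt_addrow_def)

lemma swapcols_by_additions:
  fixes M :: "'k::field option mat"
  assumes "i \<noteq> k" "i < dim_col M" "k < dim_col M"
    and "\<And>j. j < dim_row M \<Longrightarrow> M $$ (j, i) \<noteq> None \<and> M $$ (j, k) \<noteq> None"
  shows "swapcols i k M = opt_multcol i (- 1) (opt_addcol 1 k i (opt_addcol (- 1) i k (opt_addcol 1 k i M)))"
proof (rule eq_matI)
  fix j a assume "j < dim_row (opt_multcol i (- 1) (opt_addcol 1 k i (opt_addcol (- 1) i k (opt_addcol 1 k i M))))"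
    "a < dim_col (opt_multcol i (- 1) (opt_addcol 1 k i (opt_addcol (- 1) i k (opt_addcol 1 k i M))))"
  then have aj: "a < dim_col M" "j < dim_row M" by (simp_all add: opt_multcol_def opt_addcol_def)
  then obtain x y where "M $$ (j, i) = Some x" "M $$ (j, k) = Some y" using assms(4) by blast
  then show "swapcols i k M $$ (j, a) =
      opt_multcol i (- 1) (opt_addcol 1 k i (opt_addcol (- 1) i k (opt_addcol 1 k i M))) $$ (j, a)"
    using aj assms(1-3) by (simp add: opt_multcol_def opt_addcol_def)
qed (simp_all add: opt_multcol_def opt_addcol_def)

lemma label_positions_nth: "map ((!) is) (label_positions Q (map ((!) ls) is)) = filter (\<lambda>i. Q (ls ! i)) is"
proof -
  have "label_positions Q (map ((!) ls) is) = filter ((\<lambda>i. Q (ls ! i)) \<circ> (!) is) [0..<length is]"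
    unfolding label_positions_def by (intro filter_cong) auto
  then show ?thesis by (simp flip: filter_map add: map_nth)
qed

lemma label_positions_D:
  assumes "j < length (label_positions Q L)"
  shows "label_positions Q L ! j < length L" "Q (L ! (label_positions Q L ! j))"
    "label_positions Q L ! j \<in> set (label_positions Q L)"
  using nth_mem[OF assms] by (auto simp: label_positions_def)

lemma distinct_label_positions: "distinct (label_positions Q L)"
  by (simp add: label_positions_def)

lemma label_positions_nth_eq:
  "i < length (label_positions Q L) \<Longrightarrow> j < length (label_positions Q L) \<Longrightarrow>
     label_positions Q L ! i = label_positions Q L ! j \<longleftrightarrow> i = j"
  by (simp add: nth_eq_iff_index_eq distinct_label_positions)

lemma in_label_positions: "i \<in> set (label_positions Q L) \<longleftrightarrow> i < length L \<and> Q (L ! i)"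
  by (auto simp: label_positions_def)

context bipath_matrix
begin

definition class_cols :: "(label \<Rightarrow> bool) \<Rightarrow> nat list" where
  "class_cols Q = filter (\<lambda>c. Q (us ! c)) cs"

definition class_rows :: "(label \<Rightarrow> bool) \<Rightarrow> nat list" where
  "class_rows Q = filter (\<lambda>r. Q (ds ! r)) rs"

lemma class_cols_nth:
  "length (label_positions Q C) = length (class_cols Q)"
  "j < length (class_cols Q) \<Longrightarrow> cs ! (label_positions Q C ! j) = class_cols Q ! j"
  using label_positions_nth[of cs Q us] unfolding class_cols_def by (metis length_map, metis length_map nth_map)

lemma class_rows_nth:
  "length (label_positions Q R) = length (class_rows Q)"
  "j < length (class_rows Q) \<Longrightarrow> rs ! (label_positions Q R ! j) = class_rows Q ! j"
  using label_positions_nth[of rs Q ds] unfolding class_rows_def by (metis length_map, metis length_map nth_map)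

lemma set_class:
  assumes "\<And>l. Q l \<Longrightarrow> \<not> other_label l"
  shows "set (class_cols Q) = {c. c < length us \<and> Q (us ! c)}" "set (class_rows Q) = {r. r < length ds \<and> Q (ds ! r)}"
  using cs rs unfolding class_cols_def class_rows_def label_order_def by (auto dest: assms)

lemma distinct_class: "distinct (class_cols Q)" "distinct (class_rows Q)"
  using cs rs unfolding class_cols_def class_rows_def label_order_def by auto

lemma sorted_class:
  "i < j \<Longrightarrow> j < length (class_cols Q) \<Longrightarrow> label_le (us ! (class_cols Q ! i)) (us ! (class_cols Q ! j))"
  "i < j \<Longrightarrow> j < length (class_rows Q) \<Longrightarrow> label_le (ds ! (class_rows Q ! i)) (ds ! (class_rows Q ! j))"
proof -
  have "sorted_wrt (\<lambda>x y. label_le (us ! x) (us ! y)) (class_cols Q)"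
    "sorted_wrt (\<lambda>x y. label_le (ds ! x) (ds ! y)) (class_rows Q)"
    unfolding class_cols_def class_rows_def
    by (rule sorted_wrt_filter, use cs rs in \<open>simp add: label_order_def sorted_wrt_map\<close>)+
  then show "i < j \<Longrightarrow> j < length (class_cols Q) \<Longrightarrow> label_le (us ! (class_cols Q ! i)) (us ! (class_cols Q ! j))"
    "i < j \<Longrightarrow> j < length (class_rows Q) \<Longrightarrow> label_le (ds ! (class_rows Q ! i)) (ds ! (class_rows Q ! j))"
    by (simp_all add: sorted_wrt_iff_nth_less)
qed

lemma label_block_initial:
  "label_block R C Q Q' (initial_matrix us ds cs rs \<Lambda> \<Gamma>) = mat (length (class_rows Q)) (length (class_cols Q'))
     (\<lambda>(i, j). the (label_entry us ds \<Lambda> \<Gamma> (class_rows Q ! i) (class_cols Q' ! j)))"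
proof (rule eq_matI)
  fix i j assume "i < dim_row (mat (length (class_rows Q)) (length (class_cols Q'))
     (\<lambda>(i, j). the (label_entry us ds \<Lambda> \<Gamma> (class_rows Q ! i) (class_cols Q' ! j))))"
    "j < dim_col (mat (length (class_rows Q)) (length (class_cols Q'))
     (\<lambda>(i, j). the (label_entry us ds \<Lambda> \<Gamma> (class_rows Q ! i) (class_cols Q' ! j))))"
  then have ij: "i < length (class_rows Q)" "j < length (class_cols Q')" by simp_all
  then have "label_positions Q R ! i < length rs" "label_positions Q' C ! j < length cs"
    using label_positions_D(1)[of i Q R] label_positions_D(1)[of j Q' C]
    by (simp_all add: class_rows_nth class_cols_nth)
  then show "label_block R C Q Q' (initial_matrix us ds cs rs \<Lambda> \<Gamma>) $$ (i, j) =
      mat (length (class_rows Q)) (length (class_cols Q'))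
     (\<lambda>(i, j). the (label_entry us ds \<Lambda> \<Gamma> (class_rows Q ! i) (class_cols Q' ! j))) $$ (i, j)"
    using ij by (simp add: label_block_def class_rows_nth class_cols_nth initial_matrix_label_entry)
qed (simp_all add: label_block_def class_rows_nth class_cols_nth)

lemma realised_dims: "realised M \<Longrightarrow> dim_row M = length rs" "realised M \<Longrightarrow> dim_col M = length cs"
  unfolding realised_def initial_matrix_def by auto

lemma realised_central_row:
  assumes "realised M" "i \<in> set (label_positions central_label R)" "j < length cs"
  shows "M $$ (i, j) \<noteq> None"
proof -
  have "i < length rs" "central_label (ds ! (rs ! i))" using assms(2) by (auto simp: in_label_positions)
  then show ?thesis
    using assms cs_D[OF assms(3)] unfolding realised_def
    by (auto simp: initial_matrix_label_entry label_entry_def central_label_def other_label_def)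
qed

lemma realised_central_col:
  assumes "realised M" "j \<in> set (label_positions central_label C)" "i < length rs"
  shows "M $$ (i, j) \<noteq> None"
proof -
  have "j < length cs" "central_label (us ! (cs ! j))" using assms(2) by (auto simp: in_label_positions)
  then show ?thesis
    using assms rs_D[OF assms(3)] unfolding realised_def
    by (auto simp: initial_matrix_label_entry label_entry_def central_label_def other_label_def)
qed

lemma label_le_central: "central_label l \<Longrightarrow> central_label l' \<Longrightarrow> label_le l l'"
  "left_label l \<Longrightarrow> central_label l' \<Longrightarrow> label_le l l'" "central_label l \<Longrightarrow> right_label l' \<Longrightarrow> label_le l l'"
  by (simp_all add: central_label_def left_label_def right_label_def label_le_def)

lemma realised_swaprows:
  assumes M: "realised M" and i: "i \<in> set (label_positions central_label R)" "i' \<in> set (label_positions central_label R)"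
  shows "realised (swaprows i i' M)"
proof (cases "i = i'")
  case True
  then have "swaprows i i' M = M" by (intro eq_matI) auto
  then show ?thesis using M by simp
next
  case False
  have ii: "i < length rs" "i' < length rs" "central_label (R ! i)" "central_label (R ! i')"
    using i by (auto simp: in_label_positions)
  have add: "realised (opt_addrow a i i' N)" "realised (opt_addrow a i' i N)" if "realised N" for N a
    using that ii False by (auto intro!: realised_addrow label_le_central(1))
  have "swaprows i i' M = opt_multrow i (- 1) (opt_addrow 1 i' i (opt_addrow (- 1) i i' (opt_addrow 1 i' i M)))"
    using False ii realised_central_row[OF M i(1)] realised_central_row[OF M i(2)] realised_dims[OF M]
    by (intro swaprows_by_additions) auto
  then show ?thesis using M ii by (simp add: add realised_multrow)
qed

lemma realised_swapcols:
  assumes M: "realised M" and i: "i \<in> set (label_positions central_label C)" "i' \<in> set (label_positions central_label C)"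
  shows "realised (swapcols i i' M)"
proof (cases "i = i'")
  case True
  then have "swapcols i i' M = M" by (intro eq_matI) auto
  then show ?thesis using M by simp
next
  case False
  have ii: "i < length cs" "i' < length cs" "central_label (C ! i)" "central_label (C ! i')"
    using i by (auto simp: in_label_positions)
  have add: "realised (opt_addcol a i i' N)" "realised (opt_addcol a i' i N)" if "realised N" for N a
    using that ii False by (auto intro!: realised_addcol label_le_central(1))
  have "swapcols i i' M = opt_multcol i (- 1) (opt_addcol 1 i' i (opt_addcol (- 1) i i' (opt_addcol 1 i' i M)))"
    using False ii realised_central_col[OF M i(1)] realised_central_col[OF M i(2)] realised_dims[OF M]
    by (intro swapcols_by_additions) auto
  then show ?thesis using M ii by (simp add: add realised_multcol)
qed

lemma realised_central_op:
  assumes "central_op R C M M'" "realised M"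
  shows "realised M'"
  using assms
proof cases
  case (3 i i' a)
  then show ?thesis using assms(2) by (auto simp: in_label_positions intro!: realised_addrow label_le_central(1))
next
  case (6 j j' a)
  then show ?thesis using assms(2) by (auto simp: in_label_positions intro!: realised_addcol label_le_central(1))
qed (use assms(2) realised_swaprows realised_swapcols in
    \<open>auto simp: in_label_positions intro: realised_multrow realised_multcol\<close>)

lemma realised_central_ops: "(central_op R C)\<^sup>*\<^sup>* M M' \<Longrightarrow> realised M \<Longrightarrow> realised M'"
  by (induction rule: rtranclp_induct) (use realised_central_op in blast)+

lemma left_right_not_central:
  "left_label l \<Longrightarrow> \<not> central_label l" "right_label l \<Longrightarrow> \<not> central_label l"
  by (simp_all add: left_label_def right_label_def central_label_def)

lemma realised_clearing_op:
  assumes "clearing_op R C M M'" "realised M"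
  shows "realised M'"
  using assms
proof cases
  case (1 j j' a)
  then have "j' \<noteq> j" by (auto simp: in_label_positions dest: left_right_not_central(2))
  then show ?thesis using 1 assms(2)
    by (auto simp: in_label_positions intro!: realised_addcol label_le_central(3))
next
  case (2 i i' a)
  then have "i' \<noteq> i" by (auto simp: in_label_positions dest: left_right_not_central(1))
  then show ?thesis using 2 assms(2)
    by (auto simp: in_label_positions intro!: realised_addrow label_le_central(2))
qed

lemma clearing_op_central_block:
  assumes op: "clearing_op R C M M'" and M: "realised M"
  shows "label_block R C central_label central_label M' = label_block R C central_label central_label M"
proof -
  let ?pr = "label_positions central_label R" and ?pc = "label_positions central_label C"
  have "M' $$ (?pr ! i, ?pc ! j) = M $$ (?pr ! i, ?pc ! j)" if ij: "i < length ?pr" "j < length ?pc" for i j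
  proof -
    note r = label_positions_D[OF ij(1)] and c = label_positions_D[OF ij(2)]
    have d: "?pr ! i < dim_row M" "?pc ! j < dim_col M" using r c realised_dims[OF M] by auto
    from op show ?thesis
    proof cases
      case (1 k k' a)
      then have "?pc ! j \<noteq> k'" using c by (auto simp: in_label_positions dest: left_right_not_central(2))
      then show ?thesis using d by (simp add: 1 opt_addcol_def)
    next
      case (2 k k' a)
      then have "?pr ! i \<noteq> k'" using r by (auto simp: in_label_positions dest: left_right_not_central(1))
      then show ?thesis using d by (simp add: 2 opt_addrow_def)
    qed
  qed
  then show ?thesis unfolding label_block_def by (intro eq_matI) auto
qed

lemma clearing_ops:
  assumes "(clearing_op R C)\<^sup>*\<^sup>* M M'" and "realised M"
  shows "realised M' \<and> label_block R C central_label central_label M' = label_block R C central_label central_label M"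
  using assms by (induction rule: rtranclp_induct) (auto simp: realised_clearing_op clearing_op_central_block)

lemma active_hats:
  "active Us Hat0 = {c. c < length us \<and> (left_label (us ! c) \<or> central_label (us ! c))}"
  "active Ds Hat0 = {c. c < length ds \<and> (left_label (ds ! c) \<or> central_label (ds ! c))}"
  "active Us Hat1 = {c. c < length us \<and> (central_label (us ! c) \<or> right_label (us ! c))}"
  "active Ds Hat1 = {c. c < length ds \<and> (central_label (ds ! c) \<or> right_label (ds ! c))}"
  by (auto simp: active_hat0 active_hat1 left_label_def central_label_def right_label_def)

lemma class_not_other [simp]:
  "left_label l \<Longrightarrow> \<not> other_label l" "central_label l \<Longrightarrow> \<not> other_label l" "right_label l \<Longrightarrow> \<not> other_label l"
  by (simp_all add: left_label_def central_label_def right_label_def other_label_def)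

text \<open>The whole row is nonzero because the transition matrix is invertible, and its entries in the left
  columns vanish by the block form.\<close>

lemma central_row_nonzero:
  assumes f: "frame U V Us \<phi>" "frame D V Ds \<psi>" and r: "r < length ds" "central_label (ds ! r)"
  shows "\<exists>c<length us. central_label (us ! c) \<and> T \<phi> \<psi> Hat0 r c \<noteq> 0"
proof -
  have "r \<in> active Ds Hat0" using r by (simp add: active_hats)
  then obtain c where c: "c \<in> active Us Hat0" "T \<phi> \<psi> Hat0 r c \<noteq> 0"
    using transition_nonzero_row[OF VU f, of Hat0 r] unfolding T_def by auto
  then have "\<not> left_label (us ! c)"
    using frames_block_form[OF f] r unfolding block_form_def by (auto simp: active_hats)
  then show ?thesis using c by (auto simp: active_hats)
qed

lemma central_col_nonzero:
  assumes f: "frame U V Us \<phi>" "frame D V Ds \<psi>" and c: "c < length us" "central_label (us ! c)"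
  shows "\<exists>r<length ds. central_label (ds ! r) \<and> T \<phi> \<psi> Hat0 r c \<noteq> 0"
proof -
  have "c \<in> active Us Hat0" using c by (simp add: active_hats)
  then obtain r where r: "r \<in> active Ds Hat0" "T \<phi> \<psi> Hat0 r c \<noteq> 0"
    and nz: "transition_entry V (length Ds) \<psi> \<phi> Hat0 c r \<noteq> 0"
    using transition_nonzero_row[OF VD f(2,1), of Hat0 c] unfolding T_def by auto
  have "\<not> left_label (ds ! r)"
  proof
    assume "left_label (ds ! r)"
    then have "transition_entry V (length Ds) \<psi> \<phi> Hat0 c r = 0"
      using c r(1) by (intro transition_dies[OF VD f(2,1), of Hat0 Hat1 r c])
        (auto simp: active_hats central_label_def left_label_def right_label_def)
    with nz show False by simp
  qed
  then show ?thesis using r by (auto simp: active_hats)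
qed

lemma label_entry_central:
  "central_label (ds ! r) \<Longrightarrow> central_label (us ! c) \<Longrightarrow> label_entry us ds \<Lambda> \<Gamma> r c = Some (\<Lambda> r c)"
  "left_label (ds ! r) \<Longrightarrow> central_label (us ! c) \<Longrightarrow> label_entry us ds \<Lambda> \<Gamma> r c = Some (\<Lambda> r c)"
  "left_label (ds ! r) \<Longrightarrow> left_label (us ! c) \<Longrightarrow> label_entry us ds \<Lambda> \<Gamma> r c = Some (\<Lambda> r c)"
  "central_label (ds ! r) \<Longrightarrow> right_label (us ! c) \<Longrightarrow> label_entry us ds \<Lambda> \<Gamma> r c = Some (\<Gamma> r c)"
  "right_label (ds ! r) \<Longrightarrow> right_label (us ! c) \<Longrightarrow> label_entry us ds \<Lambda> \<Gamma> r c = Some (\<Gamma> r c)"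
  by (simp_all add: label_entry_def central_label_def left_label_def right_label_def)

text \<open>All operations inside the central block are permitted, so it has a rank normal form. The rank is
  full, for otherwise the normal form would contain a zero row or a zero column.\<close>

lemma normalize_central_exists:
  assumes M: "realised M"
  shows "\<exists>M1. normalize_central R C M M1"
proof -
  let ?pr = "label_positions central_label R" and ?pc = "label_positions central_label C"
  let ?p = "length ?pr" and ?q = "length ?pc"
  define St where "St F \<longleftrightarrow> (\<exists>M'. (central_op R C)\<^sup>*\<^sup>* M M' \<and> realised M' \<and>
     (\<forall>i<?p. \<forall>j<?q. M' $$ (?pr ! i, ?pc ! j) = Some (F i j)))" for F
  have StI: "St F'" if M': "(central_op R C)\<^sup>*\<^sup>* M M'" "realised M'" and op: "central_op R C M' M''"
    and e: "\<And>i j. i < ?p \<Longrightarrow> j < ?q \<Longrightarrow> M'' $$ (?pr ! i, ?pc ! j) = Some (F' i j)" for M' M'' F'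
    unfolding St_def using rtranclp.rtrancl_into_rtrancl[OF M'(1) op] realised_central_op[OF op M'(2)] e by blast
  have pr: "?pr ! i < length rs" "?pr ! i \<in> set ?pr" if "i < ?p" for i using label_positions_D[OF that] by auto
  have pc: "?pc ! i < length cs" "?pc ! i \<in> set ?pc" if "i < ?q" for i using label_positions_D[OF that] by auto
  have init: "St (\<lambda>i j. the (M $$ (?pr ! i, ?pc ! j)))"
  proof -
    have "M $$ (?pr ! i, ?pc ! j) = Some (the (M $$ (?pr ! i, ?pc ! j)))" if "i < ?p" "j < ?q" for i j
      using realised_central_row[OF M pr(2)[OF that(1)] pc(1)[OF that(2)]] by simp
    then show ?thesis unfolding St_def using M by blast
  qed
  have "\<exists>F' k. St F' \<and> k \<le> ?p \<and> k \<le> ?q \<and> (\<forall>i<?p. \<forall>j<?q. F' i j = (if i = j \<and> i < k then 1 else 0))"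
  proof (rule rank_normal_form[where St = St, OF init])
    fix F i k assume "St F"
    then obtain M' where M': "(central_op R C)\<^sup>*\<^sup>* M M'" "realised M'"
      and e: "\<And>i j. i < ?p \<Longrightarrow> j < ?q \<Longrightarrow> M' $$ (?pr ! i, ?pc ! j) = Some (F i j)" unfolding St_def by blast
    note d = realised_dims[OF M'(2)]
    { assume ik: "i < ?p" "k < ?p"
      show "St (\<lambda>r c. F (if r = i then k else if r = k then i else r) c)"
        by (rule StI[OF M' central_op.intros(1)[OF pr(2)[OF ik(1)] pr(2)[OF ik(2)]]])
          (use ik in \<open>simp add: d pr pc e label_positions_nth_eq\<close>) }
    { assume ik: "i < ?q" "k < ?q"
      show "St (\<lambda>r c. F r (if c = i then k else if c = k then i else c))"
        by (rule StI[OF M' central_op.intros(4)[OF pc(2)[OF ik(1)] pc(2)[OF ik(2)]]])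
          (use ik in \<open>simp add: d pr pc e label_positions_nth_eq\<close>) }
    { fix a :: 'k assume ia: "i < ?p" "a \<noteq> 0"
      show "St (\<lambda>r c. if r = i then a * F r c else F r c)"
        by (rule StI[OF M' central_op.intros(2)[OF pr(2)[OF ia(1)] ia(2)]])
          (use ia in \<open>simp add: d pr pc e label_positions_nth_eq opt_multrow_def\<close>) }
    { fix a :: 'k assume ik: "i < ?p" "k < ?p" "i \<noteq> k"
      have ne: "?pr ! i \<noteq> ?pr ! k" using ik by (simp add: label_positions_nth_eq)
      show "St (\<lambda>r c. if r = i then F r c + a * F k c else F r c)"
        by (rule StI[OF M' central_op.intros(3)[where a = a, OF pr(2)[OF ik(1)] pr(2)[OF ik(2)] ne]])
          (use ik in \<open>simp add: d pr pc e label_positions_nth_eq opt_addrow_def\<close>) }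
    { fix a :: 'k assume ik: "i < ?q" "k < ?q" "i \<noteq> k"
      have ne: "?pc ! i \<noteq> ?pc ! k" using ik by (simp add: label_positions_nth_eq)
      show "St (\<lambda>r c. if c = i then F r c + a * F r k else F r c)"
        by (rule StI[OF M' central_op.intros(6)[where a = a, OF pc(2)[OF ik(1)] pc(2)[OF ik(2)] ne]])
          (use ik in \<open>simp add: d pr pc e label_positions_nth_eq opt_addcol_def\<close>) }
  qed
  then obtain F k where St: "St F" and k: "k \<le> ?p" "k \<le> ?q"
    and F: "\<And>i j. i < ?p \<Longrightarrow> j < ?q \<Longrightarrow> F i j = (if i = j \<and> i < k then 1 else 0)" by blast
  from St obtain M' where M': "(central_op R C)\<^sup>*\<^sup>* M M'" "realised M'"
    and e: "\<And>i j. i < ?p \<Longrightarrow> j < ?q \<Longrightarrow> M' $$ (?pr ! i, ?pc ! j) = Some (F i j)" unfolding St_def by blast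
  from M'(2) obtain \<phi> \<psi> where f: "frame U V Us \<phi>" "frame D V Ds \<psi>"
    and eq: "M' = initial_matrix us ds cs rs (T \<phi> \<psi> Hat0) (T \<phi> \<psi> Hat1)" unfolding realised_def by blast
  have TF: "T \<phi> \<psi> Hat0 (class_rows central_label ! i) (class_cols central_label ! j) = F i j"
    if ij: "i < ?p" "j < ?q" for i j
    using e[OF ij] label_positions_D(2)[OF ij(1)] label_positions_D(2)[OF ij(2)] pr(1)[OF ij(1)] pc(1)[OF ij(2)] ij
    by (simp add: eq initial_matrix_label_entry label_entry_central class_rows_nth class_cols_nth)
  have "k = ?p"
  proof (rule ccontr)
    assume "k \<noteq> ?p"
    then have kp: "k < ?p" using k by simp
    then have "class_rows central_label ! k \<in> set (class_rows central_label)" by (simp add: class_rows_nth)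
    then obtain c where c: "c \<in> set (class_cols central_label)" "T \<phi> \<psi> Hat0 (class_rows central_label ! k) c \<noteq> 0"
      using central_row_nonzero[OF f, of "class_rows central_label ! k"] by (auto simp: set_class)
    then obtain j where "j < ?q" "class_cols central_label ! j = c" by (auto simp: in_set_conv_nth class_cols_nth)
    then show False using c TF[OF kp, of j] F[OF kp, of j] by simp
  qed
  moreover have "k = ?q"
  proof (rule ccontr)
    assume "k \<noteq> ?q"
    then have kq: "k < ?q" using k by simp
    then have "class_cols central_label ! k \<in> set (class_cols central_label)" by (simp add: class_cols_nth)
    then obtain r where r: "r \<in> set (class_rows central_label)" "T \<phi> \<psi> Hat0 r (class_cols central_label ! k) \<noteq> 0"
      using central_col_nonzero[OF f, of "class_cols central_label ! k"] by (auto simp: set_class)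
    then obtain i where i: "i < ?p" "class_rows central_label ! i = r" by (auto simp: in_set_conv_nth class_rows_nth)
    then show False using r TF[OF i(1) kq] F[OF i(1) kq] by (simp split: if_splits)
  qed
  ultimately have "label_block R C central_label central_label M' = 1\<^sub>m ?p"
    using e F unfolding label_block_def by (intro eq_matI) auto
  then show ?thesis unfolding normalize_central_def using M' by blast
qed

text \<open>As the central block is the identity, an addition that makes one entry of the neighbouring blocks
  zero changes no other entry of these blocks. So the number of nonzero entries in them decreases.\<close>

lemma clear_central_exists:
  assumes M: "realised M" and id: "label_block R C central_label central_label M = 1\<^sub>m (length (label_positions central_label R))"
  shows "\<exists>M2. clear_central R C M M2"
proof -
  let ?pr = "label_positions central_label R" and ?pc = "label_positions central_label C"
  let ?lr = "label_positions left_label R" and ?rc = "label_positions right_label C"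
  have len: "length ?pc = length ?pr" using arg_cong[OF id, of dim_col] by (simp add: label_block_def)
  \<comment> \<open>the positions next to the central block that are still to be cleared\<close>
  define bad where "bad N = {(i, j). i \<in> set ?pr \<and> j \<in> set ?rc \<and> N $$ (i, j) \<noteq> Some 0} \<union>
     {(i, j). i \<in> set ?lr \<and> j \<in> set ?pc \<and> N $$ (i, j) \<noteq> Some 0}" for N :: "'k option mat"
  have fin: "finite (bad N)" for N
    by (rule finite_subset[of _ "(set ?pr \<union> set ?lr) \<times> (set ?pc \<union> set ?rc)"]) (auto simp: bad_def)
  have "\<exists>M2. (clearing_op R C)\<^sup>*\<^sup>* N M2 \<and> bad M2 = {}"
    if "realised N" "label_block R C central_label central_label N = 1\<^sub>m (length ?pr)" for N
    using that
  proof (induction "card (bad N)" arbitrary: N rule: less_induct)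
    case (less N)
    note d = realised_dims[OF less.prems(1)]
    have unit: "N $$ (?pr ! a, ?pc ! b) = Some (if a = b then 1 else 0)" if "a < length ?pr" "b < length ?pr" for a b
    proof -
      have "label_block R C central_label central_label N $$ (a, b) = the (N $$ (?pr ! a, ?pc ! b))"
        using that len by (simp add: label_block_def)
      then have "the (N $$ (?pr ! a, ?pc ! b)) = (if a = b then 1 else 0)"
        unfolding less.prems(2) using that by simp
      moreover have "N $$ (?pr ! a, ?pc ! b) \<noteq> None"
        using realised_central_row[OF less.prems(1)] that label_positions_D[of a central_label R]
          label_positions_D[of b central_label C] len by simp
      ultimately show ?thesis by auto
    qed
    have continue: "?case" if op: "clearing_op R C N N'" and sub: "bad N' \<subset> bad N" for N'
    proof -
      have "\<exists>M2. (clearing_op R C)\<^sup>*\<^sup>* N' M2 \<and> bad M2 = {}"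
        using psubset_card_mono[OF fin sub] realised_clearing_op[OF op less.prems(1)]
          clearing_op_central_block[OF op less.prems(1)] less.prems(2) by (intro less.hyps) auto
      then show ?thesis using converse_rtranclp_into_rtranclp[of "clearing_op R C", OF op] by blast
    qed
    show ?case
    proof (cases "bad N = {}")
      case False
      then obtain i j where "(i, j) \<in> bad N" by (auto simp: bad_def)
      then consider "i \<in> set ?pr" "j \<in> set ?rc" "N $$ (i, j) \<noteq> Some 0" | "i \<in> set ?lr" "j \<in> set ?pc" "N $$ (i, j) \<noteq> Some 0"
        unfolding bad_def by blast
      then show ?thesis
      proof cases
        case 1
        then obtain a where a: "a < length ?pr" "i = ?pr ! a" by (auto simp: in_set_conv_nth)
        have j: "j < length cs" "right_label (C ! j)" using 1(2) by (auto simp: in_label_positions)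
        have nc: "j \<notin> set ?pc" using j by (auto simp: in_label_positions dest: left_right_not_central(2))
        obtain x where x: "N $$ (i, j) = Some x" using realised_central_row[OF less.prems(1) 1(1) j(1)] by auto
        let ?k = "?pc ! a"
        have k: "?k \<in> set ?pc" "?k < length cs" using label_positions_D[of a central_label C] a len by auto
        let ?N = "opt_addcol (- x) j ?k N"
        have op: "clearing_op R C N ?N" using k 1(2) by (intro clearing_op.intros(1))
        have other: "?N $$ (i', j') = N $$ (i', j')" if "i' < length rs" "j' < length cs" "j' \<noteq> j" for i' j'
          using that d by (simp add: opt_addcol_def)
        have same: "?N $$ (i', j) = (if i' = i then Some 0 else N $$ (i', j))" if i': "i' \<in> set ?pr" for i'
        proof -
          obtain b where b: "b < length ?pr" "i' = ?pr ! b" using i' by (auto simp: in_set_conv_nth)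
          have "i' < length rs" using i' by (simp add: in_label_positions)
          moreover obtain y where "N $$ (i', j) = Some y" using realised_central_row[OF less.prems(1) i' j(1)] by auto
          ultimately show ?thesis
            using d j unit[OF b(1) a(1)] x by (auto simp: opt_addcol_def b a label_positions_nth_eq)
        qed
        have "bad ?N \<subseteq> bad N - {(i, j)}"
        proof
          fix z assume z: "z \<in> bad ?N"
          obtain i' j' where zz: "z = (i', j')" by (cases z)
          have ij': "i' < length rs" "j' < length cs" using z by (auto simp: zz bad_def in_label_positions)
          show "z \<in> bad N - {(i, j)}"
          proof (cases "j' = j")
            case True
            then have "i' \<in> set ?pr" "?N $$ (i', j) \<noteq> Some 0" using z nc by (auto simp: zz bad_def)
            then show ?thesis using same[of i'] True 1(2) by (auto simp: zz bad_def split: if_splits)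
          next
            case False
            then show ?thesis using z other[OF ij' False] by (auto simp: zz bad_def)
          qed
        qed
        then have "bad ?N \<subset> bad N" using \<open>(i, j) \<in> bad N\<close> by blast
        then show ?thesis by (rule continue[OF op])
      next
        case 2
        then obtain a where a: "a < length ?pr" "j = ?pc ! a" by (auto simp: in_set_conv_nth len)
        have i: "i < length rs" "left_label (R ! i)" using 2(1) by (auto simp: in_label_positions)
        have nc: "i \<notin> set ?pr" using i by (auto simp: in_label_positions dest: left_right_not_central(1))
        obtain x where x: "N $$ (i, j) = Some x" using realised_central_col[OF less.prems(1) 2(2) i(1)] by auto
        let ?k = "?pr ! a"
        have k: "?k \<in> set ?pr" "?k < length rs" using label_positions_D[of a central_label R] a len by auto
        let ?N = "opt_addrow (- x) i ?k N"
        have op: "clearing_op R C N ?N" using k 2(1) by (intro clearing_op.intros(2))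
        have other: "?N $$ (i', j') = N $$ (i', j')" if "i' < length rs" "j' < length cs" "i' \<noteq> i" for i' j'
          using that d by (simp add: opt_addrow_def)
        have same: "?N $$ (i, j') = (if j' = j then Some 0 else N $$ (i, j'))" if j': "j' \<in> set ?pc" for j'
        proof -
          obtain b where b: "b < length ?pr" "j' = ?pc ! b" using j' by (auto simp: in_set_conv_nth len)
          have "j' < length cs" using j' by (simp add: in_label_positions)
          moreover obtain y where "N $$ (i, j') = Some y" using realised_central_col[OF less.prems(1) j' i(1)] by auto
          ultimately show ?thesis
            using d i unit[OF a(1) b(1)] x len by (auto simp: opt_addrow_def b a label_positions_nth_eq)
        qed
        have "bad ?N \<subseteq> bad N - {(i, j)}"
        proof
          fix z assume z: "z \<in> bad ?N"
          obtain i' j' where zz: "z = (i', j')" by (cases z)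
          have ij': "i' < length rs" "j' < length cs" using z by (auto simp: zz bad_def in_label_positions)
          show "z \<in> bad N - {(i, j)}"
          proof (cases "i' = i")
            case True
            then have "j' \<in> set ?pc" "?N $$ (i, j') \<noteq> Some 0" using z nc by (auto simp: zz bad_def)
            then show ?thesis using same[of j'] True 2(1) by (auto simp: zz bad_def split: if_splits)
          next
            case False
            then show ?thesis using z other[OF ij' False] by (auto simp: zz bad_def)
          qed
        qed
        then have "bad ?N \<subset> bad N" using \<open>(i, j) \<in> bad N\<close> by blast
        then show ?thesis by (rule continue[OF op])
      qed
    qed blast
  qed
  from this[OF M id] obtain M2 where M2: "(clearing_op R C)\<^sup>*\<^sup>* M M2" "bad M2 = {}" by blast
  have "label_block R C central_label right_label M2 = 0\<^sub>m (length ?pr) (length ?rc)"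
    "label_block R C left_label central_label M2 = 0\<^sub>m (length ?lr) (length ?pc)"
    unfolding label_block_def
    by (intro eq_matI; use M2(2) in \<open>force simp: bad_def\<close>)+
  then show ?thesis unfolding clear_central_def using M2(1) by blast
qed

end

section \<open>Gluing frames\<close>

text \<open>For preorders, since different indices may carry equal labels.\<close>

lemma sorted_enumeration:
  assumes "finite A" "\<And>x y. x \<in> A \<Longrightarrow> y \<in> A \<Longrightarrow> r x y \<or> r y x"
    "\<And>x y z. x \<in> A \<Longrightarrow> y \<in> A \<Longrightarrow> z \<in> A \<Longrightarrow> r x y \<Longrightarrow> r y z \<Longrightarrow> r x z"
  shows "\<exists>xs. distinct xs \<and> set xs = A \<and> sorted_wrt r xs"
  using assms
proof (induction "card A" arbitrary: A)
  case 0
  have "A = {}" using 0(1,2) by simp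
  then show ?case by (intro exI[of _ "[]"]) simp
next
  case (Suc n)
  have fin: "finite A" and ne: "A \<noteq> {}" using Suc.hyps(2) Suc.prems(1) by auto
  have "\<exists>x\<in>B. \<forall>y\<in>B. r x y" if "finite B" "B \<noteq> {}" "B \<subseteq> A" for B
    using that
  proof (induction B rule: finite_ne_induct)
    case (singleton x)
    then show ?case using Suc.prems(2)[of x x] by auto
  next
    case (insert x F)
    then obtain z where z: "z \<in> F" "\<forall>y\<in>F. r z y" by auto
    have A: "x \<in> A" "z \<in> A" "F \<subseteq> A" using insert.prems z by auto
    show ?case
    proof (cases "r x z")
      case True
      then have "\<forall>y\<in>F. r x y" using Suc.prems(3)[OF A(1,2)] z A(3) by blast
      then show ?thesis using Suc.prems(2)[OF A(1,1)] by blast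
    next
      case False
      then have "r z x" using Suc.prems(2)[OF A(1,2)] by blast
      then show ?thesis using z by blast
    qed
  qed
  from this[OF fin ne] obtain x where x: "x \<in> A" "\<forall>y\<in>A. r x y" by blast
  have "\<exists>xs. distinct xs \<and> set xs = A - {x} \<and> sorted_wrt r xs"
  proof (rule Suc.hyps(1))
    show "n = card (A - {x})" using x(1) fin Suc.hyps(2) by simp
    show "finite (A - {x})" using fin by simp
  qed (use Suc.prems in blast)+
  then obtain xs where xs: "distinct xs" "set xs = A - {x}" "sorted_wrt r xs" by blast
  then have "distinct (x # xs)" "set (x # xs) = A" "sorted_wrt r (x # xs)" using x by auto
  then show ?case by blast
qed

lemma distinct_filter_nth:
  "distinct (filter P xs) \<Longrightarrow> P (xs ! i) \<Longrightarrow> i < length xs \<Longrightarrow> j < length xs \<Longrightarrow> xs ! i = xs ! j \<Longrightarrow> i = j"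
proof (induction xs arbitrary: i j)
  case (Cons x xs)
  have *: "P y \<Longrightarrow> y \<in> set xs \<Longrightarrow> y = x \<Longrightarrow> False" for y using Cons.prems(1) by auto
  have d: "distinct (filter P xs)" using Cons.prems(1) by (auto split: if_splits)
  show ?case
  proof (cases i; cases j)
    fix i' assume i: "i = Suc i'" and "j = 0"
    then have "i' < length xs" "P (xs ! i')" "xs ! i' = x" using Cons.prems by auto
    then show ?thesis using *[of "xs ! i'"] nth_mem by blast
  next
    fix j' assume "i = 0" and j: "j = Suc j'"
    then have "j' < length xs" "P (xs ! j')" "xs ! j' = x" using Cons.prems by auto
    then show ?thesis using *[of "xs ! j'"] nth_mem by blast
  next
    fix i' j' assume "i = Suc i'" "j = Suc j'"
    then show ?thesis using Cons.IH[OF d, of i' j'] Cons.prems by simp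
  qed simp
qed simp

text \<open>Padding with zero coordinates where \<open>ks\<close> is \<^const>\<open>None\<close>.\<close>

definition reindex :: "nat option list \<Rightarrow> ('p \<Rightarrow> 'v \<Rightarrow> nat \<Rightarrow> 'k::field) \<Rightarrow> 'p \<Rightarrow> 'v \<Rightarrow> nat \<Rightarrow> 'k" where
  "reindex ks \<phi> x v = (\<lambda>k\<in>{..<length ks}. case ks ! k of None \<Rightarrow> 0 | Some c \<Rightarrow> \<phi> x v c)"

text \<open>The summands may be permuted, and summands may be inserted whose intervals do not meet \<open>P\<close>.\<close>

lemma frame_reindex:
  fixes V :: "('p::order, 'k::field, 'v) pers_module"
  assumes V: "persistence_module P V" and fr: "frame P V Is \<phi>"
    and dist: "distinct (filter (\<lambda>k. k \<noteq> None) ks)" and ks: "set ks - {None} = Some ` {..<length Is}"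
    and len: "length Ls = length ks"
    and Ls: "\<And>x k. x \<in> P \<Longrightarrow> k < length ks \<Longrightarrow> x \<in> Ls ! k \<longleftrightarrow> (\<exists>c. ks ! k = Some c \<and> x \<in> Is ! c)"
  shows "frame P V Ls (reindex ks \<phi>)"
  unfolding frame_def
proof (intro conjI ballI allI impI)
  have c: "c < length Is" if "k < length ks" "ks ! k = Some c" for k c
  proof -
    have "Some c \<in> set ks - {None}" using that by (auto simp: in_set_conv_nth)
    then show ?thesis unfolding ks by auto
  qed
  have inv: "\<exists>k<length ks. ks ! k = Some c" if "c < length Is" for c
  proof -
    have "Some c \<in> set ks" using that ks by blast
    then show ?thesis by (auto simp: in_set_conv_nth)
  qed
  fix x assume x: "x \<in> P"
  have zero: "\<phi> x v c = 0" if "v \<in> carrier (pspace V x)" "k < length ks" "ks ! k = Some c" "x \<notin> Ls ! k" for v c k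
    using frameD(6)[OF fr x that(1) c[OF that(2,3)]] Ls[OF x that(2)] that by blast
  show "bij_betw (reindex ks \<phi> x) (carrier (pspace V x)) (carrier (pspace (interval_sum Ls) x))"
    unfolding bij_betw_def
  proof
    show "inj_on (reindex ks \<phi> x) (carrier (pspace V x))"
    proof (rule inj_onI)
      fix v w assume v: "v \<in> carrier (pspace V x)" and w: "w \<in> carrier (pspace V x)"
        and eq: "reindex ks \<phi> x v = reindex ks \<phi> x w"
      show "v = w"
      proof (rule frame_eqI[OF fr x v w])
        fix i assume "i \<in> active Is x"
        then have "i < length Is" by (simp add: active_def)
        then obtain k where k: "k < length ks" "ks ! k = Some i" using inv by blast
        then show "\<phi> x v i = \<phi> x w i" using fun_cong[OF eq, of k] by (simp add: reindex_def)
      qed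
    qed
    show "reindex ks \<phi> x ` carrier (pspace V x) = carrier (pspace (interval_sum Ls) x)"
    proof
      show "reindex ks \<phi> x ` carrier (pspace V x) \<subseteq> carrier (pspace (interval_sum Ls) x)"
        using zero by (auto simp: carrier_interval_sum reindex_def len split: option.split)
      show "carrier (pspace (interval_sum Ls) x) \<subseteq> reindex ks \<phi> x ` carrier (pspace V x)"
      proof
        fix f :: "nat \<Rightarrow> 'k" assume "f \<in> carrier (pspace (interval_sum Ls) x)"
        then have f: "f \<in> extensional {..<length ks}" "\<And>k. k < length ks \<Longrightarrow> x \<notin> Ls ! k \<Longrightarrow> f k = 0"
          by (auto simp: carrier_interval_sum len)
        define g where "g = (\<lambda>c\<in>{..<length Is}. f (SOME k. k < length ks \<and> ks ! k = Some c))"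
        have g: "g c = f k" if k: "k < length ks" "ks ! k = Some c" for k c
        proof -
          let ?k = "SOME k. k < length ks \<and> ks ! k = Some c"
          have "?k < length ks \<and> ks ! ?k = Some c" by (rule someI[of _ k]) (use k in simp)
          then have "?k = k" using distinct_filter_nth[OF dist, of ?k k] k by simp
          then show ?thesis using c[OF k] by (simp add: g_def)
        qed
        have "g \<in> carrier (pspace (interval_sum Is) x)"
          unfolding carrier_interval_sum
        proof (intro conjI allI impI)
          show "g \<in> extensional {..<length Is}" by (simp add: g_def)
          fix c assume "c < length Is" "x \<notin> Is ! c"
          then obtain k where k: "k < length ks" "ks ! k = Some c" using inv by blast
          then have "x \<notin> Ls ! k" using Ls[OF x k(1)] \<open>x \<notin> Is ! c\<close> by simp
          then show "g c = 0" using g[OF k] f(2)[OF k(1)] by simp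
        qed
        then have "g \<in> \<phi> x ` carrier (pspace V x)"
          using bij_betw_imp_surj_on[OF frameD(1)[OF fr x]] by simp
        then obtain v where v: "v \<in> carrier (pspace V x)" "\<phi> x v = g" by auto
        have "reindex ks \<phi> x v = f"
        proof (rule extensionalityI[OF _ f(1)])
          fix k assume "k \<in> {..<length ks}"
          then show "reindex ks \<phi> x v k = f k"
            using v(2) g f(2)[of k] Ls[OF x, of k] by (simp add: reindex_def split: option.split)
        qed (simp add: reindex_def)
        then show "f \<in> reindex ks \<phi> x ` carrier (pspace V x)" using v(1) by blast
      qed
    qed
  qed
  fix v i assume v: "v \<in> carrier (pspace V x)" and i: "i < length Ls"
  { fix w assume "w \<in> carrier (pspace V x)"
    then show "reindex ks \<phi> x (v \<oplus>\<^bsub>pspace V x\<^esub> w) i = reindex ks \<phi> x v i + reindex ks \<phi> x w i"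
      using i len c v frameD(2)[OF fr x] by (simp add: reindex_def split: option.split) }
  { fix a show "reindex ks \<phi> x (a \<odot>\<^bsub>pspace V x\<^esub> v) i = a * reindex ks \<phi> x v i"
      using i len c v frameD(3)[OF fr x] by (simp add: reindex_def split: option.split) }
  { fix b assume b: "b \<in> P" "x \<le> b"
    show "reindex ks \<phi> b (pmap V x b v) i = (if x \<in> Ls ! i \<and> b \<in> Ls ! i then reindex ks \<phi> x v i else 0)"
      using i len c frameD(4)[OF fr x v b] Ls[OF x, of i] Ls[OF b(1), of i]
      by (simp add: reindex_def split: option.split) }
qed

text \<open>By \<open>thru\<close>, a structure map between the two parts factors through a point of the intersection, where
  both frames give the same coordinates; \<open>conv\<close> ensures that a coordinate that is alive at both ends is
  not lost at the intermediate point.\<close>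

lemma frame_union:
  fixes V :: "('p::order, 'k::field, 'v) pers_module"
  assumes V: "persistence_module (P \<union> Q) V" and fr: "frame P V Is \<phi>" "frame Q V Is \<psi>"
    and agree: "\<And>x v. x \<in> P \<Longrightarrow> x \<in> Q \<Longrightarrow> v \<in> carrier (pspace V x) \<Longrightarrow> \<phi> x v = \<psi> x v"
    and thru: "\<And>a b. a \<le> b \<Longrightarrow> a \<in> P \<and> b \<in> Q \<or> a \<in> Q \<and> b \<in> P \<Longrightarrow> \<exists>z\<in>P \<inter> Q. a \<le> z \<and> z \<le> b"
    and conv: "\<And>i a z b. i < length Is \<Longrightarrow> a \<in> Is ! i \<Longrightarrow> b \<in> Is ! i \<Longrightarrow> z \<in> P \<inter> Q \<Longrightarrow> a \<le> z \<Longrightarrow> z \<le> b \<Longrightarrow> z \<in> Is ! i"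
  shows "frame (P \<union> Q) V Is (\<lambda>x. if x \<in> P then \<phi> x else \<psi> x)"
  unfolding frame_def
proof (intro conjI ballI allI impI)
  let ?\<Phi> = "\<lambda>x. if x \<in> P then \<phi> x else \<psi> x"
  fix x assume x: "x \<in> P \<union> Q"
  then have x': "x \<in> Q" if "x \<notin> P" using that by blast
  show "bij_betw (?\<Phi> x) (carrier (pspace V x)) (carrier (pspace (interval_sum Is) x))"
    using frameD(1)[OF fr(1)] frameD(1)[OF fr(2)] x' by simp
  fix v i assume v: "v \<in> carrier (pspace V x)" and i: "i < length Is"
  { fix w assume "w \<in> carrier (pspace V x)"
    then show "?\<Phi> x (v \<oplus>\<^bsub>pspace V x\<^esub> w) i = ?\<Phi> x v i + ?\<Phi> x w i"
      using frameD(2)[OF fr(1)] frameD(2)[OF fr(2)] x' v i by simp }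
  { fix a show "?\<Phi> x (a \<odot>\<^bsub>pspace V x\<^esub> v) i = a * ?\<Phi> x v i"
      using frameD(3)[OF fr(1)] frameD(3)[OF fr(2)] x' v i by simp }
  { fix b assume b: "b \<in> P \<union> Q" "x \<le> b"
    have \<phi>: "?\<Phi> y w = \<phi> y w" if "y \<in> P" for y w using that by simp
    have \<psi>: "?\<Phi> y w = \<psi> y w" if "y \<in> Q" "w \<in> carrier (pspace V y)" for y w using that agree by auto
    have step: "?\<Phi> b' (pmap V a b' w) i = (if a \<in> Is ! i \<and> b' \<in> Is ! i then ?\<Phi> a w i else 0)"
      if ab: "a \<le> b'" "a \<in> P \<and> b' \<in> P \<or> a \<in> Q \<and> b' \<in> Q" and w: "w \<in> carrier (pspace V a)" for a b' w
      using ab(2)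
    proof
      assume "a \<in> P \<and> b' \<in> P"
      then show ?thesis using frameD(4)[OF fr(1) _ w _ ab(1) i] by simp
    next
      assume *: "a \<in> Q \<and> b' \<in> Q"
      then have "pmap V a b' w \<in> carrier (pspace V b')" using pmap_closed[OF V _ _ ab(1) w] by blast
      then show ?thesis using * \<psi> w frameD(4)[OF fr(2) _ w _ ab(1) i] by presburger
    qed
    show "?\<Phi> b (pmap V x b v) i = (if x \<in> Is ! i \<and> b \<in> Is ! i then ?\<Phi> x v i else 0)"
    proof (cases "x \<in> P \<and> b \<in> P \<or> x \<in> Q \<and> b \<in> Q")
      case True
      show ?thesis by (rule step[OF b(2) True v])
    next
      case False
      then have mixed: "x \<in> P \<and> b \<in> Q \<or> x \<in> Q \<and> b \<in> P" using x b by blast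
      then obtain z where z: "z \<in> P" "z \<in> Q" "x \<le> z" "z \<le> b" using thru[OF b(2)] by blast
      have xz: "x \<in> P \<and> z \<in> P \<or> x \<in> Q \<and> z \<in> Q" and zb: "z \<in> P \<and> b \<in> P \<or> z \<in> Q \<and> b \<in> Q"
        using x b z by blast+
      have w: "pmap V x z v \<in> carrier (pspace V z)" using pmap_closed[OF V x _ z(3) v] z by blast
      have "pmap V x b v = pmap V z b (pmap V x z v)"
        using persistence_moduleD(5)[OF V x _ b(1) z(3,4) v] z by simp
      then have "?\<Phi> b (pmap V x b v) i =
          (if z \<in> Is ! i \<and> b \<in> Is ! i then if x \<in> Is ! i \<and> z \<in> Is ! i then ?\<Phi> x v i else 0 else 0)"
        using step[OF z(4) zb w] step[OF z(3) xz v] by presburger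
      then show ?thesis using conv[OF i, of x b z] z by auto
    qed }
qed

text \<open>Both frames are reindexed by the same list of summands: the pairs matched by \<open>h\<close>, and the summands that live
  on one part only.\<close>

lemma frame_glue:
  fixes V :: "('p::order, 'k::field, 'v) pers_module"
  assumes V: "persistence_module (P \<union> Q) V" and fr: "frame P V Is \<phi>" "frame Q V Js \<psi>"
    and bij: "bij_betw h A B" and A: "A \<subseteq> {..<length Is}" and B: "B \<subseteq> {..<length Js}"
    and IP: "\<And>c. c < length Is \<Longrightarrow> Is ! c \<subseteq> P" and JQ: "\<And>r. r < length Js \<Longrightarrow> Js ! r \<subseteq> Q"
    and match: "\<And>c x. c \<in> A \<Longrightarrow> x \<in> P \<Longrightarrow> x \<in> Q \<Longrightarrow> x \<in> Is ! c \<longleftrightarrow> x \<in> Js ! h c"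
    and coord: "\<And>c x v. c \<in> A \<Longrightarrow> x \<in> P \<Longrightarrow> x \<in> Q \<Longrightarrow> v \<in> carrier (pspace V x) \<Longrightarrow> \<phi> x v c = \<psi> x v (h c)"
    and offA: "\<And>c. c < length Is \<Longrightarrow> c \<notin> A \<Longrightarrow> Is ! c \<inter> Q = {}"
    and offB: "\<And>r. r < length Js \<Longrightarrow> r \<notin> B \<Longrightarrow> Js ! r \<inter> P = {}"
    and thru: "\<And>a b. a \<le> b \<Longrightarrow> a \<in> P \<and> b \<in> Q \<or> a \<in> Q \<and> b \<in> P \<Longrightarrow> \<exists>z\<in>P \<inter> Q. a \<le> z \<and> z \<le> b"
    and conv: "\<And>c a z b. c \<in> A \<Longrightarrow> a \<in> Is ! c \<union> Js ! h c \<Longrightarrow> b \<in> Is ! c \<union> Js ! h c \<Longrightarrow>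
       z \<in> P \<inter> Q \<Longrightarrow> a \<le> z \<Longrightarrow> z \<le> b \<Longrightarrow> z \<in> Is ! c \<union> Js ! h c"
    and conv1: "\<And>c a z b. c < length Is \<Longrightarrow> c \<notin> A \<Longrightarrow> a \<in> Is ! c \<Longrightarrow> b \<in> Is ! c \<Longrightarrow>
       z \<in> P \<inter> Q \<Longrightarrow> a \<le> z \<Longrightarrow> z \<le> b \<Longrightarrow> z \<in> Is ! c"
    and conv2: "\<And>r a z b. r < length Js \<Longrightarrow> r \<notin> B \<Longrightarrow> a \<in> Js ! r \<Longrightarrow> b \<in> Js ! r \<Longrightarrow>
       z \<in> P \<inter> Q \<Longrightarrow> a \<le> z \<Longrightarrow> z \<le> b \<Longrightarrow> z \<in> Js ! r"
  shows "\<exists>Ls \<Phi>. frame (P \<union> Q) V Ls \<Phi> \<and>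
    mset Ls = image_mset (\<lambda>c. Is ! c \<union> Js ! h c) (mset_set A) +
      image_mset ((!) Is) (mset_set ({..<length Is} - A)) +
      image_mset ((!) Js) (mset_set ({..<length Js} - B))"
proof -
  have fin: "finite A" "finite B" using A B finite_subset by blast+
  define as where "as = sorted_list_of_set A"
  define as' where "as' = sorted_list_of_set ({..<length Is} - A)"
  define bs' where "bs' = sorted_list_of_set ({..<length Js} - B)"
  have as: "set as = A" "distinct as"
    and as': "set as' = {..<length Is} - A" "distinct as'"
    and bs': "set bs' = {..<length Js} - B" "distinct bs'"
    using fin unfolding as_def as'_def bs'_def by simp_all
  \<comment> \<open>for each summand of the glued frame, its index in either frame\<close>
  define Ks where "Ks = map (\<lambda>c. (Some c, Some (h c))) as @ map (\<lambda>c. (Some c, None)) as' @ map (\<lambda>r. (None, Some r)) bs'"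
  define J where "J = (\<lambda>(a, b). (case a of None \<Rightarrow> {} | Some c \<Rightarrow> Is ! c) \<union> (case b of None \<Rightarrow> {} | Some r \<Rightarrow> Js ! r))"
  define Ls where "Ls = map J Ks"
  have Ks: "(a, b) \<in> set Ks \<Longrightarrow> (\<exists>c\<in>A. a = Some c \<and> b = Some (h c)) \<or>
      (\<exists>c\<in>{..<length Is} - A. a = Some c \<and> b = None) \<or> (\<exists>r\<in>{..<length Js} - B. a = None \<and> b = Some r)" for a b
    unfolding Ks_def using as(1) as'(1) bs'(1) by auto
  have hB: "h c \<in> B" if "c \<in> A" for c using bij that by (auto simp: bij_betw_def)
  have inP: "x \<in> J k \<longleftrightarrow> (\<exists>c. fst k = Some c \<and> x \<in> Is ! c)" if "k \<in> set Ks" "x \<in> P" for x k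
  proof -
    obtain a b where k: "k = (a, b)" by (cases k)
    from Ks[OF that(1)[unfolded k]] show ?thesis
    proof (elim disjE bexE)
      fix c assume c: "c \<in> A" and ab: "a = Some c \<and> b = Some (h c)"
      have "x \<in> Js ! h c \<Longrightarrow> x \<in> Is ! c" using JQ[of "h c"] hB[OF c] B match[OF c that(2)] by blast
      then show ?thesis using ab by (auto simp: k J_def)
    next
      fix r assume r: "r \<in> {..<length Js} - B" and ab: "a = None \<and> b = Some r"
      then show ?thesis using offB[of r] that(2) by (auto simp: k J_def)
    qed (auto simp: k J_def)
  qed
  have inQ: "x \<in> J k \<longleftrightarrow> (\<exists>r. snd k = Some r \<and> x \<in> Js ! r)" if "k \<in> set Ks" "x \<in> Q" for x k
  proof -
    obtain a b where k: "k = (a, b)" by (cases k)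
    from Ks[OF that(1)[unfolded k]] show ?thesis
    proof (elim disjE bexE)
      fix c assume c: "c \<in> A" and ab: "a = Some c \<and> b = Some (h c)"
      have "x \<in> Is ! c \<Longrightarrow> x \<in> Js ! h c" using IP[of c] c A match[OF c _ that(2)] by blast
      then show ?thesis using ab by (auto simp: k J_def)
    next
      fix c assume c: "c \<in> {..<length Is} - A" and ab: "a = Some c \<and> b = None"
      then show ?thesis using offA[of c] that(2) by (auto simp: k J_def)
    qed (auto simp: k J_def)
  qed
  have V': "persistence_module P V" "persistence_module Q V"
    using persistence_module_subset[OF V] by blast+
  have f1: "frame P V Ls (reindex (map fst Ks) \<phi>)"
  proof (rule frame_reindex[OF V'(1) fr(1)])
    have "filter (\<lambda>k. k \<noteq> None) (map fst Ks) = map Some (as @ as')"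
      unfolding Ks_def by (induction as; induction as'; induction bs') (auto simp: filter_map o_def)
    then show "distinct (filter (\<lambda>k. k \<noteq> None) (map fst Ks))"
      using as as' by (auto simp: distinct_map)
    show "set (map fst Ks) - {None} = Some ` {..<length Is}"
      unfolding Ks_def using as(1) as'(1) A by auto
    show "x \<in> Ls ! k \<longleftrightarrow> (\<exists>c. map fst Ks ! k = Some c \<and> x \<in> Is ! c)" if "x \<in> P" "k < length (map fst Ks)" for x k
      using inP[of "Ks ! k" x] that by (simp add: Ls_def)
  qed (simp add: Ls_def)
  have f2: "frame Q V Ls (reindex (map snd Ks) \<psi>)"
  proof (rule frame_reindex[OF V'(2) fr(2)])
    have "filter (\<lambda>k. k \<noteq> None) (map snd Ks) = map Some (map h as @ bs')"
      unfolding Ks_def by (induction as; induction as'; induction bs') (auto simp: filter_map o_def)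
    moreover have "distinct (map h as)" "set (map h as) = B"
      using as bij by (auto simp: distinct_map bij_betw_def)
    ultimately show "distinct (filter (\<lambda>k. k \<noteq> None) (map snd Ks))"
      using bs' by (auto simp: distinct_map inj_on_def)
    show "set (map snd Ks) - {None} = Some ` {..<length Js}"
      unfolding Ks_def using as(1) bs'(1) B bij by (auto simp: bij_betw_def)
    show "x \<in> Ls ! k \<longleftrightarrow> (\<exists>c. map snd Ks ! k = Some c \<and> x \<in> Js ! c)" if "x \<in> Q" "k < length (map snd Ks)" for x k
      using inQ[of "Ks ! k" x] that by (simp add: Ls_def)
  qed (simp add: Ls_def)
  have "frame (P \<union> Q) V Ls (\<lambda>x. if x \<in> P then reindex (map fst Ks) \<phi> x else reindex (map snd Ks) \<psi> x)"
  proof (rule frame_union[OF V f1 f2 _ thru])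
    fix x v assume x: "x \<in> P" "x \<in> Q" and v: "v \<in> carrier (pspace V x)"
    show "reindex (map fst Ks) \<phi> x v = reindex (map snd Ks) \<psi> x v"
      unfolding reindex_def length_map
    proof (rule restrict_ext)
      fix k assume k: "k \<in> {..<length Ks}"
      obtain a b where ab: "Ks ! k = (a, b)" by (cases "Ks ! k")
      have "(a, b) \<in> set Ks" using k ab by (metis lessThan_iff nth_mem)
      from Ks[OF this] have "(case a of None \<Rightarrow> 0 | Some c \<Rightarrow> \<phi> x v c) = (case b of None \<Rightarrow> 0 | Some c \<Rightarrow> \<psi> x v c)"
      proof (elim disjE bexE)
        fix c assume c: "c \<in> A" and "a = Some c \<and> b = Some (h c)"
        then show ?thesis using coord[OF c x v] by simp
      next
        fix c assume c: "c \<in> {..<length Is} - A" and "a = Some c \<and> b = None"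
        then show ?thesis using frameD(6)[OF fr(1) x(1) v, of c] offA[of c] x(2) by auto
      next
        fix r assume r: "r \<in> {..<length Js} - B" and "a = None \<and> b = Some r"
        then show ?thesis using frameD(6)[OF fr(2) x(2) v, of r] offB[of r] x(1) by auto
      qed
      then show "(case map fst Ks ! k of None \<Rightarrow> 0 | Some c \<Rightarrow> \<phi> x v c) = (case map snd Ks ! k of None \<Rightarrow> 0 | Some c \<Rightarrow> \<psi> x v c)"
        using k ab by simp
    qed
  next
    fix k a z b assume k: "k < length Ls" and ab: "a \<in> Ls ! k" "b \<in> Ls ! k" and z: "z \<in> P \<inter> Q" "a \<le> z" "z \<le> b"
    obtain p q where pq: "Ks ! k = (p, q)" by (cases "Ks ! k")
    have J: "Ls ! k = J (p, q)" and mem: "(p, q) \<in> set Ks" using k pq unfolding Ls_def by (auto simp flip: pq)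
    from Ks[OF mem] show "z \<in> Ls ! k"
    proof (elim disjE bexE)
      fix c assume c: "c \<in> A" and "p = Some c \<and> q = Some (h c)"
      then show ?thesis using conv[OF c _ _ z] ab by (simp add: J J_def)
    next
      fix c assume c: "c \<in> {..<length Is} - A" and "p = Some c \<and> q = None"
      then show ?thesis using conv1[of c, OF _ _ _ _ z] ab by (simp add: J J_def)
    next
      fix r assume r: "r \<in> {..<length Js} - B" and "p = None \<and> q = Some r"
      then show ?thesis using conv2[of r, OF _ _ _ _ z] ab by (simp add: J J_def)
    qed
  qed
  moreover have "mset Ls = image_mset (\<lambda>c. Is ! c \<union> Js ! h c) (mset_set A) +
      image_mset ((!) Is) (mset_set ({..<length Is} - A)) +
      image_mset ((!) Js) (mset_set ({..<length Js} - B))"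
    using mset_set_set[OF as(2)] mset_set_set[OF as'(2)] mset_set_set[OF bs'(2)]
    unfolding Ls_def Ks_def as(1) as'(1) bs'(1) by (simp add: J_def o_def)
  ultimately show ?thesis by blast
qed

section \<open>Frames and bases\<close>

lemma finsum_image_lincomb:
  fixes W :: "('k::field, 'v) module"
  assumes W: "vectorspace class_ring W" and inj: "inj_on f J" and f: "f \<in> J \<rightarrow> carrier W"
  shows "module.lincomb W b (f ` J) = (\<Oplus>\<^bsub>W\<^esub>j\<in>J. b (f j) \<odot>\<^bsub>W\<^esub> f j)"
proof -
  interpret vectorspace class_ring W by (rule W)
  show ?thesis unfolding lincomb_def
    by (rule M.finsum_reindex[OF _ inj]) (use f in \<open>auto simp: class_ring_simps\<close>)
qed

text \<open>A basis is a set of vectors, and coordinates are functions on that set; they are translated back and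
  forth along \<open>f\<close>.\<close>

lemma basis_family_iff_unique_coordinates:
  fixes W :: "('k::field, 'v) module"
  assumes W: "vectorspace class_ring W" and fJ: "finite J" and f: "f \<in> J \<rightarrow> carrier W"
  shows "basis_family W J f \<longleftrightarrow>
    (\<forall>x\<in>carrier W. \<exists>!a. a \<in> J \<rightarrow>\<^sub>E UNIV \<and> x = (\<Oplus>\<^bsub>W\<^esub>j\<in>J. a j \<odot>\<^bsub>W\<^esub> f j))"
proof -
  interpret vectorspace class_ring W by (rule W)
  have sub: "f ` J \<subseteq> carrier W" and finB: "finite (f ` J)" using f fJ by auto
  have crit: "basis (f ` J) \<longleftrightarrow>
      (\<forall>v. v \<in> carrier W \<longrightarrow> (\<exists>!b. b \<in> f ` J \<rightarrow>\<^sub>E UNIV \<and> lincomb b (f ` J) = v))"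
    using basis_criterion[OF finB sub] by (simp add: class_ring_simps)
  define up where "up a = (\<lambda>v\<in>f ` J. a (inv_into J f v))" for a :: "_ \<Rightarrow> 'k"
  define down where "down b = (\<lambda>j\<in>J. b (f j))" for b :: "_ \<Rightarrow> 'k"
  have down_up: "down (up a) = a" if "inj_on f J" "a \<in> J \<rightarrow>\<^sub>E UNIV" for a
    using that by (intro extensionalityI[of _ J]) (auto simp: up_def down_def PiE_def)
  have up_down: "up (down b) = b" if "inj_on f J" "b \<in> f ` J \<rightarrow>\<^sub>E UNIV" for b
    using that by (intro extensionalityI[of _ "f ` J"]) (auto simp: up_def down_def PiE_def)
  have comb: "lincomb b (f ` J) = (\<Oplus>\<^bsub>W\<^esub>j\<in>J. down b j \<odot>\<^bsub>W\<^esub> f j)" if "inj_on f J" for b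
    unfolding finsum_image_lincomb[OF W that f]
    by (rule M.finsum_cong') (use f in \<open>auto simp: down_def class_ring_simps\<close>)
  have transfer: "(\<exists>!b. b \<in> f ` J \<rightarrow>\<^sub>E UNIV \<and> lincomb b (f ` J) = v) \<longleftrightarrow>
      (\<exists>!a. a \<in> J \<rightarrow>\<^sub>E UNIV \<and> v = (\<Oplus>\<^bsub>W\<^esub>j\<in>J. a j \<odot>\<^bsub>W\<^esub> f j))" if inj: "inj_on f J" for v
  proof
    assume "\<exists>!b. b \<in> f ` J \<rightarrow>\<^sub>E UNIV \<and> lincomb b (f ` J) = v"
    then obtain b where b: "b \<in> f ` J \<rightarrow>\<^sub>E UNIV" "lincomb b (f ` J) = v"
      and uniq: "\<And>b'. b' \<in> f ` J \<rightarrow>\<^sub>E UNIV \<Longrightarrow> lincomb b' (f ` J) = v \<Longrightarrow> b' = b" by metis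
    show "\<exists>!a. a \<in> J \<rightarrow>\<^sub>E UNIV \<and> v = (\<Oplus>\<^bsub>W\<^esub>j\<in>J. a j \<odot>\<^bsub>W\<^esub> f j)"
    proof (rule ex1I[of _ "down b"])
      show "down b \<in> J \<rightarrow>\<^sub>E UNIV \<and> v = (\<Oplus>\<^bsub>W\<^esub>j\<in>J. down b j \<odot>\<^bsub>W\<^esub> f j)"
        using b comb[OF inj, of b] by (auto simp: down_def)
      fix a assume a: "a \<in> J \<rightarrow>\<^sub>E UNIV \<and> v = (\<Oplus>\<^bsub>W\<^esub>j\<in>J. a j \<odot>\<^bsub>W\<^esub> f j)"
      then have da: "down (up a) = a" using down_up[OF inj] by blast
      have "up a = b" using a comb[OF inj, of "up a"] unfolding da by (intro uniq) (auto simp: up_def)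
      then show "a = down b" using da by simp
    qed
  next
    assume "\<exists>!a. a \<in> J \<rightarrow>\<^sub>E UNIV \<and> v = (\<Oplus>\<^bsub>W\<^esub>j\<in>J. a j \<odot>\<^bsub>W\<^esub> f j)"
    then obtain a where a: "a \<in> J \<rightarrow>\<^sub>E UNIV" "v = (\<Oplus>\<^bsub>W\<^esub>j\<in>J. a j \<odot>\<^bsub>W\<^esub> f j)"
      and uniq: "\<And>a'. a' \<in> J \<rightarrow>\<^sub>E UNIV \<Longrightarrow> v = (\<Oplus>\<^bsub>W\<^esub>j\<in>J. a' j \<odot>\<^bsub>W\<^esub> f j) \<Longrightarrow> a' = a" by metis
    show "\<exists>!b. b \<in> f ` J \<rightarrow>\<^sub>E UNIV \<and> lincomb b (f ` J) = v"
    proof (rule ex1I[of _ "up a"])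
      show "up a \<in> f ` J \<rightarrow>\<^sub>E UNIV \<and> lincomb (up a) (f ` J) = v"
        using a comb[OF inj, of "up a"] down_up[OF inj a(1)] by (auto simp: up_def)
      fix b assume b: "b \<in> f ` J \<rightarrow>\<^sub>E UNIV \<and> lincomb b (f ` J) = v"
      then have "down b = a" using comb[OF inj, of b] by (intro uniq) (auto simp: down_def)
      then show "b = up a" using up_down[OF inj, of b] b by simp
    qed
  qed
  show ?thesis
  proof
    assume "basis_family W J f"
    then have inj: "inj_on f J" and "basis (f ` J)" by (simp_all add: basis_family_def)
    then show "\<forall>x\<in>carrier W. \<exists>!a. a \<in> J \<rightarrow>\<^sub>E UNIV \<and> x = (\<Oplus>\<^bsub>W\<^esub>j\<in>J. a j \<odot>\<^bsub>W\<^esub> f j)"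
      unfolding crit transfer[OF inj] by simp
  next
    assume uniq: "\<forall>x\<in>carrier W. \<exists>!a. a \<in> J \<rightarrow>\<^sub>E UNIV \<and> x = (\<Oplus>\<^bsub>W\<^esub>j\<in>J. a j \<odot>\<^bsub>W\<^esub> f j)"
    have unit: "(\<Oplus>\<^bsub>W\<^esub>j\<in>J. (\<lambda>j\<in>J. if j = i then 1 else 0) j \<odot>\<^bsub>W\<^esub> f j) = f i" if i: "i \<in> J" for i
    proof -
      have "(\<Oplus>\<^bsub>W\<^esub>j\<in>J. (\<lambda>j\<in>J. if j = i then 1 else 0) j \<odot>\<^bsub>W\<^esub> f j) = (\<Oplus>\<^bsub>W\<^esub>j\<in>J. if i = j then f j else \<zero>\<^bsub>W\<^esub>)"
        using f smult_one lmult_0 by (intro M.finsum_cong') (auto simp: class_ring_simps Pi_def)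
      also have "\<dots> = f i" using M.finsum_singleton[OF i fJ f] .
      finally show ?thesis .
    qed
    have inj: "inj_on f J"
    proof (rule inj_onI, rule ccontr)
      fix i j assume ij: "i \<in> J" "j \<in> J" "f i = f j" "i \<noteq> j"
      define e where "e i = (\<lambda>j\<in>J. if j = i then 1 else (0::'k))" for i
      have "f i \<in> carrier W" using f ij by auto
      then have "\<exists>!a. a \<in> J \<rightarrow>\<^sub>E UNIV \<and> f i = (\<Oplus>\<^bsub>W\<^esub>j\<in>J. a j \<odot>\<^bsub>W\<^esub> f j)" using uniq by blast
      moreover have "e i \<in> J \<rightarrow>\<^sub>E UNIV" "e j \<in> J \<rightarrow>\<^sub>E UNIV" by (simp_all add: e_def)
      moreover have "f i = (\<Oplus>\<^bsub>W\<^esub>l\<in>J. e i l \<odot>\<^bsub>W\<^esub> f l)" "f i = (\<Oplus>\<^bsub>W\<^esub>l\<in>J. e j l \<odot>\<^bsub>W\<^esub> f l)"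
        unfolding e_def using unit[OF ij(1)] unit[OF ij(2)] ij(3) by simp_all
      ultimately have "e i = e j" by blast
      from fun_cong[OF this, of i] show False using ij by (simp add: e_def)
    qed
    then have "basis (f ` J)" unfolding crit transfer[OF inj] using uniq by simp
    with inj show "basis_family W J f" by (simp add: basis_family_def)
  qed
qed

lemma basis_coeff:
  fixes W :: "('k::field, 'v) module"
  assumes W: "vectorspace class_ring W" and fJ: "finite J" and f: "f \<in> J \<rightarrow> carrier W" and b: "basis_family W J f"
    and x: "x \<in> carrier W"
  shows "basis_coeff W J f x \<in> J \<rightarrow>\<^sub>E UNIV" "x = (\<Oplus>\<^bsub>W\<^esub>j\<in>J. basis_coeff W J f x j \<odot>\<^bsub>W\<^esub> f j)"
    and "x = (\<Oplus>\<^bsub>W\<^esub>j\<in>J. a j \<odot>\<^bsub>W\<^esub> f j) \<Longrightarrow> i \<in> J \<Longrightarrow> basis_coeff W J f x i = a i"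
proof -
  interpret vectorspace class_ring W by (rule W)
  have ex1: "\<exists>!a. a \<in> J \<rightarrow>\<^sub>E UNIV \<and> x = (\<Oplus>\<^bsub>W\<^esub>j\<in>J. a j \<odot>\<^bsub>W\<^esub> f j)"
    using b x basis_family_iff_unique_coordinates[OF W fJ f] by blast
  from theI'[OF this]
  have 1: "basis_coeff W J f x \<in> J \<rightarrow>\<^sub>E UNIV \<and> x = (\<Oplus>\<^bsub>W\<^esub>j\<in>J. basis_coeff W J f x j \<odot>\<^bsub>W\<^esub> f j)"
    unfolding basis_coeff_def .
  then show "basis_coeff W J f x \<in> J \<rightarrow>\<^sub>E UNIV" "x = (\<Oplus>\<^bsub>W\<^esub>j\<in>J. basis_coeff W J f x j \<odot>\<^bsub>W\<^esub> f j)"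
    by blast+
  assume a: "x = (\<Oplus>\<^bsub>W\<^esub>j\<in>J. a j \<odot>\<^bsub>W\<^esub> f j)" and i: "i \<in> J"
  have "(\<Oplus>\<^bsub>W\<^esub>j\<in>J. restrict a J j \<odot>\<^bsub>W\<^esub> f j) = (\<Oplus>\<^bsub>W\<^esub>j\<in>J. a j \<odot>\<^bsub>W\<^esub> f j)"
    using f by (intro M.finsum_cong') (auto simp: class_ring_simps)
  then have "restrict a J \<in> J \<rightarrow>\<^sub>E UNIV \<and> x = (\<Oplus>\<^bsub>W\<^esub>j\<in>J. restrict a J j \<odot>\<^bsub>W\<^esub> f j)" using a by simp
  then have "basis_coeff W J f x = restrict a J" using ex1 1 by blast
  then show "basis_coeff W J f x i = a i" using i by simp
qed

lemma linear_map_finsum: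
  fixes V :: "('k::field, 'v) module" and W :: "('k, 'w) module"
  assumes T: "linear_map class_ring V W T" and fJ: "finite J" and f: "f \<in> J \<rightarrow> carrier V"
  shows "T (\<Oplus>\<^bsub>V\<^esub>j\<in>J. a j \<odot>\<^bsub>V\<^esub> f j) = (\<Oplus>\<^bsub>W\<^esub>j\<in>J. a j \<odot>\<^bsub>W\<^esub> T (f j))"
proof -
  interpret V: vectorspace class_ring V using T by (simp add: linear_map_iff)
  interpret W: vectorspace class_ring W using T by (simp add: linear_map_iff)
  have Tf: "T v \<in> carrier W" if "v \<in> carrier V" for v using T that by (auto simp: linear_map_iff)
  have vc: "a \<odot>\<^bsub>V\<^esub> v \<in> carrier V" if "v \<in> carrier V" for a v
    using V.smult_closed[of a v] that by (simp add: class_ring_simps)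
  have wc: "a \<odot>\<^bsub>W\<^esub> v \<in> carrier W" if "v \<in> carrier W" for a v
    using W.smult_closed[of a v] that by (simp add: class_ring_simps)
  show ?thesis
    using fJ f
  proof (induction J rule: finite_induct)
    case empty
    then show ?case using linear_map.T0_is_0[OF T] by simp
  next
    case (insert j J)
    then have c: "f j \<in> carrier V" "f \<in> J \<rightarrow> carrier V" by auto
    have cJ: "(\<lambda>j. a j \<odot>\<^bsub>V\<^esub> f j) \<in> J \<rightarrow> carrier V" "(\<lambda>j. a j \<odot>\<^bsub>W\<^esub> T (f j)) \<in> J \<rightarrow> carrier W"
      using c Tf by (auto intro!: vc wc)
    have "T (a j \<odot>\<^bsub>V\<^esub> f j \<oplus>\<^bsub>V\<^esub> (\<Oplus>\<^bsub>V\<^esub>j\<in>J. a j \<odot>\<^bsub>V\<^esub> f j)) = T (a j \<odot>\<^bsub>V\<^esub> f j) \<oplus>\<^bsub>W\<^esub> T (\<Oplus>\<^bsub>V\<^esub>j\<in>J. a j \<odot>\<^bsub>V\<^esub> f j)"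
      using T vc[OF c(1)] V.M.finsum_closed[OF cJ(1)] unfolding linear_map_iff by blast
    moreover have "T (a j \<odot>\<^bsub>V\<^esub> f j) = a j \<odot>\<^bsub>W\<^esub> T (f j)"
      using T c(1) unfolding linear_map_iff by blast
    ultimately show ?case
      using insert.hyps insert.IH[OF c(2)] cJ vc[OF c(1)] wc[OF Tf[OF c(1)]]
      by (simp add: V.M.finsum_insert W.M.finsum_insert)
  qed
qed

text \<open>Bases at all points form a frame as soon as the structure maps send basis vectors to the basis vectors with
  the same index or, when the summand ends, to zero.\<close>

lemma frame_of_bases:
  fixes V :: "('p::order, 'k::field, 'v) pers_module"
  assumes V: "persistence_module P V"
    and g: "\<And>x i. x \<in> P \<Longrightarrow> i \<in> active Is x \<Longrightarrow> g x i \<in> carrier (pspace V x)"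
    and basis: "\<And>x. x \<in> P \<Longrightarrow> basis_family (pspace V x) (active Is x) (g x)"
    and transport: "\<And>a b i. a \<in> P \<Longrightarrow> b \<in> P \<Longrightarrow> a \<le> b \<Longrightarrow> i \<in> active Is a \<Longrightarrow>
       pmap V a b (g a i) = (if i \<in> active Is b then g b i else \<zero>\<^bsub>pspace V b\<^esub>)"
  defines "\<phi> \<equiv> \<lambda>x v. \<lambda>i\<in>{..<length Is}. if x \<in> Is ! i then basis_coeff (pspace V x) (active Is x) (g x) v i else 0"
  shows "frame P V Is \<phi>" and "x \<in> P \<Longrightarrow> c \<in> active Is x \<Longrightarrow> frame_vec V (length Is) \<phi> x c = g x c"
proof -
  have gP: "g x \<in> active Is x \<rightarrow> carrier (pspace V x)" if "x \<in> P" for x using g[OF that] by auto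
  note bc = basis_coeff[OF persistence_moduleD(1)[OF V] finite_active gP basis]
  let ?c = "\<lambda>x v. basis_coeff (pspace V x) (active Is x) (g x) v"
  let ?s = "\<lambda>x a. \<Oplus>\<^bsub>pspace V x\<^esub>j\<in>active Is x. a j \<odot>\<^bsub>pspace V x\<^esub> g x j"
  have \<phi>_co: "\<phi> x v i = ?c x v i" if "i \<in> active Is x" for x v i using that by (simp add: \<phi>_def active_def)
  have s_closed: "?s x a \<in> carrier (pspace V x)" if x: "x \<in> P" for x a
  proof -
    interpret vectorspace class_ring "pspace V x" by (rule persistence_moduleD(1)[OF V x])
    show ?thesis using gP[OF x] by (intro M.finsum_closed) (auto simp: class_ring_simps)
  qed
  have co_s: "\<phi> x (?s x a) i = a i" if x: "x \<in> P" and i: "i \<in> active Is x" for x a i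
    unfolding \<phi>_co[OF i] by (rule bc(3)[OF x x x s_closed[OF x] refl i])
  have s_co: "?s x (\<phi> x v) = v" if x: "x \<in> P" and v: "v \<in> carrier (pspace V x)" for x v
  proof -
    interpret vectorspace class_ring "pspace V x" by (rule persistence_moduleD(1)[OF V x])
    have "?s x (\<phi> x v) = ?s x (?c x v)"
      using gP[OF x] by (intro M.finsum_cong') (auto simp: \<phi>_co class_ring_simps)
    then show ?thesis using bc(2)[OF x x x v] by simp
  qed
  have ext: "\<phi> x v \<in> carrier (pspace (interval_sum Is) x)" for x v
    by (auto simp: carrier_interval_sum \<phi>_def)
  have out: "\<phi> x v i = 0" if "i < length Is" "i \<notin> active Is x" for x v i using that by (simp add: \<phi>_def active_def)
  show fr: "frame P V Is \<phi>"
    unfolding frame_def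
  proof (intro conjI ballI allI impI)
    fix x assume x: "x \<in> P"
    interpret W: vectorspace class_ring "pspace V x" by (rule persistence_moduleD(1)[OF V x])
    have sm: "c \<odot>\<^bsub>pspace V x\<^esub> g x j \<in> carrier (pspace V x)" if "j \<in> active Is x" for c j
      using pspace_closed(2)[OF V x g[OF x that]] .
    show "bij_betw (\<phi> x) (carrier (pspace V x)) (carrier (pspace (interval_sum Is) x))"
    proof (rule bij_betw_byWitness[of _ "?s x"])
      show "\<forall>f\<in>carrier (pspace (interval_sum Is) x). \<phi> x (?s x f) = f"
      proof
        fix f :: "nat \<Rightarrow> 'k" assume f: "f \<in> carrier (pspace (interval_sum Is) x)"
        then have "\<phi> x (?s x f) i = f i" if "i < length Is" for i
          using co_s[OF x, of i f] out[OF that, of x] that by (cases "i \<in> active Is x") (auto simp: carrier_interval_sum active_def)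
        then show "\<phi> x (?s x f) = f"
          using f by (intro extensionalityI[of _ "{..<length Is}"]) (auto simp: carrier_interval_sum \<phi>_def)
      qed
    qed (use s_co[OF x] ext s_closed[OF x] in auto)
    fix v i assume v: "v \<in> carrier (pspace V x)" and i: "i < length Is"
    { fix w assume w: "w \<in> carrier (pspace V x)"
      have "v \<oplus>\<^bsub>pspace V x\<^esub> w = ?s x (\<phi> x v) \<oplus>\<^bsub>pspace V x\<^esub> ?s x (\<phi> x w)" using s_co[OF x] v w by simp
      also have "\<dots> = (\<Oplus>\<^bsub>pspace V x\<^esub>j\<in>active Is x. \<phi> x v j \<odot>\<^bsub>pspace V x\<^esub> g x j \<oplus>\<^bsub>pspace V x\<^esub> \<phi> x w j \<odot>\<^bsub>pspace V x\<^esub> g x j)"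
        using sm by (subst W.M.finsum_addf) auto
      also have "\<dots> = ?s x (\<lambda>j. \<phi> x v j + \<phi> x w j)"
      proof (rule W.M.finsum_cong')
        fix j assume "j \<in> active Is x"
        then show "\<phi> x v j \<odot>\<^bsub>pspace V x\<^esub> g x j \<oplus>\<^bsub>pspace V x\<^esub> \<phi> x w j \<odot>\<^bsub>pspace V x\<^esub> g x j =
            (\<phi> x v j + \<phi> x w j) \<odot>\<^bsub>pspace V x\<^esub> g x j"
          using W.smult_l_distr[of "\<phi> x v j" "\<phi> x w j" "g x j"] g[OF x] by (simp add: class_ring_simps)
      qed (use sm in auto)
      finally have *: "v \<oplus>\<^bsub>pspace V x\<^esub> w = ?s x (\<lambda>j. \<phi> x v j + \<phi> x w j)" .
      show "\<phi> x (v \<oplus>\<^bsub>pspace V x\<^esub> w) i = \<phi> x v i + \<phi> x w i"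
        using co_s[OF x, of i "\<lambda>j. \<phi> x v j + \<phi> x w j"] out[OF i, of x] unfolding *
        by (cases "i \<in> active Is x") simp_all }
    { fix c
      have "c \<odot>\<^bsub>pspace V x\<^esub> v = c \<odot>\<^bsub>pspace V x\<^esub> ?s x (\<phi> x v)" using s_co[OF x v] by simp
      also have "\<dots> = (\<Oplus>\<^bsub>pspace V x\<^esub>j\<in>active Is x. c \<odot>\<^bsub>pspace V x\<^esub> (\<phi> x v j \<odot>\<^bsub>pspace V x\<^esub> g x j))"
        using sm by (intro W.finsum_smult_ldistr) (auto simp: class_ring_simps)
      also have "\<dots> = ?s x (\<lambda>j. c * \<phi> x v j)"
      proof (rule W.M.finsum_cong')
        fix j assume "j \<in> active Is x"
        then show "c \<odot>\<^bsub>pspace V x\<^esub> (\<phi> x v j \<odot>\<^bsub>pspace V x\<^esub> g x j) = (c * \<phi> x v j) \<odot>\<^bsub>pspace V x\<^esub> g x j"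
          using W.smult_assoc1[of c "\<phi> x v j" "g x j"] g[OF x] by (simp add: class_ring_simps)
      qed (use sm in auto)
      finally have *: "c \<odot>\<^bsub>pspace V x\<^esub> v = ?s x (\<lambda>j. c * \<phi> x v j)" .
      show "\<phi> x (c \<odot>\<^bsub>pspace V x\<^esub> v) i = c * \<phi> x v i"
        using co_s[OF x, of i "\<lambda>j. c * \<phi> x v j"] out[OF i, of x] unfolding *
        by (cases "i \<in> active Is x") simp_all }
    { fix b assume b: "b \<in> P" "x \<le> b"
      interpret B: vectorspace class_ring "pspace V b" by (rule persistence_moduleD(1)[OF V b(1)])
      have smb: "c \<odot>\<^bsub>pspace V b\<^esub> g b j \<in> carrier (pspace V b)" if "j \<in> active Is b" for c j
        using pspace_closed(2)[OF V b(1) g[OF b(1) that]] .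
      have z: "c \<odot>\<^bsub>pspace V b\<^esub> \<zero>\<^bsub>pspace V b\<^esub> = \<zero>\<^bsub>pspace V b\<^esub>" for c
        using B.smult_r_null[of c] by (simp add: class_ring_simps)
      have z0: "0 \<odot>\<^bsub>pspace V b\<^esub> w = \<zero>\<^bsub>pspace V b\<^esub>" if "w \<in> carrier (pspace V b)" for w
        using B.smult_l_null[of w] that by (simp add: class_ring_simps)
      have "pmap V x b v = pmap V x b (?s x (\<phi> x v))" using s_co[OF x v] by simp
      also have "\<dots> = (\<Oplus>\<^bsub>pspace V b\<^esub>j\<in>active Is x. \<phi> x v j \<odot>\<^bsub>pspace V b\<^esub> pmap V x b (g x j))"
        by (rule linear_map_finsum[OF persistence_moduleD(3)[OF V x b] finite_active gP[OF x]])
      also have "\<dots> = ?s b (\<lambda>j. if j \<in> active Is x then \<phi> x v j else 0)"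
        by (rule B.M.add.finprod_mono_neutral_cong)
          (use transport[OF x b] smb z z0 g[OF b(1)] in auto)
      finally have *: "pmap V x b v = ?s b (\<lambda>j. if j \<in> active Is x then \<phi> x v j else 0)" .
      show "\<phi> b (pmap V x b v) i = (if x \<in> Is ! i \<and> b \<in> Is ! i then \<phi> x v i else 0)"
        using co_s[OF b(1), of i "\<lambda>j. if j \<in> active Is x then \<phi> x v j else 0"] out[OF i, of b] i unfolding *
        by (cases "i \<in> active Is b") (simp_all add: active_def) }
  qed
  show "frame_vec V (length Is) \<phi> x c = g x c" if x: "x \<in> P" and c: "c \<in> active Is x" for x c
  proof (rule frame_vec_eqI[OF fr x c g[OF x c]])
    interpret W: vectorspace class_ring "pspace V x" by (rule persistence_moduleD(1)[OF V x])
    have z0: "0 \<odot>\<^bsub>pspace V x\<^esub> w = \<zero>\<^bsub>pspace V x\<^esub>" "1 \<odot>\<^bsub>pspace V x\<^esub> w = w" if "w \<in> carrier (pspace V x)" for w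
      using W.smult_l_null[of w] W.smult_one[of w] that by (simp_all add: class_ring_simps)
    have "?s x (\<lambda>j. if j = c then 1 else 0) = (\<Oplus>\<^bsub>pspace V x\<^esub>j\<in>active Is x. if c = j then g x j else \<zero>\<^bsub>pspace V x\<^esub>)"
      using g[OF x] z0 by (intro W.M.finsum_cong') auto
    then have "?s x (\<lambda>j. if j = c then 1 else 0) = g x c"
      using W.M.finsum_singleton[OF c finite_active gP[OF x]] by simp
    then show "\<phi> x (g x c) i = (if i = c then 1 else 0)" if "i \<in> active Is x" for i
      using co_s[OF x that, of "\<lambda>j. if j = c then 1 else 0"] by simp
  qed
qed

lemma basis_family_frame_vec:
  fixes V :: "('p::order, 'k::field, 'v) pers_module"
  assumes V: "persistence_module P V" and fr: "frame P V Is \<phi>" and x: "x \<in> P"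
  shows "basis_family (pspace V x) (active Is x) (frame_vec V (length Is) \<phi> x)"
proof -
  interpret W: vectorspace class_ring "pspace V x" by (rule persistence_moduleD(1)[OF V x])
  let ?e = "frame_vec V (length Is) \<phi> x"
  have e: "?e \<in> active Is x \<rightarrow> carrier (pspace V x)" using frame_vec(1)[OF fr x] by blast
  have sm: "c \<odot>\<^bsub>pspace V x\<^esub> ?e j \<in> carrier (pspace V x)" if "j \<in> active Is x" for c j
    using pspace_closed(2)[OF V x] e that by blast
  have closed: "(\<Oplus>\<^bsub>pspace V x\<^esub>j\<in>J. a j \<odot>\<^bsub>pspace V x\<^esub> ?e j) \<in> carrier (pspace V x)" if "J \<subseteq> active Is x" for a J
    using sm that by (intro W.M.finsum_closed) blast
  have co: "\<phi> x (\<Oplus>\<^bsub>pspace V x\<^esub>j\<in>J. a j \<odot>\<^bsub>pspace V x\<^esub> ?e j) i = (if i \<in> J then a i else 0)"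
    if "finite J" "J \<subseteq> active Is x" and i: "i < length Is" for a J i
    using that(1,2)
  proof (induction J rule: finite_induct)
    case empty
    show ?case
      using frameD(3)[OF fr x W.M.zero_closed i, of 0] W.smult_r_null[of 0] by (simp add: class_ring_simps)
  next
    case (insert j J)
    then have j: "j \<in> active Is x" "J \<subseteq> active Is x" by auto
    have "(\<Oplus>\<^bsub>pspace V x\<^esub>j\<in>insert j J. a j \<odot>\<^bsub>pspace V x\<^esub> ?e j) =
        a j \<odot>\<^bsub>pspace V x\<^esub> ?e j \<oplus>\<^bsub>pspace V x\<^esub> (\<Oplus>\<^bsub>pspace V x\<^esub>j\<in>J. a j \<odot>\<^bsub>pspace V x\<^esub> ?e j)"
      using insert.hyps sm j by (intro W.M.finsum_insert) auto
    then show ?case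
      using frameD(2)[OF fr x sm[OF j(1)] closed[OF j(2)] i] frameD(3)[OF fr x frame_vec(1)[OF fr x j(1)] i]
        frame_vec(2)[OF fr x j(1) i] insert.IH[OF j(2)] insert.hyps by auto
  qed
  have expand: "v = (\<Oplus>\<^bsub>pspace V x\<^esub>j\<in>active Is x. \<phi> x v j \<odot>\<^bsub>pspace V x\<^esub> ?e j)" if v: "v \<in> carrier (pspace V x)" for v
    by (rule frame_eqI[OF fr x v closed[OF subset_refl]]) (simp add: co active_def)
  show ?thesis
    unfolding basis_family_iff_unique_coordinates[OF persistence_moduleD(1)[OF V x] finite_active e]
  proof
    fix v assume v: "v \<in> carrier (pspace V x)"
    show "\<exists>!a. a \<in> active Is x \<rightarrow>\<^sub>E UNIV \<and> v = (\<Oplus>\<^bsub>pspace V x\<^esub>j\<in>active Is x. a j \<odot>\<^bsub>pspace V x\<^esub> ?e j)"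
    proof (rule ex1I[of _ "restrict (\<phi> x v) (active Is x)"])
      have "(\<Oplus>\<^bsub>pspace V x\<^esub>j\<in>active Is x. restrict (\<phi> x v) (active Is x) j \<odot>\<^bsub>pspace V x\<^esub> ?e j) =
          (\<Oplus>\<^bsub>pspace V x\<^esub>j\<in>active Is x. \<phi> x v j \<odot>\<^bsub>pspace V x\<^esub> ?e j)"
        using sm by (intro W.M.finsum_cong') auto
      then show "restrict (\<phi> x v) (active Is x) \<in> active Is x \<rightarrow>\<^sub>E UNIV \<and>
          v = (\<Oplus>\<^bsub>pspace V x\<^esub>j\<in>active Is x. restrict (\<phi> x v) (active Is x) j \<odot>\<^bsub>pspace V x\<^esub> ?e j)"
        using expand[OF v] by simp
      fix a assume a: "a \<in> active Is x \<rightarrow>\<^sub>E UNIV \<and> v = (\<Oplus>\<^bsub>pspace V x\<^esub>j\<in>active Is x. a j \<odot>\<^bsub>pspace V x\<^esub> ?e j)"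
      then have "\<phi> x v i = a i" if "i \<in> active Is x" for i
        using co[OF finite_active subset_refl, of i a] that by (simp add: active_def)
      then show "a = restrict (\<phi> x v) (active Is x)"
        using a by (intro extensionalityI[of _ "active Is x"]) (auto simp: PiE_def)
    qed
  qed
qed

lemma point_frame:
  fixes V :: "('p::order, 'k::field, 'v) pers_module"
  assumes V: "persistence_module {p} V"
  shows "\<exists>N \<phi>. frame {p} V (replicate N {p}) \<phi>"
proof -
  interpret vectorspace class_ring "pspace V p" using persistence_moduleD(1)[OF V] by simp
  obtain \<beta> where \<beta>: "finite \<beta>" "basis \<beta>" using finite_basis_exists persistence_moduleD(2)[OF V, of p] by auto
  obtain h where h: "bij_betw h {0..<card \<beta>} \<beta>" using ex_bij_betw_nat_finite[OF \<beta>(1)] by blast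
  have act: "active (replicate (card \<beta>) {p}) p = {0..<card \<beta>}" by (auto simp: active_def)
  have "frame {p} V (replicate (card \<beta>) {p})
     (\<lambda>x v. \<lambda>i\<in>{..<length (replicate (card \<beta>) {p})}. if x \<in> replicate (card \<beta>) {p} ! i
        then basis_coeff (pspace V x) (active (replicate (card \<beta>) {p}) x) h v i else 0)"
  proof (rule frame_of_bases(1)[OF V])
    have hc: "h i \<in> carrier (pspace V p)" if "i < card \<beta>" for i
      using h \<beta>(2) that by (auto simp: bij_betw_def basis_def)
    show "h i \<in> carrier (pspace V x)" if "x \<in> {p}" "i \<in> active (replicate (card \<beta>) {p}) x" for x i
      using that hc by (auto simp: active_def)
    show "basis_family (pspace V x) (active (replicate (card \<beta>) {p}) x) h" if "x \<in> {p}" for x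
      using that h \<beta>(2) by (auto simp: act basis_family_def bij_betw_def)
    show "pmap V a b (h i) = (if i \<in> active (replicate (card \<beta>) {p}) b then h i else \<zero>\<^bsub>pspace V b\<^esub>)"
      if "a \<in> {p}" "b \<in> {p}" "a \<le> b" "i \<in> active (replicate (card \<beta>) {p}) a" for a b i
      using that persistence_moduleD(4)[OF V, of p "h i"] hc by (auto simp: active_def)
  qed
  then show ?thesis by blast
qed

section \<open>Modules over a finite chain\<close>

lemma distinct_filter_map:
  "distinct xs \<Longrightarrow> inj_on f {x \<in> set xs. Q (f x)} \<Longrightarrow> distinct (filter Q (map f xs))"
  by (simp add: filter_map distinct_map)

text \<open>An exchange of two summands at a single point, where all intervals are equal.\<close>

lemma frame_permute:
  fixes V :: "('p::order, 'k::field, 'v) pers_module"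
  assumes V: "persistence_module {p} V" and fr: "frame {p} V (replicate N {p}) \<phi>" and ik: "i < N" "k < N"
  defines "\<sigma> \<equiv> \<lambda>r. if r = i then k else if r = k then i else r"
  defines "\<phi>' \<equiv> reindex (map (Some \<circ> \<sigma>) [0..<N]) \<phi>"
  shows "frame {p} V (replicate N {p}) \<phi>'" "r < N \<Longrightarrow> \<phi>' x v r = \<phi> x v (\<sigma> r)"
    "c < N \<Longrightarrow> frame_vec V N \<phi>' p c = frame_vec V N \<phi> p (\<sigma> c)"
proof -
  have \<sigma>\<sigma>: "\<sigma> (\<sigma> r) = r" for r by (simp add: \<sigma>_def)
  have \<sigma>N: "\<sigma> r < N" if "r < N" for r using that ik by (simp add: \<sigma>_def)
  have inj: "inj \<sigma>" by (rule inj_on_inverseI[of _ \<sigma>]) (rule \<sigma>\<sigma>)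
  show fr': "frame {p} V (replicate N {p}) \<phi>'"
    unfolding \<phi>'_def
  proof (rule frame_reindex[OF V fr])
    show "distinct (filter (\<lambda>k. k \<noteq> None) (map (Some \<circ> \<sigma>) [0..<N]))"
      using inj by (intro distinct_filter_map) (auto simp: inj_on_def)
    have "\<sigma> ` {..<N} = {..<N}"
    proof
      show "{..<N} \<subseteq> \<sigma> ` {..<N}"
      proof
        fix r assume "r \<in> {..<N}"
        then show "r \<in> \<sigma> ` {..<N}" using \<sigma>N by (intro image_eqI[of _ _ "\<sigma> r"]) (simp_all add: \<sigma>\<sigma>)
      qed
    qed (use \<sigma>N in auto)
    then show "set (map (Some \<circ> \<sigma>) [0..<N]) - {None} = Some ` {..<length (replicate N {p})}"
      by (auto simp: atLeast0LessThan simp flip: image_comp)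
  qed (use \<sigma>N in auto)
  show val: "\<phi>' x v r = \<phi> x v (\<sigma> r)" if "r < N" for x v r using that by (simp add: \<phi>'_def reindex_def)
  have act: "active (replicate N {p}) p = {..<N}" by (auto simp: active_def)
  show "frame_vec V N \<phi>' p c = frame_vec V N \<phi> p (\<sigma> c)" if c: "c < N"
  proof -
    have "frame_vec V (length (replicate N {p})) \<phi>' p c = frame_vec V N \<phi> p (\<sigma> c)"
    proof (rule frame_vec_eqI[OF fr'])
      show "frame_vec V N \<phi> p (\<sigma> c) \<in> carrier (pspace V p)"
        using frame_vec(1)[OF fr, of p "\<sigma> c"] \<sigma>N[OF c] by (simp add: act)
      fix r assume "r \<in> active (replicate N {p}) p"
      then have r: "r < N" by (simp add: act)
      have "\<phi> p (frame_vec V N \<phi> p (\<sigma> c)) (\<sigma> r) = (if \<sigma> r = \<sigma> c then 1 else 0)"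
        using frame_vec(2)[OF fr, of p "\<sigma> c" "\<sigma> r"] \<sigma>N[OF c] \<sigma>N[OF r] by (simp add: act)
      then show "\<phi>' p (frame_vec V N \<phi> p (\<sigma> c)) r = (if r = c then 1 else 0)"
        using val[OF r] inj by (auto simp: inj_on_def)
    qed (use c act in auto)
    then show ?thesis by simp
  qed
qed

text \<open>The matrix of the structure map is brought to rank normal form; its row and column operations are changes of
  frame at \<open>t\<close> and at \<open>p\<close>, which are unrestricted since all intervals over a single point are equal.\<close>

lemma two_point_rank_form:
  fixes V :: "('p::order, 'k::field, 'v) pers_module"
  assumes V: "persistence_module {p, t} V" and pt: "p < t"
  shows "\<exists>Np Nt k \<phi> \<psi>. frame {p} V (replicate Np {p}) \<phi> \<and> frame {t} V (replicate Nt {t}) \<psi> \<and> k \<le> Np \<and> k \<le> Nt \<and>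
    (\<forall>v\<in>carrier (pspace V p). \<forall>i<Nt. \<psi> t (pmap V p t v) i = (if i < k then \<phi> p v i else 0))"
proof -
  have Vp: "persistence_module {p} V" and Vt: "persistence_module {t} V"
    using persistence_module_subset[OF V] by simp_all
  obtain Np \<phi>0 where \<phi>0: "frame {p} V (replicate Np {p}) \<phi>0" using point_frame[OF Vp] by blast
  obtain Nt \<psi>0 where \<psi>0: "frame {t} V (replicate Nt {t}) \<psi>0" using point_frame[OF Vt] by blast
  let ?P = "replicate Np {p}" and ?T = "replicate Nt {t}"
  have act: "active ?P p = {..<Np}" "active ?T t = {..<Nt}" by (auto simp: active_def)
  have hom: "overlap_hom {x} {x} {x}" for x :: 'p by (simp add: overlap_hom_def)
  have pl: "pmap V p t v \<in> carrier (pspace V t)" if "v \<in> carrier (pspace V p)" for v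
    using pmap_closed[OF V, of p t v] that pt by simp
  have lin: "linear_map class_ring (pspace V p) (pspace V t) (pmap V p t)"
    using persistence_moduleD(3)[OF V, of p t] pt by simp
  have L_add: "\<psi> t (pmap V p t (v \<oplus>\<^bsub>pspace V p\<^esub> w)) i = \<psi> t (pmap V p t v) i + \<psi> t (pmap V p t w) i"
    if "frame {t} V ?T \<psi>" "v \<in> carrier (pspace V p)" "w \<in> carrier (pspace V p)" "i < Nt" for \<psi> v w i
    using lin that frameD(2)[OF that(1), of t] pl by (simp add: linear_map_iff)
  have L_smult: "\<psi> t (pmap V p t (a \<odot>\<^bsub>pspace V p\<^esub> v)) i = a * \<psi> t (pmap V p t v) i"
    if "frame {t} V ?T \<psi>" "v \<in> carrier (pspace V p)" "i < Nt" for \<psi> a v i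
    using lin that frameD(3)[OF that(1), of t] pl by (simp add: linear_map_iff)
  define G where "G \<phi> \<psi> i j = \<psi> t (pmap V p t (frame_vec V Np \<phi> p j)) i" for \<phi> \<psi> :: "'p \<Rightarrow> 'v \<Rightarrow> nat \<Rightarrow> 'k" and i j
  define St where "St F \<longleftrightarrow> (\<exists>\<phi> \<psi>. frame {p} V ?P \<phi> \<and> frame {t} V ?T \<psi> \<and> (\<forall>i<Nt. \<forall>j<Np. F i j = G \<phi> \<psi> i j))"
    for F :: "nat \<Rightarrow> nat \<Rightarrow> 'k"
  have StI: "St F" if "frame {p} V ?P \<phi>" "frame {t} V ?T \<psi>" "\<And>i j. i < Nt \<Longrightarrow> j < Np \<Longrightarrow> F i j = G \<phi> \<psi> i j" for F \<phi> \<psi>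
    unfolding St_def using that by blast
  have "\<exists>F' k. St F' \<and> k \<le> Nt \<and> k \<le> Np \<and> (\<forall>i<Nt. \<forall>j<Np. F' i j = (if i = j \<and> i < k then 1 else 0))"
  proof (rule rank_normal_form[where St = St])
    show "St (G \<phi>0 \<psi>0)" using StI[OF \<phi>0 \<psi>0] by blast
    fix F i k assume "St F"
    then obtain \<phi> \<psi> where f: "frame {p} V ?P \<phi>" "frame {t} V ?T \<psi>"
      and F: "\<And>i j. i < Nt \<Longrightarrow> j < Np \<Longrightarrow> F i j = G \<phi> \<psi> i j" unfolding St_def by blast
    have fv: "frame_vec V Np \<phi> p j \<in> carrier (pspace V p)" if "j < Np" for j
      using frame_vec(1)[OF f(1), of p j] that by (simp add: act)
    { assume ik: "i < Nt" "k < Nt"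
      show "St (\<lambda>r c. F (if r = i then k else if r = k then i else r) c)"
        by (rule StI[OF f(1) frame_permute(1)[OF Vt f(2) ik]])
          (use ik in \<open>simp add: G_def F frame_permute(2)[OF Vt f(2) ik]\<close>) }
    { assume ik: "i < Np" "k < Np"
      show "St (\<lambda>r c. F r (if c = i then k else if c = k then i else c))"
        by (rule StI[OF frame_permute(1)[OF Vp f(1) ik] f(2)])
          (use ik in \<open>simp add: G_def F frame_permute(3)[OF Vp f(1) ik]\<close>) }
    { fix a :: 'k assume i: "i < Nt" "a \<noteq> 0"
      have "frame {t} V ?T (rescale ?T a i \<psi>)" using i by (intro frame_rescale[OF Vt f(2)]) auto
      then show "St (\<lambda>r c. if r = i then a * F r c else F r c)"
        by (rule StI[OF f(1)]) (use i in \<open>simp add: G_def F rescale_def\<close>) }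
    { fix a :: 'k assume ik: "i < Nt" "k < Nt" "i \<noteq> k"
      have "frame {t} V ?T (shear ?T a i k \<psi>)" using ik hom by (intro frame_shear[OF Vt f(2)]) auto
      then show "St (\<lambda>r c. if r = i then F r c + a * F k c else F r c)"
        by (rule StI[OF f(1)]) (use ik in \<open>simp add: G_def F shear_def\<close>) }
    { fix a :: 'k assume ik: "i < Np" "k < Np" "i \<noteq> k"
      have k': "k < length ?P" "i < length ?P" "k \<noteq> i" and h: "overlap_hom {p} (?P ! i) (?P ! k)" using ik hom by simp_all
      note f' = frame_shear[OF Vp f(1) k' h, of "- a"]
      have "frame_vec V Np (shear ?P (- a) k i \<phi>) p c =
          (if c = i then frame_vec V Np \<phi> p i \<oplus>\<^bsub>pspace V p\<^esub> a \<odot>\<^bsub>pspace V p\<^esub> frame_vec V Np \<phi> p k else frame_vec V Np \<phi> p c)"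
        if "c < Np" for c
        using frame_vec_shear[OF Vp f(1) k' h, of p c "- a"] that ik by (simp add: act)
      then show "St (\<lambda>r c. if c = i then F r c + a * F r k else F r c)"
        by (intro StI[OF f' f(2)])
          (use ik fv pspace_closed(2)[OF Vp, of p] in \<open>simp add: G_def F L_add[OF f(2)] L_smult[OF f(2)]\<close>) }
  qed
  then obtain F k where St: "St F" and k: "k \<le> Nt" "k \<le> Np"
    and F: "\<And>i j. i < Nt \<Longrightarrow> j < Np \<Longrightarrow> F i j = (if i = j \<and> i < k then 1 else 0)" by blast
  from St obtain \<phi> \<psi> where f: "frame {p} V ?P \<phi>" "frame {t} V ?T \<psi>"
    and G: "\<And>i j. i < Nt \<Longrightarrow> j < Np \<Longrightarrow> F i j = G \<phi> \<psi> i j" unfolding St_def by blast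
  have "\<psi> t (pmap V p t v) i = (if i < k then \<phi> p v i else 0)" if v: "v \<in> carrier (pspace V p)" and i: "i < Nt" for v i
  proof -
    have "\<psi> t (pmap V p t v) i =
        (\<Sum>j\<in>active ?P p. \<phi> p v j * \<psi> t (pmap V p t (frame_vec V (length ?P) \<phi> p j)) i)"
      using L_add[OF f(2)] L_smult[OF f(2)] i
      by (intro frame_expansion[OF Vp f(1) _ v, where L = "\<lambda>v. \<psi> t (pmap V p t v) i"]) auto
    also have "\<dots> = (\<Sum>j<Np. \<phi> p v j * (if i = j \<and> i < k then 1 else 0))"
      using G F i by (intro sum.cong) (auto simp: act G_def)
    also have "\<dots> = (\<Sum>j<Np. if j = i then (if i < k then \<phi> p v i else 0) else 0)"
      by (intro sum.cong) auto
    also have "\<dots> = (if i < k then \<phi> p v i else 0)" using k by (simp add: sum.delta)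
    finally show ?thesis .
  qed
  then show ?thesis using f k by blast
qed

text \<open>The image of the structure map gives intervals \<open>[p, t]\<close>, its kernel \<open>[p, p]\<close> and its cokernel \<open>[t, t]\<close>.\<close>

lemma two_point_frame:
  fixes V :: "(bipath, 'k::field, 'v) pers_module"
  assumes V: "persistence_module {p, t} V" and pt: "p < t"
  shows "\<exists>ls \<psi>. set ls \<subseteq> {(p, p), (p, t), (t, t)} \<and> frame {p, t} V (map (label_interval {p, t}) ls) \<psi>"
proof -
  have Vp: "persistence_module {p} V" and Vt: "persistence_module {t} V"
    using persistence_module_subset[OF V] by simp_all
  obtain Np Nt k \<phi> \<psi> where f: "frame {p} V (replicate Np {p}) \<phi>" "frame {t} V (replicate Nt {t}) \<psi>"
    and k: "k \<le> Np" "k \<le> Nt"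
    and step: "\<And>v i. v \<in> carrier (pspace V p) \<Longrightarrow> i < Nt \<Longrightarrow> \<psi> t (pmap V p t v) i = (if i < k then \<phi> p v i else 0)"
    using two_point_rank_form[OF V pt] by blast
  define N where "N = Np + (Nt - k)"
  \<comment> \<open>summands below \<open>k\<close> form the image, those up to \<open>Np\<close> the kernel, the remaining ones the cokernel; \<open>f1\<close> and \<open>f2\<close> give their indices at \<open>p\<close> and at \<open>t\<close>\<close>
  define lab where "lab i = (if i < k then (p, t) else if i < Np then (p, p) else (t, t))" for i
  define f1 where "f1 i = (if i < Np then Some i else None)" for i
  define f2 where "f2 i = (if i < k then Some i else if i < Np then None else Some (i - Np + k))" for i
  define ls where "ls = map lab [0..<N]"
  let ?L = "map (label_interval {p, t}) ls"
  have pt': "p \<noteq> t" "p \<le> t" "\<not> t \<le> p" using pt by auto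
  have L: "?L ! i = (if i < k then {p, t} else if i < Np then {p} else {t})" if "i < N" for i
    using that pt' by (auto simp: ls_def lab_def label_interval_def)
  have len: "length ?L = N" by (simp add: ls_def)
  have fr1: "frame {p} V ?L (reindex (map f1 [0..<N]) \<phi>)"
  proof (rule frame_reindex[OF Vp f(1)])
    show "distinct (filter (\<lambda>k. k \<noteq> None) (map f1 [0..<N]))"
      by (rule distinct_filter_map) (auto simp: f1_def inj_on_def split: if_splits)
    show "set (map f1 [0..<N]) - {None} = Some ` {..<length (replicate Np {p})}"
      by (auto simp: f1_def N_def)
    show "x \<in> ?L ! i \<longleftrightarrow> (\<exists>c. map f1 [0..<N] ! i = Some c \<and> x \<in> replicate Np {p} ! c)"
      if "x \<in> {p}" "i < length (map f1 [0..<N])" for x i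
      using that L[of i] k pt' by (auto simp: f1_def)
  qed (simp add: ls_def)
  have fr2: "frame {t} V ?L (reindex (map f2 [0..<N]) \<psi>)"
  proof (rule frame_reindex[OF Vt f(2)])
    show "distinct (filter (\<lambda>k. k \<noteq> None) (map f2 [0..<N]))"
      by (rule distinct_filter_map) (auto simp: f2_def inj_on_def split: if_splits)
    show "set (map f2 [0..<N]) - {None} = Some ` {..<length (replicate Nt {t})}"
    proof
      show "Some ` {..<length (replicate Nt {t})} \<subseteq> set (map f2 [0..<N]) - {None}"
      proof
        fix o' assume "o' \<in> Some ` {..<length (replicate Nt {t})}"
        then obtain r where r: "r < Nt" "o' = Some r" by auto
        have "r < N \<and> f2 r = Some r \<or> (r - k + Np < N \<and> f2 (r - k + Np) = Some r)"
          using r k by (cases "r < k") (auto simp: f2_def N_def)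
        then show "o' \<in> set (map f2 [0..<N]) - {None}" using r by force
      qed
    qed (use k in \<open>auto simp: f2_def N_def split: if_splits\<close>)
    show "x \<in> ?L ! i \<longleftrightarrow> (\<exists>c. map f2 [0..<N] ! i = Some c \<and> x \<in> replicate Nt {t} ! c)"
      if "x \<in> {t}" "i < length (map f2 [0..<N])" for x i
      using that L[of i] k pt' by (auto simp: f2_def N_def)
  qed (simp add: ls_def)
  let ?\<Phi> = "\<lambda>x. if x = p then reindex (map f1 [0..<N]) \<phi> x else reindex (map f2 [0..<N]) \<psi> x"
  have "frame {p, t} V ?L ?\<Phi>"
    unfolding frame_def
  proof (intro conjI ballI allI impI)
    fix x assume x: "x \<in> {p, t}"
    show "bij_betw (?\<Phi> x) (carrier (pspace V x)) (carrier (pspace (interval_sum ?L) x))"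
      using x pt' frameD(1)[OF fr1] frameD(1)[OF fr2] by auto
    fix v i assume v: "v \<in> carrier (pspace V x)" and i: "i < length ?L"
    { fix w assume "w \<in> carrier (pspace V x)"
      then show "?\<Phi> x (v \<oplus>\<^bsub>pspace V x\<^esub> w) i = ?\<Phi> x v i + ?\<Phi> x w i"
        using x pt' v i frameD(2)[OF fr1 _ _ _ i] frameD(2)[OF fr2 _ _ _ i] by auto }
    { fix a show "?\<Phi> x (a \<odot>\<^bsub>pspace V x\<^esub> v) i = a * ?\<Phi> x v i"
        using x pt' v frameD(3)[OF fr1 _ _ i] frameD(3)[OF fr2 _ _ i] by auto }
    { fix b assume b: "b \<in> {p, t}" "x \<le> b"
      consider "x = p" "b = p" | "x = t" "b = t" | "x = p" "b = t" using x b pt' by auto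
      then show "?\<Phi> b (pmap V x b v) i = (if x \<in> ?L ! i \<and> b \<in> ?L ! i then ?\<Phi> x v i else 0)"
      proof cases
        case 1
        then show ?thesis using frameD(4)[OF fr1 _ _ _ _ i, of x v b] v by simp
      next
        case 2
        then show ?thesis using frameD(4)[OF fr2 _ _ _ _ i, of x v b] v pt' by simp
      next
        case 3
        have iN: "i < N" using i len by simp
        show ?thesis
          using 3 v iN pt' k step[of v i] step[of v "i - Np + k"] L[OF iN]
          by (auto simp: reindex_def f1_def f2_def N_def)
      qed }
  qed
  moreover have "set ls \<subseteq> {(p, p), (p, t), (t, t)}" by (auto simp: ls_def lab_def)
  ultimately show ?thesis by blast
qed

lemma permutation_bijection:
  assumes Lc: "distinct Lc" "length Lc = n" and Lr: "distinct Lr" "length Lr = n" and \<sigma>: "\<sigma> permutes {..<n}"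
  shows "\<exists>h. bij_betw h (set Lc) (set Lr) \<and> (\<forall>j<n. h (Lc ! j) = Lr ! \<sigma> j)"
proof -
  define h where "h = (!) Lr \<circ> (\<sigma> \<circ> inv_into {..<n} ((!) Lc))"
  have c: "bij_betw ((!) Lc) {..<n} (set Lc)" and r: "bij_betw ((!) Lr) {..<n} (set Lr)"
    using bij_betw_nth[of Lc "{..<n}" "set Lc"] bij_betw_nth[of Lr "{..<n}" "set Lr"] Lc Lr by auto
  have "bij_betw h (set Lc) (set Lr)"
    unfolding h_def
    by (rule bij_betw_trans[OF bij_betw_trans[OF bij_betw_inv_into[OF c] permutes_imp_bij[OF \<sigma>]] r])
  moreover have "h (Lc ! j) = Lr ! \<sigma> j" if "j < n" for j
    using bij_betw_inv_into_left[OF c, of j] that by (simp add: h_def)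
  ultimately show ?thesis by blast
qed

text \<open>A row of the transition matrix that is a unit vector identifies a coordinate of one frame with a
  coordinate of the other.\<close>

lemma transition_unit_row:
  fixes V :: "(bipath, 'k::field, 'v) pers_module"
  assumes V: "persistence_module P V" and fr: "frame P V Is \<phi>" and fr': "frame Q V Js \<psi>"
    and x: "x \<in> P" "x \<in> Q" and v: "v \<in> carrier (pspace V x)" and r: "r < length Js" and c: "c \<in> active Is x"
    and unit: "\<And>d. d \<in> active Is x \<Longrightarrow> transition_entry V (length Is) \<phi> \<psi> x r d = (if d = c then 1 else 0)"
  shows "\<phi> x v c = \<psi> x v r"
proof -
  have "\<psi> x v r = (\<Sum>d\<in>active Is x. if d = c then \<phi> x v c else 0)"
    unfolding transition_expansion[OF V fr fr' x v r] by (intro sum.cong) (auto simp: unit)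
  then show ?thesis using c by (simp add: sum.delta)
qed

text \<open>Induction on the length of the chain. Let \<open>t\<close> be its greatest element, \<open>p\<close> the greatest of the others.
  The summands below \<open>t\<close> that meet \<open>p\<close> end there, and those over \<open>{p, t}\<close> that meet \<open>p\<close> begin there. So
  each family is ordered by its other endpoints, the additions used by the reduction are
  realised by shears, and the transition matrix at \<open>p\<close> becomes a permutation matrix. The decompositions of
  the two parts then glue along this permutation.\<close>

theorem chain_frame:
  fixes V :: "(bipath, 'k::field, 'v) pers_module"
  assumes "finite P" "\<And>a b. a \<in> P \<Longrightarrow> b \<in> P \<Longrightarrow> a \<le> b \<or> b \<le> a" "persistence_module P V"
  shows "\<exists>ls \<phi>. set ls \<subseteq> path_labels P \<and> frame P V (map (label_interval P) ls) \<phi>"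
  using assms
proof (induction "card P" arbitrary: P)
  case 0
  then show ?case by (intro exI[of _ "[]"]) (auto simp: frame_def)
next
  case (Suc n)
  have greatest: "\<exists>t\<in>Q. \<forall>a\<in>Q. a \<le> t" if Q: "Q \<subseteq> P" "Q \<noteq> {}" for Q
  proof -
    have "finite Q" using finite_subset[OF Q(1) Suc.prems(1)] .
    from finite_has_maximal[OF this Q(2)] obtain t where t: "t \<in> Q" "\<And>b. b \<in> Q \<Longrightarrow> t \<le> b \<Longrightarrow> t = b" by blast
    have "a \<le> t" if "a \<in> Q" for a
    proof -
      have "a \<in> P" "t \<in> P" using that t(1) Q(1) by blast+
      from Suc.prems(2)[OF this] show ?thesis using t(2)[OF that] by auto
    qed
    then show ?thesis using t(1) by blast
  qed
  have "P \<noteq> {}" using Suc.hyps(2) by auto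
  then obtain t where t: "t \<in> P" "\<And>a. a \<in> P \<Longrightarrow> a \<le> t" using greatest[of P] by blast
  define P' where "P' = P - {t}"
  have P: "P = insert t P'" "t \<notin> P'" using t by (auto simp: P'_def)
  show ?case
  proof (cases "P' = {}")
    case True
    then have Pt: "P = {t}" using P by simp
    obtain N \<phi> where "frame {t} V (replicate N {t}) \<phi>" using point_frame[of t V] Suc.prems(3) Pt by blast
    moreover have "label_interval {t} (t, t) = {t}" by (simp add: label_interval_def)
    ultimately have "frame P V (map (label_interval P) (replicate N (t, t))) \<phi>" by (simp add: Pt)
    moreover have "set (replicate N (t, t)) \<subseteq> path_labels P" by (auto simp: Pt path_labels_def)
    ultimately show ?thesis by blast
  next
    case False
    then obtain p where p: "p \<in> P'" "\<And>a. a \<in> P' \<Longrightarrow> a \<le> p" using greatest[of P'] P by blast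
    have "p \<noteq> t" "p \<le> t" using p(1) P t(2)[of p] by auto
    then have pt: "p < t" "p \<noteq> t" "\<not> t \<le> p" by auto
    have below: "a < t" if "a \<in> P'" for a using p(2)[OF that] pt(1) by simp
    have "n = card P'" "finite P'" using Suc.hyps(2) Suc.prems(1) P by simp_all
    moreover have "persistence_module P' V"
      using persistence_module_subset[OF Suc.prems(3), of P'] P by blast
    ultimately obtain ls1 \<phi> where ls1: "set ls1 \<subseteq> path_labels P'" and f1: "frame P' V (map (label_interval P') ls1) \<phi>"
      using Suc.hyps(1)[of P'] Suc.prems(2) P by (meson insertI2)
    let ?Q = "{p, t}"
    have sub: "P' \<subseteq> P" "?Q \<subseteq> P" using P(1) p(1) by auto
    note V1 = persistence_module_subset[OF Suc.prems(3) sub(1)]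
    note V2 = persistence_module_subset[OF Suc.prems(3) sub(2)]
    obtain ls2 \<psi> where ls2: "set ls2 \<subseteq> {(p, p), (p, t), (t, t)}" and f2: "frame ?Q V (map (label_interval ?Q) ls2) \<psi>"
      using two_point_frame[OF V2 pt(1)] by blast
    let ?I = "map (label_interval P') ls1" and ?J = "map (label_interval ?Q) ls2"
    have l1: "fst (ls1 ! c) \<in> P'" "snd (ls1 ! c) \<in> P'" "fst (ls1 ! c) \<le> snd (ls1 ! c)" if "c < length ls1" for c
      using ls1 nth_mem[OF that] by (auto simp: path_labels_def)
    have l2: "ls2 ! r \<in> {(p, p), (p, t), (t, t)}" if "r < length ls2" for r using ls2 nth_mem[OF that] by blast
    have aI: "c \<in> active ?I p \<longleftrightarrow> c < length ls1 \<and> snd (ls1 ! c) = p" for c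
      using l1[of c] p(2)[of "fst (ls1 ! c)"] p(2)[of "snd (ls1 ! c)"]
      by (auto simp: active_label_interval[OF p(1)] intro: order.antisym)
    have aJ: "r \<in> active ?J p \<longleftrightarrow> r < length ls2 \<and> fst (ls2 ! r) = p" for r
      using l2[of r] pt by (cases "ls2 ! r") (auto simp: active_label_interval)
    have "\<exists>xs. distinct xs \<and> set xs = active ?I p \<and> sorted_wrt (\<lambda>i j. fst (ls1 ! i) \<le> fst (ls1 ! j)) xs"
    proof (rule sorted_enumeration)
      fix i j assume "i \<in> active ?I p" "j \<in> active ?I p"
      then have "fst (ls1 ! i) \<in> P" "fst (ls1 ! j) \<in> P" using l1 P(1) unfolding aI by auto
      then show "fst (ls1 ! i) \<le> fst (ls1 ! j) \<or> fst (ls1 ! j) \<le> fst (ls1 ! i)" by (rule Suc.prems(2))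
    next
      fix i j k assume "fst (ls1 ! i) \<le> fst (ls1 ! j)" "fst (ls1 ! j) \<le> fst (ls1 ! k)"
      then show "fst (ls1 ! i) \<le> fst (ls1 ! k)" by (rule order_trans)
    qed simp
    then obtain Lc where Lc: "distinct Lc" "set Lc = active ?I p" "sorted_wrt (\<lambda>i j. fst (ls1 ! i) \<le> fst (ls1 ! j)) Lc"
      by blast
    have "\<exists>xs. distinct xs \<and> set xs = active ?J p \<and> sorted_wrt (\<lambda>i j. snd (ls2 ! i) \<le> snd (ls2 ! j)) xs"
    proof (rule sorted_enumeration)
      fix i j assume ij: "i \<in> active ?J p" "j \<in> active ?J p"
      have "snd (ls2 ! r) = p \<or> snd (ls2 ! r) = t" if "r \<in> active ?J p" for r
        using l2[of r] that unfolding aJ by (cases "ls2 ! r") auto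
      from this[OF ij(1)] this[OF ij(2)] show "snd (ls2 ! i) \<le> snd (ls2 ! j) \<or> snd (ls2 ! j) \<le> snd (ls2 ! i)"
        using pt(1) by auto
    next
      fix i j k assume "snd (ls2 ! i) \<le> snd (ls2 ! j)" "snd (ls2 ! j) \<le> snd (ls2 ! k)"
      then show "snd (ls2 ! i) \<le> snd (ls2 ! k)" by (rule order_trans)
    qed simp
    then obtain Lr where Lr: "distinct Lr" "set Lr = active ?J p" "sorted_wrt (\<lambda>i j. snd (ls2 ! i) \<le> snd (ls2 ! j)) Lr"
      by blast
    have homc: "overlap_hom P' (?I ! (Lc ! j)) (?I ! (Lc ! i))" if "i < j" "j < length Lc" for i j
    proof -
      have "Lc ! i \<in> set Lc" "Lc ! j \<in> set Lc" using that by simp_all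
      then have "Lc ! i \<in> active ?I p" "Lc ! j \<in> active ?I p" unfolding Lc(2) .
      moreover have "fst (ls1 ! (Lc ! i)) \<le> fst (ls1 ! (Lc ! j))"
        using Lc(3) that by (simp add: sorted_wrt_iff_nth_less)
      ultimately have "label_le (ls1 ! (Lc ! i)) (ls1 ! (Lc ! j))" "Lc ! i < length ls1" "Lc ! j < length ls1"
        unfolding aI by (simp_all add: label_le_def)
      then show ?thesis by (simp add: overlap_hom_label)
    qed
    have homr: "overlap_hom ?Q (?J ! (Lr ! j)) (?J ! (Lr ! i))" if "i < j" "j < length Lr" for i j
    proof -
      have "Lr ! i \<in> set Lr" "Lr ! j \<in> set Lr" using that by simp_all
      then have "Lr ! i \<in> active ?J p" "Lr ! j \<in> active ?J p" unfolding Lr(2) .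
      moreover have "snd (ls2 ! (Lr ! i)) \<le> snd (ls2 ! (Lr ! j))"
        using Lr(3) that by (simp add: sorted_wrt_iff_nth_less)
      ultimately have "label_le (ls2 ! (Lr ! i)) (ls2 ! (Lr ! j))" "Lr ! i < length ls2" "Lr ! j < length ls2"
        unfolding aJ by (simp_all add: label_le_def)
      then show ?thesis by (simp add: overlap_hom_label)
    qed
    \<comment> \<open>all summands alive at \<open>p\<close> take part, so the block is the whole matrix\<close>
    have bd: "block_diagonal_at V ?I ?J p (set Lc) (set Lr) \<phi> \<psi>"
      unfolding block_diagonal_at_def Lc(2) Lr(2) by blast
    let ?T = "\<lambda>\<phi> \<psi>. mat (length Lr) (length Lc) (\<lambda>(i, j). transition_entry V (length ?I) \<phi> \<psi> p (Lr ! i) (Lc ! j))"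
    have pQ: "p \<in> ?Q" and subs: "set Lc \<subseteq> active ?I p" "set Lr \<subseteq> active ?J p" using Lc(2) Lr(2) by simp_all
    note red = block_reduction[OF V1 V2 f1 f2 p(1) pQ Lc(1) subs(1) Lr(1) subs(2) homc homr bd]
    from red obtain \<phi>' \<psi>' where f: "frame P' V ?I \<phi>'" "frame ?Q V ?J \<psi>'" and eq: "?T \<phi>' \<psi>' = reduction (?T \<phi> \<psi>)"
      by blast
    have perm: "permutation_matrix (?T \<phi>' \<psi>')" unfolding eq using red by blast
    from perm obtain \<sigma> where \<sigma>: "\<sigma> permutes {..<length Lc}"
      and T: "?T \<phi>' \<psi>' = mat (length Lc) (length Lc) (\<lambda>(i, j). if i = \<sigma> j then 1 else 0)"
      unfolding permutation_matrix_def by auto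
    have len: "length Lr = length Lc" using arg_cong[OF T, of dim_row] by simp
    have Tent: "transition_entry V (length ?I) \<phi>' \<psi>' p (Lr ! i) (Lc ! j) = (if i = \<sigma> j then 1 else 0)"
      if "i < length Lc" "j < length Lc" for i j
      using arg_cong[OF T, of "\<lambda>A. A $$ (i, j)"] that len by simp
    obtain h where h: "bij_betw h (active ?I p) (active ?J p)" and hj: "\<And>j. j < length Lc \<Longrightarrow> h (Lc ! j) = Lr ! \<sigma> j"
      using permutation_bijection[OF Lc(1) refl Lr(1) len \<sigma>] Lc(2) Lr(2) by auto
    have coord: "\<phi>' p v c = \<psi>' p v (h c)" if c: "c \<in> active ?I p" and v: "v \<in> carrier (pspace V p)" for c v
    proof (rule transition_unit_row[OF V1 f p(1) _ v _ c])
      obtain j where j: "j < length Lc" "c = Lc ! j" using c Lc(2) by (metis in_set_conv_nth)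
      have \<sigma>j: "\<sigma> j < length Lc" using permutes_in_image[OF \<sigma>, of j] j(1) by simp
      fix d assume "d \<in> active ?I p"
      then obtain i where i: "i < length Lc" "d = Lc ! i" using Lc(2) by (metis in_set_conv_nth)
      show "transition_entry V (length ?I) \<phi>' \<psi>' p (h c) d = (if d = c then 1 else 0)"
        using Tent[OF \<sigma>j i(1)] i j hj[OF j(1)] permutes_inj[OF \<sigma>] nth_eq_iff_index_eq[OF Lc(1) i(1) j(1)]
        by (auto simp: inj_def)
    qed (use h c in \<open>auto simp: bij_betw_def active_def\<close>)
    have hJ: "h c \<in> active ?J p" if "c \<in> active ?I p" for c using h that by (auto simp: bij_betw_def)
    have cap: "P' \<inter> ?Q = {p}" using p(1) P(2) by auto
    have PQ: "P' \<union> ?Q = P" using P(1) p(1) by auto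
    have VPQ: "persistence_module (P' \<union> ?Q) V" unfolding PQ by (rule Suc.prems(3))
    have convI: "z \<in> ?I ! c" if "c < length ls1" "a \<in> ?I ! c" "b \<in> ?I ! c" "z \<in> P' \<inter> ?Q" "a \<le> z" "z \<le> b" for c a b z
      using that by (auto simp: label_interval_def intro: order_trans)
    have convJ: "z \<in> ?J ! r" if "r < length ls2" "a \<in> ?J ! r" "b \<in> ?J ! r" "z \<in> P' \<inter> ?Q" "a \<le> z" "z \<le> b" for r a b z
      using that by (auto simp: label_interval_def intro: order_trans)
    have "\<exists>Ls \<Phi>. frame (P' \<union> ?Q) V Ls \<Phi> \<and>
      mset Ls = image_mset (\<lambda>c. ?I ! c \<union> ?J ! h c) (mset_set (active ?I p)) +
        image_mset ((!) ?I) (mset_set ({..<length ?I} - active ?I p)) +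
        image_mset ((!) ?J) (mset_set ({..<length ?J} - active ?J p))"
    proof (rule frame_glue[OF VPQ f h])
      show "active ?I p \<subseteq> {..<length ?I}" "active ?J p \<subseteq> {..<length ?J}" by (auto simp: active_def)
      show "?I ! c \<subseteq> P'" if "c < length ?I" for c using that by (auto simp: label_interval_def)
      show "?J ! r \<subseteq> ?Q" if "r < length ?J" for r using that by (auto simp: label_interval_def)
      { fix c x assume c: "c \<in> active ?I p" and x: "x \<in> P'" "x \<in> ?Q"
        then have xp: "x = p" using cap by blast
        show "x \<in> ?I ! c \<longleftrightarrow> x \<in> ?J ! h c" using c hJ[OF c] unfolding xp by (auto simp: active_def)
        fix v assume "v \<in> carrier (pspace V x)"
        then show "\<phi>' x v c = \<psi>' x v (h c)" using coord[OF c] unfolding xp by simp }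
      show "?I ! c \<inter> ?Q = {}" if "c < length ?I" "c \<notin> active ?I p" for c
        using that P(2) by (auto simp: active_def label_interval_def)
      show "?J ! r \<inter> P' = {}" if "r < length ?J" "r \<notin> active ?J p" for r
        using that P(2) by (auto simp: active_def label_interval_def)
      show "\<exists>z\<in>P' \<inter> ?Q. a \<le> z \<and> z \<le> b" if ab: "a \<le> b" "a \<in> P' \<and> b \<in> ?Q \<or> a \<in> ?Q \<and> b \<in> P'" for a b
      proof -
        have "a \<le> p \<and> p \<le> b"
          using ab p(2)[of a] p(2)[of b] pt below[of b] by (auto dest: order_trans)
        then show ?thesis unfolding cap by blast
      qed
      show "z \<in> ?I ! c \<union> ?J ! h c" if "c \<in> active ?I p" "z \<in> P' \<inter> ?Q" for c z
        using that unfolding cap by (auto simp: active_def)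
      show "z \<in> ?I ! c" if "c < length ?I" "a \<in> ?I ! c" "b \<in> ?I ! c" "z \<in> P' \<inter> ?Q" "a \<le> z" "z \<le> b" for c a z b
        by (rule convI[OF _ that(2-)]) (use that in simp)
      show "z \<in> ?J ! r" if "r < length ?J" "a \<in> ?J ! r" "b \<in> ?J ! r" "z \<in> P' \<inter> ?Q" "a \<le> z" "z \<le> b" for r a z b
        by (rule convJ[OF _ that(2-)]) (use that in simp)
    qed
    then obtain Ls \<Phi> where fL: "frame P V Ls \<Phi>"
      and Ls: "mset Ls = image_mset (\<lambda>c. ?I ! c \<union> ?J ! h c) (mset_set (active ?I p)) +
        image_mset ((!) ?I) (mset_set ({..<length ?I} - active ?I p)) +
        image_mset ((!) ?J) (mset_set ({..<length ?J} - active ?J p))" unfolding PQ by blast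
    have "set Ls \<subseteq> label_interval P ` path_labels P"
    proof
      fix I assume "I \<in> set Ls"
      then have "I \<in># mset Ls" by simp
      then consider c where "c \<in> active ?I p" "I = ?I ! c \<union> ?J ! h c" | c where "c < length ls1" "c \<notin> active ?I p" "I = ?I ! c"
        | r where "r < length ls2" "r \<notin> active ?J p" "I = ?J ! r"
        unfolding Ls by auto
      then show "I \<in> label_interval P ` path_labels P"
      proof cases
        case (1 c)
        let ?l = "(fst (ls1 ! c), snd (ls2 ! h c))"
        have c: "c < length ls1" "snd (ls1 ! c) = p" using 1(1) unfolding aI by auto
        have r: "h c < length ls2" "fst (ls2 ! h c) = p" using hJ[OF 1(1)] unfolding aJ by auto
        have s: "snd (ls2 ! h c) = p \<or> snd (ls2 ! h c) = t" using l2[OF r(1)] by auto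
        have "I = label_interval P ?l"
          using 1(2) c r s l1[OF c(1)] pt p(2) below P t(2)
          by (auto simp: label_interval_def dest: order_trans intro: order_trans)
        moreover have "?l \<in> path_labels P"
          using s l1[OF c(1)] c P p pt below by (auto simp: path_labels_def intro: less_imp_le)
        ultimately show ?thesis by blast
      next
        case (2 c)
        have "I = label_interval P (ls1 ! c)"
          using 2 l1[OF 2(1)] below[of "snd (ls1 ! c)"] P by (auto simp: label_interval_def)
        moreover have "ls1 ! c \<in> path_labels P"
          using l1[OF 2(1)] P by (cases "ls1 ! c") (auto simp: path_labels_def)
        ultimately show ?thesis by blast
      next
        case (3 r)
        then have "ls2 ! r = (t, t)" using l2[OF 3(1)] unfolding aJ by auto
        then have "I = label_interval P (t, t)"
          using 3 P pt below by (auto simp: label_interval_def)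
        moreover have "(t, t) \<in> path_labels P" using P by (simp add: path_labels_def)
        ultimately show ?thesis by blast
      qed
    qed
    then have "Ls \<in> lists (label_interval P ` path_labels P)" by (auto simp: in_lists_conv_set)
    then obtain ls where "set ls \<subseteq> path_labels P" "Ls = map (label_interval P) ls"
      unfolding lists_image by (auto simp: in_lists_conv_set)
    then show ?thesis using fL by blast
  qed
qed

section \<open>Intervals of the bipath poset\<close>

lemma upper_path_total: "a \<in> upper_path n \<Longrightarrow> b \<in> upper_path n \<Longrightarrow> a \<le> b \<or> b \<le> a"
  and lower_path_total: "a \<in> lower_path m \<Longrightarrow> b \<in> lower_path m \<Longrightarrow> a \<le> b \<or> b \<le> a"
  unfolding upper_path_def lower_path_def by auto

lemma finite_paths: "finite (upper_path n)" "finite (lower_path m)"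
  by (simp_all add: upper_path_def lower_path_def)

lemma paths_inter: "x \<in> upper_path n \<Longrightarrow> x \<in> lower_path m \<Longrightarrow> x = Hat0 \<or> x = Hat1"
  unfolding upper_path_def lower_path_def by auto

text \<open>The two paths are connected to each other through their endpoints only; this is what makes gluing possible.\<close>

lemma bipath_between:
  "a \<le> b \<Longrightarrow> a \<in> upper_path n \<and> b \<in> lower_path m \<or> a \<in> lower_path m \<and> b \<in> upper_path n \<Longrightarrow>
     \<exists>z\<in>upper_path n \<inter> lower_path m. a \<le> z \<and> z \<le> b"
  by (cases a; cases b) (auto simp: upper_path_def lower_path_def)

text \<open>Below an element other than \<open>Hat1\<close> there are only elements of its own path; hence the intervals of the
  output are convex in the whole poset.\<close>

lemma path_downward:
  "z \<le> b \<Longrightarrow> z \<in> bipath_poset n m \<Longrightarrow> b \<noteq> Hat1 \<Longrightarrow> b \<in> upper_path n \<Longrightarrow> z \<in> upper_path n"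
  "z \<le> b \<Longrightarrow> z \<in> bipath_poset n m \<Longrightarrow> b \<noteq> Hat1 \<Longrightarrow> b \<in> lower_path m \<Longrightarrow> z \<in> lower_path m"
  by (cases z; cases b; force simp: upper_path_def lower_path_def bipath_poset_def)+

lemma path_upward:
  "a \<le> z \<Longrightarrow> z \<in> bipath_poset n m \<Longrightarrow> a \<noteq> Hat0 \<Longrightarrow> a \<in> upper_path n \<Longrightarrow> z \<in> upper_path n"
  "a \<le> z \<Longrightarrow> z \<in> bipath_poset n m \<Longrightarrow> a \<noteq> Hat0 \<Longrightarrow> a \<in> lower_path m \<Longrightarrow> z \<in> lower_path m"
  by (cases z; cases a; force simp: upper_path_def lower_path_def bipath_poset_def)+

lemma poset_connected_through:
  assumes z: "z \<in> I" and c: "\<And>a. a \<in> I \<Longrightarrow> a \<le> z \<or> z \<le> a"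
  shows "poset_connected I"
  unfolding poset_connected_def
proof (intro ballI)
  fix a b assume "a \<in> I" "b \<in> I"
  then show "(a, b) \<in> {(x, y). x \<in> I \<and> y \<in> I \<and> (x \<le> y \<or> y \<le> x)}\<^sup>*"
    by (intro converse_rtrancl_into_rtrancl[of a z] r_into_rtrancl) (use z c in auto)
qed

lemma poset_interval_left:
  assumes "b \<in> upper_path n" "b \<noteq> Hat1" "b' \<in> lower_path m" "b' \<noteq> Hat1"
  shows "poset_interval (bipath_poset n m) (label_interval (upper_path n) (Hat0, b) \<union> label_interval (lower_path m) (Hat0, b'))"
  unfolding poset_interval_def
proof (intro conjI ballI impI)
  let ?I = "label_interval (upper_path n) (Hat0, b) \<union> label_interval (lower_path m) (Hat0, b')"
  have I: "x \<in> ?I \<longleftrightarrow> x \<in> upper_path n \<and> x \<le> b \<or> x \<in> lower_path m \<and> x \<le> b'" for x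
    by (auto simp: label_interval_def)
  show "?I \<subseteq> bipath_poset n m" by (auto simp: label_interval_def bipath_poset_def)
  have h: "Hat0 \<in> ?I" by (simp add: label_interval_def)
  then show "?I \<noteq> {}" by blast
  show "poset_connected ?I" by (rule poset_connected_through[OF h]) simp
  fix x y z assume xy: "x \<in> ?I" "y \<in> ?I" and z: "z \<in> bipath_poset n m" "x < z \<and> z < y"
  have "z \<le> y" using z by (simp add: less_imp_le)
  from xy(2) show "z \<in> ?I"
    unfolding I
  proof (elim disjE conjE)
    assume y: "y \<in> upper_path n" "y \<le> b"
    then have "y \<noteq> Hat1" using assms(2) by auto
    then show "z \<in> upper_path n \<and> z \<le> b \<or> z \<in> lower_path m \<and> z \<le> b'"
      using path_downward(1)[OF \<open>z \<le> y\<close> z(1) _ y(1)] y(2) \<open>z \<le> y\<close> by (auto intro: order_trans)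
  next
    assume y: "y \<in> lower_path m" "y \<le> b'"
    then have "y \<noteq> Hat1" using assms(4) by auto
    then show "z \<in> upper_path n \<and> z \<le> b \<or> z \<in> lower_path m \<and> z \<le> b'"
      using path_downward(2)[OF \<open>z \<le> y\<close> z(1) _ y(1)] y(2) \<open>z \<le> y\<close> by (auto intro: order_trans)
  qed
qed

lemma poset_interval_right:
  assumes "a \<in> upper_path n" "a \<noteq> Hat0" "a' \<in> lower_path m" "a' \<noteq> Hat0"
  shows "poset_interval (bipath_poset n m) (label_interval (upper_path n) (a, Hat1) \<union> label_interval (lower_path m) (a', Hat1))"
  unfolding poset_interval_def
proof (intro conjI ballI impI)
  let ?I = "label_interval (upper_path n) (a, Hat1) \<union> label_interval (lower_path m) (a', Hat1)"
  have I: "x \<in> ?I \<longleftrightarrow> x \<in> upper_path n \<and> a \<le> x \<or> x \<in> lower_path m \<and> a' \<le> x" for x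
    by (auto simp: label_interval_def)
  show "?I \<subseteq> bipath_poset n m" by (auto simp: label_interval_def bipath_poset_def)
  have h: "Hat1 \<in> ?I" by (simp add: label_interval_def)
  then show "?I \<noteq> {}" by blast
  show "poset_connected ?I" by (rule poset_connected_through[OF h]) simp
  fix x y z assume xy: "x \<in> ?I" "y \<in> ?I" and z: "z \<in> bipath_poset n m" "x < z \<and> z < y"
  have "x \<le> z" using z by (simp add: less_imp_le)
  from xy(1) show "z \<in> ?I"
    unfolding I
  proof (elim disjE conjE)
    assume x: "x \<in> upper_path n" "a \<le> x"
    then have "x \<noteq> Hat0" using assms(2) by auto
    then show "z \<in> upper_path n \<and> a \<le> z \<or> z \<in> lower_path m \<and> a' \<le> z"
      using path_upward(1)[OF \<open>x \<le> z\<close> z(1) _ x(1)] x(2) \<open>x \<le> z\<close> by (auto intro: order_trans)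
  next
    assume x: "x \<in> lower_path m" "a' \<le> x"
    then have "x \<noteq> Hat0" using assms(4) by auto
    then show "z \<in> upper_path n \<and> a \<le> z \<or> z \<in> lower_path m \<and> a' \<le> z"
      using path_upward(2)[OF \<open>x \<le> z\<close> z(1) _ x(1)] x(2) \<open>x \<le> z\<close> by (auto intro: order_trans)
  qed
qed

lemma poset_interval_whole: "poset_interval (bipath_poset n m) (bipath_poset n m)"
  unfolding poset_interval_def
  using poset_connected_through[of Hat0 "bipath_poset n m"] by (auto simp: bipath_poset_def upper_path_def)

lemma poset_interval_chain:
  assumes l: "l \<in> path_labels P" and tot: "\<And>a b. a \<in> P \<Longrightarrow> b \<in> P \<Longrightarrow> a \<le> b \<or> b \<le> a"
    and PQ: "P \<subseteq> Q" and conv: "\<And>x y z. x \<in> label_interval P l \<Longrightarrow> y \<in> label_interval P l \<Longrightarrow> z \<in> Q \<Longrightarrow> x \<le> z \<Longrightarrow> z \<le> y \<Longrightarrow> z \<in> P"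
  shows "poset_interval Q (label_interval P l)"
  unfolding poset_interval_def
proof (intro conjI ballI impI)
  have fst: "fst l \<in> label_interval P l" using l by (auto simp: path_labels_def label_interval_def)
  show "label_interval P l \<subseteq> Q" using PQ by (auto simp: label_interval_def)
  show "label_interval P l \<noteq> {}" using fst by blast
  show "poset_connected (label_interval P l)"
    by (rule poset_connected_through[OF fst]) (auto simp: label_interval_def)
  fix x y z assume "x \<in> label_interval P l" "y \<in> label_interval P l" "z \<in> Q" "x < z \<and> z < y"
  then show "z \<in> label_interval P l"
    using conv[of x y z] by (auto simp: label_interval_def intro: order_trans less_imp_le)
qed

lemma poset_interval_path:
  assumes "l \<in> path_labels P" "\<And>a b. a \<in> P \<Longrightarrow> b \<in> P \<Longrightarrow> a \<le> b \<or> b \<le> a"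
  shows "poset_interval P (label_interval P l)"
  by (rule poset_interval_chain[OF assms]) auto

lemma poset_interval_other:
  assumes "other_label l"
  shows "l \<in> path_labels (upper_path n) \<Longrightarrow> poset_interval (bipath_poset n m) (label_interval (upper_path n) l)"
    and "l \<in> path_labels (lower_path m) \<Longrightarrow> poset_interval (bipath_poset n m) (label_interval (lower_path m) l)"
proof -
  have nz: "x \<in> label_interval P l \<Longrightarrow> x \<noteq> Hat0" for x P
    using assms by (auto simp: label_interval_def other_label_def)
  show "poset_interval (bipath_poset n m) (label_interval (upper_path n) l)" if "l \<in> path_labels (upper_path n)"
  proof (rule poset_interval_chain[OF that upper_path_total])
    fix x y z assume x: "x \<in> label_interval (upper_path n) l" and z: "z \<in> bipath_poset n m" "x \<le> z"
    have "x \<in> upper_path n" using x by (simp add: label_interval_def)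
    then show "z \<in> upper_path n" using path_upward(1)[OF z(2,1) nz[OF x]] by simp
  qed (simp_all add: bipath_poset_def)
  show "poset_interval (bipath_poset n m) (label_interval (lower_path m) l)" if "l \<in> path_labels (lower_path m)"
  proof (rule poset_interval_chain[OF that lower_path_total])
    fix x y z assume x: "x \<in> label_interval (lower_path m) l" and z: "z \<in> bipath_poset n m" "x \<le> z"
    have "x \<in> lower_path m" using x by (simp add: label_interval_def)
    then show "z \<in> lower_path m" using path_upward(2)[OF z(2,1) nz[OF x]] by simp
  qed (simp_all add: bipath_poset_def)
qed

lemma angle_left:
  assumes "b \<in> upper_path n" "b \<noteq> Hat1" "b' \<in> lower_path m" "b' \<noteq> Hat1"
  shows "angle n m b' b = label_interval (upper_path n) (Hat0, b) \<union> label_interval (lower_path m) (Hat0, b')"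
  using assms by (simp add: angle_def label_interval_def)

lemma angle_right:
  assumes "a \<in> upper_path n" "a \<noteq> Hat0" "a' \<in> lower_path m" "a' \<noteq> Hat0"
  shows "angle n m a a' = label_interval (upper_path n) (a, Hat1) \<union> label_interval (lower_path m) (a', Hat1)"
proof -
  have "\<not> (a' \<in> upper_path n \<and> a \<in> lower_path m \<and> a' \<noteq> Hat1 \<and> a \<noteq> Hat1)"
    using paths_inter[of a' n m] assms by auto
  then show ?thesis using assms by (auto simp: angle_def label_interval_def)
qed

lemma angle_other_upper:
  assumes "(a, b) \<in> path_labels (upper_path n)" "other_label (a, b)"
  shows "angle n m a b = label_interval (upper_path n) (a, b)"
proof -
  have ab: "a \<in> upper_path n" "b \<in> upper_path n" "a \<le> b" "a \<noteq> Hat0" "b \<noteq> Hat1"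
    using assms by (auto simp: path_labels_def other_label_def)
  then have "a \<noteq> Hat1" "b \<noteq> Hat0" by auto
  then have "a \<notin> lower_path m" "b \<notin> lower_path m"
    using paths_inter[of a n m] paths_inter[of b n m] ab by auto
  then show ?thesis using ab \<open>a \<noteq> Hat1\<close> \<open>b \<noteq> Hat0\<close> by (simp add: angle_def label_interval_def)
qed

lemma angle_other_lower:
  assumes "(a, b) \<in> path_labels (lower_path m)" "other_label (a, b)"
  shows "angle n m b a = label_interval (lower_path m) (a, b)"
proof -
  have ab: "a \<in> lower_path m" "b \<in> lower_path m" "a \<le> b" "a \<noteq> Hat0" "b \<noteq> Hat1"
    using assms by (auto simp: path_labels_def other_label_def)
  then have "a \<noteq> Hat1" "b \<noteq> Hat0" by auto
  then have "a \<notin> upper_path n" "b \<notin> upper_path n"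
    using paths_inter[of a n m] paths_inter[of b n m] ab by auto
  then show ?thesis using ab \<open>a \<noteq> Hat1\<close> \<open>b \<noteq> Hat0\<close> by (simp add: angle_def label_interval_def)
qed

lemma label_order_exists:
  assumes ls: "set ls \<subseteq> path_labels P" and tot: "\<And>a b. a \<in> P \<Longrightarrow> b \<in> P \<Longrightarrow> a \<le> b \<or> b \<le> a"
  shows "\<exists>is. label_order ls is"
proof -
  let ?A = "{i. i < length ls \<and> \<not> other_label (ls ! i)}"
  have "\<exists>is. distinct is \<and> set is = ?A \<and> sorted_wrt (\<lambda>i j. label_le (ls ! i) (ls ! j)) is"
  proof (rule sorted_enumeration)
    fix i j assume "i \<in> ?A" "j \<in> ?A"
    then have "ls ! i \<in> path_labels P" "ls ! j \<in> path_labels P" and o': "\<not> other_label (ls ! i)" "\<not> other_label (ls ! j)"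
      using ls by auto
    then have "fst (ls ! i) \<le> fst (ls ! j) \<or> fst (ls ! j) \<le> fst (ls ! i)" "snd (ls ! i) \<le> snd (ls ! j) \<or> snd (ls ! j) \<le> snd (ls ! i)"
      using tot[of "fst (ls ! i)" "fst (ls ! j)"] tot[of "snd (ls ! i)" "snd (ls ! j)"]
      by (simp_all add: path_labels_def case_prod_beta)
    then show "label_le (ls ! i) (ls ! j) \<or> label_le (ls ! j) (ls ! i)"
      using o' unfolding label_le_def other_label_def by auto
  qed (auto simp: label_le_def intro: order_trans)
  then show ?thesis unfolding label_order_def by (simp add: sorted_wrt_map)
qed

lemma mset_nth: "mset xs = image_mset ((!) xs) (mset_set {..<length xs})"
proof -
  have "mset xs = mset (map ((!) xs) [0..<length xs])" by (simp add: map_nth)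
  then show ?thesis by (simp add: atLeast0LessThan)
qed

lemma other_summands:
  "image_mset f (filter_mset other_label (mset ls)) =
     image_mset (\<lambda>i. f (ls ! i)) (mset_set ({..<length ls} - {i. i < length ls \<and> \<not> other_label (ls ! i)}))"
proof -
  have "filter_mset other_label (mset ls) =
      image_mset ((!) ls) (mset_set {i \<in> {..<length ls}. other_label (ls ! i)})"
    by (subst mset_nth) (simp add: filter_mset_image_mset filter_mset_mset_set)
  moreover have "{i \<in> {..<length ls}. other_label (ls ! i)} =
      {..<length ls} - {i. i < length ls \<and> \<not> other_label (ls ! i)}" by auto
  ultimately show ?thesis by (simp add: multiset.map_comp comp_def)
qed

section \<open>Reducing the outer blocks\<close>

context bipath_matrix
begin

lemma matched_pairs_permutation:
  assumes len: "length (class_rows Q) = N" "length (class_cols Q) = N" and \<sigma>: "\<sigma> permutes {..<N}"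
    and A: "A = mat N N (\<lambda>(i, j). if i = \<sigma> j then 1 else (0::'k))"
  shows "matched_pairs R C Q A =
    image_mset (\<lambda>j. (ds ! (class_rows Q ! \<sigma> j), us ! (class_cols Q ! j))) (mset_set {..<N})"
proof -
  have \<sigma>N: "\<sigma> j < N" if "j < N" for j using permutes_in_image[OF \<sigma>, of j] that by simp
  have "{(i, j). i < dim_row A \<and> j < dim_col A \<and> A $$ (i, j) = 1} = (\<lambda>j. (\<sigma> j, j)) ` {..<N}"
    using \<sigma>N by (auto simp: A split: if_splits)
  moreover have "mset_set ((\<lambda>j. (\<sigma> j, j)) ` {..<N}) = image_mset (\<lambda>j. (\<sigma> j, j)) (mset_set {..<N})"
    by (rule image_mset_mset_set[symmetric]) (simp add: inj_on_def)
  ultimately have "matched_pairs R C Q A = image_mset (\<lambda>j. (R ! (label_positions Q R ! \<sigma> j), C ! (label_positions Q C ! j))) (mset_set {..<N})"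
    unfolding matched_pairs_def by (simp add: multiset.map_comp comp_def)
  also have "\<dots> = image_mset (\<lambda>j. (ds ! (class_rows Q ! \<sigma> j), us ! (class_cols Q ! j))) (mset_set {..<N})"
  proof (rule image_mset_cong)
    fix j assume "j \<in># mset_set {..<N}"
    then have j: "j < N" by simp
    then show "(R ! (label_positions Q R ! \<sigma> j), C ! (label_positions Q C ! j)) =
        (ds ! (class_rows Q ! \<sigma> j), us ! (class_cols Q ! j))"
      using \<sigma>N[OF j] label_positions_D(1)[of "\<sigma> j" Q R] label_positions_D(1)[of j Q C] len
      by (simp add: class_rows_nth class_cols_nth)
  qed
  finally show ?thesis .
qed

text \<open>One of the two off-diagonal zero blocks is part of the block form, the other has been produced by clearing.\<close>

lemma block_diagonal_hats:
  assumes f: "frame U V Us \<phi>" "frame D V Ds \<psi>"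
    and Z1: "\<And>r c. r \<in> set (class_rows left_label) \<Longrightarrow> c \<in> set (class_cols central_label) \<Longrightarrow> T \<phi> \<psi> Hat0 r c = 0"
    and Z2: "\<And>r c. r \<in> set (class_rows central_label) \<Longrightarrow> c \<in> set (class_cols right_label) \<Longrightarrow> T \<phi> \<psi> Hat1 r c = 0"
  shows "block_diagonal_at V Us Ds Hat0 (set (class_cols left_label)) (set (class_rows left_label)) \<phi> \<psi>"
    and "block_diagonal_at V Us Ds Hat1 (set (class_cols right_label)) (set (class_rows right_label)) \<phi> \<psi>"
proof -
  have bf: "central_label (ds ! r) \<Longrightarrow> left_label (us ! c) \<Longrightarrow> T \<phi> \<psi> Hat0 r c = 0"
    "right_label (ds ! r) \<Longrightarrow> central_label (us ! c) \<Longrightarrow> T \<phi> \<psi> Hat1 r c = 0"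
    if "r < length ds" "c < length us" for r c
    using frames_block_form[OF f] that unfolding block_form_def by simp_all
  show "block_diagonal_at V Us Ds Hat0 (set (class_cols left_label)) (set (class_rows left_label)) \<phi> \<psi>"
    unfolding block_diagonal_at_def
  proof (intro ballI impI)
    fix r c assume r: "r \<in> active Ds Hat0" and c: "c \<in> active Us Hat0"
      and ne: "(r \<in> set (class_rows left_label)) \<noteq> (c \<in> set (class_cols left_label))"
    then have "T \<phi> \<psi> Hat0 r c = 0"
      using Z1[of r c] bf(1)[of r c] by (auto simp: active_hats set_class)
    then show "transition_entry V (length Us) \<phi> \<psi> Hat0 r c = 0" by (simp add: T_def)
  qed
  show "block_diagonal_at V Us Ds Hat1 (set (class_cols right_label)) (set (class_rows right_label)) \<phi> \<psi>"
    unfolding block_diagonal_at_def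
  proof (intro ballI impI)
    fix r c assume r: "r \<in> active Ds Hat1" and c: "c \<in> active Us Hat1"
      and ne: "(r \<in> set (class_rows right_label)) \<noteq> (c \<in> set (class_cols right_label))"
    then have "T \<phi> \<psi> Hat1 r c = 0"
      using Z2[of r c] bf(2)[of r c] by (auto simp: active_hats set_class)
    then show "transition_entry V (length Us) \<phi> \<psi> Hat1 r c = 0" by (simp add: T_def)
  qed
qed

lemma class_active:
  "set (class_cols left_label) \<subseteq> active Us Hat0" "set (class_rows left_label) \<subseteq> active Ds Hat0"
  "set (class_cols right_label) \<subseteq> active Us Hat1" "set (class_rows right_label) \<subseteq> active Ds Hat1"
  by (auto simp: set_class active_hats)

lemma class_hom:
  assumes "\<And>l. Q l \<Longrightarrow> \<not> other_label l"
  shows "i < j \<Longrightarrow> j < length (class_cols Q) \<Longrightarrow> overlap_hom U (Us ! (class_cols Q ! j)) (Us ! (class_cols Q ! i))"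
    and "i < j \<Longrightarrow> j < length (class_rows Q) \<Longrightarrow> overlap_hom D (Ds ! (class_rows Q ! j)) (Ds ! (class_rows Q ! i))"
proof -
  assume ij: "i < j" "j < length (class_cols Q)"
  then have "class_cols Q ! i \<in> set (class_cols Q)" "class_cols Q ! j \<in> set (class_cols Q)" by simp_all
  then have "class_cols Q ! i < length us" "class_cols Q ! j < length us" by (auto simp: set_class[OF assms])
  then show "overlap_hom U (Us ! (class_cols Q ! j)) (Us ! (class_cols Q ! i))"
    using overlap_hom_label[OF sorted_class(1)[OF ij]] by simp
next
  assume ij: "i < j" "j < length (class_rows Q)"
  then have "class_rows Q ! i \<in> set (class_rows Q)" "class_rows Q ! j \<in> set (class_rows Q)" by simp_all
  then have "class_rows Q ! i < length ds" "class_rows Q ! j < length ds" by (auto simp: set_class[OF assms])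
  then show "overlap_hom D (Ds ! (class_rows Q ! j)) (Ds ! (class_rows Q ! i))"
    using overlap_hom_label[OF sorted_class(2)[OF ij]] by simp
qed

text \<open>What remains of a run once the two outer blocks have been reduced: frames whose transition
  matrices are permutation matrices in all three blocks. The left block lives at \<open>Hat0\<close>
  and the right block at \<open>Hat1\<close>, so their reductions do not disturb each other.\<close>

lemma reduced_frames:
  assumes M: "realised M"
    and id: "label_block R C central_label central_label M = 1\<^sub>m (length (label_positions central_label R))"
    and Z1: "label_block R C central_label right_label M =
       0\<^sub>m (length (label_positions central_label R)) (length (label_positions right_label C))"
    and Z2: "label_block R C left_label central_label M =
       0\<^sub>m (length (label_positions left_label R)) (length (label_positions central_label C))"
  shows "permutation_matrix (reduction (label_block R C left_label left_label M))"
    and "permutation_matrix (reduction (label_block R C right_label right_label M))"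
    and "\<exists>\<phi> \<psi>. frame U V Us \<phi> \<and> frame D V Ds \<psi> \<and>
      block_diagonal_at V Us Ds Hat0 (set (class_cols left_label)) (set (class_rows left_label)) \<phi> \<psi> \<and>
      block_diagonal_at V Us Ds Hat1 (set (class_cols right_label)) (set (class_rows right_label)) \<phi> \<psi> \<and>
      reduction (label_block R C left_label left_label M) = mat (length (class_rows left_label)) (length (class_cols left_label))
        (\<lambda>(i, j). T \<phi> \<psi> Hat0 (class_rows left_label ! i) (class_cols left_label ! j)) \<and>
      reduction (label_block R C right_label right_label M) = mat (length (class_rows right_label)) (length (class_cols right_label))
        (\<lambda>(i, j). T \<phi> \<psi> Hat1 (class_rows right_label ! i) (class_cols right_label ! j)) \<and>
      length (class_rows central_label) = length (class_cols central_label) \<and>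
      (\<forall>i<length (class_cols central_label). \<forall>j<length (class_cols central_label).
         T \<phi> \<psi> Hat0 (class_rows central_label ! i) (class_cols central_label ! j) = (if i = j then 1 else 0))"
proof -
  from M obtain \<phi> \<psi> where f: "frame U V Us \<phi>" "frame D V Ds \<psi>"
    and eq: "M = initial_matrix us ds cs rs (T \<phi> \<psi> Hat0) (T \<phi> \<psi> Hat1)" unfolding realised_def by blast
  have mem: "us ! c \<in> Collect Q" if "c \<in> set (class_cols Q)" for c Q using that by (auto simp: class_cols_def)
  have mem': "ds ! r \<in> Collect Q" if "r \<in> set (class_rows Q)" for r Q using that by (auto simp: class_rows_def)
  have memL: "left_label (us ! (class_cols left_label ! j))" if "j < length (class_cols left_label)" for j
    using mem[OF nth_mem[OF that]] by simp
  have memL': "left_label (ds ! (class_rows left_label ! j))" if "j < length (class_rows left_label)" for j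
    using mem'[OF nth_mem[OF that]] by simp
  have memR: "right_label (us ! (class_cols right_label ! j))" if "j < length (class_cols right_label)" for j
    using mem[OF nth_mem[OF that]] by simp
  have memR': "right_label (ds ! (class_rows right_label ! j))" if "j < length (class_rows right_label)" for j
    using mem'[OF nth_mem[OF that]] by simp
  let ?ll = "label_block R C left_label left_label M" and ?rr = "label_block R C right_label right_label M"
  have ll: "?ll = mat (length (class_rows left_label)) (length (class_cols left_label))
      (\<lambda>(i, j). transition_entry V (length Us) \<phi> \<psi> Hat0 (class_rows left_label ! i) (class_cols left_label ! j))"
    unfolding eq label_block_initial
    by (rule eq_matI) (simp_all add: label_entry_central memL memL' memR memR' T_def)
  have rr: "?rr = mat (length (class_rows right_label)) (length (class_cols right_label))
      (\<lambda>(i, j). transition_entry V (length Us) \<phi> \<psi> Hat1 (class_rows right_label ! i) (class_cols right_label ! j))"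
    unfolding eq label_block_initial
    by (rule eq_matI) (simp_all add: label_entry_central memL memL' memR memR' T_def)
  have lenc: "length (class_rows central_label) = length (class_cols central_label)"
    using arg_cong[OF id, of dim_col] by (simp add: label_block_def class_rows_nth class_cols_nth)
  have cc: "T \<phi> \<psi> Hat0 (class_rows central_label ! i) (class_cols central_label ! j) = (if i = j then 1 else 0)"
    if ij: "i < length (class_cols central_label)" "j < length (class_cols central_label)" for i j
  proof -
    have "label_block R C central_label central_label M $$ (i, j) = (if i = j then 1 else 0)"
      unfolding id using ij lenc by (simp add: class_rows_nth)
    then show ?thesis
      unfolding eq label_block_initial
      using ij lenc mem[OF nth_mem[OF ij(2)]] mem'[OF nth_mem, of i central_label]
      by (simp add: label_entry_central)
  qed
  have z2: "T \<phi> \<psi> Hat0 r c = 0" if rc: "r \<in> set (class_rows left_label)" "c \<in> set (class_cols central_label)" for r c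
  proof -
    from rc obtain i j where ij: "i < length (class_rows left_label)" "r = class_rows left_label ! i"
      "j < length (class_cols central_label)" "c = class_cols central_label ! j" by (metis in_set_conv_nth)
    have "label_block R C left_label central_label M $$ (i, j) = 0"
      unfolding Z2 using ij by (simp add: class_rows_nth class_cols_nth)
    then show ?thesis
      unfolding eq label_block_initial using ij mem[OF rc(2)] mem'[OF rc(1)] by (simp add: label_entry_central)
  qed
  have z1: "T \<phi> \<psi> Hat1 r c = 0" if rc: "r \<in> set (class_rows central_label)" "c \<in> set (class_cols right_label)" for r c
  proof -
    from rc obtain i j where ij: "i < length (class_rows central_label)" "r = class_rows central_label ! i"
      "j < length (class_cols right_label)" "c = class_cols right_label ! j" by (metis in_set_conv_nth)
    have "label_block R C central_label right_label M $$ (i, j) = 0"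
      unfolding Z1 using ij by (simp add: class_rows_nth class_cols_nth)
    then show ?thesis
      unfolding eq label_block_initial using ij mem[OF rc(2)] mem'[OF rc(1)] by (simp add: label_entry_central)
  qed
  note bd = block_diagonal_hats[OF f z2 z1]
  from block_reduction[OF VU VD f hats_in_paths(1,3) distinct_class(1) class_active(1) distinct_class(2) class_active(2)
      class_hom(1) class_hom(2) bd(1)]
  have left: "permutation_matrix (reduction ?ll) \<and>
    (\<exists>\<phi>' \<psi>'. frame U V Us \<phi>' \<and> frame D V Ds \<psi>' \<and>
       mat (length (class_rows left_label)) (length (class_cols left_label))
         (\<lambda>(i, j). transition_entry V (length Us) \<phi>' \<psi>' Hat0 (class_rows left_label ! i) (class_cols left_label ! j)) = reduction ?ll \<and>
       block_diagonal_at V Us Ds Hat0 (set (class_cols left_label)) (set (class_rows left_label)) \<phi>' \<psi>' \<and>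
       agree_off U V Us (set (class_cols left_label)) \<phi> \<phi>' \<and> agree_off D V Ds (set (class_rows left_label)) \<psi> \<psi>')"
    unfolding ll by simp
  then obtain \<phi>1 \<psi>1 where f1: "frame U V Us \<phi>1" "frame D V Ds \<psi>1"
    and T1: "mat (length (class_rows left_label)) (length (class_cols left_label))
         (\<lambda>(i, j). transition_entry V (length Us) \<phi>1 \<psi>1 Hat0 (class_rows left_label ! i) (class_cols left_label ! j)) = reduction ?ll"
    and bd1: "block_diagonal_at V Us Ds Hat0 (set (class_cols left_label)) (set (class_rows left_label)) \<phi>1 \<psi>1"
    and ag1: "agree_off U V Us (set (class_cols left_label)) \<phi> \<phi>1" "agree_off D V Ds (set (class_rows left_label)) \<psi> \<psi>1"
    by blast
  show "permutation_matrix (reduction ?ll)" using left by blast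
  have keep1: "transition_entry V (length Us) \<phi>1 \<psi>1 x r c = transition_entry V (length Us) \<phi> \<psi> x r c"
    if "x \<in> U" "x \<in> D" "c \<in> active Us x" "r < length Ds" "c \<notin> set (class_cols left_label)" "r \<notin> set (class_rows left_label)" for x r c
    by (rule agree_off_transition[OF ag1 f(1) that])
  have not_left: "c \<in> active Us Hat1 \<Longrightarrow> c \<notin> set (class_cols left_label)" "r \<in> active Ds Hat1 \<Longrightarrow> r \<notin> set (class_rows left_label)" for r c
    by (auto dest!: mem mem' simp: active_hats left_label_def central_label_def right_label_def)
  have not_right: "c \<in> active Us Hat0 \<Longrightarrow> c \<notin> set (class_cols right_label)" "r \<in> active Ds Hat0 \<Longrightarrow> r \<notin> set (class_rows right_label)" for r c
    by (auto dest!: mem mem' simp: active_hats left_label_def central_label_def right_label_def)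
  have actN: "r < length Ds" if "r \<in> active Ds x" for r x using that by (simp add: active_def)
  have bd1': "block_diagonal_at V Us Ds Hat1 (set (class_cols right_label)) (set (class_rows right_label)) \<phi>1 \<psi>1"
    using bd(2) keep1[of Hat1] not_left actN unfolding block_diagonal_at_def by simp
  have rr1: "?rr = mat (length (class_rows right_label)) (length (class_cols right_label))
      (\<lambda>(i, j). transition_entry V (length Us) \<phi>1 \<psi>1 Hat1 (class_rows right_label ! i) (class_cols right_label ! j))"
    unfolding rr
  proof (rule eq_matI)
    fix i j assume "i < dim_row (mat (length (class_rows right_label)) (length (class_cols right_label))
      (\<lambda>(i, j). transition_entry V (length Us) \<phi>1 \<psi>1 Hat1 (class_rows right_label ! i) (class_cols right_label ! j)))"
      "j < dim_col (mat (length (class_rows right_label)) (length (class_cols right_label))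
      (\<lambda>(i, j). transition_entry V (length Us) \<phi>1 \<psi>1 Hat1 (class_rows right_label ! i) (class_cols right_label ! j)))"
    then have ij: "i < length (class_rows right_label)" "j < length (class_cols right_label)" by simp_all
    have "class_rows right_label ! i \<in> active Ds Hat1" "class_cols right_label ! j \<in> active Us Hat1"
      using class_active(3,4) nth_mem[OF ij(1)] nth_mem[OF ij(2)] by (simp_all add: subset_iff)
    then show "mat (length (class_rows right_label)) (length (class_cols right_label))
      (\<lambda>(i, j). transition_entry V (length Us) \<phi> \<psi> Hat1 (class_rows right_label ! i) (class_cols right_label ! j)) $$ (i, j) =
      mat (length (class_rows right_label)) (length (class_cols right_label))
      (\<lambda>(i, j). transition_entry V (length Us) \<phi>1 \<psi>1 Hat1 (class_rows right_label ! i) (class_cols right_label ! j)) $$ (i, j)"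
      using ij keep1[of Hat1] not_left actN by simp
  qed simp_all
  from block_reduction[OF VU VD f1 hats_in_paths(2,4) distinct_class(1) class_active(3) distinct_class(2) class_active(4)
      class_hom(1) class_hom(2) bd1']
  have right: "permutation_matrix (reduction ?rr) \<and>
    (\<exists>\<phi>' \<psi>'. frame U V Us \<phi>' \<and> frame D V Ds \<psi>' \<and>
       mat (length (class_rows right_label)) (length (class_cols right_label))
         (\<lambda>(i, j). transition_entry V (length Us) \<phi>' \<psi>' Hat1 (class_rows right_label ! i) (class_cols right_label ! j)) = reduction ?rr \<and>
       block_diagonal_at V Us Ds Hat1 (set (class_cols right_label)) (set (class_rows right_label)) \<phi>' \<psi>' \<and>
       agree_off U V Us (set (class_cols right_label)) \<phi>1 \<phi>' \<and> agree_off D V Ds (set (class_rows right_label)) \<psi>1 \<psi>')"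
    unfolding rr1 by simp
  then obtain \<phi>2 \<psi>2 where f2: "frame U V Us \<phi>2" "frame D V Ds \<psi>2"
    and T2: "mat (length (class_rows right_label)) (length (class_cols right_label))
         (\<lambda>(i, j). transition_entry V (length Us) \<phi>2 \<psi>2 Hat1 (class_rows right_label ! i) (class_cols right_label ! j)) = reduction ?rr"
    and bd2: "block_diagonal_at V Us Ds Hat1 (set (class_cols right_label)) (set (class_rows right_label)) \<phi>2 \<psi>2"
    and ag2: "agree_off U V Us (set (class_cols right_label)) \<phi>1 \<phi>2" "agree_off D V Ds (set (class_rows right_label)) \<psi>1 \<psi>2"
    by blast
  show "permutation_matrix (reduction ?rr)" using right by blast
  have keep2: "transition_entry V (length Us) \<phi>2 \<psi>2 Hat0 r c = transition_entry V (length Us) \<phi>1 \<psi>1 Hat0 r c"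
    if "c \<in> active Us Hat0" "r \<in> active Ds Hat0" for r c
    by (rule agree_off_transition[OF ag2 f1(1) _ _ that(1) actN[OF that(2)] not_right(1)[OF that(1)] not_right(2)[OF that(2)]]) simp_all
  have bd2': "block_diagonal_at V Us Ds Hat0 (set (class_cols left_label)) (set (class_rows left_label)) \<phi>2 \<psi>2"
    using bd1 keep2 unfolding block_diagonal_at_def by simp
  have ll2: "reduction ?ll = mat (length (class_rows left_label)) (length (class_cols left_label))
        (\<lambda>(i, j). T \<phi>2 \<psi>2 Hat0 (class_rows left_label ! i) (class_cols left_label ! j))"
    unfolding T1[symmetric]
  proof (rule eq_matI)
    fix i j assume "i < dim_row (mat (length (class_rows left_label)) (length (class_cols left_label))
      (\<lambda>(i, j). T \<phi>2 \<psi>2 Hat0 (class_rows left_label ! i) (class_cols left_label ! j)))"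
      "j < dim_col (mat (length (class_rows left_label)) (length (class_cols left_label))
      (\<lambda>(i, j). T \<phi>2 \<psi>2 Hat0 (class_rows left_label ! i) (class_cols left_label ! j)))"
    then have ij: "i < length (class_rows left_label)" "j < length (class_cols left_label)" by simp_all
    have "class_rows left_label ! i \<in> active Ds Hat0" "class_cols left_label ! j \<in> active Us Hat0"
      using class_active(1,2) nth_mem[OF ij(1)] nth_mem[OF ij(2)] by (simp_all add: subset_iff)
    then show "mat (length (class_rows left_label)) (length (class_cols left_label))
      (\<lambda>(i, j). transition_entry V (length Us) \<phi>1 \<psi>1 Hat0 (class_rows left_label ! i) (class_cols left_label ! j)) $$ (i, j) =
      mat (length (class_rows left_label)) (length (class_cols left_label))
      (\<lambda>(i, j). T \<phi>2 \<psi>2 Hat0 (class_rows left_label ! i) (class_cols left_label ! j)) $$ (i, j)"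
      using ij keep2 by (simp add: T_def)
  qed simp_all
  have cc2: "T \<phi>2 \<psi>2 Hat0 (class_rows central_label ! i) (class_cols central_label ! j) = (if i = j then 1 else 0)"
    if ij: "i < length (class_cols central_label)" "j < length (class_cols central_label)" for i j
  proof -
    have "class_rows central_label ! i \<in> set (class_rows central_label)" "class_cols central_label ! j \<in> set (class_cols central_label)"
      using ij lenc by simp_all
    then have "class_rows central_label ! i \<in> active Ds Hat0" "class_cols central_label ! j \<in> active Us Hat0"
      "class_rows central_label ! i \<in> active Ds Hat1" "class_cols central_label ! j \<in> active Us Hat1"
      by (auto simp: set_class active_hats)
    then show ?thesis using cc[OF ij] keep2 keep1[of Hat0] not_left actN by (simp add: T_def)
  qed
  show "\<exists>\<phi> \<psi>. frame U V Us \<phi> \<and> frame D V Ds \<psi> \<and>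
      block_diagonal_at V Us Ds Hat0 (set (class_cols left_label)) (set (class_rows left_label)) \<phi> \<psi> \<and>
      block_diagonal_at V Us Ds Hat1 (set (class_cols right_label)) (set (class_rows right_label)) \<phi> \<psi> \<and>
      reduction ?ll = mat (length (class_rows left_label)) (length (class_cols left_label))
        (\<lambda>(i, j). T \<phi> \<psi> Hat0 (class_rows left_label ! i) (class_cols left_label ! j)) \<and>
      reduction ?rr = mat (length (class_rows right_label)) (length (class_cols right_label))
        (\<lambda>(i, j). T \<phi> \<psi> Hat1 (class_rows right_label ! i) (class_cols right_label ! j)) \<and>
      length (class_rows central_label) = length (class_cols central_label) \<and>
      (\<forall>i<length (class_cols central_label). \<forall>j<length (class_cols central_label).
         T \<phi> \<psi> Hat0 (class_rows central_label ! i) (class_cols central_label ! j) = (if i = j then 1 else 0))"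
    using f2 bd2 bd2' ll2 T2 lenc cc2 unfolding T_def
    by (intro exI[of _ \<phi>2] exI[of _ \<psi>2]) simp
qed

end

section \<open>Every run decomposes the module\<close>

context bipath_matrix
begin

text \<open>The reduced frames have equal coordinates at \<open>Hat0\<close> and \<open>Hat1\<close> for summands that correspond under the
  bijection \<open>h\<close>, composed of the matchings of the three blocks. So they glue. It remains
  to see that the unions of matched intervals, together with the unmatched intervals, are the intervals of the output.\<close>

lemma run_decomposes:
  assumes labels: "set us \<subseteq> path_labels U" "set ds \<subseteq> path_labels D" and M: "realised M"
    and id: "label_block R C central_label central_label M = 1\<^sub>m (length (label_positions central_label R))"
    and Z1: "label_block R C central_label right_label M =
       0\<^sub>m (length (label_positions central_label R)) (length (label_positions right_label C))"
    and Z2: "label_block R C left_label central_label M =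
       0\<^sub>m (length (label_positions left_label R)) (length (label_positions central_label C))"
  shows "interval_decomposition (bipath_poset n m) V (output_intervals n m us ds R C M)"
proof -
  let ?lc = "class_cols left_label" and ?lr = "class_rows left_label"
  let ?cc = "class_cols central_label" and ?cr = "class_rows central_label"
  let ?rc = "class_cols right_label" and ?rr = "class_rows right_label"
  let ?ll = "reduction (label_block R C left_label left_label M)"
  let ?rb = "reduction (label_block R C right_label right_label M)"
  from reduced_frames(3)[OF M id Z1 Z2] obtain \<phi> \<psi> where f: "frame U V Us \<phi>" "frame D V Ds \<psi>"
    and bd: "block_diagonal_at V Us Ds Hat0 (set ?lc) (set ?lr) \<phi> \<psi>" "block_diagonal_at V Us Ds Hat1 (set ?rc) (set ?rr) \<phi> \<psi>"
    and ll: "?ll = mat (length ?lr) (length ?lc) (\<lambda>(i, j). T \<phi> \<psi> Hat0 (?lr ! i) (?lc ! j))"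
    and rb: "?rb = mat (length ?rr) (length ?rc) (\<lambda>(i, j). T \<phi> \<psi> Hat1 (?rr ! i) (?rc ! j))"
    and lenc: "length ?cr = length ?cc"
    and cc: "\<And>i j. i < length ?cc \<Longrightarrow> j < length ?cc \<Longrightarrow> T \<phi> \<psi> Hat0 (?cr ! i) (?cc ! j) = (if i = j then 1 else 0)"
    by blast
  obtain \<sigma>l where \<sigma>l: "\<sigma>l permutes {..<length ?lc}"
    and Ll: "?ll = mat (length ?lc) (length ?lc) (\<lambda>(i, j). if i = \<sigma>l j then 1 else 0)"
    using reduced_frames(1)[OF M id Z1 Z2] unfolding permutation_matrix_def by (auto simp: ll)
  obtain \<sigma>r where \<sigma>r: "\<sigma>r permutes {..<length ?rc}"
    and Rr: "?rb = mat (length ?rc) (length ?rc) (\<lambda>(i, j). if i = \<sigma>r j then 1 else 0)"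
    using reduced_frames(2)[OF M id Z1 Z2] unfolding permutation_matrix_def by (auto simp: rb)
  have lenl: "length ?lr = length ?lc" using arg_cong[OF Ll, of dim_row] by (simp add: ll)
  have lenr: "length ?rr = length ?rc" using arg_cong[OF Rr, of dim_row] by (simp add: rb)
  have Tl: "T \<phi> \<psi> Hat0 (?lr ! i) (?lc ! j) = (if i = \<sigma>l j then 1 else 0)" if "i < length ?lc" "j < length ?lc" for i j
    using arg_cong[OF Ll, of "\<lambda>A. A $$ (i, j)"] that lenl by (simp add: ll)
  have Tr: "T \<phi> \<psi> Hat1 (?rr ! i) (?rc ! j) = (if i = \<sigma>r j then 1 else 0)" if "i < length ?rc" "j < length ?rc" for i j
    using arg_cong[OF Rr, of "\<lambda>A. A $$ (i, j)"] that lenr by (simp add: rb)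
  have \<sigma>lN: "\<sigma>l j < length ?lc" if "j < length ?lc" for j using permutes_in_image[OF \<sigma>l, of j] that by simp
  have \<sigma>rN: "\<sigma>r j < length ?rc" if "j < length ?rc" for j using permutes_in_image[OF \<sigma>r, of j] that by simp
  obtain hl where hl: "bij_betw hl (set ?lc) (set ?lr)" "\<And>j. j < length ?lc \<Longrightarrow> hl (?lc ! j) = ?lr ! \<sigma>l j"
    using permutation_bijection[OF distinct_class(1) refl distinct_class(2) lenl \<sigma>l] by blast
  obtain hc where hc: "bij_betw hc (set ?cc) (set ?cr)" "\<And>j. j < length ?cc \<Longrightarrow> hc (?cc ! j) = ?cr ! j"
    using permutation_bijection[OF distinct_class(1) refl distinct_class(2) lenc permutes_id] by auto
  obtain hr where hr: "bij_betw hr (set ?rc) (set ?rr)" "\<And>j. j < length ?rc \<Longrightarrow> hr (?rc ! j) = ?rr ! \<sigma>r j"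
    using permutation_bijection[OF distinct_class(1) refl distinct_class(2) lenr \<sigma>r] by blast
  define h where "h c = (if left_label (us ! c) then hl c else if central_label (us ! c) then hc c else hr c)" for c
  let ?A = "{i. i < length us \<and> \<not> other_label (us ! i)}" and ?B = "{i. i < length ds \<and> \<not> other_label (ds ! i)}"
  have classes: "left_label l \<Longrightarrow> \<not> central_label l \<and> \<not> right_label l" "central_label l \<Longrightarrow> \<not> right_label l \<and> \<not> left_label l"
    "right_label l \<Longrightarrow> \<not> left_label l \<and> \<not> central_label l" "\<not> other_label l \<longleftrightarrow> left_label l \<or> central_label l \<or> right_label l" for l
    by (auto simp: left_label_def central_label_def right_label_def other_label_def)
  have in_class: "c \<in> set ?lc \<longleftrightarrow> c < length us \<and> fst (us ! c) = Hat0 \<and> snd (us ! c) \<noteq> Hat1"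
    "c \<in> set ?cc \<longleftrightarrow> c < length us \<and> fst (us ! c) = Hat0 \<and> snd (us ! c) = Hat1"
    "c \<in> set ?rc \<longleftrightarrow> c < length us \<and> fst (us ! c) \<noteq> Hat0 \<and> snd (us ! c) = Hat1"
    "c \<in> set ?lr \<longleftrightarrow> c < length ds \<and> fst (ds ! c) = Hat0 \<and> snd (ds ! c) \<noteq> Hat1"
    "c \<in> set ?cr \<longleftrightarrow> c < length ds \<and> fst (ds ! c) = Hat0 \<and> snd (ds ! c) = Hat1"
    "c \<in> set ?rr \<longleftrightarrow> c < length ds \<and> fst (ds ! c) \<noteq> Hat0 \<and> snd (ds ! c) = Hat1" for c
    by (simp_all add: set_class, simp_all add: left_label_def central_label_def right_label_def)
  have A: "?A = set ?lc \<union> set ?cc \<union> set ?rc" and B: "?B = set ?lr \<union> set ?cr \<union> set ?rr"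
    by (auto simp: set_class classes(4))
  have hL: "h c = hl c" if "c \<in> set ?lc" for c using that by (simp add: h_def set_class)
  have hC: "h c = hc c" if "c \<in> set ?cc" for c using that classes(2) by (simp add: h_def set_class)
  have hR: "h c = hr c" if "c \<in> set ?rc" for c using that classes(3) by (simp add: h_def set_class)
  have bL: "bij_betw h (set ?lc) (set ?lr)" and bC: "bij_betw h (set ?cc) (set ?cr)" and bR: "bij_betw h (set ?rc) (set ?rr)"
    using hl(1) hc(1) hr(1) by (simp_all cong: bij_betw_cong add: hL hC hR)
  have bij: "bij_betw h ?A ?B"
    unfolding A B
    by (intro bij_betw_combine bL bC bR) (auto simp: in_class)
  have hl_mem: "h c \<in> set ?lr" if "c \<in> set ?lc" for c using bL that by (auto simp: bij_betw_def)
  have hc_mem: "h c \<in> set ?cr" if "c \<in> set ?cc" for c using bC that by (auto simp: bij_betw_def)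
  have hr_mem: "h c \<in> set ?rr" if "c \<in> set ?rc" for c using bR that by (auto simp: bij_betw_def)
  have a0: "set ?cc \<subseteq> active Us Hat0" "set ?cr \<subseteq> active Ds Hat0" "set ?cc \<subseteq> active Us Hat1" "set ?cr \<subseteq> active Ds Hat1"
    by (auto simp: set_class active_hats)
  have coordL: "\<phi> Hat0 v c = \<psi> Hat0 v (h c)" if c: "c \<in> set ?lc" and v: "v \<in> carrier (pspace V Hat0)" for c v
  proof (rule transition_unit_row[OF VU f _ _ v])
    show "h c < length Ds" "c \<in> active Us Hat0" using hl_mem[OF c] c class_active by (auto simp: set_class)
    obtain j where j: "j < length ?lc" "c = ?lc ! j" using c by (metis in_set_conv_nth)
    have hcj: "h c = ?lr ! \<sigma>l j" using hL[OF c] hl(2)[OF j(1)] j(2) by simp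
    fix d assume d: "d \<in> active Us Hat0"
    show "transition_entry V (length Us) \<phi> \<psi> Hat0 (h c) d = (if d = c then 1 else 0)"
    proof (cases "d \<in> set ?lc")
      case True
      then obtain i where i: "i < length ?lc" "d = ?lc ! i" by (metis in_set_conv_nth)
      have "T \<phi> \<psi> Hat0 (?lr ! \<sigma>l j) (?lc ! i) = (if ?lc ! i = ?lc ! j then 1 else 0)"
        using Tl[OF \<sigma>lN[OF j(1)] i(1)] inj_eq[OF permutes_inj[OF \<sigma>l], of j i]
          nth_eq_iff_index_eq[OF distinct_class(1) i(1) j(1)] by (simp add: eq_commute)
      then show ?thesis unfolding hcj unfolding i(2) j(2) T_def by simp
    next
      case False
      then have "transition_entry V (length Us) \<phi> \<psi> Hat0 (h c) d = 0"
        using bd(1) d hl_mem[OF c] class_active(2) unfolding block_diagonal_at_def by blast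
      then show ?thesis using False c by auto
    qed
  qed simp_all
  have coordC0: "\<phi> Hat0 v c = \<psi> Hat0 v (h c)" if c: "c \<in> set ?cc" and v: "v \<in> carrier (pspace V Hat0)" for c v
  proof (rule transition_unit_row[OF VU f _ _ v])
    show "h c < length Ds" "c \<in> active Us Hat0" using hc_mem[OF c] c a0 by (auto simp: set_class)
    obtain j where j: "j < length ?cc" "c = ?cc ! j" using c by (metis in_set_conv_nth)
    have hcj: "h c = ?cr ! j" using hC[OF c] hc(2)[OF j(1)] j(2) by simp
    fix d assume d: "d \<in> active Us Hat0"
    show "transition_entry V (length Us) \<phi> \<psi> Hat0 (h c) d = (if d = c then 1 else 0)"
    proof (cases "d \<in> set ?lc")
      case True
      have "h c \<notin> set ?lr" using hc_mem[OF c] by (auto simp: in_class)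
      then have "transition_entry V (length Us) \<phi> \<psi> Hat0 (h c) d = 0"
        using bd(1) d subsetD[OF a0(2) hc_mem[OF c]] True unfolding block_diagonal_at_def by simp
      then show ?thesis using True c by (auto simp: in_class)
    next
      case False
      then have "d \<in> set ?cc" using d by (auto simp: set_class active_hats)
      then obtain i where i: "i < length ?cc" "d = ?cc ! i" by (metis in_set_conv_nth)
      have "T \<phi> \<psi> Hat0 (?cr ! j) (?cc ! i) = (if ?cc ! i = ?cc ! j then 1 else 0)"
        using cc[OF j(1) i(1)] nth_eq_iff_index_eq[OF distinct_class(1) i(1) j(1)] by (simp add: eq_commute)
      then show ?thesis unfolding hcj unfolding i(2) j(2) T_def by simp
    qed
  qed simp_all
  have coordC1: "\<phi> Hat1 v c = \<psi> Hat1 v (h c)" if c: "c \<in> set ?cc" and v: "v \<in> carrier (pspace V Hat1)" for c v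
  proof (rule transition_unit_row[OF VU f _ _ v])
    show hN: "h c < length Ds" and "c \<in> active Us Hat1" using hc_mem[OF c] c a0 by (auto simp: set_class)
    obtain j where j: "j < length ?cc" "c = ?cc ! j" using c by (metis in_set_conv_nth)
    have hcj: "h c = ?cr ! j" using hC[OF c] hc(2)[OF j(1)] j(2) by simp
    fix d assume d: "d \<in> active Us Hat1"
    show "transition_entry V (length Us) \<phi> \<psi> Hat1 (h c) d = (if d = c then 1 else 0)"
    proof (cases "d \<in> set ?rc")
      case True
      have "h c \<notin> set ?rr" using hc_mem[OF c] by (auto simp: in_class)
      then have "transition_entry V (length Us) \<phi> \<psi> Hat1 (h c) d = 0"
        using bd(2) d subsetD[OF a0(4) hc_mem[OF c]] True unfolding block_diagonal_at_def by simp
      then show ?thesis using True c by (auto simp: in_class)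
    next
      case False
      then have dc: "d \<in> set ?cc" using d by (auto simp: set_class active_hats)
      then obtain i where i: "i < length ?cc" "d = ?cc ! i" by (metis in_set_conv_nth)
      have "T \<phi> \<psi> Hat0 (h c) d = T \<phi> \<psi> Hat1 (h c) d"
        using frames_block_form[OF f] hc_mem[OF c] dc unfolding block_form_def by (simp add: set_class)
      moreover have "T \<phi> \<psi> Hat0 (h c) d = (if d = c then 1 else 0)"
        unfolding hcj unfolding i(2) j(2)
        using cc[OF j(1) i(1)] nth_eq_iff_index_eq[OF distinct_class(1) i(1) j(1)] by (simp add: eq_commute)
      ultimately show ?thesis by (simp add: T_def)
    qed
  qed simp_all
  have coordR: "\<phi> Hat1 v c = \<psi> Hat1 v (h c)" if c: "c \<in> set ?rc" and v: "v \<in> carrier (pspace V Hat1)" for c v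
  proof (rule transition_unit_row[OF VU f _ _ v])
    show "h c < length Ds" "c \<in> active Us Hat1" using hr_mem[OF c] c class_active by (auto simp: set_class)
    obtain j where j: "j < length ?rc" "c = ?rc ! j" using c by (metis in_set_conv_nth)
    have hcj: "h c = ?rr ! \<sigma>r j" using hR[OF c] hr(2)[OF j(1)] j(2) by simp
    fix d assume d: "d \<in> active Us Hat1"
    show "transition_entry V (length Us) \<phi> \<psi> Hat1 (h c) d = (if d = c then 1 else 0)"
    proof (cases "d \<in> set ?rc")
      case True
      then obtain i where i: "i < length ?rc" "d = ?rc ! i" by (metis in_set_conv_nth)
      have "T \<phi> \<psi> Hat1 (?rr ! \<sigma>r j) (?rc ! i) = (if ?rc ! i = ?rc ! j then 1 else 0)"
        using Tr[OF \<sigma>rN[OF j(1)] i(1)] inj_eq[OF permutes_inj[OF \<sigma>r], of j i]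
          nth_eq_iff_index_eq[OF distinct_class(1) i(1) j(1)] by (simp add: eq_commute)
      then show ?thesis unfolding hcj unfolding i(2) j(2) T_def by simp
    next
      case False
      then have "transition_entry V (length Us) \<phi> \<psi> Hat1 (h c) d = 0"
        using bd(2) d hr_mem[OF c] class_active(4) unfolding block_diagonal_at_def by blast
      then show ?thesis using False c by auto
    qed
  qed simp_all
  have hats: "x = Hat0 \<or> x = Hat1" if "x \<in> U" "x \<in> D" for x using paths_inter that .
  have hatU: "Hat0 \<in> Us ! c \<longleftrightarrow> fst (us ! c) = Hat0" "Hat1 \<in> Us ! c \<longleftrightarrow> snd (us ! c) = Hat1"
    if "c < length us" for c using that by (auto simp: label_interval_def)
  have hatD: "Hat0 \<in> Ds ! c \<longleftrightarrow> fst (ds ! c) = Hat0" "Hat1 \<in> Ds ! c \<longleftrightarrow> snd (ds ! c) = Hat1"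
    if "c < length ds" for c using that by (auto simp: label_interval_def)
  have VB: "persistence_module (U \<union> D) V" using V by (simp add: bipath_poset_def)
  have between: "z \<in> S" if "a \<in> S" "b \<in> S" "z \<in> U \<inter> D" "a \<le> z" "z \<le> b" for a b z and S :: "bipath set"
    using hats[of z] that by auto
  have "\<exists>Ls \<Phi>. frame (U \<union> D) V Ls \<Phi> \<and>
    mset Ls = image_mset (\<lambda>c. Us ! c \<union> Ds ! h c) (mset_set ?A) +
      image_mset ((!) Us) (mset_set ({..<length Us} - ?A)) +
      image_mset ((!) Ds) (mset_set ({..<length Ds} - ?B))"
  proof (rule frame_glue[OF VB f bij])
    show "?A \<subseteq> {..<length Us}" "?B \<subseteq> {..<length Ds}" by auto
    show "Us ! c \<subseteq> U" if "c < length Us" for c using that by (auto simp: label_interval_def)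
    show "Ds ! r \<subseteq> D" if "r < length Ds" for r using that by (auto simp: label_interval_def)
    { fix c x assume c: "c \<in> ?A" and x: "x \<in> U" "x \<in> D"
      consider "c \<in> set ?lc" | "c \<in> set ?cc" | "c \<in> set ?rc" using c unfolding A by blast
      then show "x \<in> Us ! c \<longleftrightarrow> x \<in> Ds ! h c"
      proof cases
        case 1
        then show ?thesis using hats[OF x] hatU[of c] hatD[of "h c"] hl_mem[OF 1] 1 unfolding in_class by auto
      next
        case 2
        then show ?thesis using hats[OF x] hatU[of c] hatD[of "h c"] hc_mem[OF 2] 2 unfolding in_class by auto
      next
        case 3
        then show ?thesis using hats[OF x] hatU[of c] hatD[of "h c"] hr_mem[OF 3] 3 unfolding in_class by auto
      qed }
    { fix c x v assume c: "c \<in> ?A" and x: "x \<in> U" "x \<in> D" and v: "v \<in> carrier (pspace V x)"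
      show "\<phi> x v c = \<psi> x v (h c)"
      proof (cases "c \<in> active Us x")
        case True
        consider "c \<in> set ?lc" "x = Hat0" | "c \<in> set ?cc" "x = Hat0" | "c \<in> set ?cc" "x = Hat1" | "c \<in> set ?rc" "x = Hat1"
          using hats[OF x] True by (auto simp: set_class active_hats)
        then show ?thesis by cases (use coordL coordC0 coordC1 coordR v in auto)
      next
        case False
        then have nx: "x \<notin> Us ! c" using c by (simp add: active_def)
        have hcN: "h c < length Ds" using bij c by (auto simp: bij_betw_def)
        consider "c \<in> set ?lc" | "c \<in> set ?cc" | "c \<in> set ?rc" using c unfolding A by blast
        then have "x \<notin> Ds ! h c"
        proof cases
          case 1
          then show ?thesis using nx hats[OF x] hatU[of c] hatD[of "h c"] hl_mem[OF 1] 1 unfolding in_class by auto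
        next
          case 2
          then show ?thesis using nx hats[OF x] hatU[of c] hatD[of "h c"] hc_mem[OF 2] 2 unfolding in_class by auto
        next
          case 3
          then show ?thesis using nx hats[OF x] hatU[of c] hatD[of "h c"] hr_mem[OF 3] 3 unfolding in_class by auto
        qed
        then show ?thesis using frameD(6)[OF f(1) x(1) v _ nx] frameD(6)[OF f(2) x(2) v hcN] c by simp
      qed }
    show "Us ! c \<inter> D = {}" if "c < length Us" "c \<notin> ?A" for c
    proof -
      have c: "c < length us" "fst (us ! c) \<noteq> Hat0" "snd (us ! c) \<noteq> Hat1"
        using that by (simp_all add: other_label_def)
      have "x \<notin> D" if "x \<in> Us ! c" for x
        using hats[of x] hatU[OF c(1)] c that by (auto simp: label_interval_def)
      then show ?thesis by blast
    qed
    show "Ds ! r \<inter> U = {}" if "r < length Ds" "r \<notin> ?B" for r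
    proof -
      have r: "r < length ds" "fst (ds ! r) \<noteq> Hat0" "snd (ds ! r) \<noteq> Hat1"
        using that by (simp_all add: other_label_def)
      have "x \<notin> U" if "x \<in> Ds ! r" for x
        using hats[of x] hatD[OF r(1)] r that by (auto simp: label_interval_def)
      then show ?thesis by blast
    qed
    show "\<exists>z\<in>U \<inter> D. a \<le> z \<and> z \<le> b" if "a \<le> b" "a \<in> U \<and> b \<in> D \<or> a \<in> D \<and> b \<in> U" for a b
      by (rule bipath_between[OF that])
  qed (rule between; assumption)+
  then obtain Ls \<Phi> where fL: "frame (bipath_poset n m) V Ls \<Phi>"
    and Ls: "mset Ls = image_mset (\<lambda>c. Us ! c \<union> Ds ! h c) (mset_set ?A) +
      image_mset ((!) Us) (mset_set ({..<length Us} - ?A)) +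
      image_mset ((!) Ds) (mset_set ({..<length Ds} - ?B))" unfolding bipath_poset_def by blast
  have usP: "us ! c \<in> path_labels U" if "c < length us" for c using labels(1) nth_mem[OF that] by blast
  have dsP: "ds ! c \<in> path_labels D" if "c < length ds" for c using labels(2) nth_mem[OF that] by blast
  have Us_nth: "Us ! c = label_interval U (fst (us ! c), snd (us ! c))" if "c < length us" for c using that by simp
  have Ds_nth: "Ds ! c = label_interval D (fst (ds ! c), snd (ds ! c))" if "c < length ds" for c using that by simp
  have endsU: "fst (us ! c) \<in> U" "snd (us ! c) \<in> U" if "c < length us" for c using usP[OF that] by (auto simp: path_labels_def)
  have endsD: "fst (ds ! c) \<in> D" "snd (ds ! c) \<in> D" if "c < length ds" for c using dsP[OF that] by (auto simp: path_labels_def)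
  have left_I: "Us ! c \<union> Ds ! r = angle n m (snd (ds ! r)) (snd (us ! c)) \<and> poset_interval (bipath_poset n m) (Us ! c \<union> Ds ! r)"
    if "c \<in> set ?lc" "r \<in> set ?lr" for c r
  proof -
    have c: "c < length us" "left_label (us ! c)" and r: "r < length ds" "left_label (ds ! r)" using that by (auto simp: set_class)
    have e: "snd (us ! c) \<in> U" "snd (us ! c) \<noteq> Hat1" "snd (ds ! r) \<in> D" "snd (ds ! r) \<noteq> Hat1"
      using c r endsU endsD by (auto simp: left_label_def)
    show ?thesis
      unfolding Us_nth[OF c(1)] Ds_nth[OF r(1)]
      using angle_left[OF e] poset_interval_left[OF e] c(2) r(2) by (simp add: left_label_def)
  qed
  have right_I: "Us ! c \<union> Ds ! r = angle n m (fst (us ! c)) (fst (ds ! r)) \<and> poset_interval (bipath_poset n m) (Us ! c \<union> Ds ! r)"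
    if "c \<in> set ?rc" "r \<in> set ?rr" for c r
  proof -
    have c: "c < length us" "right_label (us ! c)" and r: "r < length ds" "right_label (ds ! r)" using that by (auto simp: set_class)
    have e: "fst (us ! c) \<in> U" "fst (us ! c) \<noteq> Hat0" "fst (ds ! r) \<in> D" "fst (ds ! r) \<noteq> Hat0"
      using c r endsU endsD by (auto simp: right_label_def)
    show ?thesis
      unfolding Us_nth[OF c(1)] Ds_nth[OF r(1)]
      using angle_right[OF e] poset_interval_right[OF e] c(2) r(2) by (simp add: right_label_def)
  qed
  have central_I: "Us ! c \<union> Ds ! r = bipath_poset n m" if "c \<in> set ?cc" "r \<in> set ?cr" for c r
    using that by (auto simp: in_class label_interval_def bipath_poset_def)
  have other_U: "Us ! c = (\<lambda>(i1, i2). angle n m i1 i2) (us ! c) \<and> poset_interval (bipath_poset n m) (Us ! c)"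
    if "c < length us" "other_label (us ! c)" for c
    using that angle_other_upper[of "fst (us ! c)" "snd (us ! c)" n m] poset_interval_other(1)[OF that(2)] usP[OF that(1)]
    by (simp add: split_beta)
  have other_D: "Ds ! r = (\<lambda>(j1, j2). angle n m j2 j1) (ds ! r) \<and> poset_interval (bipath_poset n m) (Ds ! r)"
    if "r < length ds" "other_label (ds ! r)" for r
    using that angle_other_lower[of "fst (ds ! r)" "snd (ds ! r)" m n] poset_interval_other(2)[OF that(2)] dsP[OF that(1)]
    by (simp add: split_beta)
  have "distinct (?cc @ ?lc @ ?rc)" using distinct_class(1) by (auto simp: in_class)
  moreover have "set (?cc @ ?lc @ ?rc) = ?A" unfolding A by auto
  ultimately have msA: "mset_set ?A = mset ?cc + mset ?lc + mset ?rc" using mset_set_set by (metis mset_append add.assoc)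
  have part: "image_mset (\<lambda>c. Us ! c \<union> Ds ! h c) (mset xs) = image_mset (\<lambda>j. Us ! (xs ! j) \<union> Ds ! h (xs ! j)) (mset_set {..<length xs})" for xs
    by (subst mset_nth) (simp add: multiset.map_comp comp_def)
  have pc: "image_mset (\<lambda>c. Us ! c \<union> Ds ! h c) (mset ?cc) = image_mset (\<lambda>_. bipath_poset n m)
       (matched_pairs R C central_label (label_block R C central_label central_label M))"
  proof -
    have one: "label_block R C central_label central_label M = mat (length ?cc) (length ?cc) (\<lambda>(i, j). if i = id j then 1 else 0)"
      unfolding id by (rule eq_matI) (auto simp: class_rows_nth lenc)
    show ?thesis
      unfolding part matched_pairs_permutation[OF lenc refl permutes_id one] multiset.map_comp
      by (rule image_mset_cong) (use hc_mem central_I in auto)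
  qed
  have pl: "image_mset (\<lambda>c. Us ! c \<union> Ds ! h c) (mset ?lc) = image_mset (\<lambda>(r, c). angle n m (snd r) (snd c)) (matched_pairs R C left_label ?ll)"
    unfolding part matched_pairs_permutation[OF lenl refl \<sigma>l Ll] multiset.map_comp
  proof (rule image_mset_cong)
    fix j assume "j \<in># mset_set {..<length ?lc}"
    then have j: "j < length ?lc" by simp
    have mem: "?lc ! j \<in> set ?lc" using j by simp
    show "Us ! (?lc ! j) \<union> Ds ! h (?lc ! j) = ((\<lambda>(r, c). angle n m (snd r) (snd c)) \<circ> (\<lambda>j. (ds ! (?lr ! \<sigma>l j), us ! (?lc ! j)))) j"
      using left_I[OF mem hl_mem[OF mem]] hL[OF mem] hl(2)[OF j] by simp
  qed
  have pr: "image_mset (\<lambda>c. Us ! c \<union> Ds ! h c) (mset ?rc) = image_mset (\<lambda>(r, c). angle n m (fst c) (fst r)) (matched_pairs R C right_label ?rb)"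
    unfolding part matched_pairs_permutation[OF lenr refl \<sigma>r Rr] multiset.map_comp
  proof (rule image_mset_cong)
    fix j assume "j \<in># mset_set {..<length ?rc}"
    then have j: "j < length ?rc" by simp
    have mem: "?rc ! j \<in> set ?rc" using j by simp
    show "Us ! (?rc ! j) \<union> Ds ! h (?rc ! j) = ((\<lambda>(r, c). angle n m (fst c) (fst r)) \<circ> (\<lambda>j. (ds ! (?rr ! \<sigma>r j), us ! (?rc ! j)))) j"
      using right_I[OF mem hr_mem[OF mem]] hR[OF mem] hr(2)[OF j] by simp
  qed
  have pu: "image_mset ((!) Us) (mset_set ({..<length Us} - ?A)) = image_mset (\<lambda>(i1, i2). angle n m i1 i2) (filter_mset other_label (mset us))"
    unfolding other_summands length_map
    by (rule image_mset_cong) (use other_U in auto)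
  have pd: "image_mset ((!) Ds) (mset_set ({..<length Ds} - ?B)) = image_mset (\<lambda>(j1, j2). angle n m j2 j1) (filter_mset other_label (mset ds))"
    unfolding other_summands length_map
    by (rule image_mset_cong) (use other_D in auto)
  have out: "mset Ls = output_intervals n m us ds R C M"
    unfolding Ls msA output_intervals_def image_mset_union pc pl pr pu pd by (simp add: add.assoc)
  have "poset_interval (bipath_poset n m) I" if I: "I \<in># mset Ls" for I
  proof -
    have "finite ?A" "finite ({..<length Us} - ?A)" "finite ({..<length Ds} - ?B)" by simp_all
    then consider c where "c \<in> ?A" "I = Us ! c \<union> Ds ! h c" | c where "c < length us" "c \<notin> ?A" "I = Us ! c"
      | r where "r < length ds" "r \<notin> ?B" "I = Ds ! r"
      using I unfolding Ls by auto
    then show ?thesis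
    proof cases
      case (1 c)
      then consider "c \<in> set ?lc" | "c \<in> set ?cc" | "c \<in> set ?rc" unfolding A by blast
      then show ?thesis
      proof cases
        case a: 1
        show ?thesis using conjunct2[OF left_I[OF a hl_mem[OF a]]] 1(2) by simp
      next
        case a: 2
        show ?thesis using central_I[OF a hc_mem[OF a]] poset_interval_whole 1 by simp
      next
        case a: 3
        show ?thesis using conjunct2[OF right_I[OF a hr_mem[OF a]]] 1(2) by simp
      qed
    next
      case (2 c)
      then have "other_label (us ! c)" by simp
      from conjunct2[OF other_U[OF 2(1) this]] show ?thesis unfolding 2(3) .
    next
      case (3 r)
      then have "other_label (ds ! r)" by simp
      from conjunct2[OF other_D[OF 3(1) this]] show ?thesis unfolding 3(3) .
    qed
  qed
  then show ?thesis
    unfolding interval_decomposition_def out[symmetric] pm_iso_iff_frame[OF V] using fL by blast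
qed

end

text \<open>The initial matrix is realised by the given frames, and every operation preserves realisability,
  so the conclusions do not depend on the choices of a run.\<close>

lemma runs_correct:
  fixes V :: "(bipath, 'k::field, 'v) pers_module"
  assumes V: "persistence_module (bipath_poset n m) V"
    and us: "path_decomposition (upper_path n) V us \<phi>" and ds: "path_decomposition (lower_path m) V ds \<psi>"
  defines "\<Lambda> \<equiv> transition_entry V (length us) \<phi> \<psi> Hat0" and "\<Gamma> \<equiv> transition_entry V (length us) \<phi> \<psi> Hat1"
  shows "steps_well_defined us ds \<Lambda> \<Gamma>" and "\<exists>\<J>. normalize_and_output n m us ds \<Lambda> \<Gamma> \<J>"
    and "normalize_and_output n m us ds \<Lambda> \<Gamma> \<J> \<Longrightarrow> interval_decomposition (bipath_poset n m) V \<J>"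
proof -
  have VU: "persistence_module (upper_path n) V" and VD: "persistence_module (lower_path m) V"
    using persistence_module_subset[OF V] by (simp_all add: bipath_poset_def)
  have f: "set us \<subseteq> path_labels (upper_path n)" "frame (upper_path n) V (map (label_interval (upper_path n)) us) \<phi>"
    "set ds \<subseteq> path_labels (lower_path m)" "frame (lower_path m) V (map (label_interval (lower_path m)) ds) \<psi>"
    using us ds by (simp_all add: path_decomposition_iff_frame[OF VU] path_decomposition_iff_frame[OF VD])
  have loc: "bipath_matrix n m V us ds cs rs" if "label_order us cs" "label_order ds rs" for cs rs
    using V that by unfold_locales
  have TT: "bipath_matrix.T V us \<phi> \<psi> Hat0 = \<Lambda>" "bipath_matrix.T V us \<phi> \<psi> Hat1 = \<Gamma>" if "bipath_matrix n m V us ds cs rs" for cs rs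
    unfolding bipath_matrix.T_def[OF that] \<Lambda>_def \<Gamma>_def by simp_all
  have re: "bipath_matrix.realised n m V us ds cs rs (initial_matrix us ds cs rs \<Lambda> \<Gamma>)"
    if "bipath_matrix n m V us ds cs rs" for cs rs
    unfolding bipath_matrix.realised_def[OF that] using f TT[OF that] by blast
  have "\<exists>cs. label_order us cs" "\<exists>rs. label_order ds rs"
    by (rule label_order_exists[OF f(1)], erule upper_path_total, assumption)
      (rule label_order_exists[OF f(3)], erule lower_path_total, assumption)
  then obtain cs0 rs0 where cs0: "label_order us cs0" and rs0: "label_order ds rs0" by blast
  have bf: "block_form us ds \<Lambda> \<Gamma>"
    using bipath_matrix.frames_block_form[OF loc[OF cs0 rs0] f(2,4)] TT[OF loc[OF cs0 rs0]] by simp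
  have steps: "(\<exists>M1. normalize_central (map ((!) ds) rs) (map ((!) us) cs) (initial_matrix us ds cs rs \<Lambda> \<Gamma>) M1) \<and>
    (\<forall>M1. normalize_central (map ((!) ds) rs) (map ((!) us) cs) (initial_matrix us ds cs rs \<Lambda> \<Gamma>) M1 \<longrightarrow>
       (\<exists>M2. clear_central (map ((!) ds) rs) (map ((!) us) cs) M1 M2) \<and>
       (\<forall>M2. clear_central (map ((!) ds) rs) (map ((!) us) cs) M1 M2 \<longrightarrow>
          permutation_matrix (reduction (label_block (map ((!) ds) rs) (map ((!) us) cs) left_label left_label M2)) \<and>
          permutation_matrix (reduction (label_block (map ((!) ds) rs) (map ((!) us) cs) right_label right_label M2)) \<and>
          interval_decomposition (bipath_poset n m) V (output_intervals n m us ds (map ((!) ds) rs) (map ((!) us) cs) M2)))"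
    if o': "label_order us cs" "label_order ds rs" for cs rs
  proof (intro conjI allI impI)
    note L = loc[OF o']
    show "\<exists>M1. normalize_central (map ((!) ds) rs) (map ((!) us) cs) (initial_matrix us ds cs rs \<Lambda> \<Gamma>) M1"
      by (rule bipath_matrix.normalize_central_exists[OF L re[OF L]])
    fix M1 assume n: "normalize_central (map ((!) ds) rs) (map ((!) us) cs) (initial_matrix us ds cs rs \<Lambda> \<Gamma>) M1"
    then have r1: "bipath_matrix.realised n m V us ds cs rs M1"
      using bipath_matrix.realised_central_ops[OF L _ re[OF L]] unfolding normalize_central_def by blast
    have id: "label_block (map ((!) ds) rs) (map ((!) us) cs) central_label central_label M1 =
        1\<^sub>m (length (label_positions central_label (map ((!) ds) rs)))" using n by (simp add: normalize_central_def)
    show "\<exists>M2. clear_central (map ((!) ds) rs) (map ((!) us) cs) M1 M2"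
      by (rule bipath_matrix.clear_central_exists[OF L r1 id])
    fix M2 assume c: "clear_central (map ((!) ds) rs) (map ((!) us) cs) M1 M2"
    then have "(clearing_op (map ((!) ds) rs) (map ((!) us) cs))\<^sup>*\<^sup>* M1 M2" by (simp add: clear_central_def)
    from bipath_matrix.clearing_ops[OF L this r1]
    have r2: "bipath_matrix.realised n m V us ds cs rs M2"
      and id2: "label_block (map ((!) ds) rs) (map ((!) us) cs) central_label central_label M2 =
        1\<^sub>m (length (label_positions central_label (map ((!) ds) rs)))" using id by simp_all
    have Z: "label_block (map ((!) ds) rs) (map ((!) us) cs) central_label right_label M2 =
       0\<^sub>m (length (label_positions central_label (map ((!) ds) rs))) (length (label_positions right_label (map ((!) us) cs)))"
      "label_block (map ((!) ds) rs) (map ((!) us) cs) left_label central_label M2 =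
       0\<^sub>m (length (label_positions left_label (map ((!) ds) rs))) (length (label_positions central_label (map ((!) us) cs)))"
      using c by (simp_all add: clear_central_def)
    show "permutation_matrix (reduction (label_block (map ((!) ds) rs) (map ((!) us) cs) left_label left_label M2))"
      by (rule bipath_matrix.reduced_frames(1)[OF L r2 id2 Z])
    show "permutation_matrix (reduction (label_block (map ((!) ds) rs) (map ((!) us) cs) right_label right_label M2))"
      by (rule bipath_matrix.reduced_frames(2)[OF L r2 id2 Z])
    show "interval_decomposition (bipath_poset n m) V (output_intervals n m us ds (map ((!) ds) rs) (map ((!) us) cs) M2)"
      by (rule bipath_matrix.run_decomposes[OF L f(1,3) r2 id2 Z])
  qed
  show "steps_well_defined us ds \<Lambda> \<Gamma>"
    unfolding steps_well_defined_def Let_def using bf steps by blast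
  show "\<exists>\<J>. normalize_and_output n m us ds \<Lambda> \<Gamma> \<J>"
    unfolding normalize_and_output_def Let_def using cs0 rs0 steps[OF cs0 rs0] by blast
  show "normalize_and_output n m us ds \<Lambda> \<Gamma> \<J> \<Longrightarrow> interval_decomposition (bipath_poset n m) V \<J>"
    unfolding normalize_and_output_def Let_def using steps by blast
qed

lemma path_decompositions_exist:
  fixes V :: "(bipath, 'k::field, 'v) pers_module"
  assumes V: "persistence_module (bipath_poset n m) V"
  shows "\<exists>us \<phi>. path_decomposition (upper_path n) V us \<phi>" "\<exists>ds \<psi>. path_decomposition (lower_path m) V ds \<psi>"
proof -
  have VU: "persistence_module (upper_path n) V" and VD: "persistence_module (lower_path m) V"
    using persistence_module_subset[OF V] by (simp_all add: bipath_poset_def)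
  show "\<exists>us \<phi>. path_decomposition (upper_path n) V us \<phi>"
    using chain_frame[OF finite_paths(1) upper_path_total VU] by (simp add: path_decomposition_iff_frame[OF VU])
  show "\<exists>ds \<psi>. path_decomposition (lower_path m) V ds \<psi>"
    using chain_frame[OF finite_paths(2) lower_path_total VD] by (simp add: path_decomposition_iff_frame[OF VD])
qed

theorem algorithm_A_correct:
  fixes V :: "(bipath, 'k::field, 'v) pers_module"
  assumes V: "persistence_module (bipath_poset n m) V"
  shows "\<exists>\<J>. algorithm_A n m V \<J>" and "algorithm_A_well_defined n m V"
    and "algorithm_A n m V \<J> \<Longrightarrow> interval_decomposition (bipath_poset n m) V \<J>"
proof -
  obtain us \<phi> ds \<psi> where p: "path_decomposition (upper_path n) V us \<phi>" "path_decomposition (lower_path m) V ds \<psi>"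
    using path_decompositions_exist[OF V] by blast
  then show "\<exists>\<J>. algorithm_A n m V \<J>"
    unfolding algorithm_A_def using runs_correct(2)[OF V p] by blast
  show "algorithm_A_well_defined n m V"
    unfolding algorithm_A_well_defined_def using runs_correct(1)[OF V] by blast
  show "algorithm_A n m V \<J> \<Longrightarrow> interval_decomposition (bipath_poset n m) V \<J>"
    unfolding algorithm_A_def using runs_correct(3)[OF V] by blast
qed

section \<open>Uniqueness of interval decompositions\<close>

lemma connected_constant:
  assumes I: "poset_connected I" and step: "\<And>a b. a \<in> I \<Longrightarrow> b \<in> I \<Longrightarrow> a \<le> b \<Longrightarrow> s a = s b"
    and ab: "a \<in> I" "b \<in> I"
  shows "s a = s b"
proof -
  have "(a, b) \<in> {(x, y). x \<in> I \<and> y \<in> I \<and> (x \<le> y \<or> y \<le> x)}\<^sup>*"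
    using I ab by (simp add: poset_connected_def)
  then show ?thesis
  proof (induction rule: rtrancl_induct)
    case (step y z)
    then have yz: "y \<in> I" "z \<in> I" "y \<le> z \<or> z \<le> y" by simp_all
    from yz(3) have "s y = s z" using assms(2)[OF yz(1,2)] assms(2)[OF yz(2,1)] by metis
    then show ?case using step.IH by simp
  qed simp
qed

text \<open>The product is the scalar by which a composite \<open>k\<^sub>I \<rightarrow> k\<^sub>J \<rightarrow> k\<^sub>I\<close> acts at \<open>x\<close>. Extended by zero outside
  \<open>I \<inter> J\<close>, this scalar is constant along comparable points of \<open>I\<close> and along those of \<open>J\<close>. As both intervals are connected
  and one of them contains a point outside the other, it is zero.\<close>

lemma composite_vanishes:
  fixes V :: "(bipath, 'k::field, 'v) pers_module"
  assumes V: "persistence_module P V" and fr: "frame P V Is \<phi>" and fr': "frame P V Js \<psi>"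
    and i: "i < length Is" "i' < length Is" "Is ! i' = Is ! i" and j: "j < length Js" and ne: "Js ! j \<noteq> Is ! i"
    and IP: "Is ! i \<subseteq> P" "Js ! j \<subseteq> P" and con: "poset_connected (Is ! i)" "poset_connected (Js ! j)"
    and x: "x \<in> Is ! i" "x \<in> Js ! j"
  shows "transition_entry V (length Js) \<psi> \<phi> x i' j * transition_entry V (length Is) \<phi> \<psi> x j i = 0"
proof -
  let ?I = "Is ! i" and ?J = "Js ! j"
  let ?f = "\<lambda>y. transition_entry V (length Is) \<phi> \<psi> y j i" and ?g = "\<lambda>y. transition_entry V (length Js) \<psi> \<phi> y i' j"
  \<comment> \<open>the scalar of the composite, as a function on the whole poset\<close>
  define s where "s y = (if y \<in> ?I \<and> y \<in> ?J then ?g y * ?f y else 0)" for y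
  have aI: "i \<in> active Is y \<longleftrightarrow> y \<in> ?I" "i' \<in> active Is y \<longleftrightarrow> y \<in> ?I" "j \<in> active Js y \<longleftrightarrow> y \<in> ?J" for y
    using i j by (simp_all add: active_def)
  have keep: "?f a = ?f b" "?g a = ?g b" if "a \<le> b" "a \<in> ?I" "b \<in> ?I" "a \<in> ?J" "b \<in> ?J" for a b
    using transition_born[OF V fr fr', of a b i j] transition_born[OF V fr' fr, of a b j i'] that
      subsetD[OF IP(1) that(2)] subsetD[OF IP(1) that(3)] by (simp_all add: aI)
  have stepI: "s a = s b" if ab: "a \<in> ?I" "b \<in> ?I" "a \<le> b" for a b
  proof -
    have "?f b = 0" if "a \<notin> ?J" "b \<in> ?J"
      using transition_born[OF V fr fr', of a b i j] ab that IP by (auto simp: aI)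
    moreover have "?g a = 0" if "a \<in> ?J" "b \<notin> ?J"
      using transition_dies[OF V fr' fr, of a b j i'] ab that IP by (auto simp: aI)
    ultimately show ?thesis using keep[of a b] ab by (auto simp: s_def)
  qed
  have stepJ: "s a = s b" if ab: "a \<in> ?J" "b \<in> ?J" "a \<le> b" for a b
  proof -
    have "?g b = 0" if "a \<notin> ?I" "b \<in> ?I"
      using transition_born[OF V fr' fr, of a b j i'] ab that IP by (auto simp: aI)
    moreover have "?f a = 0" if "a \<in> ?I" "b \<notin> ?I"
      using transition_dies[OF V fr fr', of a b i j] ab that IP by (auto simp: aI)
    ultimately show ?thesis using keep[of a b] ab by (auto simp: s_def)
  qed
  from ne obtain z where z: "z \<in> ?I \<and> z \<notin> ?J \<or> z \<in> ?J \<and> z \<notin> ?I" by blast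
  then have "s x = s z"
  proof
    assume "z \<in> ?I \<and> z \<notin> ?J"
    then show ?thesis by (intro connected_constant[where s = s, OF con(1) stepI x(1)]) simp_all
  next
    assume "z \<in> ?J \<and> z \<notin> ?I"
    then show ?thesis by (intro connected_constant[where s = s, OF con(2) stepJ x(2)]) simp_all
  qed
  then show ?thesis using z x by (auto simp: s_def split: if_splits)
qed

text \<open>At a point of \<open>I\<close> the two transition matrices are inverse to each other. Between summands with interval \<open>I\<close>,
  only the summands with interval \<open>I\<close> of the other decomposition contribute to the product, so the corresponding
  submatrices have identity as product, and their sizes can be compared.\<close>

lemma multiplicity_le:
  fixes V :: "(bipath, 'k::field, 'v) pers_module"
  assumes V: "persistence_module P V" and fr: "frame P V Is \<phi>" and fr': "frame P V Js \<psi>"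
    and int: "\<And>K. K \<in> set Is \<Longrightarrow> poset_interval P K" "\<And>K. K \<in> set Js \<Longrightarrow> poset_interval P K"
  shows "count (mset Is) I \<le> count (mset Js) I"
proof (cases "I \<in> set Is")
  case True
  let ?A = "{i. i < length Is \<and> Is ! i = I}" and ?B = "{j. j < length Js \<and> Js ! j = I}"
  have cnt: "count (mset Is) I = card ?A" "count (mset Js) I = card ?B"
    by (simp_all add: count_mset count_list_eq_length_filter length_filter_conv_card eq_commute)
  have "poset_interval P I" by (rule int(1)[OF True])
  then obtain x where x: "x \<in> I" and IP: "I \<subseteq> P" and con: "poset_connected I" unfolding poset_interval_def by blast
  have xP: "x \<in> P" using x IP by blast
  obtain a where a: "bij_betw a {..<card ?A} ?A" using ex_bij_betw_nat_finite[of ?A] by (auto simp: atLeast0LessThan)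
  obtain b where b: "bij_betw b {..<card ?B} ?B" using ex_bij_betw_nat_finite[of ?B] by (auto simp: atLeast0LessThan)
  let ?t = "transition_entry V (length Is) \<phi> \<psi> x" and ?t' = "transition_entry V (length Js) \<psi> \<phi> x"
  have "card ?A \<le> card ?B"
  proof (rule right_inverse_dim_le)
    fix k l assume kl: "k < card ?A" "l < card ?A"
    then have ak: "a k \<in> ?A" and al: "a l \<in> ?A" using a by (auto simp: bij_betw_def)
    have "(\<Sum>j<card ?B. ?t' (a k) (b j) * ?t (b j) (a l)) = (\<Sum>j\<in>?B. ?t' (a k) j * ?t j (a l))"
      by (rule sum.reindex_bij_betw[OF b])
    also have "\<dots> = (\<Sum>j\<in>active Js x. ?t' (a k) j * ?t j (a l))"
    proof (rule sum.mono_neutral_left)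
      show "?B \<subseteq> active Js x" using x by (auto simp: active_def)
      show "\<forall>j\<in>active Js x - ?B. ?t' (a k) j * ?t j (a l) = 0"
      proof
        fix j assume "j \<in> active Js x - ?B"
        then have j: "j < length Js" "x \<in> Js ! j" "Js ! j \<noteq> Is ! a l" using al by (auto simp: active_def)
        have "poset_interval P (Js ! j)" using int(2) j(1) by simp
        then show "?t' (a k) j * ?t j (a l) = 0"
          by (intro composite_vanishes[OF V fr fr'])
            (use ak al x IP con j in \<open>simp_all add: poset_interval_def\<close>)
      qed
    qed simp
    also have "\<dots> = (if a k = a l then 1 else 0)"
      using ak al x by (intro transition_inverse[OF V fr' fr xP xP]) (auto simp: active_def)
    also have "\<dots> = (if k = l then 1 else 0)"
      using a kl by (auto simp: bij_betw_def inj_on_def)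
    finally show "(\<Sum>j<card ?B. ?t' (a k) (b j) * ?t (b j) (a l)) = (if k = l then 1 else 0)" .
  qed
  then show ?thesis by (simp add: cnt)
next
  case False
  then have "count (mset Is) I = 0" by (rule count_mset_0_iff[THEN iffD2])
  then show ?thesis by (rule ord_eq_le_trans) (rule le0)
qed

theorem interval_decomposition_unique:
  fixes V :: "(bipath, 'k::field, 'v) pers_module"
  assumes V: "persistence_module P V" and J: "interval_decomposition P V \<J>" "interval_decomposition P V \<J>'"
  shows "\<J> = \<J>'"
proof -
  obtain Is \<phi> where Is: "mset Is = \<J>" "frame P V Is \<phi>" and intI: "\<And>K. K \<in> set Is \<Longrightarrow> poset_interval P K"
    using J(1) unfolding interval_decomposition_def pm_iso_iff_frame[OF V] by auto
  obtain Js \<psi> where Js: "mset Js = \<J>'" "frame P V Js \<psi>" and intJ: "\<And>K. K \<in> set Js \<Longrightarrow> poset_interval P K"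
    using J(2) unfolding interval_decomposition_def pm_iso_iff_frame[OF V] by auto
  show ?thesis
  proof (rule multiset_eqI)
    fix I
    show "count \<J> I = count \<J>' I"
      using multiplicity_le[OF V Is(2) Js(2) intI intJ, of I] multiplicity_le[OF V Js(2) Is(2) intJ intI, of I]
      unfolding Is(1) Js(1) by simp
  qed
qed

lemma persistence_diagram_eqI:
  fixes V :: "(bipath, 'k::field, 'v) pers_module"
  assumes "persistence_module P V" "interval_decomposition P V \<J>"
  shows "\<J> = persistence_diagram P V"
  unfolding persistence_diagram_def
  by (rule the_equality[symmetric]) (rule assms(2), rule interval_decomposition_unique[OF assms(1) _ assms(2)])

section \<open>Singular homology as a persistence module\<close>

lemma lookup_kscale [simp]: "Poly_Mapping.lookup (Poly_Mapping.map ((*) a) c) \<sigma> = (a :: 'k::field) * Poly_Mapping.lookup c \<sigma>"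
  by (simp add: Poly_Mapping.map.rep_eq when_def)

lemma kscale_single: "Poly_Mapping.map ((*) a) (Poly_Mapping.single \<sigma> x) = Poly_Mapping.single \<sigma> ((a :: 'k::field) * x)"
  by (rule poly_mapping_eqI) (simp add: lookup_single when_def)

lemma kscale_add: "Poly_Mapping.map ((*) (a :: 'k::field)) (c + d) = Poly_Mapping.map ((*) a) c + Poly_Mapping.map ((*) a) d"
  by (rule poly_mapping_eqI) (simp add: lookup_add algebra_simps)

lemma kscale_zero [simp]: "Poly_Mapping.map ((*) (a :: 'k::field)) 0 = 0"
  by (rule poly_mapping_eqI) simp

lemma kscale_sum: "Poly_Mapping.map ((*) (a :: 'k::field)) (sum f A) = (\<Sum>x\<in>A. Poly_Mapping.map ((*) a) (f x))"
  by (induction A rule: infinite_finite_induct) (simp_all add: kscale_add)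

lemma keys_kscale: "Poly_Mapping.keys (Poly_Mapping.map ((*) (a :: 'k::field)) c) \<subseteq> Poly_Mapping.keys c"
  by (auto simp: in_keys_iff)

lemma poly_mapping_sum_single:
  fixes c :: "'a \<Rightarrow>\<^sub>0 'k::field"
  assumes "finite A" "Poly_Mapping.keys c \<subseteq> A"
  shows "(\<Sum>\<sigma>\<in>A. Poly_Mapping.single \<sigma> (Poly_Mapping.lookup c \<sigma>)) = c"
proof (rule poly_mapping_eqI)
  fix \<tau>
  have "Poly_Mapping.lookup (\<Sum>\<sigma>\<in>A. Poly_Mapping.single \<sigma> (Poly_Mapping.lookup c \<sigma>)) \<tau> =
      (\<Sum>\<sigma>\<in>A. if \<sigma> = \<tau> then Poly_Mapping.lookup c \<tau> else 0)"
    unfolding lookup_sum by (intro sum.cong) (auto simp: lookup_single when_def)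
  also have "\<dots> = Poly_Mapping.lookup c \<tau>"
    using assms by (auto simp: in_keys_iff)
  finally show "Poly_Mapping.lookup (\<Sum>\<sigma>\<in>A. Poly_Mapping.single \<sigma> (Poly_Mapping.lookup c \<sigma>)) \<tau> = Poly_Mapping.lookup c \<tau>" .
qed

lemma kboundary_superset:
  fixes c :: "('x, 'k::field) kchain"
  assumes "finite A" "Poly_Mapping.keys c \<subseteq> A" "q \<noteq> 0"
  shows "kboundary q c = (\<Sum>\<sigma>\<in>A. \<Sum>i\<le>q. Poly_Mapping.single (singular_face q i \<sigma>) ((-1) ^ i * Poly_Mapping.lookup c \<sigma>))"
  unfolding kboundary_def using assms
  by (simp, intro sum.mono_neutral_left) (auto simp: in_keys_iff)

lemma kboundary_add:
  fixes c d :: "('x, 'k::field) kchain"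
  shows "kboundary q (c + d) = kboundary q c + kboundary q d"
proof (cases "q = 0")
  case False
  let ?A = "Poly_Mapping.keys c \<union> Poly_Mapping.keys d"
  have A: "finite ?A" by simp
  have k: "Poly_Mapping.keys (c + d) \<subseteq> ?A" by (rule Poly_Mapping.keys_add)
  show ?thesis
    unfolding kboundary_superset[OF A k False] kboundary_superset[OF A Un_upper1 False] kboundary_superset[OF A Un_upper2 False]
    by (simp add: lookup_add distrib_left single_add sum.distrib)
qed (simp add: kboundary_def)

lemma kboundary_kscale:
  fixes c :: "('x, 'k::field) kchain"
  shows "kboundary q (Poly_Mapping.map ((*) a) c) = Poly_Mapping.map ((*) a) (kboundary q c)"
proof (cases "q = 0")
  case False
  show ?thesis
    unfolding kboundary_superset[OF finite_keys keys_kscale[of a c] False] kboundary_superset[OF finite_keys[of c] subset_refl False]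
    by (simp add: kscale_sum kscale_single mult.left_commute)
qed (simp add: kboundary_def)

lemma kboundary_zero [simp]: "kboundary q 0 = 0"
  by (simp add: kboundary_def)

lemma kboundary_sum: "kboundary q (sum f A) = (\<Sum>x\<in>A. kboundary q (f x :: ('x, 'k::field) kchain))"
  by (induction A rule: infinite_finite_induct) (simp_all add: kboundary_add)

text \<open>The reduction of integral chains to chains over \<open>k\<close>. It commutes with boundaries, so that the identity \<open>\<partial> \<partial> = 0\<close>,
  known for integral chains, carries over to simplices over \<open>k\<close> and then by linearity to all chains.\<close>

definition int_to_kchain :: "('a \<Rightarrow>\<^sub>0 int) \<Rightarrow> ('a \<Rightarrow>\<^sub>0 'k::field)" where
  "int_to_kchain = Poly_Mapping.map of_int"

lemma lookup_int_to_kchain [simp]: "Poly_Mapping.lookup (int_to_kchain z) \<sigma> = of_int (Poly_Mapping.lookup z \<sigma>)"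
  by (simp add: int_to_kchain_def Poly_Mapping.map.rep_eq when_def)

lemma int_to_kchain_sum: "int_to_kchain (sum f A) = (\<Sum>x\<in>A. int_to_kchain (f x))"
  by (rule poly_mapping_eqI) (simp add: lookup_sum)

lemma kboundary_int_to_kchain:
  "kboundary q (int_to_kchain z :: ('x, 'k::field) kchain) = int_to_kchain (chain_boundary q z)"
proof (cases "q = 0")
  case False
  have keys: "Poly_Mapping.keys (int_to_kchain z :: ('x, 'k) kchain) \<subseteq> Poly_Mapping.keys z" by (auto simp: in_keys_iff)
  have "int_to_kchain (frag_cmul a (frag_cmul b (frag_of \<sigma>))) = (Poly_Mapping.single \<sigma> (of_int b * of_int a) :: ('x, 'k) kchain)"
    for a b and \<sigma> :: "(nat \<Rightarrow> real) \<Rightarrow> 'x"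
    by (rule poly_mapping_eqI) (simp add: lookup_frag_cmul lookup_single when_def)
  then show ?thesis
    unfolding kboundary_superset[OF finite_keys keys False] chain_boundary_def frag_extend_def
    using False by (simp add: int_to_kchain_sum frag_cmul_sum)
next
  case True
  have "int_to_kchain 0 = (0 :: ('x, 'k) kchain)" by (rule poly_mapping_eqI) simp
  then show ?thesis using True by (simp add: kboundary_def chain_boundary_def)
qed

lemma kboundary_kboundary:
  fixes c :: "('x, 'k::field) kchain"
  assumes c: "c \<in> kchains (Suc q) X"
  shows "kboundary q (kboundary (Suc q) c) = 0"
proof -
  have single: "kboundary q (kboundary (Suc q) (Poly_Mapping.single \<sigma> a)) = 0"
    if \<sigma>: "\<sigma> \<in> Poly_Mapping.keys c" for \<sigma> and a :: 'k
  proof -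
    have "singular_chain (Suc q) X (frag_of \<sigma>)" using c \<sigma> by (auto simp: kchains_def singular_chain_def)
    then have "chain_boundary q (chain_boundary (Suc q) (frag_of \<sigma>)) = 0"
      using chain_boundary_boundary[of "Suc q" X "frag_of \<sigma>"] by simp
    moreover have "int_to_kchain (frag_of \<sigma>) = (Poly_Mapping.single \<sigma> 1 :: ('x, 'k) kchain)"
      by (rule poly_mapping_eqI) (simp add: lookup_single when_def)
    moreover have "int_to_kchain 0 = (0 :: ('x, 'k) kchain)" by (rule poly_mapping_eqI) simp
    ultimately have "kboundary q (kboundary (Suc q) (Poly_Mapping.single \<sigma> (1 :: 'k))) = 0"
      by (metis kboundary_int_to_kchain)
    moreover have "Poly_Mapping.single \<sigma> a = Poly_Mapping.map ((*) a) (Poly_Mapping.single \<sigma> 1)" by (simp add: kscale_single)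
    ultimately show ?thesis by (simp only: kboundary_kscale kscale_zero)
  qed
  have "kboundary q (kboundary (Suc q) (\<Sum>\<sigma>\<in>Poly_Mapping.keys c. Poly_Mapping.single \<sigma> (Poly_Mapping.lookup c \<sigma>))) = 0"
    unfolding kboundary_sum by (rule sum.neutral) (use single in blast)
  then show ?thesis by (simp add: poly_mapping_sum_single)
qed

lemma kchains_add: "c \<in> kchains q X \<Longrightarrow> d \<in> kchains q X \<Longrightarrow> c + d \<in> kchains q X"
  using Poly_Mapping.keys_add[of c d] by (auto simp: kchains_def)

lemma kchains_kscale: "c \<in> kchains q X \<Longrightarrow> Poly_Mapping.map ((*) a) c \<in> kchains q X"
  using keys_kscale[of a c] by (auto simp: kchains_def)

lemma kchains_zero [simp]: "0 \<in> kchains q X"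
  by (simp add: kchains_def)

lemma kchains_sum: "(\<And>x. x \<in> A \<Longrightarrow> f x \<in> kchains q X) \<Longrightarrow> sum f A \<in> kchains q X"
  by (induction A rule: infinite_finite_induct) (auto intro: kchains_add)

lemma kboundary_kchains:
  assumes "c \<in> kchains (Suc q) X"
  shows "kboundary (Suc q) c \<in> kchains q X"
  unfolding kboundary_def if_not_P[OF Suc_not_Zero]
proof (intro kchains_sum)
  fix \<sigma> i assume "\<sigma> \<in> Poly_Mapping.keys c" "i \<in> {..Suc q}"
  then have "singular_simplex q X (singular_face (Suc q) i \<sigma>)"
    using singular_simplex_singular_face[of "Suc q" X \<sigma> i] assms by (auto simp: kchains_def)
  then show "Poly_Mapping.single (singular_face (Suc q) i \<sigma>) ((-1) ^ i * Poly_Mapping.lookup c \<sigma>) \<in> kchains q X"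
    by (auto simp: kchains_def)
qed

lemma kcycles_simps [simp]:
  "c \<in> carrier (kcycles q X) \<longleftrightarrow> c \<in> kchains q X \<and> kboundary q c = 0"
  "\<zero>\<^bsub>kcycles q X\<^esub> = 0" "c \<oplus>\<^bsub>kcycles q X\<^esub> d = c + d" "a \<odot>\<^bsub>kcycles q X\<^esub> c = Poly_Mapping.map ((*) a) c"
  by (simp_all add: kcycles_def)

lemma vectorspace_kcycles: "vectorspace class_ring (kcycles q X :: ('k::field, ('x, 'k) kchain) module)"
  (is "vectorspace _ ?Z")
proof (rule vs_criteria)
  show "field (class_ring :: 'k ring)" by (rule class_field)
  show "\<forall>v\<in>carrier ?Z. \<exists>w\<in>carrier ?Z. v \<oplus>\<^bsub>?Z\<^esub> w = \<zero>\<^bsub>?Z\<^esub>"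
  proof
    fix v assume v: "v \<in> carrier ?Z"
    have "v + Poly_Mapping.map ((*) (- 1)) v = 0" by (rule poly_mapping_eqI) (simp add: lookup_add)
    then show "\<exists>w\<in>carrier ?Z. v \<oplus>\<^bsub>?Z\<^esub> w = \<zero>\<^bsub>?Z\<^esub>"
      using v by (intro bexI[of _ "Poly_Mapping.map ((*) (- 1)) v"]) (simp_all add: kchains_kscale kboundary_kscale)
  qed
  show "\<forall>a b v. a \<in> carrier class_ring \<and> b \<in> carrier class_ring \<and> v \<in> carrier ?Z \<longrightarrow>
      (a \<otimes>\<^bsub>class_ring\<^esub> b) \<odot>\<^bsub>?Z\<^esub> v = a \<odot>\<^bsub>?Z\<^esub> (b \<odot>\<^bsub>?Z\<^esub> v)"
    by (auto simp: class_ring_simps intro!: poly_mapping_eqI)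
  show "\<forall>v\<in>carrier ?Z. \<one>\<^bsub>class_ring\<^esub> \<odot>\<^bsub>?Z\<^esub> v = v"
    by (auto simp: class_ring_simps intro!: poly_mapping_eqI)
  show "\<forall>a b v. a \<in> carrier class_ring \<and> b \<in> carrier class_ring \<and> v \<in> carrier ?Z \<longrightarrow>
      (a \<oplus>\<^bsub>class_ring\<^esub> b) \<odot>\<^bsub>?Z\<^esub> v = a \<odot>\<^bsub>?Z\<^esub> v \<oplus>\<^bsub>?Z\<^esub> b \<odot>\<^bsub>?Z\<^esub> v"
    by (auto simp: class_ring_simps lookup_add distrib_right intro!: poly_mapping_eqI)
qed (auto simp: kchains_add kchains_kscale kboundary_add kboundary_kscale kscale_add add.commute add.assoc)

text \<open>\<open>N\<close> is a subspace of \<open>M\<close>. The case of interest is that of the boundaries among the cycles.\<close>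

locale linear_quotient =
  fixes M :: "('k::field, 'v) module" and N :: "'v set"
  assumes M: "vectorspace class_ring M" and sub: "N \<subseteq> carrier M" and zero: "\<zero>\<^bsub>M\<^esub> \<in> N"
    and add: "\<And>v w. v \<in> N \<Longrightarrow> w \<in> N \<Longrightarrow> v \<oplus>\<^bsub>M\<^esub> w \<in> N"
    and smult: "\<And>a v. v \<in> N \<Longrightarrow> a \<odot>\<^bsub>M\<^esub> v \<in> N"
begin

sublocale M: vectorspace class_ring M by (rule M)

lemma M_smult: "v \<in> carrier M \<Longrightarrow> a \<odot>\<^bsub>M\<^esub> v \<in> carrier M"
  using M.smult_closed[of a v] by (simp add: class_ring_simps)

lemma neg: "v \<in> N \<Longrightarrow> \<ominus>\<^bsub>M\<^esub> v \<in> N"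
proof -
  assume v: "v \<in> N"
  then have "\<ominus>\<^bsub>M\<^esub> v = (\<ominus>\<^bsub>class_ring\<^esub> \<one>\<^bsub>class_ring\<^esub>) \<odot>\<^bsub>M\<^esub> v" using M.smult_minus_1[of v] sub by auto
  then show ?thesis using smult[OF v] by simp
qed

sublocale N: abelian_subgroup N M
proof (rule abelian_subgroupI3)
  show "additive_subgroup N M"
    by (rule additive_subgroupI, unfold_locales)
      (use sub add zero neg in \<open>auto simp flip: a_inv_def\<close>)
  show "abelian_group M" by (rule M.M.abelian_group_axioms)
qed

lemma coset_add: "v \<in> carrier M \<Longrightarrow> w \<in> carrier M \<Longrightarrow>
    (N +>\<^bsub>M\<^esub> v) \<oplus>\<^bsub>quotient_module M N\<^esub> (N +>\<^bsub>M\<^esub> w) = N +>\<^bsub>M\<^esub> (v \<oplus>\<^bsub>M\<^esub> w)"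
  by (simp add: quotient_module_def N.a_rcos_sum)

lemma coset_mem: "z \<in> N +>\<^bsub>M\<^esub> v \<longleftrightarrow> (\<exists>h\<in>N. z = h \<oplus>\<^bsub>M\<^esub> v)"
  by (auto simp: a_r_coset_def')

lemma coset_absorb: "v \<in> carrier M \<Longrightarrow> h \<in> N \<Longrightarrow> N +>\<^bsub>M\<^esub> (h \<oplus>\<^bsub>M\<^esub> v) = N +>\<^bsub>M\<^esub> v"
  using M.M.a_repr_independence[of "h \<oplus>\<^bsub>M\<^esub> v" N v] N.a_subgroup coset_mem by metis

lemma coset_nonempty: "N +>\<^bsub>M\<^esub> v \<noteq> {}"
  using zero coset_mem by blast

lemma coset_smult: "v \<in> carrier M \<Longrightarrow> a \<odot>\<^bsub>quotient_module M N\<^esub> (N +>\<^bsub>M\<^esub> v) = N +>\<^bsub>M\<^esub> (a \<odot>\<^bsub>M\<^esub> v)"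
proof -
  assume v: "v \<in> carrier M"
  have "N +>\<^bsub>M\<^esub> (a \<odot>\<^bsub>M\<^esub> z) = N +>\<^bsub>M\<^esub> (a \<odot>\<^bsub>M\<^esub> v)" if "z \<in> N +>\<^bsub>M\<^esub> v" for z
  proof -
    obtain h where h: "h \<in> N" "z = h \<oplus>\<^bsub>M\<^esub> v" using \<open>z \<in> N +>\<^bsub>M\<^esub> v\<close> coset_mem by blast
    have "a \<odot>\<^bsub>M\<^esub> z = a \<odot>\<^bsub>M\<^esub> h \<oplus>\<^bsub>M\<^esub> a \<odot>\<^bsub>M\<^esub> v"
      using M.smult_r_distr[of a h v] h v sub by (auto simp: class_ring_simps)
    then show ?thesis using coset_absorb[OF M_smult[OF v] smult[OF h(1)]] by simp
  qed
  then have "(\<Union>z\<in>N +>\<^bsub>M\<^esub> v. N +>\<^bsub>M\<^esub> (a \<odot>\<^bsub>M\<^esub> z)) = (\<Union>z\<in>N +>\<^bsub>M\<^esub> v. N +>\<^bsub>M\<^esub> (a \<odot>\<^bsub>M\<^esub> v))" by blast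
  then show ?thesis using coset_nonempty[of v] by (simp add: quotient_module_def)
qed

lemma coset_zero: "N +>\<^bsub>M\<^esub> \<zero>\<^bsub>M\<^esub> = \<zero>\<^bsub>quotient_module M N\<^esub>"
  using sub by (auto simp: quotient_module_def a_r_coset_def')

lemma coset_carrier: "X \<in> carrier (quotient_module M N) \<longleftrightarrow> (\<exists>v\<in>carrier M. X = N +>\<^bsub>M\<^esub> v)"
  by (auto simp: quotient_module_def A_RCOSETS_def')

lemma vectorspace_quotient: "vectorspace class_ring (quotient_module M N)" (is "vectorspace _ ?Q")
proof (rule vs_criteria)
  show "field (class_ring :: 'k ring)" by (rule class_field)
  show "\<zero>\<^bsub>?Q\<^esub> \<in> carrier ?Q" using coset_zero coset_carrier M.M.zero_closed by metis
  show "\<forall>X Y. X \<in> carrier ?Q \<and> Y \<in> carrier ?Q \<longrightarrow> X \<oplus>\<^bsub>?Q\<^esub> Y \<in> carrier ?Q"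
    unfolding coset_carrier using coset_add M.M.a_closed by metis
  show "\<forall>c X. c \<in> carrier class_ring \<and> X \<in> carrier ?Q \<longrightarrow> c \<odot>\<^bsub>?Q\<^esub> X \<in> carrier ?Q"
    unfolding coset_carrier using coset_smult M_smult by metis
  show "\<forall>X Y. X \<in> carrier ?Q \<and> Y \<in> carrier ?Q \<longrightarrow> X \<oplus>\<^bsub>?Q\<^esub> Y = Y \<oplus>\<^bsub>?Q\<^esub> X"
    by (auto simp: coset_carrier coset_add M.M.a_comm)
  show "\<forall>X Y Z. X \<in> carrier ?Q \<and> Y \<in> carrier ?Q \<and> Z \<in> carrier ?Q \<longrightarrow> X \<oplus>\<^bsub>?Q\<^esub> Y \<oplus>\<^bsub>?Q\<^esub> Z = X \<oplus>\<^bsub>?Q\<^esub> (Y \<oplus>\<^bsub>?Q\<^esub> Z)"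
    by (auto simp: coset_carrier coset_add M.M.a_assoc)
  show "\<forall>X\<in>carrier ?Q. X \<oplus>\<^bsub>?Q\<^esub> \<zero>\<^bsub>?Q\<^esub> = X"
    by (auto simp: coset_carrier coset_add simp flip: coset_zero)
  show "\<forall>X\<in>carrier ?Q. \<exists>Y\<in>carrier ?Q. X \<oplus>\<^bsub>?Q\<^esub> Y = \<zero>\<^bsub>?Q\<^esub>"
  proof
    fix X assume "X \<in> carrier ?Q"
    then obtain v where v: "v \<in> carrier M" "X = N +>\<^bsub>M\<^esub> v" unfolding coset_carrier by blast
    then show "\<exists>Y\<in>carrier ?Q. X \<oplus>\<^bsub>?Q\<^esub> Y = \<zero>\<^bsub>?Q\<^esub>"
      by (intro bexI[of _ "N +>\<^bsub>M\<^esub> (\<ominus>\<^bsub>M\<^esub> v)"]) (auto simp: coset_add M.M.r_neg coset_zero coset_carrier)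
  qed
  show "\<forall>a b X. a \<in> carrier class_ring \<and> b \<in> carrier class_ring \<and> X \<in> carrier ?Q \<longrightarrow>
      (a \<otimes>\<^bsub>class_ring\<^esub> b) \<odot>\<^bsub>?Q\<^esub> X = a \<odot>\<^bsub>?Q\<^esub> (b \<odot>\<^bsub>?Q\<^esub> X)"
    using M.smult_assoc1 by (auto simp: coset_carrier coset_smult M_smult)
  show "\<forall>X\<in>carrier ?Q. \<one>\<^bsub>class_ring\<^esub> \<odot>\<^bsub>?Q\<^esub> X = X"
    using M.smult_one by (auto simp: coset_carrier coset_smult)
  show "\<forall>a b X. a \<in> carrier class_ring \<and> b \<in> carrier class_ring \<and> X \<in> carrier ?Q \<longrightarrow>
      (a \<oplus>\<^bsub>class_ring\<^esub> b) \<odot>\<^bsub>?Q\<^esub> X = a \<odot>\<^bsub>?Q\<^esub> X \<oplus>\<^bsub>?Q\<^esub> b \<odot>\<^bsub>?Q\<^esub> X"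
    using M.smult_l_distr by (auto simp: coset_carrier coset_smult coset_add M_smult)
  show "\<forall>a X Y. a \<in> carrier class_ring \<and> X \<in> carrier ?Q \<and> Y \<in> carrier ?Q \<longrightarrow>
      a \<odot>\<^bsub>?Q\<^esub> (X \<oplus>\<^bsub>?Q\<^esub> Y) = a \<odot>\<^bsub>?Q\<^esub> X \<oplus>\<^bsub>?Q\<^esub> a \<odot>\<^bsub>?Q\<^esub> Y"
    using M.smult_r_distr by (auto simp: coset_carrier coset_smult coset_add M_smult)
qed

end

lemma linear_quotient_homology: "linear_quotient (kcycles q X :: ('k::field, ('x, 'k) kchain) module) (kboundaries q X)"
proof (rule linear_quotient.intro)
  show "vectorspace class_ring (kcycles q X :: ('k, ('x, 'k) kchain) module)" by (rule vectorspace_kcycles)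
  show "kboundaries q X \<subseteq> carrier (kcycles q X :: ('k, ('x, 'k) kchain) module)"
    by (auto simp: kboundaries_def kboundary_kchains kboundary_kboundary)
  show "\<zero>\<^bsub>kcycles q X\<^esub> \<in> (kboundaries q X :: ('x, 'k) kchain set)"
    unfolding kboundaries_def by (rule image_eqI[of _ _ 0]) simp_all
  fix v w :: "('x, 'k) kchain" and a :: 'k
  assume "v \<in> kboundaries q X"
  then obtain c where c: "c \<in> kchains (Suc q) X" "v = kboundary (Suc q) c" by (auto simp: kboundaries_def)
  show "a \<odot>\<^bsub>kcycles q X\<^esub> v \<in> kboundaries q X"
    unfolding kboundaries_def using c
    by (intro image_eqI[of _ _ "Poly_Mapping.map ((*) a) c"]) (simp_all add: kboundary_kscale kchains_kscale)
  assume "w \<in> kboundaries q X"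
  then obtain d where d: "d \<in> kchains (Suc q) X" "w = kboundary (Suc q) d" by (auto simp: kboundaries_def)
  show "v \<oplus>\<^bsub>kcycles q X\<^esub> w \<in> kboundaries q X"
    unfolding kboundaries_def using c d
    by (intro image_eqI[of _ _ "c + d"]) (simp_all add: kboundary_add kchains_add)
qed

lemma singular_simplex_mono:
  assumes "continuous_map X Y id" "singular_simplex q X \<sigma>"
  shows "singular_simplex q Y \<sigma>"
  using assms continuous_map_compose[of _ X \<sigma> Y id] by (auto simp: singular_simplex_def)

lemma kchains_mono: "continuous_map X Y id \<Longrightarrow> kchains q X \<subseteq> kchains q Y"
  by (auto simp: kchains_def dest!: subsetD intro: singular_simplex_mono)

lemma kboundaries_mono: "continuous_map X Y id \<Longrightarrow> kboundaries q X \<subseteq> kboundaries q Y"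
  using kchains_mono[of X Y "Suc q"] by (auto simp: kboundaries_def)

lemma kchain_map_id: "c \<in> kchains q X \<Longrightarrow> kchain_map q id c = (c :: ('x, 'k::field) kchain)"
proof -
  assume c: "c \<in> kchains q X"
  have "simplex_map q id \<sigma> = \<sigma>" if "\<sigma> \<in> Poly_Mapping.keys c" for \<sigma>
    using c that simplex_map_id_gen[of q X \<sigma> id] by (auto simp: kchains_def)
  then have "kchain_map q id c = (\<Sum>\<sigma>\<in>Poly_Mapping.keys c. Poly_Mapping.single \<sigma> (Poly_Mapping.lookup c \<sigma>))"
    unfolding kchain_map_def by (intro sum.cong) auto
  then show ?thesis by (simp add: poly_mapping_sum_single)
qed

lemma homology_class_carrier:
  "h \<in> carrier (khomology q X) \<longleftrightarrow> (\<exists>z\<in>carrier (kcycles q X). h = homology_class q X z)"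
  unfolding khomology_def homology_class_def by (rule linear_quotient.coset_carrier[OF linear_quotient_homology])

lemma homology_class_linear:
  assumes "z \<in> carrier (kcycles q X)"
  shows "w \<in> carrier (kcycles q X) \<Longrightarrow> homology_class q X z \<oplus>\<^bsub>khomology q X\<^esub> homology_class q X w = homology_class q X (z + w)"
    and "a \<odot>\<^bsub>khomology q X\<^esub> homology_class q X z = homology_class q X (Poly_Mapping.map ((*) a) z)"
  using linear_quotient.coset_add[OF linear_quotient_homology assms] linear_quotient.coset_smult[OF linear_quotient_homology assms]
  unfolding khomology_def homology_class_def by simp_all

text \<open>Inclusions act on chains as the identity, so the induced map sends the class of a cycle to the class of the
  same cycle.\<close>

lemma khom_induced_class:
  fixes z :: "('x, 'k::field) kchain"
  assumes XY: "continuous_map X Y id" and z: "z \<in> carrier (kcycles q X)"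
  shows "khom_induced q Y id (homology_class q X z) = homology_class q Y z" "z \<in> carrier (kcycles q Y)"
proof -
  interpret X: linear_quotient "kcycles q X :: ('k, ('x, 'k) kchain) module" "kboundaries q X" by (rule linear_quotient_homology)
  interpret Y: linear_quotient "kcycles q Y :: ('k, ('x, 'k) kchain) module" "kboundaries q Y" by (rule linear_quotient_homology)
  show zY: "z \<in> carrier (kcycles q Y)" using z kchains_mono[OF XY] by auto
  have "homology_class q Y (kchain_map q id w) = homology_class q Y z" if w: "w \<in> homology_class q X z" for w
  proof -
    obtain h where h: "h \<in> kboundaries q X" "w = h + z" using w X.coset_mem unfolding homology_class_def by auto
    have "w \<in> kchains q X" using h z X.sub kchains_add by fastforce
    then have "kchain_map q id w = h + z" using kchain_map_id h by blast
    moreover have "h \<in> kboundaries q Y" using h kboundaries_mono[OF XY] by blast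
    ultimately show ?thesis using Y.coset_absorb[OF zY, of h] unfolding homology_class_def by simp
  qed
  moreover have "homology_class q X z \<noteq> {}" unfolding homology_class_def by (rule X.coset_nonempty)
  ultimately have "(\<Union>w\<in>homology_class q X z. homology_class q Y (kchain_map q id w)) = homology_class q Y z" by blast
  then show "khom_induced q Y id (homology_class q X z) = homology_class q Y z" by (simp add: khom_induced_def)
qed

lemma homology_pm_simps [simp]:
  "pspace (homology_pm q S) a = khomology q (S a)" "pmap (homology_pm q S) a b = khom_induced q (S b) id"
  by (simp_all add: homology_pm_def)

lemma persistence_module_homology:
  fixes S :: "'p::order \<Rightarrow> 'x topology"
  assumes S: "filtration P S"
    and fd: "\<And>a. a \<in> P \<Longrightarrow> vectorspace.fin_dim class_ring (khomology q (S a) :: ('k::field, ('x, 'k) kchain set) module)"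
  shows "persistence_module P (homology_pm q S :: ('p, 'k, ('x, 'k) kchain set) pers_module)"
  unfolding persistence_module_def homology_pm_simps
proof (intro conjI ballI impI)
  have con: "continuous_map (S a) (S b) id" if "a \<in> P" "b \<in> P" "a \<le> b" for a b
    using S that by (auto simp: filtration_def)
  have vs: "vectorspace class_ring (khomology q (S a) :: ('k, ('x, 'k) kchain set) module)" for a
    unfolding khomology_def by (rule linear_quotient.vectorspace_quotient[OF linear_quotient_homology])
  fix a assume a: "a \<in> P"
  show "vectorspace class_ring (khomology q (S a) :: ('k, ('x, 'k) kchain set) module)" by (rule vs)
  show "vectorspace.fin_dim class_ring (khomology q (S a) :: ('k, ('x, 'k) kchain set) module)" by (rule fd[OF a])
  { fix x assume "x \<in> carrier (khomology q (S a) :: ('k, ('x, 'k) kchain set) module)"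
    then show "khom_induced q (S a) id x = x"
      unfolding homology_class_carrier using khom_induced_class(1)[OF con[OF a a order_refl]] by blast }
  fix b assume b: "b \<in> P"
  { assume ab: "a \<le> b"
    note ind = khom_induced_class[OF con[OF a b ab]]
    show "linear_map class_ring (khomology q (S a)) (khomology q (S b)) (khom_induced q (S b) id :: ('x, 'k) kchain set \<Rightarrow> _)"
      unfolding linear_map_iff
    proof (intro conjI ballI allI vs)
      show "khom_induced q (S b) id \<in> carrier (khomology q (S a)) \<rightarrow> (carrier (khomology q (S b)) :: ('x, 'k) kchain set set)"
        unfolding Pi_def homology_class_carrier using ind by blast
      fix x :: "('x, 'k) kchain set" assume "x \<in> carrier (khomology q (S a))"
      then obtain z where z: "z \<in> carrier (kcycles q (S a))" "x = homology_class q (S a) z" unfolding homology_class_carrier by blast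
      { fix c
        have "Poly_Mapping.map ((*) c) z \<in> carrier (kcycles q (S a))" using z(1) by (simp add: kchains_kscale kboundary_kscale)
        then show "khom_induced q (S b) id (c \<odot>\<^bsub>khomology q (S a)\<^esub> x) = c \<odot>\<^bsub>khomology q (S b)\<^esub> khom_induced q (S b) id x"
          unfolding z(2) homology_class_linear(2)[OF z(1)] by (simp only: ind z(1) homology_class_linear(2)) }
      fix y :: "('x, 'k) kchain set" assume "y \<in> carrier (khomology q (S a))"
      then obtain w where w: "w \<in> carrier (kcycles q (S a))" "y = homology_class q (S a) w" unfolding homology_class_carrier by blast
      have "z + w \<in> carrier (kcycles q (S a))" using z(1) w(1) by (simp add: kchains_add kboundary_add)
      then show "khom_induced q (S b) id (x \<oplus>\<^bsub>khomology q (S a)\<^esub> y) =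
          khom_induced q (S b) id x \<oplus>\<^bsub>khomology q (S b)\<^esub> khom_induced q (S b) id y"
        unfolding z(2) w(2) homology_class_linear(1)[OF z(1) w(1)] by (simp only: ind z(1) w(1) homology_class_linear(1))
    qed }
  fix c x assume c: "c \<in> P" and abc: "a \<le> b \<and> b \<le> c" and "x \<in> carrier (khomology q (S a) :: ('k, ('x, 'k) kchain set) module)"
  then obtain z where z: "z \<in> carrier (kcycles q (S a))" "x = homology_class q (S a) z" unfolding homology_class_carrier by blast
  have ab: "a \<le> b" and bc: "b \<le> c" and ac: "a \<le> c" using abc order_trans by auto
  show "khom_induced q (S c) id (khom_induced q (S b) id x) = khom_induced q (S c) id x"
    unfolding z(2) khom_induced_class(1)[OF con[OF a b ab] z(1)] khom_induced_class(1)[OF con[OF a c ac] z(1)]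
    by (rule khom_induced_class(1)[OF con[OF b c bc] khom_induced_class(2)[OF con[OF a b ab] z(1)]])
qed

section \<open>Representative cycles\<close>

text \<open>Agreement of those entries that enter the block matrix; the others are arbitrary.\<close>

definition same_entries :: "label list \<Rightarrow> label list \<Rightarrow> (nat \<Rightarrow> nat \<Rightarrow> 'k) \<Rightarrow> (nat \<Rightarrow> nat \<Rightarrow> 'k)
    \<Rightarrow> (nat \<Rightarrow> nat \<Rightarrow> 'k) \<Rightarrow> (nat \<Rightarrow> nat \<Rightarrow> 'k) \<Rightarrow> bool" where
  "same_entries us ds \<Lambda> \<Gamma> \<Lambda>' \<Gamma>' \<longleftrightarrow> (\<forall>r<length ds. \<forall>c<length us.
     (fst (ds ! r) = Hat0 \<and> fst (us ! c) = Hat0 \<longrightarrow> \<Lambda> r c = \<Lambda>' r c) \<and>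
     (snd (ds ! r) = Hat1 \<and> snd (us ! c) = Hat1 \<longrightarrow> \<Gamma> r c = \<Gamma>' r c))"

lemma block_form_same_entries:
  assumes "same_entries us ds \<Lambda> \<Gamma> \<Lambda>' \<Gamma>'"
  shows "block_form us ds \<Lambda> \<Gamma> \<longleftrightarrow> block_form us ds \<Lambda>' \<Gamma>'"
proof -
  have eq: "(central_label (ds ! r) \<and> left_label (us ! c) \<longrightarrow> \<Lambda> r c = 0) \<and>
      (right_label (ds ! r) \<and> central_label (us ! c) \<longrightarrow> \<Gamma> r c = 0) \<and>
      (central_label (ds ! r) \<and> central_label (us ! c) \<longrightarrow> \<Lambda> r c = \<Gamma> r c) \<longleftrightarrow>
      (central_label (ds ! r) \<and> left_label (us ! c) \<longrightarrow> \<Lambda>' r c = 0) \<and>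
      (right_label (ds ! r) \<and> central_label (us ! c) \<longrightarrow> \<Gamma>' r c = 0) \<and>
      (central_label (ds ! r) \<and> central_label (us ! c) \<longrightarrow> \<Lambda>' r c = \<Gamma>' r c)"
    if rc: "r < length ds" "c < length us" for r c
  proof -
    have 0: "fst (ds ! r) = Hat0 \<Longrightarrow> fst (us ! c) = Hat0 \<Longrightarrow> \<Lambda> r c = \<Lambda>' r c"
      and 1: "snd (ds ! r) = Hat1 \<Longrightarrow> snd (us ! c) = Hat1 \<Longrightarrow> \<Gamma> r c = \<Gamma>' r c"
      using assms rc unfolding same_entries_def by simp_all
    then show ?thesis unfolding central_label_def left_label_def right_label_def by auto
  qed
  show ?thesis unfolding block_form_def using eq by simp
qed

lemma initial_matrix_same_entries:
  assumes same: "same_entries us ds \<Lambda> \<Gamma> \<Lambda>' \<Gamma>'" and cs: "label_order us cs" and rs: "label_order ds rs"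
  shows "initial_matrix us ds cs rs \<Lambda> \<Gamma> = initial_matrix us ds cs rs \<Lambda>' \<Gamma>'"
proof (rule eq_matI)
  fix i j assume "i < dim_row (initial_matrix us ds cs rs \<Lambda>' \<Gamma>')" "j < dim_col (initial_matrix us ds cs rs \<Lambda>' \<Gamma>')"
  then have ij: "i < length rs" "j < length cs" by (simp_all add: initial_matrix_def)
  then have "rs ! i \<in> set rs" "cs ! j \<in> set cs" by simp_all
  then have "rs ! i < length ds" "cs ! j < length us" using cs rs by (simp_all add: label_order_def)
  then show "initial_matrix us ds cs rs \<Lambda> \<Gamma> $$ (i, j) = initial_matrix us ds cs rs \<Lambda>' \<Gamma>' $$ (i, j)"
    using same ij unfolding initial_matrix_label_entry label_entry_def same_entries_def by simp
qed (simp_all add: initial_matrix_def)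

lemma runs_same_entries:
  assumes same: "same_entries us ds \<Lambda> \<Gamma> \<Lambda>' \<Gamma>'"
  shows "steps_well_defined us ds \<Lambda> \<Gamma> \<longleftrightarrow> steps_well_defined us ds \<Lambda>' \<Gamma>'"
    and "normalize_and_output n m us ds \<Lambda> \<Gamma> \<J> \<longleftrightarrow> normalize_and_output n m us ds \<Lambda>' \<Gamma>' \<J>"
  unfolding steps_well_defined_def normalize_and_output_def Let_def block_form_same_entries[OF same]
  by (simp_all add: initial_matrix_same_entries[OF same] cong: conj_cong)

lemma alive_active: "x \<in> P \<Longrightarrow> alive ls x = active (map (label_interval P) ls) x"
  by (simp add: alive_def active_label_interval)

context
  fixes P :: "bipath set" and q :: nat and S :: "bipath \<Rightarrow> 'x topology"
    and V :: "(bipath, 'k::field, ('x, 'k) kchain set) pers_module"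
  assumes V_def: "V = homology_pm q S" and V: "persistence_module P V" and tot: "\<And>a b. a \<in> P \<Longrightarrow> b \<in> P \<Longrightarrow> a \<le> b \<or> b \<le> a"
begin

text \<open>The classes of the cycles, transported along the path, are bases at all points, and a class that is no longer alive
  has become zero: a point of a chain that is not below the end of an interval is above it.\<close>

lemma path_decomposition_of_representative_cycles:
  fixes zs :: "('x, 'k) kchain list"
  assumes rep: "representative_cycles P q S ls zs"
  obtains \<phi> where "path_decomposition P V ls \<phi>"
    and "\<And>x c. x \<in> P \<Longrightarrow> c \<in> alive ls x \<Longrightarrow> frame_vec V (length ls) \<phi> x c = rep_class q S ls zs x c"
    and "\<And>x i v. x \<in> P \<Longrightarrow> i \<in> alive ls x \<Longrightarrow>
      \<phi> x v i = basis_coeff (khomology q (S x)) (alive ls x) (rep_class q S ls zs x) v i"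
proof -
  let ?Is = "map (label_interval P) ls" and ?g = "rep_class q S ls zs"
  let ?\<phi> = "\<lambda>x v. \<lambda>i\<in>{..<length ?Is}. if x \<in> ?Is ! i then basis_coeff (pspace V x) (active ?Is x) (?g x) v i else 0"
  have labels: "set ls \<subseteq> path_labels P"
    and cyc: "\<And>i. i < length ls \<Longrightarrow> zs ! i \<in> carrier (kcycles q (S (fst (ls ! i))))"
    and dead: "\<And>i x. i < length ls \<Longrightarrow> x \<in> P \<Longrightarrow> snd (ls ! i) < x \<Longrightarrow> ?g x i = \<zero>\<^bsub>khomology q (S x)\<^esub>"
    and basis: "\<And>x. x \<in> P \<Longrightarrow> basis_family (khomology q (S x)) (alive ls x) (?g x)"
    using rep unfolding representative_cycles_def by simp_all
  have ends: "fst (ls ! i) \<in> P" "snd (ls ! i) \<in> P" if "i < length ls" for i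
    using labels nth_mem[OF that] by (auto simp: path_labels_def)
  define e where "e i = homology_class q (S (fst (ls ! i))) (zs ! i)" for i
  have e: "e i \<in> carrier (pspace V (fst (ls ! i)))" if "i < length ls" for i
    unfolding V_def e_def homology_pm_simps homology_class_carrier using cyc[OF that] by blast
  have g: "?g x i = pmap V (fst (ls ! i)) x (e i)" for x i
    by (simp add: rep_class_def V_def e_def)
  have act: "i \<in> active ?Is x \<longleftrightarrow> i < length ls \<and> fst (ls ! i) \<le> x \<and> x \<le> snd (ls ! i)" if "x \<in> P" for x i
    using that by (simp add: active_label_interval)
  have fr: "frame P V ?Is ?\<phi>" and fv: "\<And>x c. x \<in> P \<Longrightarrow> c \<in> active ?Is x \<Longrightarrow> frame_vec V (length ?Is) ?\<phi> x c = ?g x c"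
  proof -
    have gc: "?g x i \<in> carrier (pspace V x)" if "x \<in> P" "i \<in> active ?Is x" for x i
      unfolding g using pmap_closed[OF V ends(1) that(1) _ e] that act[OF that(1)] by simp
    have ba: "basis_family (pspace V x) (active ?Is x) (?g x)" if "x \<in> P" for x
      using basis[OF that] alive_active[OF that, of ls] by (simp add: V_def)
    have tr: "pmap V a b (?g a i) = (if i \<in> active ?Is b then ?g b i else \<zero>\<^bsub>pspace V b\<^esub>)"
      if ab: "a \<in> P" "b \<in> P" "a \<le> b" and i: "i \<in> active ?Is a" for a b i
    proof -
      have il: "i < length ls" "fst (ls ! i) \<le> a" using i act[OF ab(1)] by simp_all
      have "pmap V a b (?g a i) = ?g b i"
        unfolding g using persistence_moduleD(5)[OF V ends(1)[OF il(1)] ab(1,2) il(2) ab(3) e[OF il(1)]] .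
      moreover have "?g b i = \<zero>\<^bsub>pspace V b\<^esub>" if "i \<notin> active ?Is b"
      proof -
        have "\<not> b \<le> snd (ls ! i)" using that act[OF ab(2)] il ab(3) by (auto intro: order_trans)
        then have "snd (ls ! i) < b" using tot[OF ab(2) ends(2)[OF il(1)]] by auto
        then show ?thesis using dead[OF il(1) ab(2)] by (simp add: V_def)
      qed
      ultimately show ?thesis by simp
    qed
    show "frame P V ?Is ?\<phi>" by (rule frame_of_bases(1)[OF V gc ba tr])
    show "frame_vec V (length ?Is) ?\<phi> x c = ?g x c" if "x \<in> P" "c \<in> active ?Is x" for x c
      by (rule frame_of_bases(2)[OF V gc ba tr that])
  qed
  show ?thesis
  proof (rule that[of ?\<phi>])
    show "path_decomposition P V ls ?\<phi>" using fr labels by (simp add: path_decomposition_iff_frame[OF V])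
    show "frame_vec V (length ls) ?\<phi> x c = ?g x c" if "x \<in> P" "c \<in> alive ls x" for x c
      using fv[OF that(1), of c] that(2) unfolding alive_active[OF that(1)] length_map by simp
    show "?\<phi> x v i = basis_coeff (khomology q (S x)) (alive ls x) (?g x) v i" if x: "x \<in> P" and i: "i \<in> alive ls x" for x i v
    proof -
      have "i < length ?Is \<and> x \<in> ?Is ! i" using i unfolding alive_active[OF x] active_def by blast
      then show ?thesis
        unfolding alive_active[OF x] V_def homology_pm_simps by (simp only: restrict_apply lessThan_iff if_True simp_thms)
    qed
  qed
qed

text \<open>The cycles represent the basis vectors of a decomposition at the birth of each summand; the classes at
  later points are then the later basis vectors.\<close>

lemma representative_cycles_exist:
  assumes fin: "finite P"
  shows "\<exists>ls (zs :: ('x, 'k) kchain list). representative_cycles P q S ls zs"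
proof -
  from chain_frame[OF fin tot V] obtain ls \<phi> where labels: "set ls \<subseteq> path_labels P"
    and fr: "frame P V (map (label_interval P) ls) \<phi>" by blast
  let ?Is = "map (label_interval P) ls"
  let ?e = "frame_vec V (length ?Is) \<phi>"
  have ends: "fst (ls ! i) \<in> P" "snd (ls ! i) \<in> P" "fst (ls ! i) \<le> snd (ls ! i)" if "i < length ls" for i
    using labels nth_mem[OF that] by (auto simp: path_labels_def)
  have act: "i \<in> active ?Is x \<longleftrightarrow> i < length ls \<and> fst (ls ! i) \<le> x \<and> x \<le> snd (ls ! i)" if "x \<in> P" for x i
    using that by (simp add: active_label_interval)
  have born: "i \<in> active ?Is (fst (ls ! i))" if "i < length ls" for i
    using act[OF ends(1)[OF that]] that ends(3)[OF that] by simp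
  have "\<exists>z. z \<in> carrier (kcycles q (S (fst (ls ! i)))) \<and> ?e (fst (ls ! i)) i = homology_class q (S (fst (ls ! i))) z"
    if "i < length ls" for i
    using frame_vec(1)[OF fr ends(1)[OF that] born[OF that]]
    unfolding V_def homology_pm_simps homology_class_carrier by blast
  then obtain z where z: "\<And>i. i < length ls \<Longrightarrow> z i \<in> carrier (kcycles q (S (fst (ls ! i))))"
    "\<And>i. i < length ls \<Longrightarrow> ?e (fst (ls ! i)) i = homology_class q (S (fst (ls ! i))) (z i)" by metis
  let ?zs = "map z [0..<length ls]"
  have g: "rep_class q S ls ?zs x i = pmap V (fst (ls ! i)) x (?e (fst (ls ! i)) i)" if "i < length ls" for x i
    using z(2)[OF that] that by (simp add: rep_class_def V_def)
  have alive: "rep_class q S ls ?zs x i = ?e x i" if x: "x \<in> P" and i: "i \<in> active ?Is x" for x i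
  proof -
    have il: "i < length ls" "fst (ls ! i) \<le> x" using i act[OF x] by simp_all
    show ?thesis
      unfolding g[OF il(1)] by (rule pmap_frame_vec[OF V fr ends(1)[OF il(1)] x il(2) born[OF il(1)] i])
  qed
  have dead: "rep_class q S ls ?zs x i = \<zero>\<^bsub>khomology q (S x)\<^esub>" if i: "i < length ls" and x: "x \<in> P" "snd (ls ! i) < x" for x i
  proof -
    interpret W: vectorspace class_ring "pspace V x" by (rule persistence_moduleD(1)[OF V x(1)])
    have le: "fst (ls ! i) \<le> x" using ends(3)[OF i] x(2) by auto
    have nx: "x \<notin> ?Is ! i" using i x by (auto simp: label_interval_def)
    note b = frame_vec[OF fr ends(1)[OF i] born[OF i]]
    have c: "pmap V (fst (ls ! i)) x (?e (fst (ls ! i)) i) \<in> carrier (pspace V x)"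
      by (rule pmap_closed[OF V ends(1)[OF i] x(1) le b(1)])
    \<comment> \<open>a frame sends the zero vector to zero coordinates, being homogeneous\<close>
    have z0: "\<zero>\<^bsub>pspace V x\<^esub> = 0 \<odot>\<^bsub>pspace V x\<^esub> pmap V (fst (ls ! i)) x (?e (fst (ls ! i)) i)"
      using W.lmult_0[OF c] by (simp add: class_ring_simps)
    have "pmap V (fst (ls ! i)) x (?e (fst (ls ! i)) i) = \<zero>\<^bsub>pspace V x\<^esub>"
    proof (rule frame_eqI[OF fr x(1) c])
      show "\<zero>\<^bsub>pspace V x\<^esub> \<in> carrier (pspace V x)" by simp
      fix j assume j: "j \<in> active ?Is x"
      then have jl: "j < length ?Is" by (simp add: active_def)
      have "\<phi> x (pmap V (fst (ls ! i)) x (?e (fst (ls ! i)) i)) j = 0"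
        using frameD(4)[OF fr ends(1)[OF i] b(1) x(1) le jl] b(2)[OF jl] j nx by (auto simp: active_def)
      moreover have "\<phi> x \<zero>\<^bsub>pspace V x\<^esub> j = 0"
        using frameD(3)[OF fr x(1) c jl, of 0] unfolding z0[symmetric] by simp
      ultimately show "\<phi> x (pmap V (fst (ls ! i)) x (?e (fst (ls ! i)) i)) j = \<phi> x \<zero>\<^bsub>pspace V x\<^esub> j" by simp
    qed
    then show ?thesis unfolding g[OF i] by (simp add: V_def)
  qed
  have basis: "basis_family (khomology q (S x)) (alive ls x) (rep_class q S ls ?zs x)" if x: "x \<in> P" for x
  proof -
    have eq: "rep_class q S ls ?zs x ` active ?Is x = ?e x ` active ?Is x"
      using alive[OF x] by (intro image_cong refl) simp
    have "inj_on (rep_class q S ls ?zs x) (active ?Is x) \<longleftrightarrow> inj_on (?e x) (active ?Is x)"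
      using alive[OF x] by (intro inj_on_cong) simp
    then show ?thesis
      using basis_family_frame_vec[OF V fr x] eq unfolding alive_active[OF x] basis_family_def by (simp add: V_def)
  qed
  have "representative_cycles P q S ls ?zs"
    unfolding representative_cycles_def
  proof (intro conjI allI impI ballI)
    show "set ls \<subseteq> path_labels P" by (rule labels)
    show "length ?zs = length ls" by simp
    have "poset_interval P I" if I: "I \<in># mset ?Is" for I
    proof -
      from I obtain l where "l \<in> set ls" "I = label_interval P l" by auto
      then show ?thesis using poset_interval_path[OF _ tot, of l] labels by auto
    qed
    then show "interval_decomposition P (homology_pm q S :: (bipath, 'k, ('x, 'k) kchain set) pers_module) (mset ?Is)"
      unfolding interval_decomposition_def V_def[symmetric] pm_iso_iff_frame[OF V] using fr by blast
    fix i assume i: "i < length ls"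
    then show "?zs ! i \<in> carrier (kcycles q (S (fst (ls ! i))))" using z(1) by simp
    show "rep_class q S ls ?zs x i = \<zero>\<^bsub>khomology q (S x)\<^esub>" if "x \<in> P" "snd (ls ! i) < x" for x
      by (rule dead[OF i that])
  qed (rule basis)
  then show ?thesis by blast
qed

end

text \<open>The change-of-basis matrices are the transition matrices of the frames given by the cycles, in all
  entries that a run uses.\<close>

lemma cycle_runs_correct:
  fixes q :: nat and S :: "bipath \<Rightarrow> 'x topology" and zs ws :: "('x, 'k::field) kchain list"
  defines "V \<equiv> homology_pm q S :: (bipath, 'k, ('x, 'k) kchain set) pers_module"
  assumes V: "persistence_module (bipath_poset n m) V"
    and u: "representative_cycles (upper_path n) q S us zs" and d: "representative_cycles (lower_path m) q S ds ws"
  defines "\<Lambda> \<equiv> cycle_entry q S us zs ds ws Hat0" and "\<Gamma> \<equiv> cycle_entry q S us zs ds ws Hat1"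
  shows "steps_well_defined us ds \<Lambda> \<Gamma>" and "\<exists>\<J>. normalize_and_output n m us ds \<Lambda> \<Gamma> \<J>"
    and "normalize_and_output n m us ds \<Lambda> \<Gamma> \<J> \<Longrightarrow> interval_decomposition (bipath_poset n m) V \<J>"
proof -
  have VU: "persistence_module (upper_path n) V" and VD: "persistence_module (lower_path m) V"
    using persistence_module_subset[OF V] by (simp_all add: bipath_poset_def)
  obtain \<phi> where \<phi>: "path_decomposition (upper_path n) V us \<phi>"
    "\<And>x c. x \<in> upper_path n \<Longrightarrow> c \<in> alive us x \<Longrightarrow> frame_vec V (length us) \<phi> x c = rep_class q S us zs x c"
    "\<And>x i v. x \<in> upper_path n \<Longrightarrow> i \<in> alive us x \<Longrightarrow>
       \<phi> x v i = basis_coeff (khomology q (S x)) (alive us x) (rep_class q S us zs x) v i"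
  proof (rule path_decomposition_of_representative_cycles[OF V_def[THEN meta_eq_to_obj_eq] VU upper_path_total u])
    fix \<phi>' assume \<phi>': "path_decomposition (upper_path n) V us \<phi>'"
      "\<And>x c. x \<in> upper_path n \<Longrightarrow> c \<in> alive us x \<Longrightarrow> frame_vec V (length us) \<phi>' x c = rep_class q S us zs x c"
      "\<And>x i v. x \<in> upper_path n \<Longrightarrow> i \<in> alive us x \<Longrightarrow>
         \<phi>' x v i = basis_coeff (khomology q (S x)) (alive us x) (rep_class q S us zs x) v i"
    show ?thesis by (rule that[OF \<phi>'])
  qed
  obtain \<psi> where \<psi>: "path_decomposition (lower_path m) V ds \<psi>"
    "\<And>x c. x \<in> lower_path m \<Longrightarrow> c \<in> alive ds x \<Longrightarrow> frame_vec V (length ds) \<psi> x c = rep_class q S ds ws x c"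
    "\<And>x i v. x \<in> lower_path m \<Longrightarrow> i \<in> alive ds x \<Longrightarrow>
       \<psi> x v i = basis_coeff (khomology q (S x)) (alive ds x) (rep_class q S ds ws x) v i"
  proof (rule path_decomposition_of_representative_cycles[OF V_def[THEN meta_eq_to_obj_eq] VD lower_path_total d])
    fix \<phi>' assume \<phi>': "path_decomposition (lower_path m) V ds \<phi>'"
      "\<And>x c. x \<in> lower_path m \<Longrightarrow> c \<in> alive ds x \<Longrightarrow> frame_vec V (length ds) \<phi>' x c = rep_class q S ds ws x c"
      "\<And>x i v. x \<in> lower_path m \<Longrightarrow> i \<in> alive ds x \<Longrightarrow>
         \<phi>' x v i = basis_coeff (khomology q (S x)) (alive ds x) (rep_class q S ds ws x) v i"
    show ?thesis by (rule that[OF \<phi>'])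
  qed
  have entry: "transition_entry V (length us) \<phi> \<psi> x r c = cycle_entry q S us zs ds ws x r c"
    if "x \<in> upper_path n" "x \<in> lower_path m" "c \<in> alive us x" "r \<in> alive ds x" for x r c
    using \<phi>(2)[OF that(1,3)] \<psi>(3)[OF that(2,4)] by (simp add: transition_entry_frame_vec cycle_entry_def)
  have same: "same_entries us ds (transition_entry V (length us) \<phi> \<psi> Hat0) (transition_entry V (length us) \<phi> \<psi> Hat1) \<Lambda> \<Gamma>"
    unfolding same_entries_def \<Lambda>_def \<Gamma>_def by (auto intro!: entry simp: alive_def)
  show "steps_well_defined us ds \<Lambda> \<Gamma>"
    using runs_correct(1)[OF V \<phi>(1) \<psi>(1)] unfolding runs_same_entries[OF same] .
  show "\<exists>\<J>. normalize_and_output n m us ds \<Lambda> \<Gamma> \<J>"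
    using runs_correct(2)[OF V \<phi>(1) \<psi>(1)] unfolding runs_same_entries[OF same] .
  show "normalize_and_output n m us ds \<Lambda> \<Gamma> \<J> \<Longrightarrow> interval_decomposition (bipath_poset n m) V \<J>"
    using runs_correct(3)[OF V \<phi>(1) \<psi>(1), of \<J>] unfolding runs_same_entries[OF same] .
qed

theorem algorithm_B_correct:
  fixes q :: nat and S :: "bipath \<Rightarrow> 'x topology"
  defines "V \<equiv> homology_pm q S :: (bipath, 'k::field, ('x, 'k) kchain set) pers_module"
  assumes V: "persistence_module (bipath_poset n m) V"
  shows "\<exists>\<D>. algorithm_B TYPE('k) n m q S \<D>" and "algorithm_B_well_defined TYPE('k) n m q S"
    and "algorithm_B TYPE('k) n m q S \<D> \<Longrightarrow>
      interval_decomposition (bipath_poset n m) V \<D> \<and> \<D> = persistence_diagram (bipath_poset n m) V"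
proof -
  note VS = V[unfolded V_def]
  have VU: "persistence_module (upper_path n) (homology_pm q S :: (bipath, 'k, ('x, 'k) kchain set) pers_module)"
    and VD: "persistence_module (lower_path m) (homology_pm q S :: (bipath, 'k, ('x, 'k) kchain set) pers_module)"
    using persistence_module_subset[OF VS] by (simp_all add: bipath_poset_def)
  obtain us and zs :: "('x, 'k) kchain list" where u: "representative_cycles (upper_path n) q S us zs"
    using representative_cycles_exist[OF refl VU _ finite_paths(1)] upper_path_total by blast
  obtain ds and ws :: "('x, 'k) kchain list" where d: "representative_cycles (lower_path m) q S ds ws"
    using representative_cycles_exist[OF refl VD _ finite_paths(2)] lower_path_total by blast
  show "\<exists>\<D>. algorithm_B TYPE('k) n m q S \<D>"
    unfolding algorithm_B_def using u d cycle_runs_correct(2)[OF VS u d] by blast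
  show "algorithm_B_well_defined TYPE('k) n m q S"
    unfolding algorithm_B_well_defined_def using cycle_runs_correct(1)[OF VS] by blast
  assume "algorithm_B TYPE('k) n m q S \<D>"
  then have "interval_decomposition (bipath_poset n m) V \<D>"
    unfolding algorithm_B_def V_def using cycle_runs_correct(3)[OF VS] by blast
  then show "interval_decomposition (bipath_poset n m) V \<D> \<and> \<D> = persistence_diagram (bipath_poset n m) V"
    using persistence_diagram_eqI[OF V] by blast
qed

theorem theorem4p10:
  fixes n m q :: nat
    and V :: "(bipath, 'k::field, 'v) pers_module"
    and S :: "bipath \<Rightarrow> 'x topology"
  assumes "0 < n" and "0 < m"
  shows
    "(persistence_module (bipath_poset n m) V \<longrightarrow>
        (\<exists>\<J>. algorithm_A n m V \<J>) \<and>
        algorithm_A_well_defined n m V \<and>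
        (\<forall>\<J>. algorithm_A n m V \<J> \<longrightarrow> interval_decomposition (bipath_poset n m) V \<J>)) \<and>
     (filtration (bipath_poset n m) S \<and>
        (\<forall>a\<in>bipath_poset n m.
           vectorspace.fin_dim class_ring (khomology q (S a) :: ('k, ('x, 'k) kchain set) module)) \<longrightarrow>
        (\<exists>\<D>. algorithm_B TYPE('k) n m q S \<D>) \<and>
        algorithm_B_well_defined TYPE('k) n m q S \<and>
        (\<forall>\<D>. algorithm_B TYPE('k) n m q S \<D> \<longrightarrow>
           interval_decomposition (bipath_poset n m)
             (homology_pm q S :: (bipath, 'k, ('x, 'k) kchain set) pers_module) \<D> \<and>
           \<D> = persistence_diagram (bipath_poset n m)
             (homology_pm q S :: (bipath, 'k, ('x, 'k) kchain set) pers_module)))"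
proof (intro conjI impI)
  assume V: "persistence_module (bipath_poset n m) V"
  show "\<exists>\<J>. algorithm_A n m V \<J>" "algorithm_A_well_defined n m V"
    by (rule algorithm_A_correct(1)[OF V], rule algorithm_A_correct(2)[OF V])
  show "\<forall>\<J>. algorithm_A n m V \<J> \<longrightarrow> interval_decomposition (bipath_poset n m) V \<J>"
    using algorithm_A_correct(3)[OF V] by simp
next
  assume "filtration (bipath_poset n m) S \<and> (\<forall>a\<in>bipath_poset n m.
    vectorspace.fin_dim class_ring (khomology q (S a) :: ('k, ('x, 'k) kchain set) module))"
  then have V: "persistence_module (bipath_poset n m) (homology_pm q S :: (bipath, 'k, ('x, 'k) kchain set) pers_module)"
    by (intro persistence_module_homology) simp_all
  show "\<exists>\<D>. algorithm_B TYPE('k) n m q S \<D>" "algorithm_B_well_defined TYPE('k) n m q S"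
    by (rule algorithm_B_correct(1)[OF V], rule algorithm_B_correct(2)[OF V])
  show "\<forall>\<D>. algorithm_B TYPE('k) n m q S \<D> \<longrightarrow>
      interval_decomposition (bipath_poset n m)
        (homology_pm q S :: (bipath, 'k, ('x, 'k) kchain set) pers_module) \<D> \<and>
      \<D> = persistence_diagram (bipath_poset n m)
        (homology_pm q S :: (bipath, 'k, ('x, 'k) kchain set) pers_module)"
    using algorithm_B_correct(3)[OF V] by simp
qed

end
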